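(* Let $\nu\ge1$, $\rho>0$, $\mathtt m\ge 0$, and let $V:\mathbb T^\nu\times[0,\pi]\to\mathbb R$ satisfy (V1) and (V2) stated in the context. There is a constant $c_0>0$ such that for every $0<\gamma_0<1$ and every $\mathtt M>1$ there exists a set $\Omega_0\subset R_{\mathtt M}\subset\mathbb R^\nu$ with $$\frac{\operatorname{meas}(R_{\mathtt M}\setminus\Omega_0)}{\operatorname{meas}(R_{\mathtt M})}\le c_0\gamma_0$$ such that the following holds. For any $\omega\in\Omega_0$ and any weight $\mathtt w>0$ there exists a time dependent change of coordinates $\varphi(t)=e^{-\mathrm i\mathbf X(\omega t;\omega)}\psi(t)$, where $$\mathbf X(\omega t;\omega)=X(\omega t;\omega)\,\boldsymbol\sigma_4,\qquad X\in\mathrm{Lip}_{\mathtt w}(\Omega_0,\mathcal{PA}^{-1}_{\rho/2}),$$ that conjugates the equation $$\mathrm i\,\dot\varphi(t)=(\mathbf H_0+\mathbf W(\omega t))\varphi(t),\qquad \mathbf H_0=B\boldsymbol\sigma_3,\quad \mathbf W(\omega t)=\tfrac12B^{-1/2}V(\omega t)B^{-1/2}\boldsymbol\sigma_4$$ to $$\mathrm i\,\dot\psi(t)=\widetilde{\mathbf H}(t)\psi(t),\qquad\widetilde{\mathbf H}(t)=\mathbf H_0+\mathbf V(\omega t;\omega),$$ where $$\mathbf V(\theta;\omega)=\begin{pmatrix}V^d(\theta;\omega)&V^o(\theta;\omega)\\-\overline{V^o}(\theta;\omega)&-\overline{V^d}(\theta;\omega)\end{pmatrix},\qquad [V^d]^*=V^d,\quad[V^o]^*=\overline{V^o},$$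 and $$V^d\in\mathrm{Lip}_{\mathtt w}(\Omega_0,\mathcal{PA}^{-1}_{\rho/2}),\qquad V^o\in\mathrm{Lip}_{\mathtt w}(\Omega_0,\mathcal{PA}^{0}_{\rho/2}).$$ Furthermore, for any $\ell\in\mathbb N_0$ there exists $C_\ell>0$, independent of $\mathtt M$, such that $$\wp^{-1,\rho/2}_\ell(V^d)^{\mathrm{Lip}(\mathtt w)}_{\Omega_0}+\wp^{0,\rho/2}_\ell(V^o)^{\mathrm{Lip}(\mathtt w)}_{\Omega_0}\le\frac{C_\ell}{\mathtt M}.$$
   Context: Notation: $\mathbb N=\{1,2,\dots\}$, $\mathbb N_0=\mathbb N\cup\{0\}$, $\mathbb T=\mathbb R/2\pi\mathbb Z$, $\langle j\rangle=(1+|j|^2)^{1/2}$, $R_{\mathtt M}=\overline{B_{2\mathtt M}(0)}\setminus B_{\mathtt M}(0)\subset\mathbb R^\nu$ (Euclidean balls). $\boldsymbol\sigma_3=\begin{pmatrix}1&0\\0&-1\end{pmatrix}$, $\boldsymbol\sigma_4=\begin{pmatrix}1&1\\-1&-1\end{pmatrix}$. (V1) The even extension in $x$ of $V(\theta,x)$ to $\mathbb T\simeq[-\pi,\pi]$, still denoted $V$, is smooth in both variables and extends analytically in $\theta$ to a complex neighbourhood of $\mathbb T^\nu$ of width $\rho$; for every integer $\ell\ge0$ there is $C_{\ell,\rho}>0$ with $|\partial_x^\ell V(\theta,x)|\le C_{\ell,\rho}$ for all $x\in\mathbb T$, $|\operatorname{Im}\theta|\le\rho$. (V2) $\int_{\mathbb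 T^\nu}V(\theta,x)\,d\theta=0$ for every $x\in[0,\pi]$. Spaces: $\mathcal H^r$ is the space of sine series $\varphi=\sum_{m\in\mathbb N}\varphi_m\sin(mx)$ with $\|\varphi\|_{\mathcal H^r}^2=\sum\langle m\rangle^{2r}|\varphi_m|^2<\infty$; $\mathcal H^0$ is identified with the odd functions in $L^2(\mathbb T)$. Adjoints $A^*$ are with respect to the scalar product of $\mathcal H^0$; $\overline A\psi:=\overline{A\overline\psi}$. $B=\sqrt{-\Delta+\mathtt m^2}$, i.e. $B e^{\mathrm ijx}=\sqrt{j^2+\mathtt m^2}\,e^{\mathrm ijx}$; for $\mathtt m=0$, $B^{-\sigma}\psi:=\sum_{j\neq0}|j|^{-\sigma}\psi_je^{\mathrm ijx}$ for $\sigma>0$. $V(\omega t)$ is multiplication by $V(\omega t,x)$. Pseudodifferential operators: for $m\in\mathbb R$, $S^m_\rho$ is the class of functions $f:\mathbb T^\nu\times\mathbb T\times\mathbb Z\to\mathbb C$, smooth in $x$, extending analytically in $\theta$ to $\{|\operatorname{Im}\theta|\le\rho\}$, such that all seminorms $$\wp^{m,\rho}_\ell(f)=\sup_{|\operatorname{Im}\theta|\le\rho}\ \sum_{a+b\le\ell}\ \sup_{(x,j)\in\mathbb T\times\mathbb Z}\langle j\rangle^{-m+b}|\partial_x^a\triangle^bf(\theta,x,j)|,\quad\ell\in\mathbb N_0,$$ are finite, where $\triangle f(\theta,x,j)=f(\theta,x,j+1)-f(\theta,x,j)$. $\mathcal A^m_\rho$ is the set of operators $F=f(\theta,x,D_x)$,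 $(F\psi)(x)=\sum_{j\in\mathbb Z}f(\theta,x,j)\psi_je^{\mathrm ijx}$ for $\psi=\sum_j\psi_je^{\mathrm ijx}$, with $f\in S^m_\rho$, and $\wp^{m,\rho}_\ell(F):=\wp^{m,\rho}_\ell(f)$. $\mathcal{PA}^m_\rho\subset\mathcal A^m_\rho$ is the subset of parity preserving operators, i.e. mapping even functions to even functions and odd functions to odd functions of $x$. Lipschitz families: for $\Omega\subset\mathbb R^\nu$, $\mathtt w>0$ and $F:\Omega\to\mathcal{PA}^m_\rho$, $$\wp^{m,\rho}_\ell(F)^{\mathrm{Lip}(\mathtt w)}_\Omega=\sup_{\omega\in\Omega}\wp^{m,\rho}_\ell(F(\omega))+\mathtt w\sup_{\omega_1\ne\omega_2\in\Omega}\frac{\wp^{m,\rho}_\ell(F(\omega_1)-F(\omega_2))}{|\omega_1-\omega_2|},$$ and $\mathrm{Lip}_{\mathtt w}(\Omega,\mathcal{PA}^m_\rho)$ is the set of $F$ for which all of these are finite. *)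

theory Defs
  imports "HOL-Analysis.Analysis" "HOL-Library.Function_Algebras"
begin

text \<open>
  Functions on the torus \<open>\<real>/2\<pi>\<int>\<close> are \<open>2\<pi>\<close>-periodic functions on the line. The number of
  frequencies is the cardinality of the index type \<open>'n\<close>. Seminorms of symbols are taken in
  \<open>ennreal\<close>, so that an infinite supremum is really \<open>\<infinity>\<close>.
\<close>

primrec C_k :: "nat \<Rightarrow> ('a::euclidean_space \<Rightarrow> 'b::real_normed_vector) \<Rightarrow> bool" where
  "C_k 0 f \<longleftrightarrow> continuous_on UNIV f"
| "C_k (Suc k) f \<longleftrightarrow> (\<forall>p. f differentiable (at p)) \<and>
     (\<forall>v. C_k k (\<lambda>p. frechet_derivative f (at p) v))"

definition smooth :: "('a::euclidean_space \<Rightarrow> 'b::real_normed_vector) \<Rightarrow> bool" where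
  "smooth f \<longleftrightarrow> (\<forall>k. C_k k f)"

definition strip :: "real \<Rightarrow> (complex ^ 'n) set" where
  "strip \<rho> = {\<theta>. norm (\<chi> i. Im (\<theta> $ i)) \<le> \<rho>}"

definition cvec :: "real ^ 'n \<Rightarrow> complex ^ 'n" where
  "cvec \<theta> = (\<chi> i. complex_of_real (\<theta> $ i))"

text \<open>
  Analyticity of a function of several complex variables on a set that need not be open:
  complex differentiability on an open neighbourhood of the set. Note that \<open>has_derivative\<close>
  alone is only real differentiability.
\<close>

definition analytic_sev :: "(complex ^ 'n \<Rightarrow> complex) \<Rightarrow> (complex ^ 'n) set \<Rightarrow> bool" where
  "analytic_sev f S \<longleftrightarrow> (\<exists>U. open U \<and> S \<subseteq> U \<and>
     (\<forall>z\<in>U. \<exists>f'. (f has_derivative f') (at z) \<and> (\<forall>c v. f' (c *s v) = c * f' v)))"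

definition dx :: "(real \<Rightarrow> complex) \<Rightarrow> real \<Rightarrow> complex" where
  "dx g x = vector_derivative g (at x)"

text \<open>
  Functions of \<open>(\<theta>, x)\<close>, smooth in \<open>x\<close> and analytic in \<open>\<theta>\<close> on the closed strip, are carried by
  their (unique) analytic extension; values for \<open>\<theta>\<close> off the strip are irrelevant.
\<close>

definition analytic_smooth :: "real \<Rightarrow> (complex ^ 'n \<Rightarrow> real \<Rightarrow> complex) \<Rightarrow> bool" where
  "analytic_smooth \<rho> g \<longleftrightarrow>
     (\<forall>x. analytic_sev (\<lambda>\<theta>. g \<theta> x) (strip \<rho>)) \<and>
     (\<forall>\<theta>\<in>strip \<rho>. smooth (g \<theta>)) \<and>
     (\<forall>\<theta>\<in>strip \<rho>. \<forall>x. g \<theta> (x + 2 * pi) = g \<theta> x) \<and>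
     (\<forall>\<theta>\<in>strip \<rho>. \<forall>x i. g (\<theta> + axis i (2 * pi)) x = g \<theta> x)"

definition torus_periodic :: "(real ^ 'n \<Rightarrow> real \<Rightarrow> real) \<Rightarrow> bool" where
  "torus_periodic V \<longleftrightarrow> (\<forall>\<theta> i. \<forall>x\<in>{0..pi}. V (\<theta> + axis i (2 * pi)) x = V \<theta> x)"

text \<open>
  The map \<open>x \<mapsto> arccos (cos x)\<close> is the even, \<open>2\<pi>\<close>-periodic function equal to \<open>x\<close> on \<open>[0, \<pi>]\<close>;
  only the values of \<open>V\<close> for \<open>x \<in> [0, \<pi>]\<close> are used.
\<close>

definition even_ext :: "(real ^ 'n \<Rightarrow> real \<Rightarrow> real) \<Rightarrow> real ^ 'n \<Rightarrow> real \<Rightarrow> real" where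
  "even_ext V \<theta> x = V \<theta> (arccos (cos x))"

definition V1 :: "real \<Rightarrow> (real ^ 'n \<Rightarrow> real \<Rightarrow> real) \<Rightarrow> bool" where
  "V1 \<rho> V \<longleftrightarrow> smooth (\<lambda>(\<theta>, x). even_ext V \<theta> x) \<and>
     (\<exists>Vc. analytic_smooth \<rho> Vc \<and>
        (\<forall>\<theta> x. Vc (cvec \<theta>) x = complex_of_real (even_ext V \<theta> x)) \<and>
        (\<forall>l. \<exists>C>0. \<forall>x. \<forall>\<theta>\<in>strip \<rho>. norm ((dx ^^ l) (Vc \<theta>) x) \<le> C))"

definition V2 :: "(real ^ 'n \<Rightarrow> real \<Rightarrow> real) \<Rightarrow> bool" where
  "V2 V \<longleftrightarrow> (\<forall>x\<in>{0..pi}. ((\<lambda>\<theta>. V \<theta> x) has_integral 0) (cbox 0 (\<chi> i. 2 * pi)))"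

type_synonym 'n symbol = "complex ^ 'n \<Rightarrow> real \<Rightarrow> int \<Rightarrow> complex"

definition jap :: "int \<Rightarrow> real" where
  "jap j = sqrt (1 + (real_of_int j)\<^sup>2)"

definition tri :: "('n::finite) symbol \<Rightarrow> ('n::finite) symbol" where
  "tri f = (\<lambda>\<theta> x j. f \<theta> x (j + 1) - f \<theta> x j)"

definition wp :: "real \<Rightarrow> real \<Rightarrow> nat \<Rightarrow> ('n::finite) symbol \<Rightarrow> ennreal" where
  "wp m \<rho> l f = (SUP \<theta>\<in>strip \<rho>. \<Sum>(a, b)\<in>{(a, b). a + b \<le> l}. SUP (x, j)\<in>UNIV.
     ennreal (jap j powr (- m + real b) * norm ((dx ^^ a) (\<lambda>y. (tri ^^ b) f \<theta> y j) x)))"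

definition S_class :: "real \<Rightarrow> real \<Rightarrow> ('n::finite) symbol set" where
  "S_class m \<rho> = {f. (\<forall>j. analytic_smooth \<rho> (\<lambda>\<theta> x. f \<theta> x j)) \<and> (\<forall>l. wp m \<rho> l f < \<infinity>)}"

text \<open>
  A (possibly formal) Fourier series \<open>\<Sum>j. u j * exp (\<i> j x)\<close> is given by its coefficients \<open>u\<close>.
\<close>

type_synonym fser = "int \<Rightarrow> complex"

definition fourier_coeff :: "(real \<Rightarrow> complex) \<Rightarrow> int \<Rightarrow> complex" where
  "fourier_coeff g k =
     complex_of_real (1 / (2 * pi)) * integral {-pi..pi} (\<lambda>x. g x * cis (- (real_of_int k * x)))"

text \<open>
  The operator \<open>u \<mapsto> \<Sum>j. a x j * u j * exp (\<i> j x)\<close>. The series is taken in the sense of periodic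
  distributions, i.e. its Fourier coefficients are computed term by term; this gives the action
  on Sobolev spaces of any real order. For a symbol independent of \<open>j\<close> it is a multiplication
  operator.
\<close>

definition psido :: "(real \<Rightarrow> int \<Rightarrow> complex) \<Rightarrow> fser \<Rightarrow> fser" where
  "psido a u k = (\<Sum>\<^sub>\<infinity>j. fourier_coeff (\<lambda>x. a x j * u j * cis (real_of_int j * x)) k)"

definition Op :: "('n::finite) symbol \<Rightarrow> real ^ 'n \<Rightarrow> fser \<Rightarrow> fser" where
  "Op f \<theta> = psido (f (cvec \<theta>))"

definition odd_ser :: "fser \<Rightarrow> bool" where
  "odd_ser u \<longleftrightarrow> (\<forall>j. u (- j) = - u j)"

definition even_ser :: "fser \<Rightarrow> bool" where
  "even_ser u \<longleftrightarrow> (\<forall>j. u (- j) = u j)"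

definition square_summable :: "fser \<Rightarrow> bool" where
  "square_summable u \<longleftrightarrow> (\<lambda>j. (norm (u j))\<^sup>2) summable_on UNIV"

text \<open>
  An operator \<open>f(\<theta>, x, D)\<close> determines its symbol, \<open>f \<theta> x j = exp (- \<i> j x) * F (exp (\<i> j x))\<close>, so
  operators of the classes below are carried by their symbols.
\<close>

definition PA :: "real \<Rightarrow> real \<Rightarrow> ('n::finite) symbol set" where
  "PA m \<rho> = {f \<in> S_class m \<rho>. \<forall>\<theta> u. square_summable u \<longrightarrow>
     (even_ser u \<longrightarrow> even_ser (Op f \<theta> u)) \<and> (odd_ser u \<longrightarrow> odd_ser (Op f \<theta> u))}"

definition lip_wp :: "real \<Rightarrow> (real ^ 'n) set \<Rightarrow> real \<Rightarrow> real \<Rightarrow> nat \<Rightarrow> (real ^ 'n \<Rightarrow> ('n::finite) symbol) \<Rightarrow> ennreal"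
  where
  "lip_wp w \<Omega> m \<rho> l F = (SUP \<omega>\<in>\<Omega>. wp m \<rho> l (F \<omega>)) +
     ennreal w * (SUP (\<omega>1, \<omega>2)\<in>{(\<omega>1, \<omega>2). \<omega>1 \<in> \<Omega> \<and> \<omega>2 \<in> \<Omega> \<and> \<omega>1 \<noteq> \<omega>2}.
        wp m \<rho> l (\<lambda>\<theta> x j. F \<omega>1 \<theta> x j - F \<omega>2 \<theta> x j) / ennreal (norm (\<omega>1 - \<omega>2)))"

definition Lip_PA :: "real \<Rightarrow> (real ^ 'n) set \<Rightarrow> real \<Rightarrow> real \<Rightarrow> (real ^ 'n \<Rightarrow> ('n::finite) symbol) set" where
  "Lip_PA w \<Omega> m \<rho> = {F. (\<forall>\<omega>\<in>\<Omega>. F \<omega> \<in> PA m \<rho>) \<and> (\<forall>l. lip_wp w \<Omega> m \<rho> l F < \<infinity>)}"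

text \<open>
  \<open>B\<^sup>s\<close>, for \<open>s \<noteq> 0\<close>. Since \<open>0 powr a = 0\<close>, for zero mass the coefficient \<open>j = 0\<close> is annihilated.
\<close>

definition Bpow :: "real \<Rightarrow> real \<Rightarrow> fser \<Rightarrow> fser" where
  "Bpow mass s u = (\<lambda>j. complex_of_real (((real_of_int j)\<^sup>2 + mass\<^sup>2) powr (s / 2)) * u j)"

definition mult_V :: "(real ^ 'n \<Rightarrow> real \<Rightarrow> real) \<Rightarrow> real ^ 'n \<Rightarrow> fser \<Rightarrow> fser" where
  "mult_V V \<theta> = psido (\<lambda>x j. complex_of_real (even_ext V \<theta> x))"

text \<open>The series of the complex conjugate function, and the operator \<open>\<psi> \<mapsto> cnj (A (cnj \<psi>))\<close>.\<close>

definition cnj_ser :: "fser \<Rightarrow> fser" where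
  "cnj_ser u = (\<lambda>j. cnj (u (- j)))"

definition cnj_op :: "(fser \<Rightarrow> fser) \<Rightarrow> fser \<Rightarrow> fser" where
  "cnj_op A u = cnj_ser (A (cnj_ser u))"

text \<open>
  If \<open>u\<close> is odd, then \<open>\<Sum>j. u j * exp (\<i> j x) = \<Sum>m\<ge>1. sine_coeff u m * sin (m x)\<close>.
\<close>

definition sine_coeff :: "fser \<Rightarrow> int \<Rightarrow> complex" where
  "sine_coeff u m = 2 * \<i> * u m"

definition Hs :: "real \<Rightarrow> fser set" where
  "Hs r = {u. odd_ser u \<and> (\<lambda>m. jap m powr (2 * r) * (norm (sine_coeff u m))\<^sup>2) summable_on {1..}}"

definition hnorm :: "real \<Rightarrow> fser \<Rightarrow> real" where
  "hnorm r u = sqrt (\<Sum>\<^sub>\<infinity>m\<in>{1..}. jap m powr (2 * r) * (norm (sine_coeff u m))\<^sup>2)"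

definition hinner :: "fser \<Rightarrow> fser \<Rightarrow> complex" where
  "hinner u v = (\<Sum>\<^sub>\<infinity>m\<in>{1..}. sine_coeff u m * cnj (sine_coeff v m))"

definition is_adjoint :: "(fser \<Rightarrow> fser) \<Rightarrow> (fser \<Rightarrow> fser) \<Rightarrow> bool" where
  "is_adjoint A A' \<longleftrightarrow> (\<forall>u\<in>Hs 0. A u \<in> Hs 0) \<and> (\<forall>u\<in>Hs 0. A' u \<in> Hs 0) \<and>
     (\<forall>u\<in>Hs 0. \<forall>v\<in>Hs 0. hinner (A u) v = hinner u (A' v))"

type_synonym fser2 = "fser \<times> fser"

definition cscale :: "complex \<Rightarrow> fser2 \<Rightarrow> fser2" where
  "cscale c z = ((\<lambda>k. c * fst z k), (\<lambda>k. c * snd z k))"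

definition matop ::
  "(fser \<Rightarrow> fser) \<Rightarrow> (fser \<Rightarrow> fser) \<Rightarrow> (fser \<Rightarrow> fser) \<Rightarrow> (fser \<Rightarrow> fser) \<Rightarrow> fser2 \<Rightarrow> fser2" where
  "matop A11 A12 A21 A22 z = (A11 (fst z) + A12 (snd z), A21 (fst z) + A22 (snd z))"

definition \<sigma>3 :: "complex ^ 2 ^ 2" where
  "\<sigma>3 = vector [vector [1, 0], vector [0, -1]]"

definition \<sigma>4 :: "complex ^ 2 ^ 2" where
  "\<sigma>4 = vector [vector [1, 1], vector [-1, -1]]"

definition op_times_mat :: "(fser \<Rightarrow> fser) \<Rightarrow> complex ^ 2 ^ 2 \<Rightarrow> fser2 \<Rightarrow> fser2" where
  "op_times_mat A \<sigma> = matop (\<lambda>u k. \<sigma> $ 1 $ 1 * A u k) (\<lambda>u k. \<sigma> $ 1 $ 2 * A u k)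
                            (\<lambda>u k. \<sigma> $ 2 $ 1 * A u k) (\<lambda>u k. \<sigma> $ 2 $ 2 * A u k)"

text \<open>The exponential series, summed coefficient by coefficient.\<close>

definition op_exp :: "(fser2 \<Rightarrow> fser2) \<Rightarrow> fser2 \<Rightarrow> fser2" where
  "op_exp A z = ((\<lambda>k. \<Sum>n. fst ((A ^^ n) z) k / fact n), (\<lambda>k. \<Sum>n. snd ((A ^^ n) z) k / fact n))"

definition H0_op :: "real \<Rightarrow> fser2 \<Rightarrow> fser2" where
  "H0_op mass = op_times_mat (Bpow mass 1) \<sigma>3"

definition W_op :: "real \<Rightarrow> (real ^ 'n \<Rightarrow> real \<Rightarrow> real) \<Rightarrow> real ^ 'n \<Rightarrow> fser2 \<Rightarrow> fser2" where
  "W_op mass V \<theta> =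
     op_times_mat (\<lambda>u k. 1 / 2 * Bpow mass (- 1 / 2) (mult_V V \<theta> (Bpow mass (- 1 / 2) u)) k) \<sigma>4"

definition V_op :: "('n::finite) symbol \<Rightarrow> ('n::finite) symbol \<Rightarrow> real ^ 'n \<Rightarrow> fser2 \<Rightarrow> fser2" where
  "V_op Vd Vo \<theta> = matop (Op Vd \<theta>) (Op Vo \<theta>)
     (\<lambda>u. - cnj_op (Op Vo \<theta>) u) (\<lambda>u. - cnj_op (Op Vd \<theta>) u)"

definition Hs2 :: "real \<Rightarrow> fser2 set" where
  "Hs2 r = Hs r \<times> Hs r"

definition hnorm2 :: "real \<Rightarrow> fser2 \<Rightarrow> real" where
  "hnorm2 r z = sqrt ((hnorm r (fst z))\<^sup>2 + (hnorm r (snd z))\<^sup>2)"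

text \<open>
  A curve in \<open>Hs2 r\<close> satisfies \<open>\<i> d\<phi>/dt = H(t) \<phi>\<close> at time \<open>t\<close>. As \<open>H0_op\<close> loses one derivative,
  the time derivative is taken in \<open>Hs2 (r - 1)\<close>.
\<close>

definition solves_at :: "real \<Rightarrow> (real \<Rightarrow> fser2 \<Rightarrow> fser2) \<Rightarrow> (real \<Rightarrow> fser2) \<Rightarrow> real \<Rightarrow> bool" where
  "solves_at r H \<phi> t \<longleftrightarrow> (\<forall>s. \<phi> s \<in> Hs2 r) \<and>
     (\<exists>d\<in>Hs2 (r - 1).
        ((\<lambda>h. hnorm2 (r - 1) (cscale (complex_of_real (1 / h)) (\<phi> (t + h) - \<phi> t) - d)) \<longlongrightarrow> 0) (at 0) \<and>
        cscale \<i> d = H t (\<phi> t))"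

text \<open>
  The change of coordinates \<open>\<phi>(t) = P(t) \<psi>(t)\<close> conjugates \<open>\<i> d\<phi>/dt = H(t) \<phi>\<close> to
  \<open>\<i> d\<psi>/dt = H'(t) \<psi>\<close>. The equivalence is required at each single time, which yields the
  equivalence of solutions on every open time interval.
\<close>

definition conjugates ::
  "(real \<Rightarrow> fser2 \<Rightarrow> fser2) \<Rightarrow> (real \<Rightarrow> fser2 \<Rightarrow> fser2) \<Rightarrow> (real \<Rightarrow> fser2 \<Rightarrow> fser2) \<Rightarrow> bool" where
  "conjugates P H H' \<longleftrightarrow> (\<forall>r.
     (\<forall>t. bij_betw (P t) (Hs2 r) (Hs2 r)) \<and>
     (\<forall>\<psi>. (\<forall>t. \<psi> t \<in> Hs2 r) \<longrightarrow>
        (\<forall>t. solves_at r H (\<lambda>s. P s (\<psi> s)) t \<longleftrightarrow> solves_at r H' \<psi> t)))"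

definition annulus :: "real \<Rightarrow> (real ^ 'n) set" where
  "annulus M = cball 0 (2 * M) - ball 0 M"

end

theory Submission
  imports Defs "HOL-Complex_Analysis.Conformal_Mappings"
begin

text \<open>
  Since \<open>\<sigma>4\<^sup>2 = 0\<close>, the exponential of \<open>- \<i> X \<sigma>4\<close> is \<open>1 - \<i> X \<sigma>4\<close>, and conjugation with it can be
  computed in closed form: the new diagonal and off-diagonal perturbations are \<open>\<i> [X, B] + 2 X B X\<close>
  and \<open>- \<i> (X B + B X) + 2 X B X\<close>, once the time derivative of \<open>X\<close> cancels \<open>W\<close>. The latter holds for
  \<open>X = B\<^sup>-\<^sup>1\<^sup>/\<^sup>2 U B\<^sup>-\<^sup>1\<^sup>/\<^sup>2\<close> with \<open>\<omega> \<cdot> \<partial> U = V / 2\<close>, which is solved in Fourier series as \<open>V\<close> has zero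
  mean. Exponentially small divisors \<open>|k \<cdot> \<omega>| \<ge> \<gamma> M exp (- \<epsilon> |k|)\<close> suffice because \<open>V\<close> is analytic
  in \<open>\<theta>\<close>; they exclude a set of relative measure \<open>O(\<gamma>)\<close> from the annulus and yield \<open>U = O(1 / M)\<close>.
  The operator \<open>X\<close> has order \<open>- 1\<close>, and so has its commutator with \<open>B\<close>, while \<open>X B + B X\<close> has order \<open>0\<close>.
  As \<open>U\<close> is a multiplication operator, all operators are multiplications whose matrix entries
  carry an explicit weight; \<open>X B X\<close> equals \<open>B\<^sup>-\<^sup>1\<^sup>/\<^sup>2 U\<^sup>2 B\<^sup>-\<^sup>1\<^sup>/\<^sup>2\<close>.
\<close>

section \<open>Weights and their differences\<close>

text \<open>Three points shape the construction. Composition and adjoint theorems for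
  pseudodifferential operators are replaced by explicit series: a symbol is a sum over modes of
  coefficient times weight times exponentials in \<open>\<theta>\<close> and \<open>x\<close>. Only
  the weight depends on \<open>j\<close>, only the coefficient on \<open>\<omega>\<close>, and
  symbols are linear in the coefficients; so one bound of each seminorm by a weighted l1 norm yields
  size and Lipschitz estimates alike. Polynomial growth of weights in the frequency of
  \<open>x\<close> is harmless, since the Fourier coefficients of \<open>V\<close> decay faster than
  any power.

  For zero mass, \<open>B\<close> annihilates constants, and
  \<open>B\<^sup>-\<^sup>1\<^sup>/\<^sup>2 B B\<^sup>-\<^sup>1\<^sup>/\<^sup>2\<close> is the
  identity on odd sequences only. This suffices: the phase space is odd, and \<open>V\<close>, being
  even in \<open>x\<close>, preserves it.

  The nonresonance bound contains the factor \<open>M\<close>, the size of \<open>\<omega>\<close>.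
  Hence the resonant slabs have relative thickness independent of \<open>M\<close>, one small
  divisor yields \<open>1 / M\<close>, and the Lipschitz quotient, with two divisors, yields
  \<open>1 / M\<^sup>2\<close>, which is at most \<open>1 / M\<close>.\<close>

lemma jap_ge_1: "1 \<le> jap j"
  by (simp add: jap_def)

lemma jap_pos [simp]: "0 < jap j"
  using jap_ge_1[of j] by linarith

lemma jap_nonneg [simp]: "0 \<le> jap j" and jap_nonzero [simp]: "jap j \<noteq> 0"
  using jap_pos[of j] by linarith+

lemma sqrt_jap_powr: "sqrt (jap j powr m) = jap j powr (m / 2)"
  by (simp add: powr_half_sqrt_powr)

section \<open>Peetre's inequality for the Japanese bracket\<close>

lemma jap_add_le: "jap (j + p) \<le> (1 + \<bar>real_of_int p\<bar>) * jap j"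
proof -
  have "jap (j + p) = norm (1 :: real, real_of_int j + real_of_int p)"
    by (simp add: jap_def norm_Pair)
  also have "\<dots> \<le> norm (1 :: real, real_of_int j) + norm (0 :: real, real_of_int p)"
    using norm_triangle_ineq[of "(1 :: real, real_of_int j)" "(0 :: real, real_of_int p)"] by simp
  also have "\<dots> = jap j + \<bar>real_of_int p\<bar> * 1"
    by (simp add: jap_def norm_Pair)
  also have "\<dots> \<le> jap j + \<bar>real_of_int p\<bar> * jap j"
    by (intro add_left_mono mult_left_mono jap_ge_1) auto
  finally show ?thesis by (simp add: algebra_simps)
qed

text \<open>Moving the base point by \<open>p\<close> costs a polynomial in \<open>p\<close> for
  exponents of either sign: for negative \<open>s\<close> the linear bound is applied with
  \<open>j\<close> and \<open>j + p\<close> exchanged.\<close>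

lemma jap_powr_add_le: "jap (j + p) powr s \<le> (1 + \<bar>real_of_int p\<bar>) powr \<bar>s\<bar> * jap j powr s"
proof (cases "s \<ge> 0")
  case True
  have "jap (j + p) powr s \<le> ((1 + \<bar>real_of_int p\<bar>) * jap j) powr s"
    using jap_add_le[of j p] True by (intro powr_mono2) (auto simp: less_imp_le)
  then show ?thesis using True by (simp add: powr_mult less_imp_le)
next
  case False
  have "jap j \<le> (1 + \<bar>real_of_int p\<bar>) * jap (j + p)"
    using jap_add_le[of "j + p" "- p"] by simp
  then have "((1 + \<bar>real_of_int p\<bar>) * jap (j + p)) powr s \<le> jap j powr s"
    using False by (intro powr_mono2') (auto simp: less_imp_le)
  then have "(1 + \<bar>real_of_int p\<bar>) powr s * jap (j + p) powr s \<le> jap j powr s"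
    by (simp add: powr_mult less_imp_le)
  then have "(1 + \<bar>real_of_int p\<bar>) powr (-s) * ((1 + \<bar>real_of_int p\<bar>) powr s * jap (j + p) powr s)
      \<le> (1 + \<bar>real_of_int p\<bar>) powr (-s) * jap j powr s"
    by (intro mult_left_mono) auto
  also have "(1 + \<bar>real_of_int p\<bar>) powr (-s) * ((1 + \<bar>real_of_int p\<bar>) powr s * jap (j + p) powr s)
      = jap (j + p) powr s"
    by (simp add: powr_minus field_simps)
  finally show ?thesis using False by simp
qed

text \<open>A natural exponent can be absorbed by the decay conditions on coefficients, which are
  stated for all natural powers.\<close>

lemma jap_powr_add_le_power:
  assumes "\<bar>s\<bar> \<le> real N"
  shows "jap (j + p) powr s \<le> (1 + \<bar>real_of_int p\<bar>) ^ N * jap j powr s"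
proof -
  have "(1 + \<bar>real_of_int p\<bar>) powr \<bar>s\<bar> \<le> (1 + \<bar>real_of_int p\<bar>) powr real N"
    using assms by (intro powr_mono) auto
  also have "\<dots> = (1 + \<bar>real_of_int p\<bar>) ^ N"
    by (subst powr_realpow) auto
  finally show ?thesis
    using jap_powr_add_le[of j p s] by (meson mult_right_mono order_trans powr_ge_zero)
qed

text \<open>Any polynomial growth in the shift \<open>p\<close> is allowed, with no record of the
  power \<open>K\<close>: weights are always multiplied by coefficients that decrease faster than
  every power of \<open>p\<close>.\<close>

definition bounded_weight :: "real \<Rightarrow> (int \<Rightarrow> int \<Rightarrow> real) \<Rightarrow> bool" where
  "bounded_weight m \<mu> \<longleftrightarrow>
     (\<exists>C\<ge>0. \<exists>K. \<forall>p j. \<bar>\<mu> p j\<bar> \<le> C * (1 + \<bar>real_of_int p\<bar>) ^ K * jap j powr m)"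

text \<open>The symbol condition in \<open>j\<close>, truncated after \<open>n\<close> differences.
  The truncation makes induction on \<open>n\<close> possible: the rules for quotients and roots
  express a difference through the function itself with one difference less.\<close>

primrec weight_upto :: "nat \<Rightarrow> real \<Rightarrow> (int \<Rightarrow> int \<Rightarrow> real) \<Rightarrow> bool" where
  "weight_upto 0 m \<mu> \<longleftrightarrow> bounded_weight m \<mu>"
| "weight_upto (Suc n) m \<mu> \<longleftrightarrow> bounded_weight m \<mu> \<and>
     weight_upto n (m - 1) (\<lambda>p j. \<mu> p (j + 1) - \<mu> p j)"

lemma bounded_weightI:
  assumes "\<And>p j. \<bar>\<mu> p j\<bar> \<le> C * (1 + \<bar>real_of_int p\<bar>) ^ K * jap j powr m"
  shows "bounded_weight m \<mu>"
  unfolding bounded_weight_def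
proof (intro exI[of _ "\<bar>C\<bar>"] exI[of _ K] conjI allI)
  fix p j
  have "C * (1 + \<bar>real_of_int p\<bar>) ^ K * jap j powr m \<le> \<bar>C\<bar> * (1 + \<bar>real_of_int p\<bar>) ^ K * jap j powr m"
    by (intro mult_right_mono) auto
  then show "\<bar>\<mu> p j\<bar> \<le> \<bar>C\<bar> * (1 + \<bar>real_of_int p\<bar>) ^ K * jap j powr m"
    using assms[of p j] by linarith
qed simp

section \<open>Sums, products and shifts of weights\<close>

lemma bounded_weight_add:
  assumes "bounded_weight m f" "bounded_weight m g"
  shows "bounded_weight m (\<lambda>p j. f p j + g p j)"
proof -
  obtain C K where 1: "C \<ge> 0" "\<And>p j. \<bar>f p j\<bar> \<le> C * (1 + \<bar>real_of_int p\<bar>) ^ K * jap j powr m"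
    using assms(1) unfolding bounded_weight_def by blast
  obtain D L where 2: "D \<ge> 0" "\<And>p j. \<bar>g p j\<bar> \<le> D * (1 + \<bar>real_of_int p\<bar>) ^ L * jap j powr m"
    using assms(2) unfolding bounded_weight_def by blast
  show ?thesis
  proof (rule bounded_weightI[where C = "C + D" and K = "K + L"])
    fix p j
    have "C * (1 + \<bar>real_of_int p\<bar>) ^ K * jap j powr m \<le> C * (1 + \<bar>real_of_int p\<bar>) ^ (K + L) * jap j powr m"
      using 1 by (intro mult_right_mono mult_left_mono power_increasing) auto
    moreover have "D * (1 + \<bar>real_of_int p\<bar>) ^ L * jap j powr m \<le> D * (1 + \<bar>real_of_int p\<bar>) ^ (K + L) * jap j powr m"
      using 2 by (intro mult_right_mono mult_left_mono power_increasing) auto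
    ultimately show "\<bar>f p j + g p j\<bar> \<le> (C + D) * (1 + \<bar>real_of_int p\<bar>) ^ (K + L) * jap j powr m"
      using 1(2)[of p j] 2(2)[of p j] unfolding distrib_right by linarith
  qed
qed

lemma bounded_weight_mult:
  assumes "bounded_weight m f" "bounded_weight m' g"
  shows "bounded_weight (m + m') (\<lambda>p j. f p j * g p j)"
proof -
  obtain C K where 1: "C \<ge> 0" "\<And>p j. \<bar>f p j\<bar> \<le> C * (1 + \<bar>real_of_int p\<bar>) ^ K * jap j powr m"
    using assms(1) unfolding bounded_weight_def by blast
  obtain D L where 2: "D \<ge> 0" "\<And>p j. \<bar>g p j\<bar> \<le> D * (1 + \<bar>real_of_int p\<bar>) ^ L * jap j powr m'"
    using assms(2) unfolding bounded_weight_def by blast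
  show ?thesis
  proof (rule bounded_weightI[where C = "C * D" and K = "K + L"])
    fix p j
    have "\<bar>f p j * g p j\<bar> \<le> (C * (1 + \<bar>real_of_int p\<bar>) ^ K * jap j powr m) *
        (D * (1 + \<bar>real_of_int p\<bar>) ^ L * jap j powr m')"
      unfolding abs_mult using 1 by (intro mult_mono 1 2) auto
    then show "\<bar>f p j * g p j\<bar> \<le> C * D * (1 + \<bar>real_of_int p\<bar>) ^ (K + L) * jap j powr (m + m')"
      by (simp add: power_add powr_add mult_ac)
  qed
qed

text \<open>The condition on \<open>c\<close> admits both the unit shift of the Leibniz rule and the
  shift by \<open>p\<close> itself, which leads from the incoming to the outgoing mode.\<close>

lemma bounded_weight_shift:
  assumes "bounded_weight m f" "\<And>p. \<bar>c p\<bar> \<le> 1 + \<bar>p\<bar>"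
  shows "bounded_weight m (\<lambda>p j. f p (j + c p))"
proof -
  obtain C K where 1: "C \<ge> 0" "\<And>p j. \<bar>f p j\<bar> \<le> C * (1 + \<bar>real_of_int p\<bar>) ^ K * jap j powr m"
    using assms(1) unfolding bounded_weight_def by blast
  define N where "N = nat \<lceil>\<bar>m\<bar>\<rceil>"
  have N: "\<bar>m\<bar> \<le> real N"
    unfolding N_def by linarith
  show ?thesis
  proof (rule bounded_weightI[where C = "C * 2 ^ N" and K = "K + N"])
    fix p j
    have "real_of_int \<bar>c p\<bar> \<le> real_of_int (1 + \<bar>p\<bar>)"
      using assms(2)[of p] of_int_le_iff by blast
    then have c: "1 + \<bar>real_of_int (c p)\<bar> \<le> 2 * (1 + \<bar>real_of_int p\<bar>)"
      by simp
    have "jap (j + c p) powr m \<le> (1 + \<bar>real_of_int (c p)\<bar>) ^ N * jap j powr m"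
      by (rule jap_powr_add_le_power[OF N])
    also have "\<dots> \<le> (2 * (1 + \<bar>real_of_int p\<bar>)) ^ N * jap j powr m"
      by (intro mult_right_mono power_mono c) auto
    finally have *: "jap (j + c p) powr m \<le> (2 * (1 + \<bar>real_of_int p\<bar>)) ^ N * jap j powr m" .
    have "\<bar>f p (j + c p)\<bar> \<le> C * (1 + \<bar>real_of_int p\<bar>) ^ K * ((2 * (1 + \<bar>real_of_int p\<bar>)) ^ N * jap j powr m)"
      using 1 by (intro order_trans[OF 1(2)] mult_left_mono *) auto
    then show "\<bar>f p (j + c p)\<bar> \<le> C * 2 ^ N * (1 + \<bar>real_of_int p\<bar>) ^ (K + N) * jap j powr m"
      unfolding power_add power_mult_distrib by (simp only: mult_ac)
  qed
qed

lemma bounded_weight_mono: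
  assumes "bounded_weight m f" "m \<le> m'"
  shows "bounded_weight m' f"
proof -
  obtain C K where 1: "C \<ge> 0" "\<And>p j. \<bar>f p j\<bar> \<le> C * (1 + \<bar>real_of_int p\<bar>) ^ K * jap j powr m"
    using assms(1) unfolding bounded_weight_def by blast
  show ?thesis
  proof (rule bounded_weightI[where C = C and K = K])
    fix p j
    have "jap j powr m \<le> jap j powr m'"
      using assms(2) jap_ge_1 by (intro powr_mono) auto
    then have "C * (1 + \<bar>real_of_int p\<bar>) ^ K * jap j powr m \<le> C * (1 + \<bar>real_of_int p\<bar>) ^ K * jap j powr m'"
      using 1 by (intro mult_left_mono) auto
    then show "\<bar>f p j\<bar> \<le> C * (1 + \<bar>real_of_int p\<bar>) ^ K * jap j powr m'"
      using 1(2)[of p j] by linarith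
  qed
qed

lemma weight_upto_imp_bounded: "weight_upto n m f \<Longrightarrow> bounded_weight m f"
  by (cases n) auto

lemma weight_upto_Suc_D: "weight_upto (Suc n) m f \<Longrightarrow> weight_upto n m f"
proof (induction n arbitrary: m f)
  case (Suc n)
  have "weight_upto (Suc n) (m - 1) (\<lambda>p j. f p (j + 1) - f p j)" "bounded_weight m f"
    using Suc.prems by (simp_all only: weight_upto.simps)
  then have "weight_upto n (m - 1) (\<lambda>p j. f p (j + 1) - f p j)" "bounded_weight m f"
    using Suc.IH by blast+
  then show ?case by simp
qed simp

lemma weight_upto_add:
  "weight_upto n m f \<Longrightarrow> weight_upto n m g \<Longrightarrow> weight_upto n m (\<lambda>p j. f p j + g p j)"
proof (induction n arbitrary: m f g)
  case 0
  then show ?case by (simp add: bounded_weight_add)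
next
  case (Suc n)
  have "weight_upto n (m - 1) (\<lambda>p j. (f p (j + 1) - f p j) + (g p (j + 1) - g p j))"
    using Suc by simp
  moreover have "(\<lambda>p j. (f p (j + 1) - f p j) + (g p (j + 1) - g p j)) =
      (\<lambda>p j. f p (j + 1) + g p (j + 1) - (f p j + g p j))"
    by (simp add: fun_eq_iff)
  ultimately show ?case using Suc.prems by (simp add: bounded_weight_add)
qed

lemma weight_upto_shift:
  assumes "\<And>p. \<bar>c p\<bar> \<le> 1 + \<bar>p\<bar>"
  shows "weight_upto n m f \<Longrightarrow> weight_upto n m (\<lambda>p j. f p (j + c p))"
proof (induction n arbitrary: m f)
  case 0
  then show ?case using bounded_weight_shift[OF _ assms] by simp
next
  case (Suc n)
  have "weight_upto n (m - 1) (\<lambda>p j. f p (j + c p + 1) - f p (j + c p))"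
    using Suc.IH[of "m - 1" "\<lambda>p j. f p (j + 1) - f p j"] Suc.prems by simp
  then show ?case using Suc.prems bounded_weight_shift[of m f c, OF _ assms] by (simp add: add_ac)
qed

lemma weight_upto_mono:
  "weight_upto n m f \<Longrightarrow> m \<le> m' \<Longrightarrow> weight_upto n m' f"
proof (induction n arbitrary: m m' f)
  case 0
  then show ?case using bounded_weight_mono by simp
next
  case (Suc n)
  show ?case using Suc.prems Suc.IH[of "m - 1" "\<lambda>p j. f p (j + 1) - f p j" "m' - 1"]
      bounded_weight_mono[of m f m'] by simp
qed

text \<open>Discrete Leibniz rule: the difference of a product is (Delta f) times the shifted
  \<open>g\<close> plus \<open>f\<close> times (Delta g), and either summand has gained one
  order.\<close>

lemma weight_upto_mult:
  "weight_upto n m f \<Longrightarrow> weight_upto n m' g \<Longrightarrow> weight_upto n (m + m') (\<lambda>p j. f p j * g p j)"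
proof (induction n arbitrary: m m' f g)
  case 0
  then show ?case by (simp add: bounded_weight_mult)
next
  case (Suc n)
  have 1: "weight_upto n ((m - 1) + m') (\<lambda>p j. (f p (j + 1) - f p j) * g p (j + 1))"
    using Suc.prems by (intro Suc.IH weight_upto_shift[where c = "\<lambda>_. 1"] weight_upto_Suc_D[OF Suc.prems(2)]) auto
  have 2: "weight_upto n (m + (m' - 1)) (\<lambda>p j. f p j * (g p (j + 1) - g p j))"
    using Suc.prems by (intro Suc.IH weight_upto_Suc_D[OF Suc.prems(1)]) auto
  have "weight_upto n (m + m' - 1)
      (\<lambda>p j. (f p (j + 1) - f p j) * g p (j + 1) + f p j * (g p (j + 1) - g p j))"
    using 1 2 by (intro weight_upto_add) (simp_all add: algebra_simps)
  moreover have "(\<lambda>p j. (f p (j + 1) - f p j) * g p (j + 1) + f p j * (g p (j + 1) - g p j)) =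
      (\<lambda>p j. f p (j + 1) * g p (j + 1) - f p j * g p j)"
    by (simp add: fun_eq_iff algebra_simps)
  ultimately show ?case
    using bounded_weight_mult[of m f m' g] Suc.prems by simp
qed

lemma weight_upto_minus: "weight_upto n m f \<Longrightarrow> weight_upto n m (\<lambda>p j. - f p j)"
proof (induction n arbitrary: m f)
  case 0
  then show ?case by (simp add: bounded_weight_def)
next
  case (Suc n)
  have "weight_upto n (m - 1) (\<lambda>p j. - (f p (j + 1) - f p j))"
    using Suc.prems Suc.IH[of "m - 1" "\<lambda>p j. f p (j + 1) - f p j"] unfolding weight_upto.simps by blast
  then show ?case using Suc.prems by (simp add: bounded_weight_def)
qed

lemma bounded_weight_inverse:
  assumes "c > 0" "\<And>p j. f p j \<ge> c * jap j powr m"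
  shows "bounded_weight (- m) (\<lambda>p j. 1 / f p j)"
proof (rule bounded_weightI[where C = "1 / c" and K = 0])
  fix p j
  have "0 < c * jap j powr m" using assms(1) by simp
  then have "\<bar>1 / f p j\<bar> \<le> 1 / (c * jap j powr m)"
    using assms(2)[of j p] by (simp add: frac_le)
  then show "\<bar>1 / f p j\<bar> \<le> 1 / c * (1 + \<bar>real_of_int p\<bar>) ^ 0 * jap j powr - m"
    by (simp add: powr_minus field_simps)
qed

text \<open>Discrete quotient rule: the difference of \<open>1 / f\<close> is minus the difference
  of \<open>f\<close> times two reciprocals, which the induction hypothesis controls. The orders add
  up to \<open>(m - 1) - 2 * m\<close>. The lower bound with \<open>c\<close> is
  ellipticity.\<close>

lemma weight_upto_inverse:
  assumes "c > 0" "\<And>p j. f p j \<ge> c * jap j powr m" "weight_upto n m f"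
  shows "weight_upto n (- m) (\<lambda>p j. 1 / f p j)"
  using assms(3)
proof (induction n)
  case 0
  then show ?case using bounded_weight_inverse[OF assms(1,2)] by simp
next
  case (Suc n)
  have pos: "f p j > 0" for p j
    using assms(2)[of j p] assms(1) by (smt (verit) jap_pos mult_pos_pos powr_gt_zero)
  have IH: "weight_upto n (- m) (\<lambda>p j. 1 / f p j)"
    using Suc.IH weight_upto_Suc_D[OF Suc.prems] by blast
  have "weight_upto n ((m - 1) + (- m + - m))
      (\<lambda>p j. - (f p (j + 1) - f p j) * (1 / f p j * (1 / f p (j + 1))))"
    using Suc.prems IH
    by (intro weight_upto_mult weight_upto_minus weight_upto_shift[where c = "\<lambda>_. 1" and f = "\<lambda>p j. 1 / f p j"]) auto
  moreover have "(\<lambda>p j. - (f p (j + 1) - f p j) * (1 / f p j * (1 / f p (j + 1)))) =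
      (\<lambda>p j. 1 / f p (j + 1) - 1 / f p j)"
    using pos by (auto simp: fun_eq_iff field_simps less_imp_neq[symmetric])
  ultimately show ?case using bounded_weight_inverse[OF assms(1,2)] by simp
qed

lemma bounded_weight_sqrt:
  assumes "bounded_weight m f"
  shows "bounded_weight (m / 2) (\<lambda>p j. sqrt (f p j))"
proof -
  obtain C K where 1: "C \<ge> 0" "\<And>p j. \<bar>f p j\<bar> \<le> C * (1 + \<bar>real_of_int p\<bar>) ^ K * jap j powr m"
    using assms(1) unfolding bounded_weight_def by blast
  show ?thesis
  proof (rule bounded_weightI[where C = "sqrt C" and K = K])
    fix p j
    have "\<bar>sqrt (f p j)\<bar> = sqrt \<bar>f p j\<bar>" by (simp add: real_sqrt_abs2 real_sqrt_minus abs_if)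
    also have "\<dots> \<le> sqrt (C * (1 + \<bar>real_of_int p\<bar>) ^ K * jap j powr m)"
      using 1(2) by simp
    also have "\<dots> = sqrt C * sqrt ((1 + \<bar>real_of_int p\<bar>) ^ K) * jap j powr (m / 2)"
      by (simp add: real_sqrt_mult sqrt_jap_powr)
    also have "\<dots> \<le> sqrt C * (1 + \<bar>real_of_int p\<bar>) ^ K * jap j powr (m / 2)"
    proof (intro mult_right_mono mult_left_mono)
      have "1 \<le> (1 + \<bar>real_of_int p\<bar>) ^ K" by simp
      then show "sqrt ((1 + \<bar>real_of_int p\<bar>) ^ K) \<le> (1 + \<bar>real_of_int p\<bar>) ^ K"
        using real_sqrt_le_mono[of "(1 + \<bar>real_of_int p\<bar>) ^ K" "((1 + \<bar>real_of_int p\<bar>) ^ K)\<^sup>2"]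
        by (simp add: power2_eq_square)
    qed (use 1 in auto)
    finally show "\<bar>sqrt (f p j)\<bar> \<le> sqrt C * (1 + \<bar>real_of_int p\<bar>) ^ K * jap j powr (m / 2)" .
  qed
qed

text \<open>The difference of square roots is the difference divided by the sum of the roots, a weight
  with one difference less.\<close>

lemma weight_upto_sqrt:
  assumes "c > 0" "\<And>p j. f p j \<ge> c * jap j powr m" "weight_upto n m f"
  shows "weight_upto n (m / 2) (\<lambda>p j. sqrt (f p j))"
  using assms(3)
proof (induction n)
  case 0
  then show ?case by (simp add: bounded_weight_sqrt)
next
  case (Suc n)
  let ?g = "\<lambda>p j. sqrt (f p j)"
  have pos: "f p j > 0" for p j
    using assms(2)[of j p] assms(1) by (smt (verit) jap_pos mult_pos_pos powr_gt_zero)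
  have IH: "weight_upto n (m / 2) ?g"
    using Suc.IH weight_upto_Suc_D[OF Suc.prems] by blast
  have low: "?g p j \<ge> sqrt c * jap j powr (m / 2)" for p j
    using real_sqrt_le_mono[OF assms(2)[of j p]] by (simp add: real_sqrt_mult sqrt_jap_powr)
  have "weight_upto n (- (m / 2)) (\<lambda>p j. 1 / (?g p (j + 1) + ?g p j))"
  proof (rule weight_upto_inverse[where c = "sqrt c"])
    show "sqrt c * jap j powr (m / 2) \<le> ?g p (j + 1) + ?g p j" for p j
      using low[of j p] pos[of p "j + 1"] by (smt (verit) real_sqrt_gt_zero)
    show "weight_upto n (m / 2) (\<lambda>p j. ?g p (j + 1) + ?g p j)"
      using IH by (intro weight_upto_add weight_upto_shift[where c = "\<lambda>_. 1"]) auto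
  qed (use assms in auto)
  then have "weight_upto n ((m - 1) + - (m / 2)) (\<lambda>p j. (f p (j + 1) - f p j) * (1 / (?g p (j + 1) + ?g p j)))"
    using Suc.prems by (intro weight_upto_mult) auto
  moreover have "(f p (j + 1) - f p j) * (1 / (?g p (j + 1) + ?g p j)) = ?g p (j + 1) - ?g p j" for p j
  proof -
    have "?g p (j + 1) + ?g p j > 0"
      using pos[of p j] pos[of p "j + 1"] by (simp add: add_pos_pos)
    moreover have "(?g p (j + 1) - ?g p j) * (?g p (j + 1) + ?g p j) = f p (j + 1) - f p j"
      using pos[of p j] pos[of p "j + 1"] by (simp add: algebra_simps less_imp_le)
    ultimately show ?thesis by (simp add: field_simps)
  qed
  ultimately have "weight_upto n ((m - 1) + - (m / 2)) (\<lambda>p j. ?g p (j + 1) - ?g p j)"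
    by (simp only:)
  moreover have "(m - 1) + - (m / 2) = m / 2 - 1"
    by simp
  ultimately have "weight_upto n (m / 2 - 1) (\<lambda>p j. ?g p (j + 1) - ?g p j)"
    by (simp only:)
  then show ?case using bounded_weight_sqrt[of m f] Suc.prems by simp
qed

text \<open>A discrete mean value estimate: the increment over \<open>p\<close> telescopes into unit
  differences of order \<open>m - 1\<close>, each transported back to \<open>j\<close> by Peetre's
  inequality.\<close>

lemma bounded_weight_diff:
  assumes "weight_upto 1 m (\<lambda>_. s)"
  shows "bounded_weight (m - 1) (\<lambda>p j. s (j + p) - s j)"
proof -
  obtain C where C: "C \<ge> 0" "\<And>j. \<bar>s (j + 1) - s j\<bar> \<le> C * jap j powr (m - 1)"
  proof -
    from assms obtain C K where "C \<ge> 0"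
      and *: "\<And>p j. \<bar>s (j + 1) - s j\<bar> \<le> C * (1 + \<bar>real_of_int p\<bar>) ^ K * jap j powr (m - 1)"
      unfolding One_nat_def weight_upto.simps bounded_weight_def by blast
    then show ?thesis using that[of C] *[of _ 0] by simp
  qed
  define N where "N = nat \<lceil>\<bar>m - 1\<bar>\<rceil>"
  have N: "\<bar>m - 1\<bar> \<le> real N"
    unfolding N_def by linarith
  have nn: "\<bar>s (j + int q) - s j\<bar> \<le> real q * (C * (1 + real q) ^ N * jap j powr (m - 1))" for j q
  proof (induction q)
    case (Suc q)
    have "\<bar>s (j + int q + 1) - s (j + int q)\<bar> \<le> C * jap (j + int q) powr (m - 1)"
      using C(2)[of "j + int q"] by simp
    also have "\<dots> \<le> C * ((1 + \<bar>real_of_int (int q)\<bar>) ^ N * jap j powr (m - 1))"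
      by (intro mult_left_mono jap_powr_add_le_power N C)
    also have "\<dots> \<le> C * ((1 + real (Suc q)) ^ N * jap j powr (m - 1))"
      using C by (intro mult_left_mono mult_right_mono power_mono) auto
    finally have 1: "\<bar>s (j + int q + 1) - s (j + int q)\<bar> \<le> C * (1 + real (Suc q)) ^ N * jap j powr (m - 1)"
      by (simp add: mult_ac)
    have 2: "real q * (C * (1 + real q) ^ N * jap j powr (m - 1)) \<le>
        real q * (C * (1 + real (Suc q)) ^ N * jap j powr (m - 1))"
      using C by (intro mult_left_mono mult_right_mono power_mono) auto
    have eq: "s (j + int (Suc q)) - s j = (s (j + int q + 1) - s (j + int q)) + (s (j + int q) - s j)"
      by (simp add: add_ac)
    have "\<bar>s (j + int (Suc q)) - s j\<bar> \<le> C * (1 + real (Suc q)) ^ N * jap j powr (m - 1) +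
        real q * (C * (1 + real (Suc q)) ^ N * jap j powr (m - 1))"
      unfolding eq using 1 2 Suc by linarith
    then show ?case by (simp add: algebra_simps)
  qed simp
  show ?thesis
  \<comment> \<open>One power counts the summands of the telescope, \<open>N\<close> powers
    transport each summand, and \<open>N\<close> more move the base point from \<open>j + p\<close>
    to \<open>j\<close> when \<open>p\<close> is negative.\<close>
  proof (rule bounded_weightI[where C = C and K = "1 + 2 * N"])
    fix p j
    define q where "q = nat \<bar>p\<bar>"
    have q: "real q = \<bar>real_of_int p\<bar>" by (simp add: q_def)
    have "\<bar>s (j + p) - s j\<bar> \<le> real q * (C * (1 + real q) ^ N * ((1 + real q) ^ N * jap j powr (m - 1)))"
    proof (cases "p \<ge> 0")
      case True
      then have "\<bar>s (j + p) - s j\<bar> \<le> real q * (C * (1 + real q) ^ N * (1 * jap j powr (m - 1)))"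
        using nn[of j q] by (simp add: q_def)
      also have "\<dots> \<le> real q * (C * (1 + real q) ^ N * ((1 + real q) ^ N * jap j powr (m - 1)))"
        using C by (intro mult_left_mono mult_right_mono one_le_power) auto
      finally show ?thesis .
    next
      case False
      then have "\<bar>s (j + p) - s j\<bar> \<le> real q * (C * (1 + real q) ^ N * jap (j + p) powr (m - 1))"
        using nn[of "j + p" q] by (simp add: q_def)
      also have "\<dots> \<le> real q * (C * (1 + real q) ^ N * ((1 + real q) ^ N * jap j powr (m - 1)))"
        using C jap_powr_add_le_power[OF N, of j p] q by (intro mult_left_mono) auto
      finally show ?thesis .
    qed
    also have "\<dots> \<le> (1 + real q) * (C * (1 + real q) ^ N * ((1 + real q) ^ N * jap j powr (m - 1)))"
      using C by (intro mult_right_mono) auto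
    finally show "\<bar>s (j + p) - s j\<bar> \<le> C * (1 + \<bar>real_of_int p\<bar>) ^ (1 + 2 * N) * jap j powr (m - 1)"
      unfolding q power_add mult_2 by (simp only: mult_ac power_one_right)
  qed
qed

text \<open>This gain of one order turns the increment of the symbol of \<open>B\<close> into a
  weight of order 0. It is the reason why the commutator of \<open>X\<close> with \<open>B\<close>
  has the order of \<open>X\<close>.\<close>

lemma weight_upto_diff:
  "weight_upto (Suc n) m (\<lambda>_. s) \<Longrightarrow> weight_upto n (m - 1) (\<lambda>p j. s (j + p) - s j)"
proof (induction n arbitrary: m s)
  case 0
  then show ?case using bounded_weight_diff by simp
next
  case (Suc n)
  have "bounded_weight (m - 1) (\<lambda>p j. s (j + p) - s j)"
    using Suc.prems by (intro bounded_weight_diff) (auto intro: weight_upto_imp_bounded)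
  moreover have "weight_upto n (m - 1 - 1) (\<lambda>p j. (s (j + p + 1) - s (j + p)) - (s (j + 1) - s j))"
    using Suc.prems by (intro Suc.IH[of "m - 1" "\<lambda>j. s (j + 1) - s j"]) auto
  ultimately show ?case by (simp add: algebra_simps)
qed

text \<open>Such a weight has every order \<open>m\<close>, that is, it is smoothing; it serves to
  repair a symbol at the single mode \<open>j = 0\<close>.\<close>

lemma weight_upto_finite_support:
  "finite {j. s j \<noteq> 0} \<Longrightarrow> weight_upto n m (\<lambda>_. s)"
proof (induction n arbitrary: m s)
  have bw: "bounded_weight m (\<lambda>_. s)" if fin: "finite {j. s j \<noteq> 0}" for m and s :: "int \<Rightarrow> real"
  proof (rule bounded_weightI[where C = "\<Sum>j\<in>{j. s j \<noteq> 0}. \<bar>s j\<bar> * jap j powr (- m)" and K = 0])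
    fix p j :: int
    show "\<bar>s j\<bar> \<le> (\<Sum>j\<in>{j. s j \<noteq> 0}. \<bar>s j\<bar> * jap j powr (- m)) * (1 + \<bar>real_of_int p\<bar>) ^ 0 * jap j powr m"
    proof (cases "s j = 0")
      case True
      then show ?thesis by (simp add: sum_nonneg)
    next
      case False
      then have "\<bar>s j\<bar> * jap j powr (- m) \<le> (\<Sum>j\<in>{j. s j \<noteq> 0}. \<bar>s j\<bar> * jap j powr (- m))"
        using fin by (intro member_le_sum) auto
      then have "\<bar>s j\<bar> * jap j powr (- m) * jap j powr m \<le> (\<Sum>j\<in>{j. s j \<noteq> 0}. \<bar>s j\<bar> * jap j powr (- m)) * jap j powr m"
        by (intro mult_right_mono) auto
      then show ?thesis by (simp add: powr_minus mult.assoc)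
    qed
  qed
  {
    case 0
    then show ?case using bw by simp
  next
    case (Suc n)
    have "{j. s (j + 1) - s j \<noteq> 0} \<subseteq> (\<lambda>j. j - 1) ` {j. s j \<noteq> 0} \<union> {j. s j \<noteq> 0}"
    proof
      fix j assume "j \<in> {j. s (j + 1) - s j \<noteq> 0}"
      then have "s (j + 1) \<noteq> 0 \<or> s j \<noteq> 0" by auto
      then show "j \<in> (\<lambda>j. j - 1) ` {j. s j \<noteq> 0} \<union> {j. s j \<noteq> 0}"
        by (auto intro: image_eqI[where x = "j + 1"])
    qed
    then have "finite {j. s (j + 1) - s j \<noteq> 0}"
      using Suc.prems finite_subset by blast
    then show ?case using Suc bw by simp
  }
qed

lemma weight_upto_zero: "weight_upto n m (\<lambda>_ _. 0)"
  by (rule weight_upto_finite_support) simp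

lemma abs_le_jap: "\<bar>real_of_int j\<bar> \<le> jap j"
  by (simp add: jap_def real_le_rsqrt)

text \<open>The successive differences are \<open>2 * j + 1\<close>, \<open>2\<close> and
  \<open>0\<close>, so that only the first three levels require an estimate.\<close>

lemma weight_upto_square: "weight_upto n 2 (\<lambda>_ j. (real_of_int j)\<^sup>2 + a)"
proof -
  have 0: "bounded_weight 2 (\<lambda>_ j. (real_of_int j)\<^sup>2 + a)"
  proof (rule bounded_weightI[where C = "1 + \<bar>a\<bar>" and K = 0])
    fix p j :: int
    have "jap j powr 2 = 1 + (real_of_int j)\<^sup>2"
      using powr_realpow[of "jap j" 2] by (simp add: jap_def)
    moreover have "\<bar>(real_of_int j)\<^sup>2 + a\<bar> \<le> (real_of_int j)\<^sup>2 + \<bar>a\<bar> * 1"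
      by (rule order_trans[OF abs_triangle_ineq]) simp
    moreover have "\<dots> \<le> (1 + \<bar>a\<bar>) * (1 + (real_of_int j)\<^sup>2)" by (simp add: algebra_simps)
    ultimately show "\<bar>(real_of_int j)\<^sup>2 + a\<bar> \<le> (1 + \<bar>a\<bar>) * (1 + \<bar>real_of_int p\<bar>) ^ 0 * jap j powr 2"
      by simp
  qed
  have 1: "bounded_weight 1 (\<lambda>_ j. 2 * real_of_int j + 1)"
  proof (rule bounded_weightI[where C = 3 and K = 0])
    fix p j :: int
    show "\<bar>2 * real_of_int j + 1\<bar> \<le> 3 * (1 + \<bar>real_of_int p\<bar>) ^ 0 * jap j powr 1"
      using abs_le_jap[of j] jap_ge_1[of j] by (simp add: abs_if split: if_splits)
  qed
  have 2: "bounded_weight 0 (\<lambda>_ _. 2)"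
    by (rule bounded_weightI[where C = 2 and K = 0]) simp
  have "(\<lambda>(p::int) j. (real_of_int (j + 1))\<^sup>2 + a - ((real_of_int j)\<^sup>2 + a)) = (\<lambda>_ j. 2 * real_of_int j + 1)"
    by (simp add: fun_eq_iff power2_eq_square algebra_simps)
  note eqs = this
  show ?thesis
  proof (cases n)
    case 0
    then show ?thesis using \<open>bounded_weight 2 _\<close> by simp
  next
    case (Suc n1)
    have "weight_upto n1 1 (\<lambda>_ j. 2 * real_of_int j + 1)"
    proof (cases n1)
      case (Suc n2)
      have "weight_upto n2 0 (\<lambda>_ _. 2)"
        using 2 weight_upto_zero by (cases n2) auto
      then show ?thesis using Suc 1 by simp
    qed (use 1 in simp)
    then show ?thesis using Suc 0 eqs by simp
  qed
qed

section \<open>The symbols of powers of \<open>B\<close>\<close>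

definition bsym :: "real \<Rightarrow> real \<Rightarrow> int \<Rightarrow> real" where
  "bsym mass s j = ((real_of_int j)\<^sup>2 + mass\<^sup>2) powr (s / 2)"

lemma bsym_minus [simp]: "bsym mass s (- j) = bsym mass s j"
  by (simp add: bsym_def)

text \<open>For zero mass the square of \<open>B\<close> is modified at \<open>j = 0\<close> to become elliptic; a weight of finite
  support corrects the modification.\<close>

lemma weight_upto_bsym:
  "weight_upto n 1 (\<lambda>_. bsym mass 1)" "weight_upto n (1 / 2) (\<lambda>_. bsym mass (1 / 2))"
  "weight_upto n (- (1 / 2)) (\<lambda>_. bsym mass (- 1 / 2))"
proof -
  define d where "d = (\<lambda>j::int. if j = 0 \<and> mass = 0 then 1 else 0 :: real)"
  define f where "f = (\<lambda>j. (real_of_int j)\<^sup>2 + mass\<^sup>2 + d j)"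
  have dw: "weight_upto n m (\<lambda>_. d)" for m
    by (rule weight_upto_finite_support) (simp add: d_def)
  have fw: "weight_upto n 2 (\<lambda>_. f)"
    unfolding f_def by (intro weight_upto_add weight_upto_square dw)
  have lf: "\<exists>c>0. \<forall>j. f j \<ge> c * jap j powr 2"
  proof -
    define c where "c = (if mass = 0 then 1 / 2 else min 1 (mass\<^sup>2))"
    have "f j \<ge> c * jap j powr 2" for j
    proof -
      have j2: "jap j powr 2 = 1 + (real_of_int j)\<^sup>2"
        using powr_realpow[of "jap j" 2] by (simp add: jap_def)
      show ?thesis
      proof (cases "mass = 0")
        case True
        have "j = 0 \<or> 1 \<le> (real_of_int j)\<^sup>2"
          by (smt (verit, best) of_int_1_le_iff of_int_power zero_less_power2)
        then show ?thesis unfolding j2 by (auto simp: f_def d_def c_def True)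
      next
        case False
        have "c \<le> 1" "c \<le> mass\<^sup>2" using False by (auto simp: c_def)
        then have "c * (1 + (real_of_int j)\<^sup>2) \<le> mass\<^sup>2 + 1 * (real_of_int j)\<^sup>2"
          unfolding distrib_left by (intro add_mono mult_right_mono) auto
        then show ?thesis unfolding j2 by (simp add: f_def d_def False)
      qed
    qed
    moreover have "c > 0" by (simp add: c_def)
    ultimately show ?thesis by blast
  qed
  then obtain c where c: "c > 0" "\<And>j. f j \<ge> c * jap j powr 2" by blast
  have f1: "weight_upto n 1 (\<lambda>_ j. sqrt (f j))"
    using weight_upto_sqrt[OF c(1) c(2) fw] by simp
  have c1: "sqrt (f j) \<ge> sqrt c * jap j powr 1" for j
    using real_sqrt_le_mono[OF c(2)[of j]] by (simp add: real_sqrt_mult sqrt_jap_powr)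
  have f2: "weight_upto n (1 / 2) (\<lambda>_ j. sqrt (sqrt (f j)))"
    using weight_upto_sqrt[OF _ c1 f1] c by simp
  have c2: "sqrt (sqrt (f j)) \<ge> sqrt (sqrt c) * jap j powr (1 / 2)" for j
    using real_sqrt_le_mono[OF c1[of j]] by (simp add: real_sqrt_mult powr_half_sqrt)
  have f3: "weight_upto n (- (1 / 2)) (\<lambda>_ j. 1 / sqrt (sqrt (f j)))"
    using weight_upto_inverse[OF _ c2 f2] c by simp
  have e: "bsym mass s j = f j powr (s / 2) - d j" for j s
    by (auto simp: bsym_def f_def d_def)
  have fpos: "f j > 0" for j
    using c(2)[of j] c(1) by (smt (verit) jap_pos mult_pos_pos powr_gt_zero)
  have p4: "f j powr (1 / 4) = sqrt (sqrt (f j))" for j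
  proof -
    have "f j powr (1 / 4) = (f j powr (1 / 2)) powr (1 / 2)"
      by (simp add: powr_powr)
    then show ?thesis using fpos[of j] by (simp add: powr_half_sqrt less_imp_le)
  qed
  show "weight_upto n 1 (\<lambda>_. bsym mass 1)"
    using weight_upto_add[OF f1 weight_upto_minus[OF dw]] fpos
    by (simp add: e[abs_def] powr_half_sqrt less_imp_le)
  show "weight_upto n (1 / 2) (\<lambda>_. bsym mass (1 / 2))"
    using weight_upto_add[OF f2 weight_upto_minus[OF dw]] by (simp add: e[abs_def] p4)
  have "f j powr (- 1 / 4) = 1 / sqrt (sqrt (f j))" for j
    using p4[of j] powr_minus[of "f j" "1 / 4"] by (simp add: field_simps)
  then show "weight_upto n (- (1 / 2)) (\<lambda>_. bsym mass (- 1 / 2))"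
    using weight_upto_add[OF f3 weight_upto_minus[OF dw]] by (simp add: e[abs_def])
qed

text \<open>These are the weights of \<open>X\<close>, of its commutator and of its anticommutator
  with \<open>B\<close>. The commutator contains an increment of \<open>b\<close>, of order 0
  instead of 1; in the anticommutator each factor \<open>b\<close> meets a \<open>\<beta>\<close> at
  the same mode and leaves a root of \<open>B\<close>.\<close>

lemma weight_upto_sandwich:
  fixes mass :: real
  defines "\<beta> \<equiv> bsym mass (- 1 / 2)" and "b \<equiv> bsym mass 1"
  shows "weight_upto n (- 1) (\<lambda>p j. \<beta> (j + p) * \<beta> j)"
    and "weight_upto n (- 1) (\<lambda>p j. \<beta> (j + p) * \<beta> j * (b j - b (j + p)))"
    and "weight_upto n 0 (\<lambda>p j. \<beta> (j + p) * \<beta> j * (b j + b (j + p)))"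
proof -
  have bw: "weight_upto n (- (1 / 2)) (\<lambda>_ j. \<beta> j)"
    unfolding \<beta>_def using weight_upto_bsym(3) .
  have bs: "weight_upto n (- (1 / 2)) (\<lambda>p j. \<beta> (j + p))"
    using weight_upto_shift[where c = "\<lambda>p. p", OF _ bw] by simp
  show w1: "weight_upto n (- 1) (\<lambda>p j. \<beta> (j + p) * \<beta> j)"
    using weight_upto_mult[OF bs bw] by simp
  have "weight_upto n (1 - 1) (\<lambda>p j. b (j + p) - b j)"
    unfolding b_def by (rule weight_upto_diff[OF weight_upto_bsym(1)])
  then have "weight_upto n 0 (\<lambda>p j. - (b (j + p) - b j))"
    using weight_upto_minus[of n 0 "\<lambda>p j. b (j + p) - b j"] by simp
  from weight_upto_mult[OF w1 this]
  show "weight_upto n (- 1) (\<lambda>p j. \<beta> (j + p) * \<beta> j * (b j - b (j + p)))" by simp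
  have "weight_upto n (1 / 2) (\<lambda>_ j. bsym mass (1 / 2) j)"
    using weight_upto_bsym(2) .
  note cw = this
  have cs: "weight_upto n (1 / 2) (\<lambda>p j. bsym mass (1 / 2) (j + p))"
    using weight_upto_shift[where c = "\<lambda>p. p", OF _ cw] by simp
  \<comment> \<open>This holds at \<open>j = 0\<close> for zero mass as well, where both sides
    vanish because \<open>0 powr a = 0\<close>.\<close>
  have 1: "\<beta> j * b j = bsym mass (1 / 2) j" for j
    unfolding \<beta>_def b_def bsym_def by (simp add: powr_add[symmetric])
  have eq: "\<beta> (j + p) * \<beta> j * (b j + b (j + p)) =
      \<beta> (j + p) * bsym mass (1 / 2) j + bsym mass (1 / 2) (j + p) * \<beta> j" for p j
    unfolding 1[symmetric] by (simp add: algebra_simps)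
  have "weight_upto n 0 (\<lambda>p j. \<beta> (j + p) * bsym mass (1 / 2) j)"
    using weight_upto_mult[OF bs cw] by simp
  moreover have "weight_upto n 0 (\<lambda>p j. bsym mass (1 / 2) (j + p) * \<beta> j)"
    using weight_upto_mult[OF cs bw] by simp
  ultimately show "weight_upto n 0 (\<lambda>p j. \<beta> (j + p) * \<beta> j * (b j + b (j + p)))"
    unfolding eq by (rule weight_upto_add)
qed

definition dl :: "(int \<Rightarrow> 'a::ab_group_add) \<Rightarrow> int \<Rightarrow> 'a" where
  "dl s j = s (j + 1) - s j"

text \<open>Passes from the recursive description to iterated differences, the form in which the
  seminorms see a weight.\<close>

lemma weight_upto_dl:
  "weight_upto n m \<mu> \<Longrightarrow> b \<le> n \<Longrightarrow> bounded_weight (m - real b) (\<lambda>p. (dl ^^ b) (\<mu> p))"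
proof (induction n arbitrary: m \<mu> b)
  case 0
  then show ?case by simp
next
  case (Suc n)
  show ?case
  proof (cases b)
    case 0
    then show ?thesis using Suc.prems by simp
  next
    case (Suc c)
    have "bounded_weight (m - 1 - real c) (\<lambda>p. (dl ^^ c) (dl (\<mu> p)))"
      using Suc.IH[of "m - 1" "\<lambda>p. dl (\<mu> p)" c] Suc.prems Suc by (simp add: dl_def[abs_def])
    moreover have "(dl ^^ b) (\<mu> p) = (dl ^^ c) (dl (\<mu> p))" for p
      by (simp only: Suc funpow_Suc_right comp_def)
    moreover have "m - 1 - real c = m - real b"
      by (simp add: Suc)
    ultimately show ?thesis by (simp only:)
  qed
qed

section \<open>Exponential series\<close>

lemma summable_on_norm_bound:
  fixes f :: "'i \<Rightarrow> 'a::banach"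
  assumes "M summable_on A" "\<And>i. i \<in> A \<Longrightarrow> norm (f i) \<le> M i"
  shows "f summable_on A"
  using abs_summable_summable Infinite_Sum.abs_summable_on_comparison_test'[OF assms] by blast

lemma norm_infsum_bound_le:
  fixes f :: "'i \<Rightarrow> 'a::banach"
  assumes "M summable_on A" "\<And>i. i \<in> A \<Longrightarrow> norm (f i) \<le> M i"
  shows "norm (infsum f A) \<le> infsum M A"
  by (rule norm_infsum_le[OF has_sum_infsum[OF summable_on_norm_bound[OF assms]] has_sum_infsum[OF assms(1)] assms(2)])

lemma summable_on_minus_distrib:
  fixes f g :: "'i \<Rightarrow> 'a::real_normed_vector"
  assumes "f summable_on A" "g summable_on A"
  shows "(\<lambda>i. f i - g i) summable_on A"
  using summable_on_add[OF assms(1) summable_on_uminus[THEN iffD2, OF assms(2)]] by simp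

lemma infsum_minus_distrib:
  fixes f g :: "'i \<Rightarrow> 'a::real_normed_vector"
  assumes "f summable_on A" "g summable_on A"
  shows "(\<Sum>\<^sub>\<infinity>i\<in>A. f i - g i) = infsum f A - infsum g A"
  using infsum_add[OF assms(1) summable_on_uminus[THEN iffD2, OF assms(2)]] by (simp add: infsum_uminus)

text \<open>The Weierstrass M-test gives uniform convergence along finite subsets, and with it both
  the exchange of sum and integral and the continuity of the sum.\<close>

lemma integral_infsum:
  fixes f :: "'i \<Rightarrow> 'a::euclidean_space \<Rightarrow> 'b::banach"
  assumes cont: "\<And>i. continuous_on (cbox a b) (f i)"
    and bound: "\<And>i x. x \<in> cbox a b \<Longrightarrow> norm (f i x) \<le> M i" and M: "M summable_on UNIV"
  shows "((\<lambda>i. integral (cbox a b) (f i)) has_sum integral (cbox a b) (\<lambda>x. \<Sum>\<^sub>\<infinity>i. f i x)) UNIV"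
    and "continuous_on (cbox a b) (\<lambda>x. \<Sum>\<^sub>\<infinity>i. f i x)"
proof -
  have u: "uniform_limit (cbox a b) (\<lambda>X x. \<Sum>i\<in>X. f i x) (\<lambda>x. \<Sum>\<^sub>\<infinity>i. f i x) (finite_subsets_at_top UNIV)"
    using bound M by (intro Weierstrass_m_test_general) auto
  have c: "continuous_on (cbox a b) (\<lambda>x. \<Sum>i\<in>X. f i x)" for X
    by (intro continuous_intros cont)
  obtain I J where I: "\<And>X. ((\<lambda>x. \<Sum>i\<in>X. f i x) has_integral I X) (cbox a b)"
    and J: "((\<lambda>x. \<Sum>\<^sub>\<infinity>i. f i x) has_integral J) (cbox a b)" and lim: "(I \<longlongrightarrow> J) (finite_subsets_at_top UNIV)"
    by (rule uniform_limit_integral_cbox[OF u c]) auto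
  have "I X = (\<Sum>i\<in>X. integral (cbox a b) (f i))" if "finite X" for X
  proof -
    have "((\<lambda>x. \<Sum>i\<in>X. f i x) has_integral (\<Sum>i\<in>X. integral (cbox a b) (f i))) (cbox a b)"
      using that by (intro has_integral_sum integrable_integral integrable_continuous cont)
    then show ?thesis using I has_integral_unique by blast
  qed
  then have "\<forall>\<^sub>F X in finite_subsets_at_top UNIV. I X = (\<Sum>i\<in>X. integral (cbox a b) (f i))"
    by (intro eventually_finite_subsets_at_top_weakI) auto
  then have "((\<lambda>X. \<Sum>i\<in>X. integral (cbox a b) (f i)) \<longlongrightarrow> J) (finite_subsets_at_top UNIV)"
    using lim Lim_transform_eventually by blast
  moreover have "J = integral (cbox a b) (\<lambda>x. \<Sum>\<^sub>\<infinity>i. f i x)"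
    using J by (simp add: integral_unique)
  ultimately show "((\<lambda>i. integral (cbox a b) (f i)) has_sum integral (cbox a b) (\<lambda>x. \<Sum>\<^sub>\<infinity>i. f i x)) UNIV"
    by (simp add: has_sum_def)
  show "continuous_on (cbox a b) (\<lambda>x. \<Sum>\<^sub>\<infinity>i. f i x)"
    by (rule uniform_limit_theorem[OF _ u]) (use c in auto)
qed

text \<open>A quadratic remainder with summable constants \<open>M\<close> sums up directly, without
  uniform convergence of derivatives. Arbitrary normed domains cover the complex angles as well as
  the real variable \<open>x\<close>.\<close>

lemma has_derivative_infsum:
  fixes f :: "'i \<Rightarrow> 'a::real_normed_vector \<Rightarrow> 'b::banach"
  assumes \<delta>: "0 < \<delta>" and lin: "\<And>i. linear (L i)"
    and L: "\<And>i h. norm (L i h) \<le> B i * norm h" and B: "B summable_on UNIV"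
    and R: "\<And>i h. norm h \<le> \<delta> \<Longrightarrow> norm (f i (x + h) - f i x - L i h) \<le> M i * (norm h)\<^sup>2"
    and M: "M summable_on UNIV" and F: "(\<lambda>i. f i x) summable_on UNIV"
  shows "((\<lambda>y. \<Sum>\<^sub>\<infinity>i. f i y) has_derivative (\<lambda>h. \<Sum>\<^sub>\<infinity>i. L i h)) (at x)"
proof -
  have Ls: "(\<lambda>i. L i h) summable_on UNIV" for h
    by (rule summable_on_norm_bound[OF summable_on_cmult_left[OF B] L])
  have bl: "bounded_linear (\<lambda>h. \<Sum>\<^sub>\<infinity>i. L i h)"
  proof (rule bounded_linear_intro[where K = "infsum B UNIV"])
    show "(\<Sum>\<^sub>\<infinity>i. L i (h + k)) = (\<Sum>\<^sub>\<infinity>i. L i h) + (\<Sum>\<^sub>\<infinity>i. L i k)" for h k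
      by (simp add: linear_add[OF lin] infsum_add Ls)
    show "(\<Sum>\<^sub>\<infinity>i. L i (r *\<^sub>R h)) = r *\<^sub>R (\<Sum>\<^sub>\<infinity>i. L i h)" for r h
      by (simp add: linear_scale[OF lin] infsum_scaleR_right)
    show "norm (\<Sum>\<^sub>\<infinity>i. L i h) \<le> norm h * infsum B UNIV" for h
    proof -
      have "norm (\<Sum>\<^sub>\<infinity>i. L i h) \<le> (\<Sum>\<^sub>\<infinity>i. B i * norm h)"
        by (rule norm_infsum_bound_le[OF summable_on_cmult_left[OF B] L])
      then show ?thesis by (simp add: infsum_cmult_left' mult.commute)
    qed
  qed
  have main: "norm ((\<Sum>\<^sub>\<infinity>i. f i (x + h)) - (\<Sum>\<^sub>\<infinity>i. f i x) - (\<Sum>\<^sub>\<infinity>i. L i h)) \<le> infsum M UNIV * (norm h)\<^sup>2"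
    if h: "norm h \<le> \<delta>" for h
  proof -
    have Rs: "(\<lambda>i. f i (x + h) - f i x - L i h) summable_on UNIV"
      by (rule summable_on_norm_bound[OF summable_on_cmult_left[OF M] R[OF h]])
    have "(\<lambda>i. (f i (x + h) - f i x - L i h) + (f i x + L i h)) summable_on UNIV"
      by (intro summable_on_add Rs F Ls)
    then have s: "(\<lambda>i. f i (x + h)) summable_on UNIV" by simp
    have "(\<Sum>\<^sub>\<infinity>i. f i (x + h)) - (\<Sum>\<^sub>\<infinity>i. f i x) - (\<Sum>\<^sub>\<infinity>i. L i h) = (\<Sum>\<^sub>\<infinity>i. f i (x + h) - f i x - L i h)"
      by (simp add: infsum_minus_distrib summable_on_minus_distrib F Ls s)
    also have "norm \<dots> \<le> (\<Sum>\<^sub>\<infinity>i. M i * (norm h)\<^sup>2)"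
      by (rule norm_infsum_bound_le[OF summable_on_cmult_left[OF M] R[OF h]])
    also have "\<dots> = infsum M UNIV * (norm h)\<^sup>2"
      by (rule infsum_cmult_left')
    finally show ?thesis .
  qed
  show ?thesis
    unfolding has_derivative_at
  proof (intro conjI bl)
    show "(\<lambda>h. norm ((\<Sum>\<^sub>\<infinity>i. f i (x + h)) - (\<Sum>\<^sub>\<infinity>i. f i x) - (\<Sum>\<^sub>\<infinity>i. L i h)) / norm h) \<midarrow>0\<rightarrow> 0"
    proof (rule Lim_null_comparison)
      show "\<forall>\<^sub>F h in at 0. norm (norm ((\<Sum>\<^sub>\<infinity>i. f i (x + h)) - (\<Sum>\<^sub>\<infinity>i. f i x) - (\<Sum>\<^sub>\<infinity>i. L i h)) / norm h)
          \<le> infsum M UNIV * norm h"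
        unfolding eventually_at
      proof (intro exI[of _ \<delta>] conjI \<delta> ballI impI)
        fix h :: 'a assume "h \<noteq> 0 \<and> dist h 0 < \<delta>"
        then show "norm (norm ((\<Sum>\<^sub>\<infinity>i. f i (x + h)) - (\<Sum>\<^sub>\<infinity>i. f i x) - (\<Sum>\<^sub>\<infinity>i. L i h)) / norm h)
          \<le> infsum M UNIV * norm h"
          using main[of h] by (simp add: divide_le_eq power2_eq_square mult.assoc)
      qed
      show "((\<lambda>h::'a. infsum M UNIV * norm h) \<longlongrightarrow> 0) (at 0)"
        by (auto intro!: tendsto_eq_intros)
    qed
  qed
qed

section \<open>Exponential series in complex angles\<close>

lemma norm_exp_remainder:
  fixes w z :: complex
  shows "norm (exp (w + z) - exp w - z * exp w) \<le> norm (exp w) * exp \<bar>Re z\<bar> * (norm z)\<^sup>2"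
proof -
  have "exp (w + z) - exp w - z * exp w = exp w * (exp z - (\<Sum>k\<le>1. z ^ k / fact k))"
    by (simp add: exp_add algebra_simps)
  also have "norm \<dots> \<le> norm (exp w) * (exp \<bar>Re z\<bar> * (norm z)\<^sup>2)"
    using Taylor_exp[of z 1] unfolding norm_mult
    by (intro mult_left_mono) (simp_all add: numeral_2_eq_2)
  finally show ?thesis by (simp add: mult.assoc)
qed

text \<open>The bilinear product, without conjugation: its exponential has to be holomorphic in
  \<open>\<theta>\<close>.\<close>

definition cdot :: "real ^ 'n \<Rightarrow> complex ^ 'n \<Rightarrow> complex" where
  "cdot k \<theta> = (\<Sum>i\<in>UNIV. of_real (k $ i) * \<theta> $ i)"

lemma cdot_add_right: "cdot k (\<theta> + h) = cdot k \<theta> + cdot k h"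
  by (simp add: cdot_def distrib_left sum.distrib)

lemma cdot_scale: "cdot k (c *s v) = c * cdot k v"
  by (simp add: cdot_def sum_distrib_left mult_ac)

lemma cdot_scaleR: "cdot k (r *\<^sub>R v) = of_real r * cdot k v"
  by (simp add: cdot_def sum_distrib_left mult_ac scaleR_conv_of_real[where 'a = complex])

lemma cdot_cvec: "cdot k (cvec \<theta>) = of_real (k \<bullet> \<theta>)"
  by (simp add: cdot_def cvec_def inner_vec_def)

lemma cdot_axis: "cdot k (axis i c) = of_real (k $ i) * c"
proof -
  have "cdot k (axis i c) = (\<Sum>l\<in>UNIV. if l = i then of_real (k $ l) * c else 0)"
    unfolding cdot_def by (intro sum.cong) (auto simp: axis_def)
  then show ?thesis by simp
qed

lemma norm_cdot_le: "norm (cdot k \<theta>) \<le> norm k * norm \<theta>"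
proof -
  have "norm (cdot k \<theta>) \<le> (\<Sum>i\<in>UNIV. \<bar>k $ i\<bar> * \<bar>norm (\<theta> $ i)\<bar>)"
    unfolding cdot_def by (rule order_trans[OF norm_sum]) (simp add: norm_mult)
  also have "\<dots> \<le> L2_set (\<lambda>i. k $ i) UNIV * L2_set (\<lambda>i. norm (\<theta> $ i)) UNIV"
    by (rule L2_set_mult_ineq)
  also have "\<dots> = norm k * norm \<theta>"
    by (simp add: norm_vec_def L2_set_def)
  finally show ?thesis .
qed

lemma Im_cdot_le: "\<bar>Im (cdot k \<theta>)\<bar> \<le> norm k * norm (\<chi> i. Im (\<theta> $ i))"
proof -
  have "Im (cdot k \<theta>) = k \<bullet> (\<chi> i. Im (\<theta> $ i))"
    by (simp add: cdot_def inner_vec_def)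
  then show ?thesis by (metis Cauchy_Schwarz_ineq2)
qed

lemma norm_exp_cdot_le: "norm (\<chi> i. Im (\<theta> $ i)) \<le> \<sigma> \<Longrightarrow> norm (exp (\<i> * cdot k \<theta>)) \<le> exp (\<sigma> * norm k)"
  using Im_cdot_le[of k \<theta>] mult_left_mono[of "norm (\<chi> i. Im (\<theta> $ i))" \<sigma> "norm k"]
  by (simp add: mult.commute)

lemma open_strip: "open {\<theta> :: complex ^ 'n. norm (\<chi> i. Im (\<theta> $ i)) < s}"
  by (intro open_Collect_less continuous_intros)

lemma mult_exp_le: "0 < \<delta> \<Longrightarrow> 0 \<le> t \<Longrightarrow> t \<le> (1 / \<delta>) * exp (\<delta> * t)" for t :: real
proof -
  assume "0 < \<delta>" "0 \<le> t"
  moreover have "\<delta> * t \<le> exp (\<delta> * t)"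
    using exp_ge_add_one_self[of "\<delta> * t"] by linarith
  ultimately show ?thesis by (simp add: field_simps)
qed

lemma power2_exp_le: "0 < \<delta> \<Longrightarrow> 0 \<le> t \<Longrightarrow> t\<^sup>2 \<le> (2 / \<delta>\<^sup>2) * exp (\<delta> * t)" for t :: real
proof -
  assume "0 < \<delta>" "0 \<le> t"
  then have "(\<delta> * t)\<^sup>2 / 2 \<le> exp (\<delta> * t)"
    using exp_lower_Taylor_quadratic[of "\<delta> * t"] mult_nonneg_nonneg[of \<delta> t] by linarith
  then show ?thesis using \<open>0 < \<delta>\<close> by (simp add: field_simps)
qed

lemma exp_series_derivative:
  fixes \<kappa> :: "'i \<Rightarrow> real ^ 'n" and z :: "complex ^ 'n"
  assumes c: "(\<lambda>i. norm (c i) * exp (\<sigma> * norm (\<kappa> i))) summable_on UNIV"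
    and z: "norm (\<chi> i. Im (z $ i)) < \<sigma>"
  shows "((\<lambda>\<theta>. \<Sum>\<^sub>\<infinity>i. c i * exp (\<i> * cdot (\<kappa> i) \<theta>)) has_derivative
           (\<lambda>h. \<Sum>\<^sub>\<infinity>i. c i * (\<i> * cdot (\<kappa> i) h * exp (\<i> * cdot (\<kappa> i) z)))) (at z)"
proof -
  define s where "s = norm (\<chi> i. Im (z $ i))"
  \<comment> \<open>In the remainder, one half of the width left above the height \<open>s\<close>
    of \<open>z\<close> pays for the displacement \<open>h\<close>, the other half for the powers of
    \<open>norm (\<kappa> i)\<close> brought down by differentiation.\<close>
  define \<delta> where "\<delta> = (\<sigma> - s) / 2"
  have \<delta>: "0 < \<delta>" "s + \<delta> + \<delta> = \<sigma>" and s: "0 \<le> s"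
    using z by (simp_all add: \<delta>_def s_def)
  have es: "norm (exp (\<i> * cdot (\<kappa> i) z)) \<le> exp (s * norm (\<kappa> i))" for i
    by (rule norm_exp_cdot_le) (simp add: s_def)
  have eq: "exp (\<delta> * norm (\<kappa> i)) * exp ((s + \<delta>) * norm (\<kappa> i)) = exp (\<sigma> * norm (\<kappa> i))" for i
    unfolding exp_add[symmetric] distrib_right[symmetric] \<delta>(2)[symmetric] by (simp add: algebra_simps)
  have es': "exp (s * norm (\<kappa> i)) \<le> exp ((s + \<delta>) * norm (\<kappa> i))" for i
    using \<delta> by (simp add: distrib_right)
  show ?thesis
  proof (rule has_derivative_infsum[OF \<delta>(1)])
    show "linear (\<lambda>h. c i * (\<i> * cdot (\<kappa> i) h * exp (\<i> * cdot (\<kappa> i) z)))" for i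
      by (rule linearI) (simp_all add: cdot_add_right cdot_scaleR algebra_simps scaleR_conv_of_real[where 'a = complex])
    show "norm (c i * (\<i> * cdot (\<kappa> i) h * exp (\<i> * cdot (\<kappa> i) z))) \<le>
        (1 / \<delta>) * (norm (c i) * exp (\<sigma> * norm (\<kappa> i))) * norm h" for i h
    proof -
      have "norm (\<kappa> i) * exp (s * norm (\<kappa> i)) \<le> (1 / \<delta> * exp (\<delta> * norm (\<kappa> i))) * exp ((s + \<delta>) * norm (\<kappa> i))"
        using \<delta> es' by (intro mult_mono mult_exp_le) auto
      also have "\<dots> = 1 / \<delta> * exp (\<sigma> * norm (\<kappa> i))"
        using eq[of i] by simp
      finally have 1: "norm (\<kappa> i) * exp (s * norm (\<kappa> i)) \<le> 1 / \<delta> * exp (\<sigma> * norm (\<kappa> i))" .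
      have "norm (cdot (\<kappa> i) h) * norm (exp (\<i> * cdot (\<kappa> i) z)) \<le> (norm (\<kappa> i) * norm h) * exp (s * norm (\<kappa> i))"
        by (intro mult_mono norm_cdot_le es) auto
      also have "\<dots> = (norm (\<kappa> i) * exp (s * norm (\<kappa> i))) * norm h" by simp
      also have "\<dots> \<le> (1 / \<delta> * exp (\<sigma> * norm (\<kappa> i))) * norm h"
        by (intro mult_right_mono 1) auto
      finally have "norm (c i) * (norm (cdot (\<kappa> i) h) * norm (exp (\<i> * cdot (\<kappa> i) z))) \<le>
          norm (c i) * ((1 / \<delta> * exp (\<sigma> * norm (\<kappa> i))) * norm h)"
        by (intro mult_left_mono) auto
      then show ?thesis by (simp add: norm_mult mult_ac)
    qed
    show "(\<lambda>i. (1 / \<delta>) * (norm (c i) * exp (\<sigma> * norm (\<kappa> i)))) summable_on UNIV"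
      by (intro summable_on_cmult_right c)
    show "norm (c i * exp (\<i> * cdot (\<kappa> i) (z + h)) - c i * exp (\<i> * cdot (\<kappa> i) z) -
          c i * (\<i> * cdot (\<kappa> i) h * exp (\<i> * cdot (\<kappa> i) z))) \<le>
        (2 / \<delta>\<^sup>2) * (norm (c i) * exp (\<sigma> * norm (\<kappa> i))) * (norm h)\<^sup>2" if h: "norm h \<le> \<delta>" for i h
    proof -
      have e1: "exp \<bar>Re (\<i> * cdot (\<kappa> i) h)\<bar> \<le> exp (\<delta> * norm (\<kappa> i))"
      proof -
        have "\<bar>Re (\<i> * cdot (\<kappa> i) h)\<bar> \<le> norm (cdot (\<kappa> i) h)"
          using abs_Re_le_cmod[of "\<i> * cdot (\<kappa> i) h"] by (simp add: norm_mult)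
        also have "\<dots> \<le> norm (\<kappa> i) * norm h" by (rule norm_cdot_le)
        also have "\<dots> \<le> norm (\<kappa> i) * \<delta>" using h by (intro mult_left_mono) auto
        finally show ?thesis by (simp add: mult.commute)
      qed
      have e2: "(norm (\<i> * cdot (\<kappa> i) h))\<^sup>2 \<le> (2 / \<delta>\<^sup>2 * exp (\<delta> * norm (\<kappa> i))) * (norm h)\<^sup>2"
      proof -
        have "(norm (\<i> * cdot (\<kappa> i) h))\<^sup>2 \<le> (norm (\<kappa> i) * norm h)\<^sup>2"
          using norm_cdot_le[of "\<kappa> i" h] by (intro power_mono) (auto simp: norm_mult)
        also have "\<dots> \<le> (2 / \<delta>\<^sup>2 * exp (\<delta> * norm (\<kappa> i))) * (norm h)\<^sup>2"
          unfolding power_mult_distrib using \<delta> by (intro mult_right_mono power2_exp_le) auto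
        finally show ?thesis .
      qed
      have "norm (exp (\<i> * cdot (\<kappa> i) z + \<i> * cdot (\<kappa> i) h) - exp (\<i> * cdot (\<kappa> i) z) -
          \<i> * cdot (\<kappa> i) h * exp (\<i> * cdot (\<kappa> i) z)) \<le>
          norm (exp (\<i> * cdot (\<kappa> i) z)) * exp \<bar>Re (\<i> * cdot (\<kappa> i) h)\<bar> * (norm (\<i> * cdot (\<kappa> i) h))\<^sup>2"
        by (rule norm_exp_remainder)
      also have "\<dots> \<le> exp (s * norm (\<kappa> i)) * exp (\<delta> * norm (\<kappa> i)) *
          ((2 / \<delta>\<^sup>2 * exp (\<delta> * norm (\<kappa> i))) * (norm h)\<^sup>2)"
        by (intro mult_mono es e1 e2) auto
      also have "\<dots> = (2 / \<delta>\<^sup>2) * exp (\<sigma> * norm (\<kappa> i)) * (norm h)\<^sup>2"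
        unfolding eq[symmetric] by (simp add: distrib_right exp_add)
      finally have "norm (c i) * norm (exp (\<i> * cdot (\<kappa> i) z + \<i> * cdot (\<kappa> i) h) - exp (\<i> * cdot (\<kappa> i) z) -
          \<i> * cdot (\<kappa> i) h * exp (\<i> * cdot (\<kappa> i) z)) \<le> norm (c i) * ((2 / \<delta>\<^sup>2) * exp (\<sigma> * norm (\<kappa> i)) * (norm h)\<^sup>2)"
        by (intro mult_left_mono) auto
      then show ?thesis
        unfolding norm_mult[symmetric] by (simp add: cdot_add_right algebra_simps)
    qed
    show "(\<lambda>i. (2 / \<delta>\<^sup>2) * (norm (c i) * exp (\<sigma> * norm (\<kappa> i)))) summable_on UNIV"
      by (intro summable_on_cmult_right c)
    show "(\<lambda>i. c i * exp (\<i> * cdot (\<kappa> i) z)) summable_on UNIV"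
    proof (rule summable_on_norm_bound[OF c])
      fix i
      have "norm (exp (\<i> * cdot (\<kappa> i) z)) \<le> exp (\<sigma> * norm (\<kappa> i))"
        using z by (intro norm_exp_cdot_le) auto
      then show "norm (c i * exp (\<i> * cdot (\<kappa> i) z)) \<le> norm (c i) * exp (\<sigma> * norm (\<kappa> i))"
        unfolding norm_mult by (intro mult_left_mono) auto
    qed
  qed
qed

text \<open>The neighbourhood is the open strip of width \<open>\<sigma>\<close>; complex linearity
  of the derivative is inherited from \<open>cdot\<close> term by term.\<close>

lemma analytic_sev_exp_series:
  fixes \<kappa> :: "'i \<Rightarrow> real ^ 'n"
  assumes c: "(\<lambda>i. norm (c i) * exp (\<sigma> * norm (\<kappa> i))) summable_on UNIV" and "s < \<sigma>"
  shows "analytic_sev (\<lambda>\<theta>. \<Sum>\<^sub>\<infinity>i. c i * exp (\<i> * cdot (\<kappa> i) \<theta>)) (strip s)"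
  unfolding analytic_sev_def
proof (intro exI conjI ballI)
  show "open {\<theta> :: complex ^ 'n. norm (\<chi> i. Im (\<theta> $ i)) < \<sigma>}"
    by (rule open_strip)
  show "strip s \<subseteq> {\<theta> :: complex ^ 'n. norm (\<chi> i. Im (\<theta> $ i)) < \<sigma>}"
    using assms(2) by (auto simp: strip_def)
  fix z :: "complex ^ 'n" assume "z \<in> {\<theta>. norm (\<chi> i. Im (\<theta> $ i)) < \<sigma>}"
  then show "((\<lambda>\<theta>. \<Sum>\<^sub>\<infinity>i. c i * exp (\<i> * cdot (\<kappa> i) \<theta>)) has_derivative
           (\<lambda>h. \<Sum>\<^sub>\<infinity>i. c i * (\<i> * cdot (\<kappa> i) h * exp (\<i> * cdot (\<kappa> i) z)))) (at z)"
    using exp_series_derivative[OF c] by auto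
  show "\<forall>a v. (\<Sum>\<^sub>\<infinity>i. c i * (\<i> * cdot (\<kappa> i) (a *s v) * exp (\<i> * cdot (\<kappa> i) z))) =
      a * (\<Sum>\<^sub>\<infinity>i. c i * (\<i> * cdot (\<kappa> i) v * exp (\<i> * cdot (\<kappa> i) z)))"
    by (simp add: cdot_scale infsum_cmult_right'[symmetric] mult_ac)
qed

text \<open>Decay is measured along a frequency map \<open>\<pi>\<close> that need not be injective,
  since modes with different frequencies in \<open>\<theta>\<close>, or pairs of modes, may share
  their frequency in \<open>x\<close>.\<close>

definition rapid :: "('i \<Rightarrow> int) \<Rightarrow> ('i \<Rightarrow> complex) \<Rightarrow> bool" where
  "rapid \<pi> c \<longleftrightarrow> (\<forall>N. (\<lambda>i. norm (c i) * (1 + \<bar>real_of_int (\<pi> i)\<bar>) ^ N) summable_on UNIV)"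

definition trig_series :: "('i \<Rightarrow> int) \<Rightarrow> ('i \<Rightarrow> complex) \<Rightarrow> real \<Rightarrow> complex" where
  "trig_series \<pi> c x = (\<Sum>\<^sub>\<infinity>i. c i * cis (real_of_int (\<pi> i) * x))"

section \<open>Trigonometric series with rapidly decreasing coefficients\<close>

lemma rapidD: "rapid \<pi> c \<Longrightarrow> (\<lambda>i. norm (c i) * (1 + \<bar>real_of_int (\<pi> i)\<bar>) ^ N) summable_on UNIV"
  by (simp add: rapid_def)

lemma rapid_summable: "rapid \<pi> c \<Longrightarrow> (\<lambda>i. norm (c i)) summable_on UNIV"
  using rapidD[of \<pi> c 0] by simp

lemma rapid_mult:
  assumes "rapid \<pi> c" and b: "\<And>i. norm (a i) \<le> C * (1 + \<bar>real_of_int (\<pi> i)\<bar>) ^ K"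
  shows "rapid \<pi> (\<lambda>i. a i * c i)"
  unfolding rapid_def
proof
  fix N
  show "(\<lambda>i. norm (a i * c i) * (1 + \<bar>real_of_int (\<pi> i)\<bar>) ^ N) summable_on UNIV"
  proof (rule summable_on_comparison_test)
    show "(\<lambda>i. C * (norm (c i) * (1 + \<bar>real_of_int (\<pi> i)\<bar>) ^ (K + N))) summable_on UNIV"
      by (intro summable_on_cmult_right rapidD assms)
    fix i
    have "norm (a i) * (norm (c i) * (1 + \<bar>real_of_int (\<pi> i)\<bar>) ^ N) \<le>
        C * (1 + \<bar>real_of_int (\<pi> i)\<bar>) ^ K * (norm (c i) * (1 + \<bar>real_of_int (\<pi> i)\<bar>) ^ N)"
      by (intro mult_right_mono b) auto
    then show "norm (a i * c i) * (1 + \<bar>real_of_int (\<pi> i)\<bar>) ^ N \<le>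
        C * (norm (c i) * (1 + \<bar>real_of_int (\<pi> i)\<bar>) ^ (K + N))"
      by (simp add: norm_mult power_add mult_ac)
  qed auto
qed

lemma rapid_cmult: "rapid \<pi> c \<Longrightarrow> rapid \<pi> (\<lambda>i. a * c i)"
  by (rule rapid_mult[where C = "norm a" and K = 0]) auto

lemma rapid_deriv: "rapid \<pi> c \<Longrightarrow> rapid \<pi> (\<lambda>i. (\<i> * of_int (\<pi> i)) ^ a * c i)"
proof (rule rapid_mult[where C = 1 and K = a])
  fix i
  have "\<bar>real_of_int (\<pi> i)\<bar> ^ a \<le> (1 + \<bar>real_of_int (\<pi> i)\<bar>) ^ a"
    by (intro power_mono) auto
  then show "norm ((\<i> * of_int (\<pi> i)) ^ a) \<le> 1 * (1 + \<bar>real_of_int (\<pi> i)\<bar>) ^ a"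
    by (simp add: norm_power norm_mult)
qed

lemma trig_series_has_derivative:
  assumes "rapid \<pi> c"
  shows "(trig_series \<pi> c has_derivative (\<lambda>h. of_real h * trig_series \<pi> (\<lambda>i. \<i> * of_int (\<pi> i) * c i) x)) (at x)"
proof -
  have "((\<lambda>y. \<Sum>\<^sub>\<infinity>i. c i * cis (real_of_int (\<pi> i) * y)) has_derivative
      (\<lambda>h. \<Sum>\<^sub>\<infinity>i. of_real h * (\<i> * of_int (\<pi> i) * c i * cis (real_of_int (\<pi> i) * x)))) (at x)"
  proof (rule has_derivative_infsum[of 1])
    show "linear (\<lambda>h. of_real h * (\<i> * of_int (\<pi> i) * c i * cis (real_of_int (\<pi> i) * x)))" for i
      by (rule linearI) (simp_all add: algebra_simps scaleR_conv_of_real)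
    show "norm (of_real h * (\<i> * of_int (\<pi> i) * c i * cis (real_of_int (\<pi> i) * x))) \<le>
        (norm (c i) * (1 + \<bar>real_of_int (\<pi> i)\<bar>) ^ 1) * norm h" for i h
      by (simp add: norm_mult algebra_simps)
    show "(\<lambda>i. norm (c i) * (1 + \<bar>real_of_int (\<pi> i)\<bar>) ^ 1) summable_on UNIV"
      by (rule rapidD[OF assms])
    show "norm (c i * cis (real_of_int (\<pi> i) * (x + h)) - c i * cis (real_of_int (\<pi> i) * x) -
        of_real h * (\<i> * of_int (\<pi> i) * c i * cis (real_of_int (\<pi> i) * x))) \<le>
        (norm (c i) * (1 + \<bar>real_of_int (\<pi> i)\<bar>) ^ 2) * (norm h)\<^sup>2" for i h
    proof -
      let ?w = "\<i> * of_real (real_of_int (\<pi> i) * x)" and ?z = "\<i> * of_real (real_of_int (\<pi> i) * h)"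
      have "c i * cis (real_of_int (\<pi> i) * (x + h)) - c i * cis (real_of_int (\<pi> i) * x) -
        of_real h * (\<i> * of_int (\<pi> i) * c i * cis (real_of_int (\<pi> i) * x)) =
        c i * (exp (?w + ?z) - exp ?w - ?z * exp ?w)"
        by (simp add: cis_conv_exp algebra_simps)
      also have "norm \<dots> \<le> norm (c i) * (norm (exp ?w) * exp \<bar>Re ?z\<bar> * (norm ?z)\<^sup>2)"
        unfolding norm_mult[of "c i"] by (intro mult_left_mono norm_exp_remainder) auto
      also have "\<dots> = norm (c i) * (\<bar>real_of_int (\<pi> i)\<bar> ^ 2 * (norm h)\<^sup>2)"
        by (simp add: norm_mult power_mult_distrib)
      also have "\<dots> \<le> norm (c i) * ((1 + \<bar>real_of_int (\<pi> i)\<bar>) ^ 2 * (norm h)\<^sup>2)"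
        by (intro mult_left_mono mult_right_mono power_mono) auto
      finally show ?thesis by (simp add: mult.assoc)
    qed
    show "(\<lambda>i. norm (c i) * (1 + \<bar>real_of_int (\<pi> i)\<bar>) ^ 2) summable_on UNIV"
      by (rule rapidD[OF assms])
    show "(\<lambda>i. c i * cis (real_of_int (\<pi> i) * x)) summable_on UNIV"
      by (rule summable_on_norm_bound[OF rapid_summable[OF assms]]) (simp add: norm_mult)
  qed simp
  then show ?thesis
    by (simp add: trig_series_def[abs_def] infsum_cmult_right')
qed

lemma dx_trig_series: "rapid \<pi> c \<Longrightarrow> dx (trig_series \<pi> c) = trig_series \<pi> (\<lambda>i. \<i> * of_int (\<pi> i) * c i)"
proof
  fix x assume "rapid \<pi> c"
  then have "(trig_series \<pi> c has_vector_derivative trig_series \<pi> (\<lambda>i. \<i> * of_int (\<pi> i) * c i) x) (at x)"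
    using trig_series_has_derivative[of \<pi> c x] by (simp add: has_vector_derivative_def scaleR_conv_of_real)
  then show "dx (trig_series \<pi> c) x = trig_series \<pi> (\<lambda>i. \<i> * of_int (\<pi> i) * c i) x"
    unfolding dx_def by (rule vector_derivative_at)
qed

lemma dx_pow_trig_series:
  "rapid \<pi> c \<Longrightarrow> (dx ^^ a) (trig_series \<pi> c) = trig_series \<pi> (\<lambda>i. (\<i> * of_int (\<pi> i)) ^ a * c i)"
proof (induction a)
  case (Suc a)
  show ?case using dx_trig_series[OF rapid_deriv[OF Suc.prems, of a]] Suc by (simp add: mult_ac)
qed simp

text \<open>A derivative is a series of the same kind with coefficients that are still rapidly
  decreasing, so the induction over the order runs over all coefficient families at once.\<close>

lemma smooth_trig_series:
  assumes "rapid \<pi> c"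
  shows "smooth (trig_series \<pi> c)"
proof -
  have "C_k k (trig_series \<pi> c)" if "rapid \<pi> c" for k c
    using that
  proof (induction k arbitrary: c)
    case 0
    have "isCont (trig_series \<pi> c) x" for x
      using trig_series_has_derivative[OF 0] has_derivative_continuous by blast
    then show ?case by (simp add: continuous_at_imp_continuous_on)
  next
    case (Suc k)
    have "frechet_derivative (trig_series \<pi> c) (at x) v = trig_series \<pi> (\<lambda>i. of_real v * (\<i> * of_int (\<pi> i) * c i)) x" for x v
      using frechet_derivative_at[OF trig_series_has_derivative[OF Suc.prems, of x], symmetric]
      by (simp add: trig_series_def infsum_cmult_right' mult.assoc)
    moreover have "rapid \<pi> (\<lambda>i. of_real v * (\<i> * of_int (\<pi> i) * c i))" for v
      using rapid_deriv[OF Suc.prems, of 1] by (intro rapid_cmult) simp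
    moreover have "trig_series \<pi> c differentiable (at x)" for x
      using trig_series_has_derivative[OF Suc.prems] differentiable_def by blast
    ultimately show ?case using Suc.IH by simp
  qed
  then show ?thesis using assms by (simp add: smooth_def)
qed

lemma trig_series_periodic: "trig_series \<pi> c (x + 2 * pi) = trig_series \<pi> c x"
proof -
  have "cis (real_of_int (\<pi> i) * (x + 2 * pi)) = cis (real_of_int (\<pi> i) * x)" for i
  proof -
    have "cis (real_of_int (\<pi> i) * (x + 2 * pi)) = cis (real_of_int (\<pi> i) * x) * cis (2 * pi * real_of_int (\<pi> i))"
      by (simp add: cis_mult algebra_simps)
    then show ?thesis by (simp add: cis_multiple_2pi)
  qed
  then show ?thesis by (simp add: trig_series_def)
qed

lemma norm_trig_series_le:
  "(\<lambda>i. norm (c i)) summable_on UNIV \<Longrightarrow> norm (trig_series \<pi> c x) \<le> (\<Sum>\<^sub>\<infinity>i. norm (c i))"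
  unfolding trig_series_def by (rule norm_infsum_bound_le) (auto simp: norm_mult)

section \<open>Orthogonality of exponentials\<close>

lemma has_integral_cis_multiple:
  "((\<lambda>x. cis (real_of_int n * x)) has_integral (if n = 0 then 2 * of_real pi else 0)) {-pi..pi}"
proof (cases "n = 0")
  case True
  then show ?thesis
    using has_integral_const_real[of "1::complex" "-pi" pi] by (simp add: scaleR_conv_of_real)
next
  case False
  have "((\<lambda>x. cis (real_of_int n * x)) has_integral
      (cis (real_of_int n * pi) / (\<i> * of_int n) - cis (real_of_int n * (- pi)) / (\<i> * of_int n))) {-pi..pi}"
  proof (rule fundamental_theorem_of_calculus)
    fix x
    have "((\<lambda>z. exp (\<i> * (of_int n * z)) / (\<i> * of_int n)) has_field_derivative
        exp (\<i> * (of_int n * of_real x))) (at (of_real x))"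
      using False by (auto intro!: derivative_eq_intros simp: field_simps)
    from has_vector_derivative_real_field[OF this]
    have "((\<lambda>x. exp (\<i> * of_real (real_of_int n * x)) / (\<i> * of_int n)) has_vector_derivative
        (exp (\<i> * of_real (real_of_int n * x)))) (at x within {-pi..pi})"
      by simp
    then show "((\<lambda>x. cis (real_of_int n * x) / (\<i> * of_int n)) has_vector_derivative
        cis (real_of_int n * x)) (at x within {-pi..pi})"
      by (simp add: cis_conv_exp)
  qed simp
  moreover have "cis (real_of_int n * pi) = cis (real_of_int n * (- pi))"
  proof -
    have "cis (real_of_int n * pi) = cis (real_of_int n * (- pi)) * cis (2 * pi * real_of_int n)"
      by (simp add: cis_mult algebra_simps)
    then show ?thesis by (simp add: cis_multiple_2pi)
  qed
  ultimately show ?thesis using False by simp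
qed

text \<open>Orthogonality keeps exactly the indices that shift frequency \<open>j\<close> to
  frequency \<open>k\<close>; for a symbol this is the matrix entry from mode \<open>j\<close> to
  mode \<open>k\<close>.\<close>

lemma fourier_coeff_trig_series:
  assumes c: "(\<lambda>i. norm (c i)) summable_on UNIV"
  shows "fourier_coeff (\<lambda>x. trig_series \<pi> c x * a * cis (real_of_int j * x)) k =
     (\<Sum>\<^sub>\<infinity>i\<in>{i. \<pi> i = k - j}. c i) * a"
proof -
  let ?f = "\<lambda>i x. c i * a * cis (real_of_int (\<pi> i + j - k) * x)"
  have 1: "trig_series \<pi> c x * a * cis (real_of_int j * x) * cis (- (real_of_int k * x)) = (\<Sum>\<^sub>\<infinity>i. ?f i x)" for x
  proof -
    have e: "?f i x = c i * cis (real_of_int (\<pi> i) * x) * (a * cis (real_of_int j * x) * cis (- (real_of_int k * x)))" for i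
      by (simp add: cis_mult algebra_simps)
    show ?thesis unfolding e infsum_cmult_left' by (simp add: trig_series_def mult.assoc)
  qed
  have I: "integral (cbox (-pi) pi) (?f i) = c i * a * (if \<pi> i = k - j then 2 * of_real pi else 0)" for i
    using has_integral_mult_right[OF has_integral_cis_multiple[of "\<pi> i + j - k"], of "c i * a"]
    unfolding interval_cbox by (intro integral_unique) (simp add: mult.assoc add_diff_eq eq_diff_eq)
  have "((\<lambda>i. integral (cbox (-pi) pi) (?f i)) has_sum integral (cbox (-pi) pi) (\<lambda>x. \<Sum>\<^sub>\<infinity>i. ?f i x)) UNIV"
  proof (rule integral_infsum[where M = "\<lambda>i. norm (c i) * norm a"])
    show "continuous_on (cbox (-pi) pi) (?f i)" for i
      by (intro continuous_intros)
    show "(\<lambda>i. norm (c i) * norm a) summable_on UNIV"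
      by (intro summable_on_cmult_left c)
  qed (simp add: norm_mult)
  then have "integral {-pi..pi} (\<lambda>x. \<Sum>\<^sub>\<infinity>i. ?f i x) = (\<Sum>\<^sub>\<infinity>i. c i * a * (if \<pi> i = k - j then 2 * of_real pi else 0))"
    unfolding I interval_cbox by (rule infsumI[symmetric])
  also have "\<dots> = (\<Sum>\<^sub>\<infinity>i\<in>{i. \<pi> i = k - j}. c i * (a * (2 * of_real pi)))"
    by (rule infsum_cong_neutral) auto
  also have "\<dots> = (\<Sum>\<^sub>\<infinity>i\<in>{i. \<pi> i = k - j}. c i) * (a * (2 * of_real pi))"
    by (rule infsum_cmult_left')
  finally show ?thesis
    unfolding fourier_coeff_def 1 by (simp add: divide_simps)
qed

section \<open>Symbols given by Fourier modes\<close>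

text \<open>The exponential weight in the frequency of \<open>\<theta>\<close> encodes analyticity
  on a strip of width \<open>\<sigma>\<close>, the polynomial weights in the frequency of
  \<open>x\<close> encode smoothness.\<close>

definition admissible :: "real \<Rightarrow> ('i \<Rightarrow> real ^ 'n) \<Rightarrow> ('i \<Rightarrow> int) \<Rightarrow> ('i \<Rightarrow> complex) \<Rightarrow> bool" where
  "admissible \<sigma> \<kappa> \<pi> G \<longleftrightarrow>
     (\<forall>N. (\<lambda>i. norm (G i) * exp (\<sigma> * norm (\<kappa> i)) * (1 + \<bar>real_of_int (\<pi> i)\<bar>) ^ N) summable_on UNIV)"

definition gnorm :: "real \<Rightarrow> ('i \<Rightarrow> real ^ 'n) \<Rightarrow> ('i \<Rightarrow> int) \<Rightarrow> nat \<Rightarrow> ('i \<Rightarrow> complex) \<Rightarrow> real" where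
  "gnorm \<sigma> \<kappa> \<pi> N G = (\<Sum>\<^sub>\<infinity>i. norm (G i) * exp (\<sigma> * norm (\<kappa> i)) * (1 + \<bar>real_of_int (\<pi> i)\<bar>) ^ N)"

definition weight_family :: "real \<Rightarrow> ('i \<Rightarrow> int) \<Rightarrow> ('i \<Rightarrow> int \<Rightarrow> real) \<Rightarrow> bool" where
  "weight_family m \<pi> \<mu> \<longleftrightarrow> (\<forall>b. \<exists>C\<ge>0. \<exists>K. \<forall>i j.
     \<bar>(dl ^^ b) (\<mu> i) j\<bar> \<le> C * (1 + \<bar>real_of_int (\<pi> i)\<bar>) ^ K * jap j powr (m - real b))"

text \<open>All dependence on \<open>j\<close> sits in the weight \<open>\<mu>\<close>. Later the
  coefficients \<open>G\<close> alone carry the dependence on the frequency vector, so that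
  differences in \<open>j\<close> and differences in the parameter never interfere.\<close>

definition exp_symbol :: "('i \<Rightarrow> real ^ 'n) \<Rightarrow> ('i \<Rightarrow> int) \<Rightarrow> ('i \<Rightarrow> int \<Rightarrow> real) \<Rightarrow> ('i \<Rightarrow> complex)
    \<Rightarrow> complex ^ 'n \<Rightarrow> real \<Rightarrow> int \<Rightarrow> complex" where
  "exp_symbol \<kappa> \<pi> \<mu> G \<theta> x j =
     trig_series \<pi> (\<lambda>i. of_real (\<mu> i j) * (G i * exp (\<i> * cdot (\<kappa> i) \<theta>))) x"

lemma gnorm_nonneg: "0 \<le> gnorm \<sigma> \<kappa> \<pi> N G"
  unfolding gnorm_def by (rule infsum_nonneg) auto

lemma norm_coeff_strip_le:
  assumes "\<theta> \<in> strip \<sigma>'" "\<sigma>' \<le> \<sigma>"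
  shows "norm (G i * exp (\<i> * cdot (\<kappa> i) \<theta>)) \<le> norm (G i) * exp (\<sigma> * norm (\<kappa> i))"
proof -
  have "norm (exp (\<i> * cdot (\<kappa> i) \<theta>)) \<le> exp (\<sigma> * norm (\<kappa> i))"
    using assms by (intro norm_exp_cdot_le) (simp add: strip_def)
  then show ?thesis unfolding norm_mult by (intro mult_left_mono) auto
qed

lemma admissible_rapid:
  assumes "admissible \<sigma> \<kappa> \<pi> G" "\<theta> \<in> strip \<sigma>'" "\<sigma>' \<le> \<sigma>"
  shows "rapid \<pi> (\<lambda>i. G i * exp (\<i> * cdot (\<kappa> i) \<theta>))"
  unfolding rapid_def
proof
  fix N
  show "(\<lambda>i. norm (G i * exp (\<i> * cdot (\<kappa> i) \<theta>)) * (1 + \<bar>real_of_int (\<pi> i)\<bar>) ^ N) summable_on UNIV"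
  proof (rule summable_on_comparison_test)
    show "(\<lambda>i. norm (G i) * exp (\<sigma> * norm (\<kappa> i)) * (1 + \<bar>real_of_int (\<pi> i)\<bar>) ^ N) summable_on UNIV"
      using assms(1) by (simp add: admissible_def)
  qed (auto intro!: mult_right_mono norm_coeff_strip_le[OF assms(2,3)])
qed

lemma weight_familyD:
  assumes "weight_family m \<pi> \<mu>"
  shows "\<exists>C K. (\<forall>b. C b \<ge> 0) \<and> (\<forall>b i j. \<bar>(dl ^^ b) (\<mu> i) j\<bar> \<le>
    C b * (1 + \<bar>real_of_int (\<pi> i)\<bar>) ^ K b * jap j powr (m - real b))"
proof -
  let ?P = "\<lambda>b C K. \<forall>i j. \<bar>(dl ^^ b) (\<mu> i) j\<bar> \<le> C * (1 + \<bar>real_of_int (\<pi> i)\<bar>) ^ K * jap j powr (m - real b)"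
  have "\<forall>b. \<exists>C. C \<ge> 0 \<and> (\<exists>K. ?P b C K)"
    using assms unfolding weight_family_def by simp
  from choice[OF this] obtain C where C: "\<forall>b. C b \<ge> 0 \<and> (\<exists>K. ?P b (C b) K)" ..
  then have "\<forall>b. \<exists>K. ?P b (C b) K" by simp
  from choice[OF this] obtain K where "\<forall>b. ?P b (C b) (K b)" ..
  with C show ?thesis by (intro exI[of _ C] exI[of _ K] conjI) simp_all
qed

lemma rapid_weight:
  assumes "weight_family m \<pi> \<mu>" "rapid \<pi> c"
  shows "rapid \<pi> (\<lambda>i. of_real ((dl ^^ b) (\<mu> i) j) * c i)"
proof -
  obtain C K where b: "\<And>b. C b \<ge> 0"
    "\<And>b i j. \<bar>(dl ^^ b) (\<mu> i) j\<bar> \<le> C b * (1 + \<bar>real_of_int (\<pi> i)\<bar>) ^ K b * jap j powr (m - real b)"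
    using weight_familyD[OF assms(1)] by blast
  show ?thesis
  proof (rule rapid_mult[OF assms(2), where C = "C b * jap j powr (m - real b)" and K = "K b"])
    show "norm (of_real ((dl ^^ b) (\<mu> i) j) :: complex) \<le> C b * jap j powr (m - real b) * (1 + \<bar>real_of_int (\<pi> i)\<bar>) ^ K b" for i
      using b(2)[of b i j] by (simp add: mult_ac)
  qed
qed

lemma tri_pow: "(tri ^^ b) f \<theta> x j = (dl ^^ b) (\<lambda>j. f \<theta> x j) j"
  by (induction b arbitrary: j) (simp_all add: tri_def dl_def)

lemma trig_series_minus:
  assumes "rapid \<pi> c" "rapid \<pi> d"
  shows "trig_series \<pi> (\<lambda>i. c i - d i) x = trig_series \<pi> c x - trig_series \<pi> d x"
proof -
  have "(\<lambda>i. c i * cis (real_of_int (\<pi> i) * x)) summable_on UNIV" if "rapid \<pi> c" for c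
    by (rule summable_on_norm_bound[OF rapid_summable[OF that]]) (simp add: norm_mult)
  then show ?thesis
    unfolding trig_series_def left_diff_distrib using assms by (intro infsum_minus_distrib)
qed

lemma dl_pow_Suc: "(dl ^^ Suc b) s j = (dl ^^ b) s (j + 1) - (dl ^^ b) s j"
  by (subst funpow.simps) (simp only: o_apply dl_def)

lemma dl_pow_trig_series:
  assumes "weight_family m \<pi> \<mu>" "rapid \<pi> c"
  shows "(dl ^^ b) (\<lambda>j. trig_series \<pi> (\<lambda>i. of_real (\<mu> i j) * c i) x) j =
    trig_series \<pi> (\<lambda>i. of_real ((dl ^^ b) (\<mu> i) j) * c i) x"
proof (induction b arbitrary: j)
  case (Suc b)
  show ?case
    unfolding dl_pow_Suc Suc.IH of_real_diff left_diff_distrib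
    by (rule trig_series_minus[OF rapid_weight[OF assms] rapid_weight[OF assms], symmetric])
qed simp

lemma exp_symbol_derivatives:
  assumes "weight_family m \<pi> \<mu>" "admissible \<sigma> \<kappa> \<pi> G" "\<theta> \<in> strip \<sigma>'" "\<sigma>' \<le> \<sigma>"
  shows "(dx ^^ a) (\<lambda>y. (tri ^^ b) (exp_symbol \<kappa> \<pi> \<mu> G) \<theta> y j) x =
    trig_series \<pi> (\<lambda>i. (\<i> * of_int (\<pi> i)) ^ a *
      (of_real ((dl ^^ b) (\<mu> i) j) * (G i * exp (\<i> * cdot (\<kappa> i) \<theta>)))) x"
proof -
  note r = admissible_rapid[OF assms(2-4)]
  have "(\<lambda>y. (tri ^^ b) (exp_symbol \<kappa> \<pi> \<mu> G) \<theta> y j) =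
    trig_series \<pi> (\<lambda>i. of_real ((dl ^^ b) (\<mu> i) j) * (G i * exp (\<i> * cdot (\<kappa> i) \<theta>)))"
    unfolding tri_pow exp_symbol_def dl_pow_trig_series[OF assms(1) r] ..
  then show ?thesis
    by (simp add: dx_pow_trig_series[OF rapid_weight[OF assms(1) r]])
qed

lemma gnorm_mono:
  assumes "admissible \<sigma> \<kappa> \<pi> G" "N \<le> N'"
  shows "gnorm \<sigma> \<kappa> \<pi> N G \<le> gnorm \<sigma> \<kappa> \<pi> N' G"
  using assms unfolding gnorm_def admissible_def
  by (intro infsum_mono mult_left_mono power_increasing) auto

text \<open>The weight contributes \<open>K\<close> powers of the frequency and the derivatives in
  \<open>x\<close> another \<open>a\<close>; the powers of \<open>jap j\<close> cancel because
  \<open>b\<close> differences lower the order by \<open>b\<close>.\<close>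

lemma exp_symbol_seminorm_summand_le:
  assumes C: "C \<ge> 0" "\<And>i j. \<bar>(dl ^^ b) (\<mu> i) j\<bar> \<le> C * (1 + \<bar>real_of_int (\<pi> i)\<bar>) ^ K * jap j powr (m - real b)"
    and wt: "weight_family m \<pi> \<mu>" and G: "admissible \<sigma> \<kappa> \<pi> G" and \<theta>: "\<theta> \<in> strip \<sigma>'" "\<sigma>' \<le> \<sigma>"
  shows "jap j powr (- m + real b) * norm ((dx ^^ a) (\<lambda>y. (tri ^^ b) (exp_symbol \<kappa> \<pi> \<mu> G) \<theta> y j) x)
    \<le> C * gnorm \<sigma> \<kappa> \<pi> (K + a) G"
proof -
  let ?t = "\<lambda>i. (\<i> * of_int (\<pi> i)) ^ a * (of_real ((dl ^^ b) (\<mu> i) j) * (G i * exp (\<i> * cdot (\<kappa> i) \<theta>)))"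
  let ?g = "\<lambda>i. norm (G i) * exp (\<sigma> * norm (\<kappa> i)) * (1 + \<bar>real_of_int (\<pi> i)\<bar>) ^ (K + a)"
  have s: "(\<lambda>i. norm (?t i)) summable_on UNIV"
    by (intro rapid_summable[of \<pi>] rapid_deriv rapid_weight[OF wt] admissible_rapid[OF G \<theta>])
  have b: "norm (?t i) \<le> C * jap j powr (m - real b) * ?g i" for i
  proof -
    have "norm (?t i) = \<bar>real_of_int (\<pi> i)\<bar> ^ a * (\<bar>(dl ^^ b) (\<mu> i) j\<bar> * norm (G i * exp (\<i> * cdot (\<kappa> i) \<theta>)))"
      by (simp add: norm_mult norm_power)
    also have "\<dots> \<le> (1 + \<bar>real_of_int (\<pi> i)\<bar>) ^ a * ((C * (1 + \<bar>real_of_int (\<pi> i)\<bar>) ^ K * jap j powr (m - real b)) *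
        (norm (G i) * exp (\<sigma> * norm (\<kappa> i))))"
      using C(1) by (intro mult_mono power_mono C(2) norm_coeff_strip_le[OF \<theta>] mult_nonneg_nonneg) auto
    also have "\<dots> = C * jap j powr (m - real b) * ?g i"
      by (simp add: power_add mult_ac)
    finally show ?thesis .
  qed
  have "norm (trig_series \<pi> ?t x) \<le> (\<Sum>\<^sub>\<infinity>i. norm (?t i))"
    by (rule norm_trig_series_le[OF s])
  also have "\<dots> \<le> (\<Sum>\<^sub>\<infinity>i. C * jap j powr (m - real b) * ?g i)"
    using G by (intro infsum_mono s b summable_on_cmult_right) (simp add: admissible_def)
  also have "\<dots> = C * jap j powr (m - real b) * gnorm \<sigma> \<kappa> \<pi> (K + a) G"
    unfolding gnorm_def by (rule infsum_cmult_right')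
  finally have "norm (trig_series \<pi> ?t x) \<le> C * jap j powr (m - real b) * gnorm \<sigma> \<kappa> \<pi> (K + a) G" .
  then have "jap j powr (- m + real b) * norm (trig_series \<pi> ?t x) \<le>
      jap j powr (- m + real b) * (C * jap j powr (m - real b) * gnorm \<sigma> \<kappa> \<pi> (K + a) G)"
    by (intro mult_left_mono) auto
  also have "\<dots> = (jap j powr (- m + real b) * jap j powr (m - real b)) * (C * gnorm \<sigma> \<kappa> \<pi> (K + a) G)"
    by (simp add: mult_ac)
  also have "\<dots> = C * gnorm \<sigma> \<kappa> \<pi> (K + a) G"
    by (simp add: powr_add[symmetric])
  finally show ?thesis
    unfolding exp_symbol_derivatives[OF wt G \<theta>] .
qed

text \<open>The constants \<open>N\<close> and \<open>C\<close> precede the coefficients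
  \<open>G\<close>: the bound may thus be applied to each parameter value and to differences of two
  parameter values.\<close>

lemma wp_exp_symbol_le:
  fixes \<kappa> :: "'i \<Rightarrow> real ^ 'n"
  assumes "weight_family m \<pi> \<mu>"
  shows "\<exists>N C. C \<ge> 0 \<and> (\<forall>G. admissible \<sigma> \<kappa> \<pi> G \<longrightarrow> \<sigma>' \<le> \<sigma> \<longrightarrow>
    wp m \<sigma>' l (exp_symbol \<kappa> \<pi> \<mu> G) \<le> ennreal (C * gnorm \<sigma> \<kappa> \<pi> N G))"
proof -
  obtain C K where b: "\<And>b. C b \<ge> 0"
    "\<And>b i j. \<bar>(dl ^^ b) (\<mu> i) j\<bar> \<le> C b * (1 + \<bar>real_of_int (\<pi> i)\<bar>) ^ K b * jap j powr (m - real b)"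
    using weight_familyD[OF assms] by blast
  define I where "I = {(a, b). a + b \<le> l}"
  have fin: "finite I"
    by (rule finite_subset[of _ "{..l} \<times> {..l}"]) (auto simp: I_def)
  \<comment> \<open>The sum is a convenient upper bound for every \<open>K b + a\<close> with
    \<open>a + b \<le> l\<close>.\<close>
  define N where "N = (\<Sum>b\<le>l. K b) + l"
  have N: "K b + a \<le> N" if "(a, b) \<in> I" for a b
  proof -
    have "K b \<le> (\<Sum>b\<le>l. K b)" using that by (intro member_le_sum) (auto simp: I_def)
    then show ?thesis using that by (auto simp: N_def I_def)
  qed
  have "wp m \<sigma>' l (exp_symbol \<kappa> \<pi> \<mu> G) \<le> ennreal ((\<Sum>(a, b)\<in>I. C b) * gnorm \<sigma> \<kappa> \<pi> N G)"
    if G: "admissible \<sigma> \<kappa> \<pi> G" and le: "\<sigma>' \<le> \<sigma>" for G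
    unfolding wp_def
  proof (rule SUP_least)
    fix \<theta> :: "complex ^ 'n" assume \<theta>: "\<theta> \<in> strip \<sigma>'"
    have "(\<Sum>(a, b)\<in>I. SUP (x, j)\<in>UNIV. ennreal (jap j powr (- m + real b) *
        norm ((dx ^^ a) (\<lambda>y. (tri ^^ b) (exp_symbol \<kappa> \<pi> \<mu> G) \<theta> y j) x)))
        \<le> (\<Sum>(a, b)\<in>I. ennreal (C b * gnorm \<sigma> \<kappa> \<pi> N G))"
    proof (rule sum_mono, clarify, rule SUP_least, clarify)
      fix a b x j assume "(a, b) \<in> I"
      then have "C b * gnorm \<sigma> \<kappa> \<pi> (K b + a) G \<le> C b * gnorm \<sigma> \<kappa> \<pi> N G"
        by (intro mult_left_mono gnorm_mono G N b)
      then show "ennreal (jap j powr (- m + real b) *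
        norm ((dx ^^ a) (\<lambda>y. (tri ^^ b) (exp_symbol \<kappa> \<pi> \<mu> G) \<theta> y j) x)) \<le> ennreal (C b * gnorm \<sigma> \<kappa> \<pi> N G)"
        by (intro ennreal_leI order_trans[OF exp_symbol_seminorm_summand_le[OF b(1) b(2) assms G \<theta> le]])
    qed
    also have "\<dots> = ennreal (\<Sum>(a, b)\<in>I. C b * gnorm \<sigma> \<kappa> \<pi> N G)"
      by (simp add: case_prod_unfold sum_ennreal b gnorm_nonneg)
    also have "(\<Sum>(a, b)\<in>I. C b * gnorm \<sigma> \<kappa> \<pi> N G) = (\<Sum>(a, b)\<in>I. C b) * gnorm \<sigma> \<kappa> \<pi> N G"
      by (simp add: case_prod_unfold sum_distrib_right)
    finally show "(\<Sum>(a, b)\<in>{(a, b). a + b \<le> l}. SUP (x, j)\<in>UNIV. ennreal (jap j powr (- m + real b) *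
        norm ((dx ^^ a) (\<lambda>y. (tri ^^ b) (exp_symbol \<kappa> \<pi> \<mu> G) \<theta> y j) x)))
        \<le> ennreal ((\<Sum>(a, b)\<in>I. C b) * gnorm \<sigma> \<kappa> \<pi> N G)"
      unfolding I_def .
  qed
  moreover have "(\<Sum>(a, b)\<in>I. C b) \<ge> 0"
    using b(1) by (auto intro!: sum_nonneg)
  ultimately show ?thesis by blast
qed

text \<open>The strict inequality of widths provides the open neighbourhood for analyticity, the
  integrality of \<open>\<kappa>\<close> the periodicity in the angles.\<close>

lemma exp_symbol_S_class:
  fixes \<kappa> :: "'i \<Rightarrow> real ^ 'n"
  assumes wt: "weight_family m \<pi> \<mu>" and G: "admissible \<sigma> \<kappa> \<pi> G" and le: "\<sigma>' < \<sigma>"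
    and int: "\<And>i l. \<kappa> i $ l \<in> \<int>"
  shows "exp_symbol \<kappa> \<pi> \<mu> G \<in> S_class m \<sigma>'"
proof -
  have "analytic_smooth \<sigma>' (\<lambda>\<theta> x. exp_symbol \<kappa> \<pi> \<mu> G \<theta> x j)" for j
    unfolding analytic_smooth_def
  proof (intro conjI allI ballI)
    fix x
    obtain C K where b: "\<And>b. C b \<ge> 0"
      "\<And>b i j. \<bar>(dl ^^ b) (\<mu> i) j\<bar> \<le> C b * (1 + \<bar>real_of_int (\<pi> i)\<bar>) ^ K b * jap j powr (m - real b)"
      using weight_familyD[OF wt] by blast
    have eq: "exp_symbol \<kappa> \<pi> \<mu> G \<theta> x j =
        (\<Sum>\<^sub>\<infinity>i. (of_real (\<mu> i j) * G i * cis (real_of_int (\<pi> i) * x)) * exp (\<i> * cdot (\<kappa> i) \<theta>))" for \<theta>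
      unfolding exp_symbol_def trig_series_def by (simp add: mult_ac)
    show "analytic_sev (\<lambda>\<theta>. exp_symbol \<kappa> \<pi> \<mu> G \<theta> x j) (strip \<sigma>')"
      unfolding eq
    proof (rule analytic_sev_exp_series[OF _ le])
      show "(\<lambda>i. norm (of_real (\<mu> i j) * G i * cis (real_of_int (\<pi> i) * x)) * exp (\<sigma> * norm (\<kappa> i))) summable_on UNIV"
      proof (rule summable_on_comparison_test)
        show "(\<lambda>i. C 0 * jap j powr m * (norm (G i) * exp (\<sigma> * norm (\<kappa> i)) * (1 + \<bar>real_of_int (\<pi> i)\<bar>) ^ K 0)) summable_on UNIV"
          using G unfolding admissible_def by (intro summable_on_cmult_right) auto
        fix i
        have "\<bar>\<mu> i j\<bar> * (norm (G i) * exp (\<sigma> * norm (\<kappa> i))) \<le>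
            (C 0 * (1 + \<bar>real_of_int (\<pi> i)\<bar>) ^ K 0 * jap j powr m) * (norm (G i) * exp (\<sigma> * norm (\<kappa> i)))"
          using b(2)[of 0 i j] by (intro mult_right_mono) auto
        then show "norm (of_real (\<mu> i j) * G i * cis (real_of_int (\<pi> i) * x)) * exp (\<sigma> * norm (\<kappa> i)) \<le>
            C 0 * jap j powr m * (norm (G i) * exp (\<sigma> * norm (\<kappa> i)) * (1 + \<bar>real_of_int (\<pi> i)\<bar>) ^ K 0)"
          by (simp add: norm_mult mult_ac)
      qed auto
    qed
  next
    fix \<theta> :: "complex ^ 'n" assume "\<theta> \<in> strip \<sigma>'"
    then have r: "rapid \<pi> (\<lambda>i. of_real (\<mu> i j) * (G i * exp (\<i> * cdot (\<kappa> i) \<theta>)))"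
      using rapid_weight[OF wt admissible_rapid[OF G], of \<theta> \<sigma>' 0] le by simp
    show "smooth (\<lambda>x. exp_symbol \<kappa> \<pi> \<mu> G \<theta> x j)"
      unfolding exp_symbol_def using smooth_trig_series[OF r] by simp
    show "exp_symbol \<kappa> \<pi> \<mu> G \<theta> (x + 2 * pi) j = exp_symbol \<kappa> \<pi> \<mu> G \<theta> x j" for x
      unfolding exp_symbol_def by (rule trig_series_periodic)
    show "exp_symbol \<kappa> \<pi> \<mu> G (\<theta> + axis l (2 * pi)) x j = exp_symbol \<kappa> \<pi> \<mu> G \<theta> x j" for x l
    proof -
      have "exp (\<i> * cdot (\<kappa> i) (\<theta> + axis l (complex_of_real (2 * pi)))) = exp (\<i> * cdot (\<kappa> i) \<theta>)" for i
      proof -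
        obtain n where n: "\<kappa> i $ l = of_int n" using int Ints_cases by metis
        have "exp (\<i> * cdot (\<kappa> i) (\<theta> + axis l (complex_of_real (2 * pi)))) =
            exp (\<i> * cdot (\<kappa> i) \<theta>) * cis (2 * pi * of_int n)"
          by (simp add: cdot_add_right cdot_axis n distrib_left exp_add cis_conv_exp mult_ac)
        then show ?thesis by (simp add: cis_multiple_2pi)
      qed
      then show ?thesis unfolding exp_symbol_def by simp
    qed
  qed
  moreover have "wp m \<sigma>' l (exp_symbol \<kappa> \<pi> \<mu> G) < \<infinity>" for l
  proof -
    obtain N C where "\<forall>G. admissible \<sigma> \<kappa> \<pi> G \<longrightarrow> \<sigma>' \<le> \<sigma> \<longrightarrow>
        wp m \<sigma>' l (exp_symbol \<kappa> \<pi> \<mu> G) \<le> ennreal (C * gnorm \<sigma> \<kappa> \<pi> N G)"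
      using wp_exp_symbol_le[OF wt, of \<sigma> \<kappa> \<sigma>' l] by blast
    then have "wp m \<sigma>' l (exp_symbol \<kappa> \<pi> \<mu> G) \<le> ennreal (C * gnorm \<sigma> \<kappa> \<pi> N G)"
      using G le by simp
    also have "\<dots> < \<infinity>" by simp
    finally show ?thesis .
  qed
  ultimately show ?thesis by (simp add: S_class_def)
qed

text \<open>The matrix entry from mode \<open>j\<close> to mode \<open>k\<close>: precisely the
  indices with frequency \<open>k - j\<close> connect the two.\<close>

definition kernel :: "('i \<Rightarrow> real ^ 'n) \<Rightarrow> ('i \<Rightarrow> int) \<Rightarrow> ('i \<Rightarrow> int \<Rightarrow> real) \<Rightarrow> ('i \<Rightarrow> complex) \<Rightarrow>
    real ^ 'n \<Rightarrow> int \<Rightarrow> int \<Rightarrow> complex" where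
  "kernel \<kappa> \<pi> \<mu> G \<theta> k j = (\<Sum>\<^sub>\<infinity>i\<in>{i. \<pi> i = k - j}. of_real (\<mu> i j) * (G i * cis (\<kappa> i \<bullet> \<theta>)))"

section \<open>Matrix form of the operators and parity\<close>

lemma cvec_in_strip: "0 \<le> \<sigma> \<Longrightarrow> cvec \<theta> \<in> strip \<sigma>"
  by (simp add: strip_def cvec_def) (metis norm_zero zero_vec_def)

lemma exp_cdot_cvec: "exp (\<i> * cdot k (cvec \<theta>)) = cis (k \<bullet> \<theta>)"
  by (simp add: cdot_cvec cis_conv_exp)

lemma Op_exp_symbol:
  assumes wt: "weight_family m \<pi> \<mu>" and G: "admissible \<sigma> \<kappa> \<pi> G" and pos: "0 \<le> \<sigma>"
  shows "Op (exp_symbol \<kappa> \<pi> \<mu> G) \<theta> u k = (\<Sum>\<^sub>\<infinity>j. kernel \<kappa> \<pi> \<mu> G \<theta> k j * u j)"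
proof -
  have r: "rapid \<pi> (\<lambda>i. of_real (\<mu> i j) * (G i * exp (\<i> * cdot (\<kappa> i) (cvec \<theta>))))" for j
    using rapid_weight[OF wt admissible_rapid[OF G cvec_in_strip[OF pos] order_refl], of 0] by simp
  show ?thesis
    unfolding Op_def psido_def exp_symbol_def fourier_coeff_trig_series[OF rapid_summable[OF r]]
    by (simp add: kernel_def exp_cdot_cvec)
qed

text \<open>Invariance under simultaneous reflection of both modes says that the matrix commutes
  with the parity operator. The involution \<open>\<iota>\<close> realizes the reflection on the
  index set.\<close>

lemma kernel_minus:
  assumes inv: "\<And>i. \<iota> (\<iota> i) = i" and "\<And>i. \<pi> (\<iota> i) = - \<pi> i" "\<And>i. \<kappa> (\<iota> i) = \<kappa> i" "\<And>i. G (\<iota> i) = G i"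
    and "\<And>i j. \<mu> (\<iota> i) (- j) = \<mu> i j"
  shows "kernel \<kappa> \<pi> \<mu> G \<theta> (- k) (- j) = kernel \<kappa> \<pi> \<mu> G \<theta> k j"
  unfolding kernel_def
proof (rule infsum_reindex_bij_witness[of _ \<iota> \<iota>])
  fix i
  show "of_real (\<mu> (\<iota> i) j) * (G (\<iota> i) * cis (\<kappa> (\<iota> i) \<bullet> \<theta>)) = of_real (\<mu> i (- j)) * (G i * cis (\<kappa> i \<bullet> \<theta>))"
    using assms(5)[of i "- j"] by (simp add: assms)
qed (use assms in auto)

lemma infsum_minus_reindex: "(\<Sum>\<^sub>\<infinity>j::int. f (- j)) = (\<Sum>\<^sub>\<infinity>j. f j)"
  by (rule infsum_reindex_bij_witness[of _ uminus uminus]) auto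

lemma kernel_op_minus:
  assumes "\<And>k j. K (- k) (- j) = K k j"
  shows "(\<Sum>\<^sub>\<infinity>j. K (- k) j * u j) = (\<Sum>\<^sub>\<infinity>j::int. K k j * u (- j))"
  using infsum_minus_reindex[of "\<lambda>j. K (- k) j * u j", symmetric] assms by simp

lemma exp_symbol_PA:
  assumes wt: "weight_family m \<pi> \<mu>" and G: "admissible \<sigma> \<kappa> \<pi> G" and le: "\<sigma>' < \<sigma>" and pos: "0 \<le> \<sigma>"
    and int: "\<And>i l. \<kappa> i $ l \<in> \<int>"
    and sym: "\<And>i. \<iota> (\<iota> i) = i" "\<And>i. \<pi> (\<iota> i) = - \<pi> i" "\<And>i. \<kappa> (\<iota> i) = \<kappa> i" "\<And>i. G (\<iota> i) = G i"
      "\<And>i j. \<mu> (\<iota> i) (- j) = \<mu> i j"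
  shows "exp_symbol \<kappa> \<pi> \<mu> G \<in> PA m \<sigma>'"
proof -
  have km: "(\<Sum>\<^sub>\<infinity>j. kernel \<kappa> \<pi> \<mu> G \<theta> (- k) j * u j) = (\<Sum>\<^sub>\<infinity>j. kernel \<kappa> \<pi> \<mu> G \<theta> k j * u (- j))" for \<theta> k u
    by (intro kernel_op_minus kernel_minus[where \<iota> = \<iota>] sym)
  have "even_ser (Op (exp_symbol \<kappa> \<pi> \<mu> G) \<theta> u)" if "even_ser u" for \<theta> u
    using that unfolding even_ser_def Op_exp_symbol[OF wt G pos] km by simp
  moreover have "odd_ser (Op (exp_symbol \<kappa> \<pi> \<mu> G) \<theta> u)" if "odd_ser u" for \<theta> u
    using that unfolding odd_ser_def Op_exp_symbol[OF wt G pos] km by (simp add: infsum_uminus)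
  ultimately show ?thesis
    using exp_symbol_S_class[OF wt G le int] by (auto simp: PA_def)
qed

section \<open>Lipschitz dependence on a parameter\<close>

lemma exp_symbol_minus:
  assumes "weight_family m \<pi> \<mu>" "admissible \<sigma> \<kappa> \<pi> G" "admissible \<sigma> \<kappa> \<pi> H" "\<theta> \<in> strip \<sigma>'" "\<sigma>' \<le> \<sigma>"
  shows "exp_symbol \<kappa> \<pi> \<mu> G \<theta> x j - exp_symbol \<kappa> \<pi> \<mu> H \<theta> x j = exp_symbol \<kappa> \<pi> \<mu> (\<lambda>i. G i - H i) \<theta> x j"
  using trig_series_minus[OF rapid_weight[OF assms(1) admissible_rapid[OF assms(2,4,5)], of 0]
      rapid_weight[OF assms(1) admissible_rapid[OF assms(3,4,5)], of 0], of j j x]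
  by (simp add: exp_symbol_def algebra_simps)

lemma admissible_minus:
  assumes "admissible \<sigma> \<kappa> \<pi> G" "admissible \<sigma> \<kappa> \<pi> H"
  shows "admissible \<sigma> \<kappa> \<pi> (\<lambda>i. G i - H i)"
  unfolding admissible_def
proof
  fix N
  have "(\<lambda>i. norm (G i) * exp (\<sigma> * norm (\<kappa> i)) * (1 + \<bar>real_of_int (\<pi> i)\<bar>) ^ N +
      norm (H i) * exp (\<sigma> * norm (\<kappa> i)) * (1 + \<bar>real_of_int (\<pi> i)\<bar>) ^ N) summable_on UNIV"
    using assms unfolding admissible_def by (intro summable_on_add) auto
  then show "(\<lambda>i. norm (G i - H i) * exp (\<sigma> * norm (\<kappa> i)) * (1 + \<bar>real_of_int (\<pi> i)\<bar>) ^ N) summable_on UNIV"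
    by (rule summable_on_comparison_test) (auto simp: distrib_right[symmetric] intro!: mult_right_mono norm_triangle_ineq4)
qed

text \<open>The difference of two series is known to be the series of the differences on the strip
  only, where both converge; off the strip the symbols carry no information.\<close>

lemma wp_cong_strip:
  assumes "\<And>\<theta> x j. \<theta> \<in> strip \<rho> \<Longrightarrow> f \<theta> x j = g \<theta> x j"
  shows "wp m \<rho> l f = wp m \<rho> l g"
proof -
  have "(tri ^^ b) f \<theta> y j = (tri ^^ b) g \<theta> y j" if "\<theta> \<in> strip \<rho>" for \<theta> y j b
  proof -
    have "f \<theta> = g \<theta>" using assms[OF that] by (intro ext)
    then show ?thesis by (simp only: tri_pow)
  qed
  then show ?thesis
    unfolding wp_def by (intro SUP_cong sum.cong refl) auto
qed

text \<open>By linearity the difference of two symbols is the symbol of the difference of the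
  coefficients, so the same bound serves the supremum and the Lipschitz quotient.\<close>

lemma lip_wp_exp_symbol_le:
  fixes \<kappa> :: "'i \<Rightarrow> real ^ 'n" and \<Omega> :: "(real ^ 'n) set"
  assumes wt: "weight_family m \<pi> \<mu>"
    and N: "\<And>G. admissible \<sigma> \<kappa> \<pi> G \<Longrightarrow> wp m \<sigma>' l (exp_symbol \<kappa> \<pi> \<mu> G) \<le> ennreal (C * gnorm \<sigma> \<kappa> \<pi> N G)"
    and C: "C \<ge> 0" "A \<ge> 0" "L \<ge> 0" "w \<ge> 0" and le: "\<sigma>' \<le> \<sigma>"
    and adm: "\<And>\<omega>. \<omega> \<in> \<Omega> \<Longrightarrow> admissible \<sigma> \<kappa> \<pi> (G \<omega>)"
    and A: "\<And>\<omega>. \<omega> \<in> \<Omega> \<Longrightarrow> gnorm \<sigma> \<kappa> \<pi> N (G \<omega>) \<le> A"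
    and L: "\<And>\<omega>1 \<omega>2. \<omega>1 \<in> \<Omega> \<Longrightarrow> \<omega>2 \<in> \<Omega> \<Longrightarrow> gnorm \<sigma> \<kappa> \<pi> N (\<lambda>i. G \<omega>1 i - G \<omega>2 i) \<le> L * norm (\<omega>1 - \<omega>2)"
  shows "lip_wp w \<Omega> m \<sigma>' l (\<lambda>\<omega>. exp_symbol \<kappa> \<pi> \<mu> (G \<omega>)) \<le> ennreal (C * (A + w * L))"
proof -
  have 1: "(SUP \<omega>\<in>\<Omega>. wp m \<sigma>' l (exp_symbol \<kappa> \<pi> \<mu> (G \<omega>))) \<le> ennreal (C * A)"
  proof (rule SUP_least)
    fix \<omega> assume "\<omega> \<in> \<Omega>"
    then show "wp m \<sigma>' l (exp_symbol \<kappa> \<pi> \<mu> (G \<omega>)) \<le> ennreal (C * A)"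
      by (intro order_trans[OF N[OF adm]] ennreal_leI mult_left_mono A C)
  qed
  have 2: "(SUP (\<omega>1, \<omega>2)\<in>{(\<omega>1, \<omega>2). \<omega>1 \<in> \<Omega> \<and> \<omega>2 \<in> \<Omega> \<and> \<omega>1 \<noteq> \<omega>2}.
        wp m \<sigma>' l (\<lambda>\<theta> x j. exp_symbol \<kappa> \<pi> \<mu> (G \<omega>1) \<theta> x j - exp_symbol \<kappa> \<pi> \<mu> (G \<omega>2) \<theta> x j)
          / ennreal (norm (\<omega>1 - \<omega>2))) \<le> ennreal (C * L)"
  proof (rule SUP_least, clarify)
    fix \<omega>1 \<omega>2 :: "real ^ 'n" assume \<omega>: "\<omega>1 \<in> \<Omega>" "\<omega>2 \<in> \<Omega>" "\<omega>1 \<noteq> \<omega>2"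
    then have p: "norm (\<omega>1 - \<omega>2) > 0" by simp
    have "wp m \<sigma>' l (\<lambda>\<theta> x j. exp_symbol \<kappa> \<pi> \<mu> (G \<omega>1) \<theta> x j - exp_symbol \<kappa> \<pi> \<mu> (G \<omega>2) \<theta> x j)
        = wp m \<sigma>' l (exp_symbol \<kappa> \<pi> \<mu> (\<lambda>i. G \<omega>1 i - G \<omega>2 i))"
      using exp_symbol_minus[OF wt adm adm _ le] \<omega> by (intro wp_cong_strip) auto
    also have "\<dots> \<le> ennreal (C * gnorm \<sigma> \<kappa> \<pi> N (\<lambda>i. G \<omega>1 i - G \<omega>2 i))"
      by (intro N admissible_minus adm \<omega>)
    also have "\<dots> \<le> ennreal (C * (L * norm (\<omega>1 - \<omega>2)))"
      by (intro ennreal_leI mult_left_mono L C \<omega>)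
    finally have "wp m \<sigma>' l (\<lambda>\<theta> x j. exp_symbol \<kappa> \<pi> \<mu> (G \<omega>1) \<theta> x j - exp_symbol \<kappa> \<pi> \<mu> (G \<omega>2) \<theta> x j)
      / ennreal (norm (\<omega>1 - \<omega>2)) \<le> ennreal (C * (L * norm (\<omega>1 - \<omega>2))) / ennreal (norm (\<omega>1 - \<omega>2))"
      by (rule divide_right_mono_ennreal)
    also have "\<dots> = ennreal (C * L)"
      using C p by (subst divide_ennreal) auto
    finally show "wp m \<sigma>' l (\<lambda>\<theta> x j. exp_symbol \<kappa> \<pi> \<mu> (G \<omega>1) \<theta> x j - exp_symbol \<kappa> \<pi> \<mu> (G \<omega>2) \<theta> x j)
      / ennreal (norm (\<omega>1 - \<omega>2)) \<le> ennreal (C * L)" .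
  qed
  have "lip_wp w \<Omega> m \<sigma>' l (\<lambda>\<omega>. exp_symbol \<kappa> \<pi> \<mu> (G \<omega>)) \<le> ennreal (C * A) + ennreal w * ennreal (C * L)"
    unfolding lip_wp_def by (intro add_mono 1 mult_left_mono 2) auto
  also have "\<dots> = ennreal (C * (A + w * L))"
    using C by (simp add: ennreal_mult[symmetric] ennreal_plus[symmetric] algebra_simps del: ennreal_plus)
  finally show ?thesis .
qed

section \<open>Matrix operators on Sobolev sequences\<close>

text \<open>Translates sums over the positive frequencies of sine series into sums over all
  integers; for odd sequences, squares and products of two coefficients are even and vanish at
  zero.\<close>

lemma summable_on_even_int:
  fixes f :: "int \<Rightarrow> 'a::banach"
  assumes even: "\<And>j. f (- j) = f j" and "f 0 = 0"
  shows "f summable_on UNIV \<longleftrightarrow> f summable_on {1..}"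
    and "infsum f UNIV = infsum f {1..} + infsum f {1..}"
proof -
  have bij: "f summable_on {..-1} \<longleftrightarrow> f summable_on {1..}"
    by (rule summable_on_reindex_bij_witness[of _ uminus uminus]) (auto simp: even)
  have bij': "infsum f {..-1} = infsum f {1..}"
    by (rule infsum_reindex_bij_witness[of _ uminus uminus]) (auto simp: even)
  have 0: "f j = 0" if "j \<in> UNIV - ({1..} \<union> {..-1})" for j
  proof -
    have "j = 0" using that by auto
    then show ?thesis using assms(2) by simp
  qed
  have un: "f summable_on UNIV \<longleftrightarrow> f summable_on ({1..} \<union> {..-1})"
    by (rule summable_on_cong_neutral) (use 0 in auto)
  have un': "infsum f UNIV = infsum f ({1..} \<union> {..-1})"
    by (rule infsum_cong_neutral) (use 0 in auto)
  have s: "f summable_on ({1..} \<union> {..-1}) \<longleftrightarrow> f summable_on {1..}"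
  proof
    assume "f summable_on ({1..} \<union> {..-1})"
    then show "f summable_on {1..}" by (rule summable_on_subset_banach) auto
  next
    assume "f summable_on {1..}"
    then show "f summable_on ({1..} \<union> {..-1})"
      using bij by (intro summable_on_Un_disjoint) auto
  qed
  then show "f summable_on UNIV \<longleftrightarrow> f summable_on {1..}" using un by simp
  show "infsum f UNIV = infsum f {1..} + infsum f {1..}"
  proof (cases "f summable_on {1..}")
    case True
    then have "infsum f ({1..} \<union> {..-1}) = infsum f {1..} + infsum f {..-1}"
      using bij by (intro infsum_Un_disjoint) auto
    then show ?thesis using un' bij' by simp
  next
    case False
    then show ?thesis using s un' by (simp add: infsum_not_exists)
  qed
qed

text \<open>Parity is dropped and the sum runs over all integers, which makes convolution estimates
  available. For odd sequences \<open>sob_sq\<close> is half the square of the norm of sine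
  series.\<close>

definition sobolev :: "real \<Rightarrow> fser \<Rightarrow> bool" where
  "sobolev r u \<longleftrightarrow> (\<lambda>j. jap j powr (2 * r) * (norm (u j))\<^sup>2) summable_on UNIV"

definition sob_sq :: "real \<Rightarrow> fser \<Rightarrow> real" where
  "sob_sq r u = (\<Sum>\<^sub>\<infinity>j. jap j powr (2 * r) * (norm (u j))\<^sup>2)"

section \<open>Sine series as odd two-sided sequences\<close>

lemma jap_minus [simp]: "jap (- j) = jap j"
  by (simp add: jap_def)

lemma odd_ser_0: "odd_ser u \<Longrightarrow> u 0 = 0"
  unfolding odd_ser_def by (metis add.inverse_neutral eq_neg_iff_add_eq_0 mult_2 mult_eq_0_iff zero_neq_numeral)

lemma norm_sine_coeff_sq: "(norm (sine_coeff u m))\<^sup>2 = 4 * (norm (u m))\<^sup>2"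
  by (simp add: sine_coeff_def norm_mult power_mult_distrib)

lemma Hs_iff: "u \<in> Hs r \<longleftrightarrow> odd_ser u \<and> sobolev r u"
proof (cases "odd_ser u")
  case True
  let ?f = "\<lambda>j. jap j powr (2 * r) * (norm (u j))\<^sup>2"
  have "?f summable_on UNIV \<longleftrightarrow> ?f summable_on {1..}"
    using True odd_ser_0[OF True] by (intro summable_on_even_int) (auto simp: odd_ser_def)
  moreover have "(\<lambda>j. 4 * ?f j) summable_on {1..} \<longleftrightarrow> ?f summable_on {1..}"
    using summable_on_cmult_right'[of 4 ?f "{1..}"] by simp
  ultimately show ?thesis
    using True by (simp add: Hs_def sobolev_def norm_sine_coeff_sq mult.left_commute)
qed (simp add: Hs_def)

lemma hnorm_eq: "odd_ser u \<Longrightarrow> hnorm r u = sqrt (2 * sob_sq r u)"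
proof -
  assume odd: "odd_ser u"
  let ?f = "\<lambda>j. jap j powr (2 * r) * (norm (u j))\<^sup>2"
  have "infsum ?f UNIV = infsum ?f {1..} + infsum ?f {1..}"
    using odd odd_ser_0[OF odd] by (intro summable_on_even_int) (auto simp: odd_ser_def)
  moreover have "(\<Sum>\<^sub>\<infinity>j\<in>{1..}. 4 * ?f j) = 4 * infsum ?f {1..}"
    by (rule infsum_cmult_right')
  ultimately show ?thesis
    by (simp add: hnorm_def sob_sq_def norm_sine_coeff_sq mult.left_commute)
qed

lemma hinner_eq: "odd_ser u \<Longrightarrow> odd_ser v \<Longrightarrow> hinner u v = 2 * (\<Sum>\<^sub>\<infinity>j. u j * cnj (v j))"
proof -
  assume odd: "odd_ser u" "odd_ser v"
  let ?f = "\<lambda>j. u j * cnj (v j)"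
  have "infsum ?f UNIV = infsum ?f {1..} + infsum ?f {1..}"
    using odd odd_ser_0[OF odd(1)] by (intro summable_on_even_int) (auto simp: odd_ser_def)
  moreover have "(\<Sum>\<^sub>\<infinity>j\<in>{1..}. 4 * ?f j) = 4 * infsum ?f {1..}"
    by (rule infsum_cmult_right')
  moreover have "sine_coeff u m * cnj (sine_coeff v m) = 4 * ?f m" for m
    by (simp add: sine_coeff_def)
  ultimately show ?thesis
    by (simp add: hinner_def)
qed

lemma sob_sq_nonneg: "0 \<le> sob_sq r u"
  unfolding sob_sq_def by (rule infsum_nonneg) auto

lemma norm_add_sq_le: "(norm (a + b))\<^sup>2 \<le> 2 * (norm a)\<^sup>2 + 2 * (norm b)\<^sup>2" for a b :: "'a::real_normed_vector"
proof -
  have "(norm (a + b))\<^sup>2 \<le> (norm a + norm b)\<^sup>2"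
    by (intro power_mono norm_triangle_ineq) auto
  also have "\<dots> \<le> 2 * (norm a)\<^sup>2 + 2 * (norm b)\<^sup>2"
    using sum_squares_bound[of "norm a" "norm b"] by (simp add: power2_sum)
  finally show ?thesis .
qed

section \<open>Elementary Sobolev estimates\<close>

lemma sobolev_add:
  assumes "sobolev r u" "sobolev r v"
  shows "sobolev r (\<lambda>k. u k + v k)" "sob_sq r (\<lambda>k. u k + v k) \<le> 2 * sob_sq r u + 2 * sob_sq r v"
proof -
  let ?f = "\<lambda>u j. jap j powr (2 * r) * (norm (u j))\<^sup>2"
  have s: "(\<lambda>j. 2 * ?f u j + 2 * ?f v j) summable_on UNIV"
    using assms unfolding sobolev_def by (intro summable_on_add summable_on_cmult_right)
  have le: "?f (\<lambda>k. u k + v k) j \<le> 2 * ?f u j + 2 * ?f v j" for j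
    using mult_left_mono[OF norm_add_sq_le[of "u j" "v j"], of "jap j powr (2 * r)"] by (simp add: algebra_simps)
  show 1: "sobolev r (\<lambda>k. u k + v k)"
    unfolding sobolev_def by (rule summable_on_comparison_test[OF s le]) auto
  have "sob_sq r (\<lambda>k. u k + v k) \<le> (\<Sum>\<^sub>\<infinity>j. 2 * ?f u j + 2 * ?f v j)"
    using 1 unfolding sob_sq_def sobolev_def by (intro infsum_mono s le)
  also have "\<dots> = (\<Sum>\<^sub>\<infinity>j. 2 * ?f u j) + (\<Sum>\<^sub>\<infinity>j. 2 * ?f v j)"
    using assms unfolding sobolev_def by (intro infsum_add summable_on_cmult_right)
  finally show "sob_sq r (\<lambda>k. u k + v k) \<le> 2 * sob_sq r u + 2 * sob_sq r v"
    unfolding sob_sq_def infsum_cmult_right' .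
qed

lemma sobolev_cmult:
  assumes "sobolev r u"
  shows "sobolev r (\<lambda>k. c * u k)" "sob_sq r (\<lambda>k. c * u k) = (norm c)\<^sup>2 * sob_sq r u"
proof -
  let ?f = "\<lambda>u j. jap j powr (2 * r) * (norm (u j))\<^sup>2"
  have e: "?f (\<lambda>k. c * u k) j = (norm c)\<^sup>2 * ?f u j" for j
    by (simp add: norm_mult power_mult_distrib mult_ac)
  show "sobolev r (\<lambda>k. c * u k)"
    using assms unfolding sobolev_def e by (intro summable_on_cmult_right)
  show "sob_sq r (\<lambda>k. c * u k) = (norm c)\<^sup>2 * sob_sq r u"
    unfolding sob_sq_def e by (rule infsum_cmult_right')
qed

lemma sobolev_multiplier:
  assumes "sobolev r u" "\<And>j. norm (m j) \<le> C * jap j"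
  shows "sobolev (r - 1) (\<lambda>k. m k * u k)"
  unfolding sobolev_def
proof (rule summable_on_comparison_test)
  show "(\<lambda>j. C\<^sup>2 * (jap j powr (2 * r) * (norm (u j))\<^sup>2)) summable_on UNIV"
    using assms(1) unfolding sobolev_def by (intro summable_on_cmult_right)
  fix j
  have "(norm (m j * u j))\<^sup>2 \<le> (C * jap j)\<^sup>2 * (norm (u j))\<^sup>2"
    unfolding norm_mult power_mult_distrib[of "norm (m j)"]
    by (intro mult_right_mono power_mono assms) auto
  then have "jap j powr (2 * (r - 1)) * (norm (m j * u j))\<^sup>2 \<le>
      jap j powr (2 * (r - 1)) * ((C * jap j)\<^sup>2 * (norm (u j))\<^sup>2)"
    by (intro mult_left_mono) auto
  also have "\<dots> = (jap j powr (2 * (r - 1)) * (jap j)\<^sup>2) * (C\<^sup>2 * (norm (u j))\<^sup>2)"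
    by (simp add: power_mult_distrib mult_ac)
  also have "jap j powr (2 * (r - 1)) * (jap j)\<^sup>2 = jap j powr (2 * (r - 1) + 2)"
    unfolding powr_add using powr_realpow[of "jap j" 2] by simp
  also have "2 * (r - 1) + 2 = 2 * r"
    by simp
  also have "jap j powr (2 * r) * (C\<^sup>2 * (norm (u j))\<^sup>2) = C\<^sup>2 * (jap j powr (2 * r) * (norm (u j))\<^sup>2)"
    by (rule mult.left_commute)
  finally show "jap j powr (2 * (r - 1)) * (norm (m j * u j))\<^sup>2 \<le> C\<^sup>2 * (jap j powr (2 * r) * (norm (u j))\<^sup>2)" .
qed auto

lemma sobolev_mono:
  assumes "sobolev r u" "s \<le> r"
  shows "sobolev s u"
  unfolding sobolev_def
proof (rule summable_on_comparison_test)
  show "(\<lambda>j. jap j powr (2 * r) * (norm (u j))\<^sup>2) summable_on UNIV"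
    using assms(1) unfolding sobolev_def .
  show "jap j powr (2 * s) * (norm (u j))\<^sup>2 \<le> jap j powr (2 * r) * (norm (u j))\<^sup>2" for j
    using assms(2) jap_ge_1 by (intro mult_right_mono powr_mono) auto
qed auto

text \<open>Cauchy--Schwarz, from the nonnegativity of the sum of \<open>a (w - t)\<^sup>2\<close> at the minimizing \<open>t\<close>.\<close>

lemma infsum_weighted_square_le:
  fixes a w :: "'i \<Rightarrow> real"
  assumes a: "a summable_on A" "\<And>i. i \<in> A \<Longrightarrow> 0 \<le> a i"
    and aw2: "(\<lambda>i. a i * (w i)\<^sup>2) summable_on A" and w: "\<And>i. i \<in> A \<Longrightarrow> 0 \<le> w i"
  shows "(\<lambda>i. a i * w i) summable_on A"
    and "(\<Sum>\<^sub>\<infinity>i\<in>A. a i * w i)\<^sup>2 \<le> infsum a A * (\<Sum>\<^sub>\<infinity>i\<in>A. a i * (w i)\<^sup>2)"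
proof -
  show aw: "(\<lambda>i. a i * w i) summable_on A"
  proof (rule summable_on_comparison_test)
    show "(\<lambda>i. a i + a i * (w i)\<^sup>2) summable_on A"
      by (intro summable_on_add a aw2)
    fix i assume i: "i \<in> A"
    have "w i \<le> 1 + (w i)\<^sup>2"
    proof -
      have "0 \<le> (w i - 1)\<^sup>2" by simp
      then show ?thesis using w[OF i] unfolding power2_diff by (simp add: power2_eq_square)
    qed
    then show "a i * w i \<le> a i + a i * (w i)\<^sup>2"
      using mult_left_mono[OF _ a(2)[OF i]] by (fastforce simp: distrib_left)
    show "0 \<le> a i * w i" using a(2) w i by auto
  qed
  define S where "S = (\<Sum>\<^sub>\<infinity>i\<in>A. a i * w i)"
  define T where "T = (\<Sum>\<^sub>\<infinity>i\<in>A. a i * (w i)\<^sup>2)"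
  define Q where "Q = infsum a A"
  have *: "0 \<le> T - 2 * t * S + t\<^sup>2 * Q" for t
  proof -
    have s1: "(\<lambda>i. 2 * t * (a i * w i)) summable_on A" and s2: "(\<lambda>i. t\<^sup>2 * a i) summable_on A"
      by (intro summable_on_cmult_right aw a)+
    have "0 \<le> (\<Sum>\<^sub>\<infinity>i\<in>A. a i * (w i - t)\<^sup>2)"
      using a(2) by (intro infsum_nonneg) auto
    also have "\<dots> = (\<Sum>\<^sub>\<infinity>i\<in>A. a i * (w i)\<^sup>2 - 2 * t * (a i * w i) + t\<^sup>2 * a i)"
      by (simp add: power2_diff algebra_simps)
    also have "\<dots> = (\<Sum>\<^sub>\<infinity>i\<in>A. a i * (w i)\<^sup>2 - 2 * t * (a i * w i)) + (\<Sum>\<^sub>\<infinity>i\<in>A. t\<^sup>2 * a i)"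
      by (intro infsum_add summable_on_minus_distrib aw2 s1 s2)
    also have "(\<Sum>\<^sub>\<infinity>i\<in>A. a i * (w i)\<^sup>2 - 2 * t * (a i * w i)) = T - (\<Sum>\<^sub>\<infinity>i\<in>A. 2 * t * (a i * w i))"
      unfolding T_def by (intro infsum_minus_distrib aw2 s1)
    finally show ?thesis by (simp add: infsum_cmult_right' S_def Q_def)
  qed
  show "(\<Sum>\<^sub>\<infinity>i\<in>A. a i * w i)\<^sup>2 \<le> infsum a A * (\<Sum>\<^sub>\<infinity>i\<in>A. a i * (w i)\<^sup>2)"
  proof (cases "Q = 0")
    case True
    then have "\<And>i. i \<in> A \<Longrightarrow> a i = 0"
      using nonneg_infsum_le_0D[of a A] a by (simp add: Q_def)
    then have "(\<Sum>\<^sub>\<infinity>i\<in>A. a i * w i) = 0" by (intro infsum_0) simp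
    then show ?thesis using True by (simp add: Q_def)
  next
    case False
    then have Q: "Q > 0" using infsum_nonneg[of A a] a(2) by (simp add: Q_def less_le)
    have "0 \<le> Q * (T - 2 * (S / Q) * S + (S / Q)\<^sup>2 * Q)"
      using *[of "S / Q"] Q by (intro mult_nonneg_nonneg) auto
    also have "\<dots> = Q * T - S\<^sup>2"
      using Q by (simp add: field_simps power2_eq_square)
    finally show ?thesis by (simp add: S_def T_def Q_def)
  qed
qed

lemma summable_on_convolution:
  fixes a c :: "int \<Rightarrow> real"
  assumes a: "a summable_on UNIV" "\<And>p. 0 \<le> a p" and c: "c summable_on UNIV" "\<And>j. 0 \<le> c j"
  shows "(\<lambda>(j, k). a (k - j) * c j) summable_on UNIV \<times> UNIV"
    and "((\<lambda>k. a (k - j) * c j) has_sum infsum a UNIV * c j) UNIV"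
proof -
  have hs: "((\<lambda>k. a (k - j) * c j) has_sum infsum a UNIV * c j) UNIV" for j
  proof -
    have "bij_betw (\<lambda>k. k - j) UNIV UNIV"
      by (rule bij_betwI[of _ _ _ "\<lambda>k. k + j"]) auto
    then have "((\<lambda>k. a (k - j)) has_sum infsum a UNIV) UNIV"
      using has_sum_infsum[OF a(1)] by (simp add: has_sum_reindex_bij_betw[of "\<lambda>k. k - j" UNIV UNIV a])
    then show ?thesis by (rule has_sum_cmult_left)
  qed
  then show "((\<lambda>k. a (k - j) * c j) has_sum infsum a UNIV * c j) UNIV" .
  show "(\<lambda>(j, k). a (k - j) * c j) summable_on UNIV \<times> UNIV"
  proof (rule summable_on_SigmaI)
    show "((\<lambda>k. case (j, k) of (j, k) \<Rightarrow> a (k - j) * c j) has_sum infsum a UNIV * c j) UNIV" for j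
      using hs by simp
    show "(\<lambda>j. infsum a UNIV * c j) summable_on UNIV"
      by (intro summable_on_cmult_right c)
  qed (use a c in auto)
qed

text \<open>Young's inequality: for fixed \<open>k\<close>, Cauchy--Schwarz with respect to the
  weight \<open>a (k - j)\<close>, followed by summation over \<open>k\<close> with the order of
  summation exchanged.\<close>

lemma young_l1_l2:
  fixes a w :: "int \<Rightarrow> real"
  assumes a: "a summable_on UNIV" "\<And>p. 0 \<le> a p" and w: "\<And>j. 0 \<le> w j" "(\<lambda>j. (w j)\<^sup>2) summable_on UNIV"
  shows "(\<lambda>j. a (k - j) * w j) summable_on UNIV"
    and "(\<lambda>k. (\<Sum>\<^sub>\<infinity>j. a (k - j) * w j)\<^sup>2) summable_on UNIV"
    and "(\<Sum>\<^sub>\<infinity>k. (\<Sum>\<^sub>\<infinity>j. a (k - j) * w j)\<^sup>2) \<le> (infsum a UNIV)\<^sup>2 * (\<Sum>\<^sub>\<infinity>j. (w j)\<^sup>2)"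
proof -
  have ra: "(\<lambda>j. a (k - j)) summable_on UNIV" "(\<Sum>\<^sub>\<infinity>j. a (k - j)) = infsum a UNIV" for k
  proof -
    have "bij_betw (\<lambda>j. k - j) UNIV UNIV"
      by (rule bij_betwI[of _ _ _ "\<lambda>j. k - j"]) auto
    then show "(\<lambda>j. a (k - j)) summable_on UNIV" "(\<Sum>\<^sub>\<infinity>j. a (k - j)) = infsum a UNIV"
      using a(1) by (simp_all add: summable_on_reindex_bij_betw[of "\<lambda>j. k - j" UNIV UNIV a]
        infsum_reindex_bij_betw[of "\<lambda>j. k - j" UNIV UNIV a])
  qed
  have w20: "0 \<le> (w j)\<^sup>2" for j by simp
  note hs = summable_on_convolution(2)[OF a w(2) w20]
  have S2: "(\<lambda>(j, k). a (k - j) * (w j)\<^sup>2) summable_on UNIV \<times> UNIV"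
    by (rule summable_on_convolution(1)[OF a w(2) w20])
  then have S2': "(\<lambda>(k, j). a (k - j) * (w j)\<^sup>2) summable_on UNIV \<times> UNIV"
    by (subst (asm) summable_on_swap) simp
  have T: "(\<lambda>j. a (k - j) * (w j)\<^sup>2) summable_on UNIV" for k
    using summable_on_SigmaD1[of "\<lambda>k j. a (k - j) * (w j)\<^sup>2" UNIV "\<lambda>_. UNIV" k] S2' by simp
  have Ts: "(\<lambda>k. \<Sum>\<^sub>\<infinity>j. a (k - j) * (w j)\<^sup>2) summable_on UNIV"
    using summable_on_Sigma_banach[of "\<lambda>k j. a (k - j) * (w j)\<^sup>2" UNIV "\<lambda>_. UNIV"] S2' by simp
  have Te: "(\<Sum>\<^sub>\<infinity>k. \<Sum>\<^sub>\<infinity>j. a (k - j) * (w j)\<^sup>2) = infsum a UNIV * (\<Sum>\<^sub>\<infinity>j. (w j)\<^sup>2)"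
  proof -
    have "(\<Sum>\<^sub>\<infinity>k. \<Sum>\<^sub>\<infinity>j. a (k - j) * (w j)\<^sup>2) = (\<Sum>\<^sub>\<infinity>j. \<Sum>\<^sub>\<infinity>k. a (k - j) * (w j)\<^sup>2)"
      by (rule infsum_swap_banach[OF S2'])
    also have "\<dots> = (\<Sum>\<^sub>\<infinity>j. infsum a UNIV * (w j)\<^sup>2)"
      using infsumI[OF hs] by simp
    finally show ?thesis by (simp add: infsum_cmult_right')
  qed
  note cs = infsum_weighted_square_le[OF ra(1) a(2) T w(1)]
  show "(\<lambda>j. a (k - j) * w j) summable_on UNIV" by (rule cs(1))
  have le: "(\<Sum>\<^sub>\<infinity>j. a (k - j) * w j)\<^sup>2 \<le> infsum a UNIV * (\<Sum>\<^sub>\<infinity>j. a (k - j) * (w j)\<^sup>2)" for k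
    using cs(2)[of k] ra(2) by simp
  show s: "(\<lambda>k. (\<Sum>\<^sub>\<infinity>j. a (k - j) * w j)\<^sup>2) summable_on UNIV"
    by (rule summable_on_comparison_test[OF summable_on_cmult_right[OF Ts] le]) auto
  have "(\<Sum>\<^sub>\<infinity>k. (\<Sum>\<^sub>\<infinity>j. a (k - j) * w j)\<^sup>2) \<le> (\<Sum>\<^sub>\<infinity>k. infsum a UNIV * (\<Sum>\<^sub>\<infinity>j. a (k - j) * (w j)\<^sup>2))"
    by (intro infsum_mono s summable_on_cmult_right Ts le)
  also have "\<dots> = (infsum a UNIV)\<^sup>2 * (\<Sum>\<^sub>\<infinity>j. (w j)\<^sup>2)"
    unfolding infsum_cmult_right' Te by (simp add: power2_eq_square)
  finally show "(\<Sum>\<^sub>\<infinity>k. (\<Sum>\<^sub>\<infinity>j. a (k - j) * w j)\<^sup>2) \<le> (infsum a UNIV)\<^sup>2 * (\<Sum>\<^sub>\<infinity>j. (w j)\<^sup>2)" .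
qed

section \<open>Operators given by infinite matrices\<close>

definition kop :: "(int \<Rightarrow> int \<Rightarrow> complex) \<Rightarrow> fser \<Rightarrow> fser" where
  "kop K u k = (\<Sum>\<^sub>\<infinity>j. K k j * u j)"

text \<open>Peetre's inequality moves the Sobolev weight from \<open>k\<close> to \<open>j\<close>
  at the price of a power of \<open>k - j\<close>, after which Young's inequality applies. The order
  \<open>r\<close> may be negative, as is needed to compare time derivatives.\<close>

lemma kop_sobolev:
  assumes K: "\<And>k j. norm (K k j) \<le> \<alpha> (k - j)"
    and \<alpha>: "(\<lambda>p. \<alpha> p * (1 + \<bar>real_of_int p\<bar>) ^ N) summable_on UNIV" and r: "\<bar>r\<bar> \<le> real N"
    and u: "sobolev r u"
  shows "(\<lambda>j. norm (K k j * u j)) summable_on UNIV"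
    and "sobolev r (kop K u)"
    and "sob_sq r (kop K u) \<le> (\<Sum>\<^sub>\<infinity>p. \<alpha> p * (1 + \<bar>real_of_int p\<bar>) ^ N)\<^sup>2 * sob_sq r u"
proof -
  define a where "a = (\<lambda>p. \<alpha> p * (1 + \<bar>real_of_int p\<bar>) ^ N)"
  define w where "w = (\<lambda>j. jap j powr r * norm (u j))"
  have \<alpha>0: "0 \<le> \<alpha> p" for p
    using order_trans[OF norm_ge_zero K[of p 0]] by simp
  have a0: "0 \<le> a p" for p by (simp add: a_def \<alpha>0)
  have sq: "(jap j powr r * x)\<^sup>2 = jap j powr (2 * r) * x\<^sup>2" for j x
    by (simp add: power_mult_distrib powr_power mult.commute)
  have w2: "(w j)\<^sup>2 = jap j powr (2 * r) * (norm (u j))\<^sup>2" for j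
    by (simp add: w_def sq)
  have ws: "(\<lambda>j. (w j)\<^sup>2) summable_on UNIV"
    using u by (simp add: w2 sobolev_def)
  note y = young_l1_l2[OF \<alpha>[folded a_def] a0 _ ws]
  have w0: "0 \<le> w j" for j by (simp add: w_def)
  have b: "jap k powr r * norm (K k j * u j) \<le> a (k - j) * w j" for k j
  proof -
    have "jap k powr r * norm (K k j * u j) \<le>
        ((1 + \<bar>real_of_int (k - j)\<bar>) ^ N * jap j powr r) * (\<alpha> (k - j) * norm (u j))"
      unfolding norm_mult using jap_powr_add_le_power[OF r, of j "k - j"]
      by (intro mult_mono mult_right_mono K) (auto simp: \<alpha>0)
    then show ?thesis by (simp add: a_def w_def mult_ac)
  qed
  have s1: "(\<lambda>j. jap k powr r * norm (K k j * u j)) summable_on UNIV" for k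
    by (rule summable_on_comparison_test[OF y(1)[OF w0] b]) auto
  then show abs: "(\<lambda>j. norm (K k j * u j)) summable_on UNIV" for k
    using summable_on_cmult_right'[of "jap k powr r" "\<lambda>j. norm (K k j * u j)" UNIV] by simp
  have le: "jap k powr (2 * r) * (norm (kop K u k))\<^sup>2 \<le> (\<Sum>\<^sub>\<infinity>j. a (k - j) * w j)\<^sup>2" for k
  proof -
    have "jap k powr r * norm (kop K u k) \<le> jap k powr r * (\<Sum>\<^sub>\<infinity>j. norm (K k j * u j))"
      unfolding kop_def by (intro mult_left_mono norm_infsum_bound abs) auto
    also have "\<dots> = (\<Sum>\<^sub>\<infinity>j. jap k powr r * norm (K k j * u j))"
      by (rule infsum_cmult_right'[symmetric])
    also have "\<dots> \<le> (\<Sum>\<^sub>\<infinity>j. a (k - j) * w j)"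
      by (intro infsum_mono s1 y(1) w0 b)
    finally have "(jap k powr r * norm (kop K u k))\<^sup>2 \<le> (\<Sum>\<^sub>\<infinity>j. a (k - j) * w j)\<^sup>2"
      by (intro power_mono) auto
    then show ?thesis by (simp only: sq)
  qed
  show s: "sobolev r (kop K u)"
    unfolding sobolev_def by (rule summable_on_comparison_test[OF y(2)[OF w0] le]) auto
  have "sob_sq r (kop K u) \<le> (\<Sum>\<^sub>\<infinity>k. (\<Sum>\<^sub>\<infinity>j. a (k - j) * w j)\<^sup>2)"
    using s unfolding sob_sq_def sobolev_def by (intro infsum_mono y(2) w0 le)
  also have "\<dots> \<le> (infsum a UNIV)\<^sup>2 * (\<Sum>\<^sub>\<infinity>j. (w j)\<^sup>2)"
    by (rule y(3)[OF w0])
  finally show "sob_sq r (kop K u) \<le> (\<Sum>\<^sub>\<infinity>p. \<alpha> p * (1 + \<bar>real_of_int p\<bar>) ^ N)\<^sup>2 * sob_sq r u"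
    by (simp add: a_def w2 sob_sq_def)
qed

lemma kop_odd:
  assumes "\<And>k j. K (- k) (- j) = K k j" "odd_ser u"
  shows "odd_ser (kop K u)"
  unfolding odd_ser_def
proof
  fix k
  have "kop K u (- k) = (\<Sum>\<^sub>\<infinity>j. K k j * u (- j))"
    unfolding kop_def by (rule kernel_op_minus) (rule assms(1))
  then show "kop K u (- k) = - kop K u k"
    using assms(2) by (simp add: odd_ser_def kop_def infsum_uminus)
qed

text \<open>The double series is dominated by \<open>\<alpha> (k - j)\<close> times the sum of the
  squared moduli, which is summable in both variables; hence the order of summation may be
  exchanged. Reflection invariance keeps the images odd.\<close>

lemma kop_hermitian:
  assumes K: "\<And>k j. norm (K k j) \<le> \<alpha> (k - j)" and \<alpha>: "\<alpha> summable_on UNIV"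
    and sym: "\<And>k j. K (- k) (- j) = K k j" "\<And>k j. K' k j = cnj (K j k)"
  shows "is_adjoint (kop K) (kop K')"
proof -
  have sym': "K' (- k) (- j) = K' k j" for k j
    by (simp add: sym)
  have K': "norm (K' k j) \<le> \<alpha> (- (k - j))" for k j
    using K[of j k] by (simp add: sym)
  have \<alpha>': "(\<lambda>p. \<alpha> (- p)) summable_on UNIV"
  proof -
    have "bij_betw (uminus :: int \<Rightarrow> int) UNIV UNIV"
      by (rule bij_betwI[of _ _ _ uminus]) auto
    from summable_on_reindex_bij_betw[OF this, of \<alpha>] show ?thesis using \<alpha> by simp
  qed
  have \<alpha>0: "0 \<le> \<alpha> p" for p
    using order_trans[OF norm_ge_zero K[of p 0]] by simp
  have Hs: "kop K u \<in> Hs 0" "kop K' u \<in> Hs 0" if "u \<in> Hs 0" for u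
  proof -
    have "odd_ser u" "sobolev 0 u" using that by (auto simp: Hs_iff)
    moreover have "sobolev 0 (kop K u)"
      by (rule kop_sobolev(2)[where N = 0 and \<alpha> = \<alpha>]) (use K \<alpha> \<open>sobolev 0 u\<close> in simp_all)
    moreover have "sobolev 0 (kop K' u)"
      by (rule kop_sobolev(2)[where N = 0 and \<alpha> = "\<lambda>p. \<alpha> (- p)"]) (use K' \<alpha>' \<open>sobolev 0 u\<close> in simp_all)
    moreover have "odd_ser (kop K u)"
      by (rule kop_odd) (rule sym(1), fact)
    moreover have "odd_ser (kop K' u)"
      by (rule kop_odd) (rule sym', fact)
    ultimately show "kop K u \<in> Hs 0" "kop K' u \<in> Hs 0" by (simp_all add: Hs_iff)
  qed
  have "hinner (kop K u) v = hinner u (kop K' v)" if u: "u \<in> Hs 0" and v: "v \<in> Hs 0" for u v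
  proof -
    have ul: "(\<lambda>j. (norm (u j))\<^sup>2) summable_on UNIV" and vl: "(\<lambda>j. (norm (v j))\<^sup>2) summable_on UNIV"
      using u v by (auto simp: Hs_iff sobolev_def)
    have "(\<lambda>(k, j). norm (K k j * u j * cnj (v k))) summable_on UNIV \<times> UNIV"
    proof (rule summable_on_comparison_test)
      have "(\<lambda>(k, j). \<alpha> (- (j - k)) * (norm (v k))\<^sup>2) summable_on UNIV \<times> UNIV"
        by (rule summable_on_convolution(1)[OF \<alpha>' \<alpha>0 vl]) simp
      then have 1: "(\<lambda>(k, j). \<alpha> (k - j) * (norm (v k))\<^sup>2) summable_on UNIV \<times> UNIV"
        by simp
      have "(\<lambda>(j, k). \<alpha> (k - j) * (norm (u j))\<^sup>2) summable_on UNIV \<times> UNIV"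
        by (rule summable_on_convolution(1)[OF \<alpha> \<alpha>0 ul]) simp
      then have 2: "(\<lambda>(k, j). \<alpha> (k - j) * (norm (u j))\<^sup>2) summable_on UNIV \<times> UNIV"
        by (subst (asm) summable_on_swap) simp
      show "(\<lambda>x. (case x of (k, j) \<Rightarrow> \<alpha> (k - j) * (norm (v k))\<^sup>2) + (case x of (k, j) \<Rightarrow> \<alpha> (k - j) * (norm (u j))\<^sup>2)) summable_on UNIV \<times> UNIV"
        by (intro summable_on_add 1 2)
      fix x :: "int \<times> int"
      obtain k j where x: "x = (k, j)" by fastforce
      have "norm (u j) * norm (v k) \<le> (norm (u j))\<^sup>2 + (norm (v k))\<^sup>2"
        using sum_squares_bound[of "norm (u j)" "norm (v k)"] mult_nonneg_nonneg[OF norm_ge_zero[of "u j"] norm_ge_zero[of "v k"]]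
        by linarith
      then have "norm (K k j) * (norm (u j) * norm (v k)) \<le> \<alpha> (k - j) * ((norm (u j))\<^sup>2 + (norm (v k))\<^sup>2)"
        by (intro mult_mono K) (auto simp: \<alpha>0)
      then show "(case x of (k, j) \<Rightarrow> norm (K k j * u j * cnj (v k))) \<le>
        (case x of (k, j) \<Rightarrow> \<alpha> (k - j) * (norm (v k))\<^sup>2) + (case x of (k, j) \<Rightarrow> \<alpha> (k - j) * (norm (u j))\<^sup>2)"
        by (simp add: x norm_mult algebra_simps)
    qed auto
    then have "(\<lambda>x. norm (case x of (k, j) \<Rightarrow> K k j * u j * cnj (v k))) summable_on UNIV \<times> UNIV"
      by (simp add: case_prod_unfold)
    then have sw: "(\<Sum>\<^sub>\<infinity>k. \<Sum>\<^sub>\<infinity>j. K k j * u j * cnj (v k)) = (\<Sum>\<^sub>\<infinity>j. \<Sum>\<^sub>\<infinity>k. K k j * u j * cnj (v k))"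
      by (rule infsum_swap_banach[OF abs_summable_summable])
    have e1: "kop K u k * cnj (v k) = (\<Sum>\<^sub>\<infinity>j. K k j * u j * cnj (v k))" for k
      unfolding kop_def by (rule infsum_cmult_left'[symmetric])
    have e2: "(\<Sum>\<^sub>\<infinity>k. K k j * u j * cnj (v k)) = u j * cnj (kop K' v j)" for j
    proof -
      have "u j * cnj (kop K' v j) = u j * (\<Sum>\<^sub>\<infinity>k. cnj (K' j k * v k))"
        by (simp only: kop_def infsum_cnj)
      also have "\<dots> = (\<Sum>\<^sub>\<infinity>k. u j * cnj (K' j k * v k))"
        by (rule infsum_cmult_right'[symmetric])
      also have "\<dots> = (\<Sum>\<^sub>\<infinity>k. K k j * u j * cnj (v k))"
        by (intro infsum_cong) (simp only: sym(2) complex_cnj_mult complex_cnj_cnj mult_ac)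
      finally show ?thesis ..
    qed
    have "(\<Sum>\<^sub>\<infinity>k. kop K u k * cnj (v k)) = (\<Sum>\<^sub>\<infinity>j. u j * cnj (kop K' v j))"
      unfolding e1 sw by (simp only: e2)
    moreover have "odd_ser u" "odd_ser v" "odd_ser (kop K u)" "odd_ser (kop K' v)"
      using u v Hs(1)[OF u] Hs(2)[OF v] by (auto simp: Hs_iff)
    ultimately show ?thesis
      by (simp only: hinner_eq)
  qed
  then show ?thesis
    using Hs by (simp add: is_adjoint_def)
qed

section \<open>Conjugation with a nilpotent generator\<close>

lemma Hs_add: "u \<in> Hs r \<Longrightarrow> v \<in> Hs r \<Longrightarrow> (\<lambda>k. u k + v k) \<in> Hs r"
  by (auto simp: Hs_iff odd_ser_def intro: sobolev_add)

lemma Hs_cmult: "u \<in> Hs r \<Longrightarrow> (\<lambda>k. c * u k) \<in> Hs r"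
  by (auto simp: Hs_iff odd_ser_def intro: sobolev_cmult)

lemma Hs_uminus: "u \<in> Hs r \<Longrightarrow> (\<lambda>k. - u k) \<in> Hs r"
  using Hs_cmult[of u r "-1"] by simp

lemma Hs_minus: "u \<in> Hs r \<Longrightarrow> v \<in> Hs r \<Longrightarrow> (\<lambda>k. u k - v k) \<in> Hs r"
  using Hs_add[of u r "\<lambda>k. - v k"] Hs_uminus[of v r] by simp

lemma Hs_mono: "u \<in> Hs r \<Longrightarrow> s \<le> r \<Longrightarrow> u \<in> Hs s"
  by (auto simp: Hs_iff intro: sobolev_mono)

lemma Hs2_iff: "z \<in> Hs2 r \<longleftrightarrow> fst z \<in> Hs r \<and> snd z \<in> Hs r"
  by (cases z) (simp add: Hs2_def)

lemma Hs_sobolev: "u \<in> Hs r \<Longrightarrow> sobolev r u"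
  by (simp add: Hs_iff)

lemma hnorm2_eq: "z \<in> Hs2 r \<Longrightarrow> hnorm2 r z = sqrt (2 * sob_sq r (fst z) + 2 * sob_sq r (snd z))"
  by (simp add: hnorm2_def Hs2_iff Hs_iff hnorm_eq sob_sq_nonneg)

lemma hnorm2_tendsto_0_iff:
  assumes "\<And>h. F h \<in> Hs2 r"
  shows "((\<lambda>h. hnorm2 r (F h)) \<longlongrightarrow> 0) A \<longleftrightarrow>
    ((\<lambda>h. sob_sq r (fst (F h))) \<longlongrightarrow> 0) A \<and> ((\<lambda>h. sob_sq r (snd (F h))) \<longlongrightarrow> 0) A"
proof
  assume "((\<lambda>h. hnorm2 r (F h)) \<longlongrightarrow> 0) A"
  then have lim: "((\<lambda>h. (hnorm2 r (F h))\<^sup>2) \<longlongrightarrow> 0) A"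
    using tendsto_power[of "\<lambda>h. hnorm2 r (F h)" 0 A 2] by simp
  have sq: "(hnorm2 r (F h))\<^sup>2 = 2 * sob_sq r (fst (F h)) + 2 * sob_sq r (snd (F h))" for h
    using assms[of h] by (simp add: hnorm2_eq sob_sq_nonneg)
  have "sob_sq r (fst (F h)) \<le> (hnorm2 r (F h))\<^sup>2" "sob_sq r (snd (F h)) \<le> (hnorm2 r (F h))\<^sup>2" for h
    unfolding sq using sob_sq_nonneg[of r "fst (F h)"] sob_sq_nonneg[of r "snd (F h)"] by linarith+
  then show "((\<lambda>h. sob_sq r (fst (F h))) \<longlongrightarrow> 0) A \<and> ((\<lambda>h. sob_sq r (snd (F h))) \<longlongrightarrow> 0) A"
    by (auto intro!: tendsto_sandwich[OF _ _ tendsto_const lim] simp: sob_sq_nonneg)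
next
  assume "((\<lambda>h. sob_sq r (fst (F h))) \<longlongrightarrow> 0) A \<and> ((\<lambda>h. sob_sq r (snd (F h))) \<longlongrightarrow> 0) A"
  then have "((\<lambda>h. sqrt (2 * sob_sq r (fst (F h)) + 2 * sob_sq r (snd (F h)))) \<longlongrightarrow> sqrt (2 * 0 + 2 * 0)) A"
    by (intro tendsto_intros) auto
  then show "((\<lambda>h. hnorm2 r (F h)) \<longlongrightarrow> 0) A"
    using assms by (simp add: hnorm2_eq)
qed

text \<open>Here \<open>W\<close> is the time derivative of \<open>X\<close>: \<open>X_deriv\<close>
  bounds the squared norm of a first-order Taylor remainder, hence the power 4 of \<open>h\<close>.
  Additivity of \<open>X\<close> is confined to the scale \<open>Hs r\<close>, where the underlying
  series converge, whereas homogeneity holds for arbitrary sequences.\<close>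

locale shear_conjugation =
  fixes B :: "fser \<Rightarrow> fser" and X W :: "real \<Rightarrow> fser \<Rightarrow> fser"
  assumes B_Hs: "u \<in> Hs r \<Longrightarrow> B u \<in> Hs (r - 1)"
    and B_add: "B (\<lambda>k. u k + v k) = (\<lambda>k. B u k + B v k)"
    and B_cmult: "B (\<lambda>k. c * u k) = (\<lambda>k. c * B u k)"
    and X_Hs: "u \<in> Hs r \<Longrightarrow> X t u \<in> Hs r"
    and X_add: "u \<in> Hs r \<Longrightarrow> v \<in> Hs r \<Longrightarrow> X t (\<lambda>k. u k + v k) = (\<lambda>k. X t u k + X t v k)"
    and X_cmult: "X t (\<lambda>k. c * u k) = (\<lambda>k. c * X t u k)"
    and W_Hs: "u \<in> Hs r \<Longrightarrow> W t u \<in> Hs r"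
    and X_bound: "\<exists>C\<ge>0. \<forall>h u. \<bar>h\<bar> \<le> 1 \<longrightarrow> u \<in> Hs r \<longrightarrow> sob_sq r (X (t + h) u) \<le> C * sob_sq r u"
    and W_bound: "\<exists>C\<ge>0. \<forall>u. u \<in> Hs r \<longrightarrow> sob_sq r (W t u) \<le> C * sob_sq r u"
    and X_deriv: "\<exists>C\<ge>0. \<forall>h u. \<bar>h\<bar> \<le> 1 \<longrightarrow> u \<in> Hs r \<longrightarrow>
      sob_sq r (\<lambda>k. X (t + h) u k - X t u k - of_real h * W t u k) \<le> C * h ^ 4 * sob_sq r u"
begin

text \<open>For \<open>c = \<i>\<close> this is the closed form of the exponential. The sum of the
  two components is invariant, so that the inverse is obtained by changing the sign of
  \<open>c\<close>.\<close>

definition shear :: "complex \<Rightarrow> real \<Rightarrow> fser2 \<Rightarrow> fser2" where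
  "shear c t z = ((\<lambda>k. fst z k - c * X t (\<lambda>k. fst z k + snd z k) k),
                  (\<lambda>k. snd z k + c * X t (\<lambda>k. fst z k + snd z k) k))"

lemma shear_Hs2: "z \<in> Hs2 r \<Longrightarrow> shear c t z \<in> Hs2 r"
  unfolding shear_def Hs2_iff by (auto intro!: Hs_minus Hs_add Hs_cmult X_Hs)

lemma shear_sum: "fst (shear c t z) k + snd (shear c t z) k = fst z k + snd z k"
  by (simp add: shear_def)

lemma shear_inverse: "shear (- c) t (shear c t z) = z"
proof -
  have "shear (- c) t (shear c t z) = ((\<lambda>k. fst (shear c t z) k + c * X t (\<lambda>k. fst z k + snd z k) k),
                  (\<lambda>k. snd (shear c t z) k - c * X t (\<lambda>k. fst z k + snd z k) k))"
    unfolding shear_def[of "- c"] shear_sum by simp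
  then show ?thesis by (simp add: shear_def)
qed

lemma shear_bij: "bij_betw (shear c t) (Hs2 r) (Hs2 r)"
  using shear_inverse[of c] shear_inverse[of "- c"]
  by (intro bij_betwI[of _ _ _ "shear (- c) t"]) (auto intro: shear_Hs2)

lemma X_minus: "u \<in> Hs r \<Longrightarrow> v \<in> Hs r \<Longrightarrow> X t (\<lambda>k. u k - v k) = (\<lambda>k. X t u k - X t v k)"
  using X_add[of u r "\<lambda>k. (-1) * v k" t] X_cmult[of t "-1" v] Hs_cmult[of v r "-1"] by simp

text \<open>The product rule for the curve \<open>X t (S t)\<close>. The curve \<open>S\<close>
  lives in order \<open>s + 1\<close> but is differentiable only in order \<open>s\<close>, because
  \<open>B\<close> loses one derivative.\<close>

lemma X_difference_quotient:
  assumes S: "\<And>h. S h \<in> Hs (s + 1)" and E: "E \<in> Hs s"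
    and lim: "((\<lambda>h. sob_sq s (\<lambda>k. of_real (1 / h) * (S (t + h) k - S t k) - E k)) \<longlongrightarrow> 0) (at 0)"
  shows "((\<lambda>h. sob_sq s (\<lambda>k. of_real (1 / h) * (X (t + h) (S (t + h)) k - X t (S t) k) -
      (X t E k + W t (S t) k))) \<longlongrightarrow> 0) (at 0)"
proof -
  have S': "S h \<in> Hs s" for h by (rule Hs_mono[OF S]) simp
  obtain C1 where C1: "C1 \<ge> 0" "\<And>h u. \<bar>h\<bar> \<le> 1 \<Longrightarrow> u \<in> Hs s \<Longrightarrow> sob_sq s (X (t + h) u) \<le> C1 * sob_sq s u"
    using X_bound by blast
  obtain C2 where C2: "C2 \<ge> 0" "\<And>u. u \<in> Hs s \<Longrightarrow> sob_sq s (W t u) \<le> C2 * sob_sq s u"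
    using W_bound by blast
  obtain C3 where C3: "C3 \<ge> 0" "\<And>h u. \<bar>h\<bar> \<le> 1 \<Longrightarrow> u \<in> Hs s \<Longrightarrow>
      sob_sq s (\<lambda>k. X (t + h) u k - X t u k - of_real h * W t u k) \<le> C3 * h ^ 4 * sob_sq s u"
    using X_deriv by blast
  define \<delta> where "\<delta> = (\<lambda>h k. of_real (1 / h) * (S (t + h) k - S t k) - E k)"
  have \<delta>: "\<delta> h \<in> Hs s" for h
    unfolding \<delta>_def by (rule Hs_minus[OF Hs_cmult[OF Hs_minus[OF S' S']] E])
  define R where "R = (\<lambda>h u k. X (t + h) u k - X t u k - of_real h * W t u k)"
  have R: "R h u \<in> Hs s" if "u \<in> Hs s" for h u
    unfolding R_def by (rule Hs_minus[OF Hs_minus[OF X_Hs[OF that] X_Hs[OF that]] Hs_cmult[OF W_Hs[OF that]]])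
  define D where "D = (\<lambda>h k. of_real (1 / h) * (X (t + h) (S (t + h)) k - X t (S t) k) - (X t E k + W t (S t) k))"
  let ?b = "\<lambda>h. 2 * (C1 * sob_sq s (\<delta> h)) + 2 * (2 * (2 * (C3 * h ^ 4 * sob_sq s E) + 2 * (h\<^sup>2 * (C2 * sob_sq s E))) +
      2 * (C3 * h\<^sup>2 * sob_sq s (S t)))"
  have gen: "x \<le> 2 * y + 2 * z \<Longrightarrow> z \<le> 2 * p + 2 * q \<Longrightarrow> p \<le> 2 * f + 2 * g \<Longrightarrow> f \<le> f' \<Longrightarrow> g \<le> g' \<Longrightarrow>
      q \<le> q' \<Longrightarrow> y \<le> y' \<Longrightarrow> x \<le> 2 * y' + 2 * (2 * (2 * f' + 2 * g') + 2 * q')" for x y z p q f g f' g' q' y' :: real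
    by simp
  have bound: "sob_sq s (D h) \<le> ?b h" if h: "h \<noteq> 0" "\<bar>h\<bar> \<le> 1" for h
  proof -
    have X\<delta>: "X (t + h) (\<delta> h) = (\<lambda>k. of_real (1 / h) * (X (t + h) (S (t + h)) k - X (t + h) (S t) k) - X (t + h) E k)"
      unfolding \<delta>_def X_minus[OF Hs_cmult[OF Hs_minus[OF S' S']] E] X_cmult X_minus[OF S' S'] ..
    \<comment> \<open>The error splits into \<open>X (t + h)\<close> applied to the error of the
      quotient of \<open>S\<close>, the variation of \<open>X\<close> on \<open>E\<close>, and the
      Taylor remainder of \<open>X\<close> on \<open>S t\<close> divided by \<open>h\<close>. The
      last has squared norm of order \<open>h\<^sup>2\<close>.\<close>
    have Deq: "D h = (\<lambda>k. X (t + h) (\<delta> h) k + ((R h E k + of_real h * W t E k) + of_real (1 / h) * R h (S t) k))"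
      unfolding D_def X\<delta> R_def using h(1) by (auto simp: fun_eq_iff field_simps)
    have RE: "sobolev s (R h E)" and RS: "sobolev s (R h (S t))" and WE: "sobolev s (W t E)" and X\<delta>s: "sobolev s (X (t + h) (\<delta> h))"
      by (simp_all add: Hs_sobolev R E S' W_Hs X_Hs \<delta>)
    note WE' = sobolev_cmult[OF WE, of "of_real h"] and RS' = sobolev_cmult[OF RS, of "of_real (1 / h)"]
    have "sob_sq s (D h) \<le> 2 * sob_sq s (X (t + h) (\<delta> h)) +
        2 * sob_sq s (\<lambda>k. (R h E k + of_real h * W t E k) + of_real (1 / h) * R h (S t) k)"
      unfolding Deq by (rule sobolev_add(2)[OF X\<delta>s sobolev_add(1)[OF sobolev_add(1)[OF RE WE'(1)] RS'(1)]])
    moreover have "sob_sq s (\<lambda>k. (R h E k + of_real h * W t E k) + of_real (1 / h) * R h (S t) k) \<le>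
        2 * sob_sq s (\<lambda>k. R h E k + of_real h * W t E k) + 2 * sob_sq s (\<lambda>k. of_real (1 / h) * R h (S t) k)"
      by (rule sobolev_add(2)[OF sobolev_add(1)[OF RE WE'(1)] RS'(1)])
    moreover have "sob_sq s (\<lambda>k. R h E k + of_real h * W t E k) \<le> 2 * sob_sq s (R h E) + 2 * sob_sq s (\<lambda>k. of_real h * W t E k)"
      by (rule sobolev_add(2)[OF RE WE'(1)])
    moreover have "sob_sq s (R h E) \<le> C3 * h ^ 4 * sob_sq s E"
      unfolding R_def by (rule C3(2)[OF h(2) E])
    moreover have "sob_sq s (\<lambda>k. of_real h * W t E k) \<le> h\<^sup>2 * (C2 * sob_sq s E)"
      unfolding WE'(2) by (simp add: mult_left_mono C2(2)[OF E])
    moreover have "sob_sq s (\<lambda>k. of_real (1 / h) * R h (S t) k) \<le> C3 * h\<^sup>2 * sob_sq s (S t)"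
    proof -
      have "sob_sq s (\<lambda>k. of_real (1 / h) * R h (S t) k) = (1 / h)\<^sup>2 * sob_sq s (R h (S t))"
        unfolding RS'(2) norm_of_real by (simp add: power_divide)
      also have "\<dots> \<le> (1 / h)\<^sup>2 * (C3 * h ^ 4 * sob_sq s (S t))"
        unfolding R_def by (rule mult_left_mono[OF C3(2)[OF h(2) S']]) simp
      also have "\<dots> = C3 * h\<^sup>2 * sob_sq s (S t)"
        using h(1) by (simp add: power_divide power4_eq_xxxx power2_eq_square)
      finally show ?thesis .
    qed
    moreover have "sob_sq s (X (t + h) (\<delta> h)) \<le> C1 * sob_sq s (\<delta> h)"
      by (rule C1(2)[OF h(2) \<delta>])
    ultimately show ?thesis by (rule gen)
  qed
  have l\<delta>: "((\<lambda>h. sob_sq s (\<delta> h)) \<longlongrightarrow> 0) (at 0)"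
    using lim by (simp add: \<delta>_def)
  have "(?b \<longlongrightarrow> 2 * (C1 * 0) + 2 * (2 * (2 * (C3 * 0 ^ 4 * sob_sq s E) + 2 * (0\<^sup>2 * (C2 * sob_sq s E))) +
      2 * (C3 * 0\<^sup>2 * sob_sq s (S t)))) (at 0)"
    by (intro tendsto_intros l\<delta>)
  then have lim0: "(?b \<longlongrightarrow> 0) (at 0)" by simp
  have "((\<lambda>h. sob_sq s (D h)) \<longlongrightarrow> 0) (at 0)"
  proof (rule tendsto_sandwich[OF _ _ tendsto_const lim0])
    show "\<forall>\<^sub>F h in at 0. 0 \<le> sob_sq s (D h)" by (simp add: sob_sq_nonneg)
    show "\<forall>\<^sub>F h in at 0. sob_sq s (D h) \<le> ?b h"
      unfolding eventually_at
    proof (intro exI[of _ 1] conjI ballI impI)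
      fix h :: real assume "h \<noteq> 0 \<and> dist h 0 < 1"
      then show "sob_sq s (D h) \<le> ?b h" by (intro bound) auto
    qed simp
  qed
  then show ?thesis by (simp only: D_def)
qed

definition quot :: "(real \<Rightarrow> fser2) \<Rightarrow> fser2 \<Rightarrow> real \<Rightarrow> real \<Rightarrow> fser2" where
  "quot \<psi> e t h = cscale (complex_of_real (1 / h)) (\<psi> (t + h) - \<psi> t) - e"

lemma quot_fst: "fst (quot \<psi> e t h) = (\<lambda>k. of_real (1 / h) * (fst (\<psi> (t + h)) k - fst (\<psi> t) k) - fst e k)"
  and quot_snd: "snd (quot \<psi> e t h) = (\<lambda>k. of_real (1 / h) * (snd (\<psi> (t + h)) k - snd (\<psi> t) k) - snd e k)"
  by (simp_all add: quot_def cscale_def fun_eq_iff)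

lemma quot_Hs2:
  assumes "\<And>t. \<psi> t \<in> Hs2 r" "e \<in> Hs2 (r - 1)"
  shows "quot \<psi> e t h \<in> Hs2 (r - 1)"
proof -
  have "fst (\<psi> t) \<in> Hs (r - 1)" "snd (\<psi> t) \<in> Hs (r - 1)" for t
    using assms(1)[of t] Hs_mono[of _ r "r - 1"] by (auto simp: Hs2_iff)
  then show ?thesis
    using assms(2) unfolding Hs2_iff quot_fst quot_snd by (intro conjI Hs_minus Hs_cmult) auto
qed

text \<open>The velocity of the sheared curve when the given curve passes through \<open>z\<close>
  with velocity \<open>e\<close>; the summand with \<open>W\<close> comes from the motion of
  \<open>X\<close>.\<close>

definition shear_velocity :: "complex \<Rightarrow> real \<Rightarrow> fser2 \<Rightarrow> fser2 \<Rightarrow> fser2" where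
  "shear_velocity c t z e =
    ((\<lambda>k. fst e k - c * (X t (\<lambda>k. fst e k + snd e k) k + W t (\<lambda>k. fst z k + snd z k) k)),
     (\<lambda>k. snd e k + c * (X t (\<lambda>k. fst e k + snd e k) k + W t (\<lambda>k. fst z k + snd z k) k)))"

lemma shear_velocity_Hs2: "z \<in> Hs2 r \<Longrightarrow> e \<in> Hs2 (r - 1) \<Longrightarrow> shear_velocity c t z e \<in> Hs2 (r - 1)"
  using Hs_mono[of _ r "r - 1"] unfolding shear_velocity_def Hs2_iff
  by (auto intro!: Hs_minus Hs_add Hs_cmult X_Hs W_Hs)

lemma shear_tendsto:
  assumes \<psi>: "\<And>t. \<psi> t \<in> Hs2 r" and e: "e \<in> Hs2 (r - 1)"
    and lim: "((\<lambda>h. hnorm2 (r - 1) (quot \<psi> e t h)) \<longlongrightarrow> 0) (at 0)"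
  shows "((\<lambda>h. hnorm2 (r - 1) (quot (\<lambda>s. shear c s (\<psi> s)) (shear_velocity c t (\<psi> t) e) t h)) \<longlongrightarrow> 0) (at 0)"
proof -
  let ?s = "r - 1"
  define S where "S = (\<lambda>s k. fst (\<psi> s) k + snd (\<psi> s) k)"
  define E where "E = (\<lambda>k. fst e k + snd e k)"
  define \<phi> where "\<phi> = (\<lambda>s. shear c s (\<psi> s))"
  define d where "d = shear_velocity c t (\<psi> t) e"
  have q: "quot \<psi> e t h \<in> Hs2 ?s" for h by (rule quot_Hs2[OF \<psi> e])
  have \<phi>: "\<phi> t \<in> Hs2 r" for t unfolding \<phi>_def by (rule shear_Hs2[OF \<psi>])
  have d: "d \<in> Hs2 ?s" unfolding d_def by (rule shear_velocity_Hs2[OF \<psi> e])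
  have l: "((\<lambda>h. sob_sq ?s (fst (quot \<psi> e t h))) \<longlongrightarrow> 0) (at 0)"
    "((\<lambda>h. sob_sq ?s (snd (quot \<psi> e t h))) \<longlongrightarrow> 0) (at 0)"
    using lim unfolding hnorm2_tendsto_0_iff[OF q] by blast+
  have qs: "sobolev ?s (fst (quot \<psi> e t h))" "sobolev ?s (snd (quot \<psi> e t h))" for h
    using q[of h] by (auto simp: Hs2_iff Hs_sobolev)
  have S: "S s \<in> Hs (?s + 1)" for s
    using \<psi>[of s] by (auto simp: S_def Hs2_iff intro: Hs_add)
  have E: "E \<in> Hs ?s"
    using e by (auto simp: E_def Hs2_iff intro: Hs_add)
  have "((\<lambda>h. sob_sq ?s (\<lambda>k. of_real (1 / h) * (S (t + h) k - S t k) - E k)) \<longlongrightarrow> 0) (at 0)"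
  proof (rule tendsto_sandwich[OF _ _ tendsto_const])
    show "\<forall>\<^sub>F h in at 0. sob_sq ?s (\<lambda>k. of_real (1 / h) * (S (t + h) k - S t k) - E k) \<le>
        2 * sob_sq ?s (fst (quot \<psi> e t h)) + 2 * sob_sq ?s (snd (quot \<psi> e t h))"
    proof (rule always_eventually, rule allI)
      fix h
      have "(\<lambda>k. of_real (1 / h) * (S (t + h) k - S t k) - E k) =
          (\<lambda>k. fst (quot \<psi> e t h) k + snd (quot \<psi> e t h) k)"
        unfolding quot_fst quot_snd S_def E_def by (simp add: fun_eq_iff ring_distribs)
      then show "sob_sq ?s (\<lambda>k. of_real (1 / h) * (S (t + h) k - S t k) - E k) \<le>
        2 * sob_sq ?s (fst (quot \<psi> e t h)) + 2 * sob_sq ?s (snd (quot \<psi> e t h))"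
        using sobolev_add(2)[OF qs] by simp
    qed
    show "((\<lambda>h. 2 * sob_sq ?s (fst (quot \<psi> e t h)) + 2 * sob_sq ?s (snd (quot \<psi> e t h))) \<longlongrightarrow> 0) (at 0)"
      using tendsto_add[OF tendsto_mult_left[OF l(1), of 2] tendsto_mult_left[OF l(2), of 2]] by simp
  qed (simp add: sob_sq_nonneg)
  note lX = X_difference_quotient[OF S E this]
  define G where "G = (\<lambda>h k. of_real (1 / h) * (X (t + h) (S (t + h)) k - X t (S t) k) - (X t E k + W t (S t) k))"
  have lG: "((\<lambda>h. sob_sq ?s (G h)) \<longlongrightarrow> 0) (at 0)"
    using lX by (simp only: G_def)
  have Gs: "sobolev ?s (G h)" for h
    unfolding G_def
    by (rule Hs_sobolev, rule Hs_minus[OF Hs_cmult[OF Hs_minus[OF X_Hs X_Hs]] Hs_add[OF X_Hs[OF E] W_Hs]])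
      (rule Hs_mono[OF S], simp)+
  have f1: "fst (quot \<phi> d t h) = (\<lambda>k. fst (quot \<psi> e t h) k + (- c) * G h k)"
    and f2: "snd (quot \<phi> d t h) = (\<lambda>k. snd (quot \<psi> e t h) k + c * G h k)" for h
    unfolding quot_fst quot_snd by (simp_all add: \<phi>_def d_def shear_def shear_velocity_def G_def S_def E_def fun_eq_iff algebra_simps)
  have comb: "((\<lambda>h. sob_sq ?s (\<lambda>k. u h k + a * G h k)) \<longlongrightarrow> 0) (at 0)"
    if u: "((\<lambda>h. sob_sq ?s (u h)) \<longlongrightarrow> 0) (at 0)" "\<And>h. sobolev ?s (u h)" for u :: "real \<Rightarrow> fser" and a
  proof (rule tendsto_sandwich[OF _ _ tendsto_const])
    show "\<forall>\<^sub>F h in at 0. sob_sq ?s (\<lambda>k. u h k + a * G h k) \<le> 2 * sob_sq ?s (u h) + 2 * ((norm a)\<^sup>2 * sob_sq ?s (G h))"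
      using sobolev_add(2)[OF u(2) sobolev_cmult(1)[OF Gs]] sobolev_cmult(2)[OF Gs] by (intro always_eventually) simp
    show "((\<lambda>h. 2 * sob_sq ?s (u h) + 2 * ((norm a)\<^sup>2 * sob_sq ?s (G h))) \<longlongrightarrow> 0) (at 0)"
      using tendsto_add[OF tendsto_mult_left[OF u(1), of 2] tendsto_mult_left[OF tendsto_mult_left[OF lG, of "(norm a)\<^sup>2"], of 2]]
      by simp
  qed (simp add: sob_sq_nonneg)
  have "((\<lambda>h. hnorm2 ?s (quot \<phi> d t h)) \<longlongrightarrow> 0) (at 0)"
    unfolding hnorm2_tendsto_0_iff[OF quot_Hs2[OF \<phi> d]] f1 f2
    using comb[OF l(1) qs(1)] comb[OF l(2) qs(2)] by blast
  then show ?thesis by (simp only: \<phi>_def d_def)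
qed

section \<open>The two Hamiltonians\<close>

definition H_orig :: "real \<Rightarrow> fser2 \<Rightarrow> fser2" where
  "H_orig t z = ((\<lambda>k. B (fst z) k + W t (\<lambda>k. fst z k + snd z k) k),
                 (\<lambda>k. - B (snd z) k - W t (\<lambda>k. fst z k + snd z k) k))"

text \<open>The second row consists of the negated conjugates of the entries in the first, with
  \<open>X\<close> and \<open>B\<close> treated as real operators.\<close>

definition H_new :: "real \<Rightarrow> fser2 \<Rightarrow> fser2" where
  "H_new t z =
    ((\<lambda>k. B (fst z) k + (\<i> * (X t (B (fst z)) k - B (X t (fst z)) k) + 2 * X t (B (X t (fst z))) k)
         + (- \<i> * (X t (B (snd z)) k + B (X t (snd z)) k) + 2 * X t (B (X t (snd z))) k)),
     (\<lambda>k. - B (snd z) k - (\<i> * (X t (B (fst z)) k + B (X t (fst z)) k) + 2 * X t (B (X t (fst z))) k)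
         - (- \<i> * (X t (B (snd z)) k - B (X t (snd z)) k) + 2 * X t (B (X t (snd z))) k)))"

text \<open>In the sum of the two rows of \<open>H_orig\<close> the terms with \<open>W\<close>
  cancel, and in that of \<open>H_new\<close> the terms \<open>X B\<close> and \<open>X B X\<close>.
  The sum of the velocities therefore has the same expression \<open>E\<close> for both
  equations.\<close>

lemma X_sum_velocity:
  assumes z: "z \<in> Hs2 r"
    and E: "\<And>k. \<i> * E k = B (fst z) k - B (snd z) k - 2 * \<i> * (B (X t (fst z)) k + B (X t (snd z)) k)"
  shows "X t E k = - \<i> * (X t (B (fst z)) k - X t (B (snd z)) k)
    - 2 * (X t (B (X t (fst z))) k + X t (B (X t (snd z))) k)"
proof -
  have "E k = (- \<i>) * (\<i> * E k)" for k by simp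
  then have "E = (\<lambda>k. (- \<i>) * (B (fst z) k - B (snd z) k) - 2 * (B (X t (fst z)) k + B (X t (snd z)) k))"
    unfolding E by (auto simp: fun_eq_iff algebra_simps)
  moreover have h: "B (fst z) \<in> Hs (r - 1)" "B (snd z) \<in> Hs (r - 1)" "B (X t (fst z)) \<in> Hs (r - 1)" "B (X t (snd z)) \<in> Hs (r - 1)"
    using z by (auto simp: Hs2_iff intro!: B_Hs X_Hs)
  moreover have "X t (\<lambda>k. (- \<i>) * (B (fst z) k - B (snd z) k) - 2 * (B (X t (fst z)) k + B (X t (snd z)) k)) =
      (\<lambda>k. (- \<i>) * (X t (B (fst z)) k - X t (B (snd z)) k) - 2 * (X t (B (X t (fst z))) k + X t (B (X t (snd z))) k))"
    unfolding X_minus[OF Hs_cmult[OF Hs_minus[OF h(1,2)]] Hs_cmult[OF Hs_add[OF h(3,4)]]] X_cmult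
      X_minus[OF h(1,2)] X_add[OF h(3,4)] ..
  ultimately show ?thesis by simp
qed

lemma B_shear:
  assumes "z \<in> Hs2 r"
  shows "B (fst (shear c t z)) k = B (fst z) k - c * (B (X t (fst z)) k + B (X t (snd z)) k)"
    and "B (snd (shear c t z)) k = B (snd z) k + c * (B (X t (fst z)) k + B (X t (snd z)) k)"
proof -
  have X: "X t (\<lambda>k. fst z k + snd z k) = (\<lambda>k. X t (fst z) k + X t (snd z) k)"
    using assms by (intro X_add[of _ r]) (auto simp: Hs2_iff)
  have "fst (shear c t z) = (\<lambda>k. fst z k + (- c) * (X t (fst z) k + X t (snd z) k))"
    "snd (shear c t z) = (\<lambda>k. snd z k + c * (X t (fst z) k + X t (snd z) k))"
    by (simp_all add: shear_def X)
  then show "B (fst (shear c t z)) k = B (fst z) k - c * (B (X t (fst z)) k + B (X t (snd z)) k)"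
    "B (snd (shear c t z)) k = B (snd z) k + c * (B (X t (fst z)) k + B (X t (snd z)) k)"
    by (simp_all only: B_add B_cmult) simp_all
qed

text \<open>Multiplied by \<open>\<i>\<close>, the motion of the shear contributes
  \<open>- \<i> * \<i> * W\<close>, which is exactly the perturbation in the first row of
  \<open>H_orig\<close>; the second row has the opposite sign.\<close>

lemma shear_forward:
  assumes z: "z \<in> Hs2 r" and e: "cscale \<i> e = H_new t z"
  shows "cscale \<i> (shear_velocity \<i> t z e) = H_orig t (shear \<i> t z)"
proof -
  have e1: "\<i> * fst e k = fst (H_new t z) k" and e2: "\<i> * snd e k = snd (H_new t z) k" for k
    by (simp_all add: e[symmetric] cscale_def)
  have XE: "X t (\<lambda>k. fst e k + snd e k) k = - \<i> * (X t (B (fst z)) k - X t (B (snd z)) k)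
    - 2 * (X t (B (X t (fst z))) k + X t (B (X t (snd z))) k)" for k
    by (rule X_sum_velocity[OF z]) (simp add: distrib_left e1 e2, simp add: H_new_def algebra_simps)
  have "\<i> * fst (shear_velocity \<i> t z e) k = fst (H_orig t (shear \<i> t z)) k" for k
    unfolding H_orig_def fst_conv B_shear[OF z] shear_sum
    by (simp add: shear_velocity_def right_diff_distrib e1 XE, simp add: H_new_def algebra_simps)
  moreover have "\<i> * snd (shear_velocity \<i> t z e) k = snd (H_orig t (shear \<i> t z)) k" for k
    unfolding H_orig_def snd_conv B_shear[OF z] shear_sum
    by (simp add: shear_velocity_def distrib_left e2 XE, simp add: H_new_def algebra_simps)
  ultimately show ?thesis by (simp add: cscale_def prod_eq_iff fun_eq_iff)
qed

text \<open>The converse is again a computation with a shear velocity, namely that of the inverse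
  shear applied to the transformed curve.\<close>

lemma shear_backward:
  assumes z: "z \<in> Hs2 r" and d: "cscale \<i> d = H_orig t (shear \<i> t z)"
  shows "cscale \<i> (shear_velocity (- \<i>) t (shear \<i> t z) d) = H_new t z"
proof -
  have d1: "\<i> * fst d k = B (fst z) k - \<i> * (B (X t (fst z)) k + B (X t (snd z)) k) + W t (\<lambda>k. fst z k + snd z k) k"
    and d2: "\<i> * snd d k = - (B (snd z) k + \<i> * (B (X t (fst z)) k + B (X t (snd z)) k)) - W t (\<lambda>k. fst z k + snd z k) k" for k
  proof -
    have "\<i> * fst d k = fst (H_orig t (shear \<i> t z)) k" "\<i> * snd d k = snd (H_orig t (shear \<i> t z)) k"
      by (simp_all add: d[symmetric] cscale_def)
    then show "\<i> * fst d k = B (fst z) k - \<i> * (B (X t (fst z)) k + B (X t (snd z)) k) + W t (\<lambda>k. fst z k + snd z k) k"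
      "\<i> * snd d k = - (B (snd z) k + \<i> * (B (X t (fst z)) k + B (X t (snd z)) k)) - W t (\<lambda>k. fst z k + snd z k) k"
      unfolding H_orig_def fst_conv snd_conv B_shear[OF z] shear_sum by simp_all
  qed
  have XE: "X t (\<lambda>k. fst d k + snd d k) k = - \<i> * (X t (B (fst z)) k - X t (B (snd z)) k)
    - 2 * (X t (B (X t (fst z))) k + X t (B (X t (snd z))) k)" for k
    by (rule X_sum_velocity[OF z]) (simp only: distrib_left d1 d2, simp add: algebra_simps)
  have "\<i> * fst (shear_velocity (- \<i>) t (shear \<i> t z) d) k = fst (H_new t z) k" for k
    unfolding shear_velocity_def shear_sum
    by (simp only: fst_conv right_diff_distrib d1 XE) (simp add: H_new_def algebra_simps)
  moreover have "\<i> * snd (shear_velocity (- \<i>) t (shear \<i> t z) d) k = snd (H_new t z) k" for k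
    unfolding shear_velocity_def shear_sum
    by (simp add: right_diff_distrib d2 XE, simp add: H_new_def algebra_simps)
  ultimately show ?thesis by (simp add: cscale_def prod_eq_iff fun_eq_iff)
qed

lemma solves_at_quot:
  "solves_at r H \<phi> t \<longleftrightarrow> (\<forall>s. \<phi> s \<in> Hs2 r) \<and> (\<exists>d\<in>Hs2 (r - 1).
    ((\<lambda>h. hnorm2 (r - 1) (quot \<phi> d t h)) \<longlongrightarrow> 0) (at 0) \<and> cscale \<i> d = H t (\<phi> t))"
  by (simp add: solves_at_def quot_def)

text \<open>Agreement on the spaces \<open>Hs2 r\<close> is all that can be expected of the concrete
  operators, since their series may diverge elsewhere.\<close>

theorem conjugates_shear:
  assumes P: "\<And>t r z. z \<in> Hs2 r \<Longrightarrow> P t z = shear \<i> t z"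
    and H: "\<And>t r z. z \<in> Hs2 r \<Longrightarrow> H t z = H_orig t z"
    and H': "\<And>t r z. z \<in> Hs2 r \<Longrightarrow> H' t z = H_new t z"
  shows "conjugates P H H'"
  unfolding conjugates_def
proof (intro allI conjI impI)
  fix r t
  show "bij_betw (P t) (Hs2 r) (Hs2 r)"
    using shear_bij[of \<i> t r] bij_betw_cong[of "Hs2 r" "P t" "shear \<i> t" "Hs2 r"] P by blast
next
  fix r t and \<psi> :: "real \<Rightarrow> fser2" assume \<psi>: "\<forall>t. \<psi> t \<in> Hs2 r"
  then have \<psi>': "\<psi> s \<in> Hs2 r" for s by blast
  define \<phi> where "\<phi> = (\<lambda>s. shear \<i> s (\<psi> s))"
  have \<phi>: "\<phi> s \<in> Hs2 r" for s unfolding \<phi>_def by (rule shear_Hs2[OF \<psi>'])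
  have eq: "(\<lambda>s. P s (\<psi> s)) = \<phi>" using P[OF \<psi>'] by (simp add: \<phi>_def)
  have \<psi>\<phi>: "(\<lambda>s. shear (- \<i>) s (\<phi> s)) = \<psi>" by (simp add: \<phi>_def shear_inverse)
  show "solves_at r H (\<lambda>s. P s (\<psi> s)) t = solves_at r H' \<psi> t"
    unfolding eq
  proof
    assume "solves_at r H' \<psi> t"
    then obtain e where e: "e \<in> Hs2 (r - 1)" "((\<lambda>h. hnorm2 (r - 1) (quot \<psi> e t h)) \<longlongrightarrow> 0) (at 0)"
      and eH: "cscale \<i> e = H_new t (\<psi> t)"
      unfolding solves_at_quot H'[OF \<psi>'] by blast
    have "cscale \<i> (shear_velocity \<i> t (\<psi> t) e) = H t (\<phi> t)"
      unfolding H[OF \<phi>] unfolding \<phi>_def by (rule shear_forward[OF \<psi>' eH])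
    then show "solves_at r H \<phi> t"
      unfolding solves_at_quot using \<phi> shear_velocity_Hs2[OF \<psi>' e(1), of \<i> t] shear_tendsto[OF \<psi>' e, of \<i>, folded \<phi>_def]
      by blast
  next
    assume "solves_at r H \<phi> t"
    then obtain d where d: "d \<in> Hs2 (r - 1)" "((\<lambda>h. hnorm2 (r - 1) (quot \<phi> d t h)) \<longlongrightarrow> 0) (at 0)"
      and dH: "cscale \<i> d = H_orig t (\<phi> t)"
      unfolding solves_at_quot H[OF \<phi>] by blast
    have "cscale \<i> (shear_velocity (- \<i>) t (\<phi> t) d) = H' t (\<psi> t)"
      unfolding H'[OF \<psi>'] unfolding \<phi>_def by (rule shear_backward[OF \<psi>' dH[unfolded \<phi>_def]])
    then show "solves_at r H' \<psi> t"
      unfolding solves_at_quot using \<psi> shear_velocity_Hs2[OF \<phi> d(1), of "- \<i>" t] shear_tendsto[OF \<phi> d, of "- \<i>", unfolded \<psi>\<phi>]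
      by blast
  qed
qed

end

section \<open>Weighted multiplication operators\<close>

definition rnorm :: "nat \<Rightarrow> (int \<Rightarrow> complex) \<Rightarrow> real" where
  "rnorm N a = (\<Sum>\<^sub>\<infinity>p. norm (a p) * (1 + \<bar>real_of_int p\<bar>) ^ N)"

abbreviation rapid_seq :: "(int \<Rightarrow> complex) \<Rightarrow> bool" where
  "rapid_seq \<equiv> rapid (\<lambda>p. p)"

lemma rnorm_nonneg: "0 \<le> rnorm N a"
  unfolding rnorm_def by (rule infsum_nonneg) auto

lemma rapid_add:
  assumes "rapid \<pi> a" "rapid \<pi> b"
  shows "rapid \<pi> (\<lambda>i. a i + b i)"
  unfolding rapid_def
proof
  fix N
  have "(\<lambda>i. norm (a i) * (1 + \<bar>real_of_int (\<pi> i)\<bar>) ^ N + norm (b i) * (1 + \<bar>real_of_int (\<pi> i)\<bar>) ^ N) summable_on UNIV"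
    by (rule summable_on_add[OF rapidD[OF assms(1)] rapidD[OF assms(2)]])
  then show "(\<lambda>i. norm (a i + b i) * (1 + \<bar>real_of_int (\<pi> i)\<bar>) ^ N) summable_on UNIV"
    by (rule summable_on_comparison_test) (auto simp: distrib_right[symmetric] intro!: mult_right_mono norm_triangle_ineq)
qed

lemma rapid_minus: "rapid \<pi> a \<Longrightarrow> rapid \<pi> b \<Longrightarrow> rapid \<pi> (\<lambda>i. a i - b i)"
  using rapid_add[of \<pi> a "\<lambda>i. -1 * b i"] rapid_cmult[of \<pi> b "-1"] by simp

lemma rnorm_add_le:
  assumes "rapid_seq a" "rapid_seq b"
  shows "rnorm N (\<lambda>p. a p + b p) \<le> rnorm N a + rnorm N b"
proof -
  have "rnorm N (\<lambda>p. a p + b p) \<le> (\<Sum>\<^sub>\<infinity>p. norm (a p) * (1 + \<bar>real_of_int p\<bar>) ^ N + norm (b p) * (1 + \<bar>real_of_int p\<bar>) ^ N)"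
    unfolding rnorm_def
    using rapidD[OF rapid_add[OF assms], of N] summable_on_add[OF rapidD[OF assms(1), of N] rapidD[OF assms(2), of N]]
    by (rule infsum_mono) (auto simp: distrib_right[symmetric] intro!: mult_right_mono norm_triangle_ineq)
  also have "\<dots> = rnorm N a + rnorm N b"
    unfolding rnorm_def by (rule infsum_add[OF rapidD[OF assms(1)] rapidD[OF assms(2)]])
  finally show ?thesis .
qed

lemma rnorm_cmult: "rnorm N (\<lambda>p. c * a p) = norm c * rnorm N a"
  unfolding rnorm_def norm_mult mult.assoc by (rule infsum_cmult_right')

lemma kop_cmult: "kop K (\<lambda>j. c * f j) = (\<lambda>k. c * kop K f k)"
  unfolding kop_def by (simp add: infsum_cmult_right'[symmetric] mult.left_commute)

text \<open>Weights are functions of the shift \<open>p = k - j\<close> and of the incoming mode \<open>j\<close>.\<close>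

definition wop :: "(int \<Rightarrow> int \<Rightarrow> real) \<Rightarrow> (int \<Rightarrow> complex) \<Rightarrow> fser \<Rightarrow> fser" where
  "wop m a = kop (\<lambda>k j. of_real (m (k - j) j) * a (k - j))"

lemma wop_cmult: "wop m a (\<lambda>j. c * f j) = (\<lambda>k. c * wop m a f k)"
  unfolding wop_def by (rule kop_cmult)

text \<open>In the last claim the constants depend on the weight and the order only and the bound is
  linear in the coefficient norm. A Taylor estimate for coefficients thereby becomes one for
  operators.\<close>

lemma wop_sobolev:
  assumes m: "bounded_weight 0 m"
  shows "rapid_seq a \<Longrightarrow> sobolev r f \<Longrightarrow> (\<lambda>j. of_real (m (k - j) j) * a (k - j) * f j) summable_on UNIV"
    and "rapid_seq a \<Longrightarrow> sobolev r f \<Longrightarrow> sobolev r (wop m a f)"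
    and "\<exists>C\<ge>0. \<exists>N. \<forall>a f. rapid_seq a \<longrightarrow> sobolev r f \<longrightarrow> sob_sq r (wop m a f) \<le> (C * rnorm N a)\<^sup>2 * sob_sq r f"
proof -
  obtain C L where C: "C \<ge> 0" "\<And>p j. \<bar>m p j\<bar> \<le> C * (1 + \<bar>real_of_int p\<bar>) ^ L * jap j powr 0"
    using m unfolding bounded_weight_def by blast
  define N where "N = nat \<lceil>\<bar>r\<bar>\<rceil>"
  have N: "\<bar>r\<bar> \<le> real N" unfolding N_def by linarith
  let ?\<alpha> = "\<lambda>a p. C * (1 + \<bar>real_of_int p\<bar>) ^ L * norm (a p)"
  have K: "norm (of_real (m (k - j) j) * a (k - j)) \<le> ?\<alpha> a (k - j)" for a :: "int \<Rightarrow> complex" and k j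
    using mult_right_mono[OF C(2)[of "k - j" j], of "norm (a (k - j))"] by (simp add: norm_mult)
  have eq: "?\<alpha> a p * (1 + \<bar>real_of_int p\<bar>) ^ N = C * (norm (a p) * (1 + \<bar>real_of_int p\<bar>) ^ (L + N))" for a :: "int \<Rightarrow> complex" and p
    by (simp add: power_add)
  have s: "(\<lambda>p. ?\<alpha> a p * (1 + \<bar>real_of_int p\<bar>) ^ N) summable_on UNIV" if "rapid_seq a" for a
    unfolding eq using rapidD[OF that] by (rule summable_on_cmult_right)
  have ks: "(\<lambda>j. norm (of_real (m (k - j) j) * a (k - j) * f j)) summable_on UNIV"
    "sobolev r (kop (\<lambda>k j. of_real (m (k - j) j) * a (k - j)) f)"
    "sob_sq r (kop (\<lambda>k j. of_real (m (k - j) j) * a (k - j)) f) \<le> (\<Sum>\<^sub>\<infinity>p. ?\<alpha> a p * (1 + \<bar>real_of_int p\<bar>) ^ N)\<^sup>2 * sob_sq r f"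
    if "rapid_seq a" "sobolev r f" for a f k
    using kop_sobolev[where \<alpha> = "?\<alpha> a" and K = "\<lambda>k j. of_real (m (k - j) j) * a (k - j)", OF K[of _ _ a] s[OF that(1)] N that(2)]
    by blast+
  show "(\<lambda>j. of_real (m (k - j) j) * a (k - j) * f j) summable_on UNIV" if "rapid_seq a" "sobolev r f"
    by (rule abs_summable_summable[OF ks(1)[OF that]])
  show "sobolev r (wop m a f)" if "rapid_seq a" "sobolev r f"
    unfolding wop_def by (rule ks(2)[OF that])
  have "sob_sq r (wop m a f) \<le> (C * rnorm (L + N) a)\<^sup>2 * sob_sq r f" if "rapid_seq a" "sobolev r f" for a f
    using ks(3)[OF that] unfolding eq infsum_cmult_right' by (simp only: wop_def rnorm_def)
  then show "\<exists>C\<ge>0. \<exists>N. \<forall>a f. rapid_seq a \<longrightarrow> sobolev r f \<longrightarrow> sob_sq r (wop m a f) \<le> (C * rnorm N a)\<^sup>2 * sob_sq r f"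
    using C(1) by blast
qed

lemma wop_odd:
  assumes "\<And>p j. m (- p) (- j) = m p j" "\<And>p. a (- p) = a p" "odd_ser f"
  shows "odd_ser (wop m a f)"
proof -
  have "of_real (m (- k - - j) (- j)) * a (- k - - j) = of_real (m (k - j) j) * a (k - j)" for k j
    using assms(1)[of "k - j" j] assms(2)[of "k - j"] by (simp add: algebra_simps)
  then show ?thesis
    unfolding wop_def by (intro kop_odd assms(3)) simp
qed

lemma wop_Hs:
  assumes "bounded_weight 0 m" "\<And>p j. m (- p) (- j) = m p j" "\<And>p. a (- p) = a p" "rapid_seq a" "f \<in> Hs r"
  shows "wop m a f \<in> Hs r"
proof -
  have f: "odd_ser f" "sobolev r f" using assms(5) by (simp_all add: Hs_iff)
  have "sobolev r (wop m a f)" by (rule wop_sobolev(2)[OF assms(1,4) f(2)])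
  moreover have "odd_ser (wop m a f)" by (rule wop_odd) (rule assms(2) assms(3) f(1))+
  ultimately show ?thesis by (simp add: Hs_iff)
qed

lemma wop_add:
  assumes "bounded_weight 0 m" "rapid_seq a" "sobolev r f" "sobolev r g"
  shows "wop m a (\<lambda>j. f j + g j) = (\<lambda>k. wop m a f k + wop m a g k)"
  unfolding wop_def kop_def
  by (simp add: distrib_left infsum_add[OF wop_sobolev(1)[OF assms(1,2,3)] wop_sobolev(1)[OF assms(1,2,4)]])

lemma wop_coeff_minus:
  assumes "bounded_weight 0 m" "rapid_seq a" "rapid_seq b" "sobolev r f"
  shows "wop m (\<lambda>p. a p - b p) f k = wop m a f k - wop m b f k"
  using infsum_minus_distrib[OF wop_sobolev(1)[OF assms(1,2,4)] wop_sobolev(1)[OF assms(1,3,4)], of k k]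
  by (simp add: wop_def kop_def algebra_simps)

lemma wop_coeff_cmult: "wop m (\<lambda>p. c * a p) f k = c * wop m a f k"
  unfolding wop_def kop_def by (simp add: infsum_cmult_right'[symmetric] mult_ac)

section \<open>The multiplier \<open>B\<close> on odd sequences\<close>

lemma Bpow_eq: "Bpow mass s f = (\<lambda>j. of_real (bsym mass s j) * f j)"
  by (simp add: Bpow_def bsym_def)

lemma bsym_order_bounds:
  "\<exists>C. \<forall>j. norm (of_real (bsym mass 1 j) :: complex) \<le> C * jap j"
  "\<exists>C. \<forall>j. \<bar>bsym mass (- 1 / 2) j\<bar> \<le> C"
proof -
  obtain C K where C: "\<And>p j. \<bar>bsym mass 1 j\<bar> \<le> C * (1 + \<bar>real_of_int p\<bar>) ^ K * jap j powr 1"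
    using weight_upto_bsym(1)[of 0 mass] unfolding weight_upto.simps bounded_weight_def by blast
  have "norm (of_real (bsym mass 1 j) :: complex) \<le> C * jap j" for j
    using C[of j 0] by simp
  then show "\<exists>C. \<forall>j. norm (of_real (bsym mass 1 j) :: complex) \<le> C * jap j" by blast
  obtain C K where C: "C \<ge> 0" "\<And>p j. \<bar>bsym mass (- 1 / 2) j\<bar> \<le> C * (1 + \<bar>real_of_int p\<bar>) ^ K * jap j powr (- (1 / 2))"
    using weight_upto_bsym(3)[of 0 mass] unfolding weight_upto.simps bounded_weight_def by blast
  have "\<bar>bsym mass (- 1 / 2) j\<bar> \<le> C" for j
  proof -
    have "\<bar>bsym mass (- 1 / 2) j\<bar> \<le> C * jap j powr (- (1 / 2))"
      using C(2)[of j 0] by simp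
    also have "\<dots> \<le> C * jap j powr 0"
      using C(1) jap_ge_1[of j] by (intro mult_left_mono powr_mono) auto
    finally show ?thesis by simp
  qed
  then show "\<exists>C. \<forall>j. \<bar>bsym mass (- 1 / 2) j\<bar> \<le> C" by blast
qed

lemma Bpow_Hs: "f \<in> Hs r \<Longrightarrow> Bpow mass 1 f \<in> Hs (r - 1)"
proof -
  assume f: "f \<in> Hs r"
  obtain C where C: "\<And>j. norm (of_real (bsym mass 1 j) :: complex) \<le> C * jap j"
    using bsym_order_bounds(1) by blast
  have "sobolev (r - 1) (\<lambda>j. of_real (bsym mass 1 j) * f j)"
    by (rule sobolev_multiplier[OF Hs_sobolev[OF f] C])
  then show ?thesis
    using f by (simp add: Bpow_eq Hs_iff odd_ser_def)
qed

lemma beta_Hs: "f \<in> Hs r \<Longrightarrow> (\<lambda>j. of_real (bsym mass (- 1 / 2) j) * f j) \<in> Hs r"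
proof -
  assume f: "f \<in> Hs r"
  obtain C where C: "\<And>j. \<bar>bsym mass (- 1 / 2) j\<bar> \<le> C"
    using bsym_order_bounds(2) by blast
  have "sobolev r (\<lambda>j. of_real (bsym mass (- 1 / 2) j) * f j)"
    unfolding sobolev_def
  proof (rule summable_on_comparison_test)
    show "(\<lambda>j. C\<^sup>2 * (jap j powr (2 * r) * (norm (f j))\<^sup>2)) summable_on UNIV"
      using Hs_sobolev[OF f] unfolding sobolev_def by (rule summable_on_cmult_right)
    fix j
    have "(bsym mass (- 1 / 2) j)\<^sup>2 \<le> C\<^sup>2"
      using power_mono[OF C[of j], of 2] by simp
    then have "(bsym mass (- 1 / 2) j)\<^sup>2 * (jap j powr (2 * r) * (norm (f j))\<^sup>2) \<le> C\<^sup>2 * (jap j powr (2 * r) * (norm (f j))\<^sup>2)"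
      by (rule mult_right_mono) simp
    then show "jap j powr (2 * r) * (norm (of_real (bsym mass (- 1 / 2) j) * f j))\<^sup>2 \<le> C\<^sup>2 * (jap j powr (2 * r) * (norm (f j))\<^sup>2)"
      by (simp add: norm_mult power_mult_distrib mult_ac)
  qed auto
  then show ?thesis
    using f by (simp add: Hs_iff odd_ser_def)
qed

text \<open>
  Matrix entries, from mode \<open>j\<close> to mode \<open>j + p\<close>, that the operators \<open>B\<^sup>-\<^sup>1\<^sup>/\<^sup>2 U B\<^sup>-\<^sup>1\<^sup>/\<^sup>2 = X\<close>,
  \<open>X B - B X\<close> and \<open>X B + B X\<close> have relative to a multiplication operator \<open>U\<close>.
\<close>

definition sw :: "real \<Rightarrow> int \<Rightarrow> int \<Rightarrow> real" where
  "sw mass p j = bsym mass (- 1 / 2) (j + p) * bsym mass (- 1 / 2) j"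

definition sw_diff :: "real \<Rightarrow> int \<Rightarrow> int \<Rightarrow> real" where
  "sw_diff mass p j = bsym mass (- 1 / 2) (j + p) * bsym mass (- 1 / 2) j * (bsym mass 1 j - bsym mass 1 (j + p))"

definition sw_sum :: "real \<Rightarrow> int \<Rightarrow> int \<Rightarrow> real" where
  "sw_sum mass p j = bsym mass (- 1 / 2) (j + p) * bsym mass (- 1 / 2) j * (bsym mass 1 j + bsym mass 1 (j + p))"

lemma sw_weight: "weight_upto n (- 1) (sw mass)" "weight_upto n (- 1) (sw_diff mass)" "weight_upto n 0 (sw_sum mass)"
  using weight_upto_sandwich[of n mass] by (simp_all add: sw_def[abs_def] sw_diff_def[abs_def] sw_sum_def[abs_def])

lemma sw_bounded: "bounded_weight 0 (sw mass)" "bounded_weight 0 (sw_diff mass)" "bounded_weight 0 (sw_sum mass)"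
  using bounded_weight_mono[OF weight_upto_imp_bounded[OF sw_weight(1)], of 0]
    bounded_weight_mono[OF weight_upto_imp_bounded[OF sw_weight(2)], of 0]
    weight_upto_imp_bounded[OF sw_weight(3)] by auto

lemma sw_minus: "sw mass (- p) (- j) = sw mass p j" "sw_diff mass (- p) (- j) = sw_diff mass p j"
  "sw_sum mass (- p) (- j) = sw_sum mass p j"
proof -
  have "bsym mass s (- j - p) = bsym mass s (j + p)" for s
    using bsym_minus[of mass s "j + p"] by simp
  then show "sw mass (- p) (- j) = sw mass p j" "sw_diff mass (- p) (- j) = sw_diff mass p j"
    "sw_sum mass (- p) (- j) = sw_sum mass p j"
    by (simp_all add: sw_def sw_diff_def sw_sum_def)
qed

text \<open>For zero mass the mode \<open>j = 0\<close> is lost, but odd sequences vanish there.\<close>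

lemma sandwich_cancel:
  assumes "odd_ser g"
  shows "of_real (bsym mass (- 1 / 2) j) * (of_real (bsym mass 1 j) * (of_real (bsym mass (- 1 / 2) j) * g j)) = g j"
proof (cases "j = 0 \<and> mass = 0")
  case True
  then show ?thesis using odd_ser_0[OF assms] by simp
next
  case False
  then have "(real_of_int j)\<^sup>2 + mass\<^sup>2 > 0"
    by (auto simp: sum_power2_gt_zero_iff)
  with False have "bsym mass (- 1 / 2) j * bsym mass 1 j * bsym mass (- 1 / 2) j = 1"
    unfolding bsym_def by (simp add: powr_add[symmetric])
  then have "complex_of_real (bsym mass (- 1 / 2) j * bsym mass 1 j * bsym mass (- 1 / 2) j) = 1"
    by simp
  then have "complex_of_real (bsym mass (- 1 / 2) j) * complex_of_real (bsym mass 1 j) * complex_of_real (bsym mass (- 1 / 2) j) = 1"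
    by (simp only: of_real_mult)
  then show ?thesis
    by (metis mult.assoc mult_1)
qed

lemma wop_sw_eq: "wop (sw mass) a f k =
    of_real (bsym mass (- 1 / 2) k) * kop (\<lambda>k j. a (k - j)) (\<lambda>j. of_real (bsym mass (- 1 / 2) j) * f j) k"
  unfolding wop_def kop_def infsum_cmult_right'[symmetric] by (simp add: sw_def mult_ac)

lemma wop_1: "wop (\<lambda>_ _. 1) a = kop (\<lambda>k j. a (k - j))"
  by (simp add: wop_def)

text \<open>The three inner factors cancel on odd sequences only; evenness of \<open>a\<close>
  ensures that the intermediate sequence stays odd.\<close>

lemma wop_composition:
  assumes a: "rapid_seq a" "\<And>p. a (- p) = a p" and f: "f \<in> Hs r"
    and sq: "\<And>g. g \<in> Hs r \<Longrightarrow> kop (\<lambda>k j. a2 (k - j)) g = kop (\<lambda>k j. a (k - j)) (kop (\<lambda>k j. a (k - j)) g)"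
  shows "wop (sw mass) a (Bpow mass 1 (wop (sw mass) a f)) = wop (sw mass) a2 f"
proof
  fix k
  define g where "g = (\<lambda>j. of_real (bsym mass (- 1 / 2) j) * f j)"
  have g: "g \<in> Hs r" unfolding g_def by (rule beta_Hs[OF f])
  have bw: "bounded_weight 0 (\<lambda>_ _. 1)"
    by (rule bounded_weightI[where C = 1 and K = 0]) simp
  have "kop (\<lambda>k j. a (k - j)) g \<in> Hs r"
    unfolding wop_1[symmetric] by (rule wop_Hs[OF bw _ _ a(1) g]) (simp_all add: a(2))
  then have odd: "odd_ser (kop (\<lambda>k j. a (k - j)) g)" by (simp add: Hs_iff)
  have "wop (sw mass) a f = (\<lambda>j. of_real (bsym mass (- 1 / 2) j) * kop (\<lambda>k j. a (k - j)) g j)"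
    by (simp only: fun_eq_iff wop_sw_eq g_def) simp
  then have "wop (sw mass) a (Bpow mass 1 (wop (sw mass) a f)) k =
    of_real (bsym mass (- 1 / 2) k) * kop (\<lambda>k j. a (k - j)) (kop (\<lambda>k j. a (k - j)) g) k"
    by (simp only: wop_sw_eq Bpow_eq sandwich_cancel[OF odd])
  also have "\<dots> = wop (sw mass) a2 f k"
    by (simp only: wop_sw_eq[of mass a2] g_def[symmetric] sq[OF g])
  finally show "wop (sw mass) a (Bpow mass 1 (wop (sw mass) a f)) k = wop (sw mass) a2 f k" .
qed

text \<open>The matrix of the new diagonal entry; \<open>a\<close> and \<open>a2\<close> stand for
  the Fourier coefficients in \<open>x\<close> of the multiplier \<open>U\<close> and of its
  square.\<close>

definition ker_d :: "real \<Rightarrow> (int \<Rightarrow> complex) \<Rightarrow> (int \<Rightarrow> complex) \<Rightarrow> int \<Rightarrow> int \<Rightarrow> complex" where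
  "ker_d mass a a2 k j = of_real (sw_diff mass (k - j) j) * (\<i> * a (k - j)) + of_real (sw mass (k - j) j) * (2 * a2 (k - j))"

definition ker_o :: "real \<Rightarrow> (int \<Rightarrow> complex) \<Rightarrow> (int \<Rightarrow> complex) \<Rightarrow> int \<Rightarrow> int \<Rightarrow> complex" where
  "ker_o mass a a2 k j = of_real (sw_sum mass (k - j) j) * (- \<i> * a (k - j)) + of_real (sw mass (k - j) j) * (2 * a2 (k - j))"

lemma kop_two_weights:
  assumes m: "bounded_weight 0 m" "bounded_weight 0 m'" and a: "rapid_seq a" "rapid_seq a2" and f: "sobolev r f"
  shows "kop (\<lambda>k j. of_real (m (k - j) j) * (c * a (k - j)) + of_real (m' (k - j) j) * (d * a2 (k - j))) f k
    = c * wop m a f k + d * wop m' a2 f k"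
proof -
  have "kop (\<lambda>k j. of_real (m (k - j) j) * (c * a (k - j)) + of_real (m' (k - j) j) * (d * a2 (k - j))) f k
    = wop m (\<lambda>p. c * a p) f k + wop m' (\<lambda>p. d * a2 p) f k"
    unfolding wop_def kop_def
    by (simp only: distrib_right infsum_add[OF wop_sobolev(1)[OF m(1) rapid_cmult[OF a(1)] f] wop_sobolev(1)[OF m(2) rapid_cmult[OF a(2)] f]])
  then show ?thesis by (simp only: wop_coeff_cmult)
qed

lemma wop_sw_diff:
  assumes a: "rapid_seq a" and f: "f \<in> Hs r"
  shows "wop (sw_diff mass) a f k = wop (sw mass) a (Bpow mass 1 f) k - Bpow mass 1 (wop (sw mass) a f) k"
    and "wop (sw_sum mass) a f k = wop (sw mass) a (Bpow mass 1 f) k + Bpow mass 1 (wop (sw mass) a f) k"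
proof -
  let ?F = "\<lambda>j. of_real (sw mass (k - j) j) * a (k - j) * Bpow mass 1 f j"
  let ?G = "\<lambda>j. of_real (bsym mass 1 k) * (of_real (sw mass (k - j) j) * a (k - j) * f j)"
  have F: "?F summable_on UNIV"
    by (rule wop_sobolev(1)[OF sw_bounded(1) a Hs_sobolev[OF Bpow_Hs[OF f]]])
  have G: "?G summable_on UNIV"
    by (rule summable_on_cmult_right[OF wop_sobolev(1)[OF sw_bounded(1) a Hs_sobolev[OF f]]])
  have GG: "infsum ?G UNIV = Bpow mass 1 (wop (sw mass) a f) k"
    unfolding infsum_cmult_right' by (simp add: Bpow_eq wop_def kop_def)
  have FF: "infsum ?F UNIV = wop (sw mass) a (Bpow mass 1 f) k"
    by (simp add: wop_def kop_def)
  have "wop (sw_diff mass) a f k = (\<Sum>\<^sub>\<infinity>j. ?F j - ?G j)"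
    unfolding wop_def kop_def by (intro infsum_cong) (simp add: sw_def sw_diff_def Bpow_eq algebra_simps)
  then show "wop (sw_diff mass) a f k = wop (sw mass) a (Bpow mass 1 f) k - Bpow mass 1 (wop (sw mass) a f) k"
    by (simp only: infsum_minus_distrib[OF F G] FF GG)
  have "wop (sw_sum mass) a f k = (\<Sum>\<^sub>\<infinity>j. ?F j + ?G j)"
    unfolding wop_def kop_def by (intro infsum_cong) (simp add: sw_def sw_sum_def Bpow_eq algebra_simps)
  then show "wop (sw_sum mass) a f k = wop (sw mass) a (Bpow mass 1 f) k + Bpow mass 1 (wop (sw mass) a f) k"
    by (simp only: infsum_add[OF F G] FF GG)
qed

text \<open>Conjugation of functions reflects the frequencies of their coefficients. The reflection
  invariance of the matrix undoes this and leaves entrywise conjugation.\<close>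

lemma cnj_op_kop:
  assumes "\<And>k j. K (- k) (- j) = K k j"
  shows "cnj_op (kop K) f = kop (\<lambda>k j. cnj (K k j)) f"
proof
  fix k
  have "(\<Sum>\<^sub>\<infinity>j. K (- k) j * cnj (f (- j))) = (\<Sum>\<^sub>\<infinity>j. K k j * cnj (f (- (- j))))"
    by (rule kernel_op_minus[where u = "\<lambda>j. cnj (f (- j))"]) (rule assms)
  then have "cnj_op (kop K) f k = cnj (\<Sum>\<^sub>\<infinity>j. K k j * cnj (f j))"
    by (simp only: cnj_op_def cnj_ser_def kop_def minus_minus)
  then show "cnj_op (kop K) f k = kop (\<lambda>k j. cnj (K k j)) f k"
    by (simp only: kop_def infsum_cnj[symmetric] complex_cnj_mult complex_cnj_cnj)
qed

lemma ker_minus: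
  assumes "\<And>p. a (- p) = a p" "\<And>p. a2 (- p) = a2 p"
  shows "ker_d mass a a2 (- k) (- j) = ker_d mass a a2 k j" "ker_o mass a a2 (- k) (- j) = ker_o mass a a2 k j"
proof -
  have e: "- k - - j = - (k - j)" by simp
  show "ker_d mass a a2 (- k) (- j) = ker_d mass a a2 k j" "ker_o mass a a2 (- k) (- j) = ker_o mass a a2 k j"
    unfolding ker_d_def ker_o_def e assms sw_minus by simp_all
qed

text \<open>The components of \<open>F z\<close> are opposite, so homogeneity alone annihilates
  \<open>F (F z)\<close>. Additivity, which may fail for divergent series, is required at the single
  point \<open>z\<close>.\<close>

lemma op_exp_nilpotent:
  assumes A_add: "A (\<lambda>k. fst z k + snd z k) = (\<lambda>k. A (fst z) k + A (snd z) k)"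
    and A_cmult: "\<And>c f. A (\<lambda>k. c * f k) = (\<lambda>k. c * A f k)"
  shows "op_exp (\<lambda>z. cscale (- \<i>) (op_times_mat A \<sigma>4 z)) z =
    ((\<lambda>k. fst z k - \<i> * A (\<lambda>k. fst z k + snd z k) k), (\<lambda>k. snd z k + \<i> * A (\<lambda>k. fst z k + snd z k) k))"
proof -
  define F where "F = (\<lambda>z. cscale (- \<i>) (op_times_mat A \<sigma>4 z))"
  have s4: "\<sigma>4 $ 1 $ 1 = 1" "\<sigma>4 $ 1 $ 2 = 1" "\<sigma>4 $ 2 $ 1 = - 1" "\<sigma>4 $ 2 $ 2 = - 1"
    by (simp_all add: \<sigma>4_def vector_2)
  have F1: "fst (F z) = (\<lambda>k. - \<i> * (A (fst z) k + A (snd z) k))" and F2: "snd (F z) = (\<lambda>k. \<i> * (A (fst z) k + A (snd z) k))" for z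
    by (simp_all add: F_def cscale_def op_times_mat_def matop_def s4 fun_eq_iff algebra_simps)
  have Am: "A (\<lambda>k. - f k) = (\<lambda>k. - A f k)" for f
    using A_cmult[of "-1" f] by simp
  have A0: "A (\<lambda>k. 0) = (\<lambda>k. 0)"
    using A_cmult[of 0 "\<lambda>_. 0"] by simp
  have FF: "F (F z) = ((\<lambda>k. 0), (\<lambda>k. 0))"
  proof -
    have "snd (F z) = (\<lambda>k. - fst (F z) k)" by (simp add: F1 F2)
    then have "A (snd (F z)) = (\<lambda>k. - A (fst (F z)) k)" by (simp only: Am)
    then show ?thesis by (simp add: prod_eq_iff F1[of "F z"] F2[of "F z"])
  qed
  have F0: "F ((\<lambda>k. 0), (\<lambda>k. 0)) = ((\<lambda>k. 0), (\<lambda>k. 0))"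
    by (simp add: prod_eq_iff F1 F2 A0)
  have Fn0: "(F ^^ n) ((\<lambda>k. 0), (\<lambda>k. 0)) = ((\<lambda>k. 0), (\<lambda>k. 0))" for n
    by (induction n) (simp_all add: F0)
  have Fn: "(F ^^ n) z = ((\<lambda>k. 0), (\<lambda>k. 0))" if "n \<ge> 2" for n
  proof -
    obtain m where "n = m + 2" using \<open>n \<ge> 2\<close> by (metis add.commute le_Suc_ex)
    then have "(F ^^ n) z = (F ^^ m) ((F ^^ 2) z)" by (simp only: funpow_add o_apply)
    also have "(F ^^ 2) z = F (F z)" by (simp add: numeral_2_eq_2)
    finally show ?thesis by (simp only: FF Fn0)
  qed
  have s1: "(\<Sum>n. fst ((F ^^ n) z) k / fact n) = fst z k + fst (F z) k" for k
  proof -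
    have "(\<Sum>n. fst ((F ^^ n) z) k / fact n) = (\<Sum>n\<in>{0, 1}. fst ((F ^^ n) z) k / fact n)"
    proof (rule suminf_finite)
      fix n :: nat assume "n \<notin> {0, 1}"
      then have "n \<ge> 2" by auto
      then show "fst ((F ^^ n) z) k / fact n = 0" by (simp add: Fn)
    qed simp
    then show ?thesis by simp
  qed
  have s2: "(\<Sum>n. snd ((F ^^ n) z) k / fact n) = snd z k + snd (F z) k" for k
  proof -
    have "(\<Sum>n. snd ((F ^^ n) z) k / fact n) = (\<Sum>n\<in>{0, 1}. snd ((F ^^ n) z) k / fact n)"
    proof (rule suminf_finite)
      fix n :: nat assume "n \<notin> {0, 1}"
      then have "n \<ge> 2" by auto
      then show "snd ((F ^^ n) z) k / fact n = 0" by (simp add: Fn)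
    qed simp
    then show ?thesis by simp
  qed
  show ?thesis
    unfolding op_exp_def F_def[symmetric] s1 s2 F1 F2 A_add by (simp add: algebra_simps)
qed

text \<open>At each time \<open>u\<close>, \<open>u2\<close> and \<open>w\<close> are the Fourier
  coefficients in \<open>x\<close> of \<open>U\<close>, of its square and of its time derivative.
  Functions that are real and even in \<open>x\<close> have real and even coefficients.\<close>

locale coefficient_flow =
  fixes mass :: real and u u2 w :: "real \<Rightarrow> int \<Rightarrow> complex"
  assumes rapid_u: "rapid_seq (u t)" and rapid_u2: "rapid_seq (u2 t)" and rapid_w: "rapid_seq (w t)"
    and even_u: "u t (- p) = u t p" and even_u2: "u2 t (- p) = u2 t p" and even_w: "w t (- p) = w t p"
    and real_u: "cnj (u t p) = u t p" and real_u2: "cnj (u2 t p) = u2 t p"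
    and flow: "\<exists>C\<ge>0. \<forall>h::real. \<bar>h\<bar> \<le> 1 \<longrightarrow> rnorm N (\<lambda>p. u (t + h) p - u t p - of_real h * w t p) \<le> C * h\<^sup>2"
    and square: "sobolev r g \<Longrightarrow> kop (\<lambda>k j. u2 t (k - j)) g = kop (\<lambda>k j. u t (k - j)) (kop (\<lambda>k j. u t (k - j)) g)"
begin

lemma rapid_remainder: "rapid_seq (\<lambda>p. u (t + h) p - u t p - of_real h * w t p)"
  by (intro rapid_minus rapid_cmult rapid_u rapid_w)

lemma rnorm_u_bound: "\<exists>C\<ge>0. \<forall>h. \<bar>h\<bar> \<le> 1 \<longrightarrow> rnorm N (u (t + h)) \<le> C"
proof -
  obtain C where C: "C \<ge> 0" "\<And>h. \<bar>h\<bar> \<le> 1 \<Longrightarrow> rnorm N (\<lambda>p. u (t + h) p - u t p - of_real h * w t p) \<le> C * h\<^sup>2"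
    using flow by blast
  have "rnorm N (u (t + h)) \<le> C + (rnorm N (u t) + rnorm N (w t))" if h: "\<bar>h\<bar> \<le> 1" for h
  proof -
    let ?R = "\<lambda>p. u (t + h) p - u t p - of_real h * w t p"
    have "u (t + h) = (\<lambda>p. ?R p + (u t p + of_real h * w t p))" by (simp add: fun_eq_iff)
    then have "rnorm N (u (t + h)) \<le> rnorm N ?R + rnorm N (\<lambda>p. u t p + of_real h * w t p)"
      using rnorm_add_le[OF rapid_remainder[of t h] rapid_add[OF rapid_u[of t] rapid_cmult[OF rapid_w[of t], of "of_real h"]], of N]
      by simp
    also have "rnorm N ?R \<le> C * h\<^sup>2" by (rule C(2)[OF h])
    also have "C * h\<^sup>2 \<le> C"
      using C(1) h by (intro mult_left_le) (auto simp: abs_square_le_1)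
    also have "rnorm N (\<lambda>p. u t p + of_real h * w t p) \<le> rnorm N (u t) + \<bar>h\<bar> * rnorm N (w t)"
      using rnorm_add_le[OF rapid_u[of t] rapid_cmult[OF rapid_w[of t], of "of_real h"], of N] by (simp add: rnorm_cmult)
    also have "\<bar>h\<bar> * rnorm N (w t) \<le> rnorm N (w t)"
      using h rnorm_nonneg[of N "w t"] by (intro mult_left_le_one_le) auto
    finally show ?thesis by simp
  qed
  then show ?thesis
    using C(1) rnorm_nonneg[of N "u t"] rnorm_nonneg[of N "w t"] by (intro exI[of _ "C + (rnorm N (u t) + rnorm N (w t))"]) auto
qed

sublocale shear_conjugation "Bpow mass 1" "\<lambda>t. wop (sw mass) (u t)" "\<lambda>t. wop (sw mass) (w t)"
proof
  fix f g :: fser and r t :: real and c :: complex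
  show "f \<in> Hs r \<Longrightarrow> Bpow mass 1 f \<in> Hs (r - 1)" by (rule Bpow_Hs)
  show "Bpow mass 1 (\<lambda>k. f k + g k) = (\<lambda>k. Bpow mass 1 f k + Bpow mass 1 g k)"
    by (simp add: Bpow_eq distrib_left)
  show "Bpow mass 1 (\<lambda>k. c * f k) = (\<lambda>k. c * Bpow mass 1 f k)"
    by (simp add: Bpow_eq mult.left_commute)
  show "f \<in> Hs r \<Longrightarrow> wop (sw mass) (u t) f \<in> Hs r"
    by (rule wop_Hs[OF sw_bounded(1) _ _ rapid_u]) (simp_all add: sw_minus even_u)
  show "f \<in> Hs r \<Longrightarrow> wop (sw mass) (w t) f \<in> Hs r"
    by (rule wop_Hs[OF sw_bounded(1) _ _ rapid_w]) (simp_all add: sw_minus even_w)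
  show "wop (sw mass) (u t) (\<lambda>k. f k + g k) = (\<lambda>k. wop (sw mass) (u t) f k + wop (sw mass) (u t) g k)"
    if "f \<in> Hs r" "g \<in> Hs r"
    by (rule wop_add[OF sw_bounded(1) rapid_u Hs_sobolev[OF that(1)] Hs_sobolev[OF that(2)]])
  show "wop (sw mass) (u t) (\<lambda>k. c * f k) = (\<lambda>k. c * wop (sw mass) (u t) f k)"
    by (rule wop_cmult)
next
  fix r t
  obtain C N where C: "C \<ge> 0" "\<And>a f. rapid_seq a \<Longrightarrow> sobolev r f \<Longrightarrow>
      sob_sq r (wop (sw mass) a f) \<le> (C * rnorm N a)\<^sup>2 * sob_sq r f"
    using wop_sobolev(3)[OF sw_bounded(1)] by blast
  obtain D where D: "D \<ge> 0" "\<And>h. \<bar>h\<bar> \<le> 1 \<Longrightarrow> rnorm N (u (t + h)) \<le> D"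
    using rnorm_u_bound by blast
  obtain E where E: "E \<ge> 0" "\<And>h. \<bar>h\<bar> \<le> 1 \<Longrightarrow> rnorm N (\<lambda>p. u (t + h) p - u t p - of_real h * w t p) \<le> E * h\<^sup>2"
    using flow by blast
  have b: "sob_sq r (wop (sw mass) a f) \<le> (C * A)\<^sup>2 * sob_sq r f" if "rapid_seq a" "f \<in> Hs r" "rnorm N a \<le> A" for a f A
  proof -
    have "(C * rnorm N a)\<^sup>2 \<le> (C * A)\<^sup>2"
      using C(1) rnorm_nonneg[of N a] that(3) by (intro power_mono mult_left_mono) auto
    then have "(C * rnorm N a)\<^sup>2 * sob_sq r f \<le> (C * A)\<^sup>2 * sob_sq r f"
      by (intro mult_right_mono sob_sq_nonneg)
    then show ?thesis using C(2)[OF that(1) Hs_sobolev[OF that(2)]] by linarith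
  qed
  show "\<exists>C\<ge>0. \<forall>h::real. \<forall>f. \<bar>h\<bar> \<le> 1 \<longrightarrow> f \<in> Hs r \<longrightarrow> sob_sq r (wop (sw mass) (u (t + h)) f) \<le> C * sob_sq r f"
  proof (intro exI[of _ "(C * D)\<^sup>2"] conjI allI impI)
    fix h :: real and f assume "\<bar>h\<bar> \<le> 1" "f \<in> Hs r"
    then show "sob_sq r (wop (sw mass) (u (t + h)) f) \<le> (C * D)\<^sup>2 * sob_sq r f"
      by (intro b rapid_u D(2))
  qed simp
  show "\<exists>C\<ge>0. \<forall>f. f \<in> Hs r \<longrightarrow> sob_sq r (wop (sw mass) (w t) f) \<le> C * sob_sq r f"
  proof (intro exI[of _ "(C * rnorm N (w t))\<^sup>2"] conjI allI impI)
    fix f assume "f \<in> Hs r"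
    then show "sob_sq r (wop (sw mass) (w t) f) \<le> (C * rnorm N (w t))\<^sup>2 * sob_sq r f"
      by (intro b rapid_w) auto
  qed simp
  show "\<exists>C\<ge>0. \<forall>h::real. \<forall>f. \<bar>h\<bar> \<le> 1 \<longrightarrow> f \<in> Hs r \<longrightarrow>
      sob_sq r (\<lambda>k. wop (sw mass) (u (t + h)) f k - wop (sw mass) (u t) f k - of_real h * wop (sw mass) (w t) f k)
        \<le> C * h ^ 4 * sob_sq r f"
  proof (intro exI[of _ "(C * E)\<^sup>2"] conjI allI impI)
    fix h :: real and f assume h: "\<bar>h\<bar> \<le> 1" and f: "f \<in> Hs r"
    have "wop (sw mass) (\<lambda>p. u (t + h) p - u t p - of_real h * w t p) f k =
        wop (sw mass) (u (t + h)) f k - wop (sw mass) (u t) f k - of_real h * wop (sw mass) (w t) f k" for k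
      using wop_coeff_minus[OF sw_bounded(1) rapid_minus[OF rapid_u rapid_u] rapid_cmult[OF rapid_w] Hs_sobolev[OF f], of mass "t + h" t "of_real h" t k]
        wop_coeff_minus[OF sw_bounded(1) rapid_u rapid_u Hs_sobolev[OF f], of mass "t + h" t k]
      by (simp add: wop_coeff_cmult)
    then have "(\<lambda>k. wop (sw mass) (u (t + h)) f k - wop (sw mass) (u t) f k - of_real h * wop (sw mass) (w t) f k) =
        wop (sw mass) (\<lambda>p. u (t + h) p - u t p - of_real h * w t p) f"
      by (simp add: fun_eq_iff)
    then have "sob_sq r (\<lambda>k. wop (sw mass) (u (t + h)) f k - wop (sw mass) (u t) f k - of_real h * wop (sw mass) (w t) f k)
        \<le> (C * (E * h\<^sup>2))\<^sup>2 * sob_sq r f"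
      using b[OF rapid_remainder f E(2)[OF h]] by (simp only:)
    then show "sob_sq r (\<lambda>k. wop (sw mass) (u (t + h)) f k - wop (sw mass) (u t) f k - of_real h * wop (sw mass) (w t) f k)
        \<le> (C * E)\<^sup>2 * h ^ 4 * sob_sq r f"
      by (simp add: power_mult_distrib mult_ac)
  qed simp
qed

lemma ker_d_op:
  assumes "f \<in> Hs r"
  shows "kop (ker_d mass (u t) (u2 t)) f k =
    \<i> * (wop (sw mass) (u t) (Bpow mass 1 f) k - Bpow mass 1 (wop (sw mass) (u t) f) k)
    + 2 * wop (sw mass) (u t) (Bpow mass 1 (wop (sw mass) (u t) f)) k"
  and "cnj_op (kop (ker_d mass (u t) (u2 t))) f k =
    - \<i> * (wop (sw mass) (u t) (Bpow mass 1 f) k - Bpow mass 1 (wop (sw mass) (u t) f) k)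
    + 2 * wop (sw mass) (u t) (Bpow mass 1 (wop (sw mass) (u t) f)) k"
  and "kop (ker_o mass (u t) (u2 t)) f k =
    - \<i> * (wop (sw mass) (u t) (Bpow mass 1 f) k + Bpow mass 1 (wop (sw mass) (u t) f) k)
    + 2 * wop (sw mass) (u t) (Bpow mass 1 (wop (sw mass) (u t) f)) k"
  and "cnj_op (kop (ker_o mass (u t) (u2 t))) f k =
    \<i> * (wop (sw mass) (u t) (Bpow mass 1 f) k + Bpow mass 1 (wop (sw mass) (u t) f) k)
    + 2 * wop (sw mass) (u t) (Bpow mass 1 (wop (sw mass) (u t) f)) k"
proof -
  have c: "wop (sw mass) (u t) (Bpow mass 1 (wop (sw mass) (u t) f)) = wop (sw mass) (u2 t) f"
    by (rule wop_composition[OF rapid_u _ assms]) (rule even_u, rule square[OF Hs_sobolev])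
  note k2 = kop_two_weights[OF _ sw_bounded(1) rapid_u rapid_u2 Hs_sobolev[OF assms]]
  note d = wop_sw_diff[OF rapid_u assms]
  have cd: "(\<lambda>k j. cnj (ker_d mass (u t) (u2 t) k j)) =
      (\<lambda>k j. of_real (sw_diff mass (k - j) j) * (- \<i> * u t (k - j)) + of_real (sw mass (k - j) j) * (2 * u2 t (k - j)))"
    by (simp add: ker_d_def real_u real_u2 fun_eq_iff)
  have co: "(\<lambda>k j. cnj (ker_o mass (u t) (u2 t) k j)) =
      (\<lambda>k j. of_real (sw_sum mass (k - j) j) * (\<i> * u t (k - j)) + of_real (sw mass (k - j) j) * (2 * u2 t (k - j)))"
    by (simp add: ker_o_def real_u real_u2 fun_eq_iff)
  show "kop (ker_d mass (u t) (u2 t)) f k =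
    \<i> * (wop (sw mass) (u t) (Bpow mass 1 f) k - Bpow mass 1 (wop (sw mass) (u t) f) k)
    + 2 * wop (sw mass) (u t) (Bpow mass 1 (wop (sw mass) (u t) f)) k"
    unfolding c ker_d_def[abs_def] k2[OF sw_bounded(2)] d ..
  show "kop (ker_o mass (u t) (u2 t)) f k =
    - \<i> * (wop (sw mass) (u t) (Bpow mass 1 f) k + Bpow mass 1 (wop (sw mass) (u t) f) k)
    + 2 * wop (sw mass) (u t) (Bpow mass 1 (wop (sw mass) (u t) f)) k"
    unfolding c ker_o_def[abs_def] k2[OF sw_bounded(3)] d ..
  have "cnj_op (kop (ker_d mass (u t) (u2 t))) f = kop (\<lambda>k j. cnj (ker_d mass (u t) (u2 t) k j)) f"
    by (rule cnj_op_kop) (rule ker_minus(1), rule even_u, rule even_u2)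
  then show "cnj_op (kop (ker_d mass (u t) (u2 t))) f k =
    - \<i> * (wop (sw mass) (u t) (Bpow mass 1 f) k - Bpow mass 1 (wop (sw mass) (u t) f) k)
    + 2 * wop (sw mass) (u t) (Bpow mass 1 (wop (sw mass) (u t) f)) k"
    unfolding cd c by (simp only: k2[OF sw_bounded(2)] d)
  have "cnj_op (kop (ker_o mass (u t) (u2 t))) f = kop (\<lambda>k j. cnj (ker_o mass (u t) (u2 t) k j)) f"
    by (rule cnj_op_kop) (rule ker_minus(2), rule even_u, rule even_u2)
  then show "cnj_op (kop (ker_o mass (u t) (u2 t))) f k =
    \<i> * (wop (sw mass) (u t) (Bpow mass 1 f) k + Bpow mass 1 (wop (sw mass) (u t) f) k)
    + 2 * wop (sw mass) (u t) (Bpow mass 1 (wop (sw mass) (u t) f)) k"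
    unfolding co c by (simp only: k2[OF sw_bounded(3)] d)
qed

text \<open>\<open>M t\<close> stands for multiplication by the potential; the factor 2 in its
  matrix cancels the one half in front of the perturbation, so that \<open>w\<close> generates the
  perturbation exactly.\<close>

theorem conjugates_coefficient_flow:
  assumes M: "\<And>t f k. M t f k = kop (\<lambda>k j. 2 * w t (k - j)) f k"
  shows "conjugates
    (\<lambda>t. op_exp (\<lambda>z. cscale (- \<i>) (op_times_mat (wop (sw mass) (u t)) \<sigma>4 z)))
    (\<lambda>t z. H0_op mass z +
       op_times_mat (\<lambda>f k. 1 / 2 * Bpow mass (- 1 / 2) (M t (Bpow mass (- 1 / 2) f)) k) \<sigma>4 z)
    (\<lambda>t z. H0_op mass z + matop (kop (ker_d mass (u t) (u2 t))) (kop (ker_o mass (u t) (u2 t)))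
       (\<lambda>f. - cnj_op (kop (ker_o mass (u t) (u2 t))) f) (\<lambda>f. - cnj_op (kop (ker_d mass (u t) (u2 t))) f) z)"
proof (rule conjugates_shear)
  fix t r z assume z: "z \<in> Hs2 r"
  then have z1: "fst z \<in> Hs r" and z2: "snd z \<in> Hs r" by (simp_all add: Hs2_iff)
  show "op_exp (\<lambda>z. cscale (- \<i>) (op_times_mat (wop (sw mass) (u t)) \<sigma>4 z)) z = shear \<i> t z"
    unfolding shear_def by (rule op_exp_nilpotent[OF X_add[OF z1 z2] X_cmult])
  have s3: "\<sigma>3 $ 1 $ 1 = 1" "\<sigma>3 $ 1 $ 2 = 0" "\<sigma>3 $ 2 $ 1 = 0" "\<sigma>3 $ 2 $ 2 = - 1"
    by (simp_all add: \<sigma>3_def vector_2)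
  have s4: "\<sigma>4 $ 1 $ 1 = 1" "\<sigma>4 $ 1 $ 2 = 1" "\<sigma>4 $ 2 $ 1 = - 1" "\<sigma>4 $ 2 $ 2 = - 1"
    by (simp_all add: \<sigma>4_def vector_2)
  have W: "1 / 2 * Bpow mass (- 1 / 2) (M t (Bpow mass (- 1 / 2) f)) k = wop (sw mass) (w t) f k" for f k
  proof -
    have "kop (\<lambda>k j. 2 * w t (k - j)) g k = 2 * kop (\<lambda>k j. w t (k - j)) g k" for g
      unfolding kop_def infsum_cmult_right'[symmetric] by (simp add: mult.assoc)
    then show ?thesis by (simp add: wop_sw_eq Bpow_eq M)
  qed
  have Wadd: "wop (sw mass) (w t) (\<lambda>k. fst z k + snd z k) = (\<lambda>k. wop (sw mass) (w t) (fst z) k + wop (sw mass) (w t) (snd z) k)"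
    by (rule wop_add[OF sw_bounded(1) rapid_w Hs_sobolev[OF z1] Hs_sobolev[OF z2]])
  show "H0_op mass z +
       op_times_mat (\<lambda>f k. 1 / 2 * Bpow mass (- 1 / 2) (M t (Bpow mass (- 1 / 2) f)) k) \<sigma>4 z = H_orig t z"
    unfolding W H_orig_def Wadd H0_op_def op_times_mat_def matop_def s3 s4
    by (simp add: prod_eq_iff fun_eq_iff)
  show "H0_op mass z + matop (kop (ker_d mass (u t) (u2 t))) (kop (ker_o mass (u t) (u2 t)))
       (\<lambda>f. - cnj_op (kop (ker_o mass (u t) (u2 t))) f) (\<lambda>f. - cnj_op (kop (ker_d mass (u t) (u2 t))) f) z = H_new t z"
    unfolding H_new_def H0_op_def op_times_mat_def matop_def s3
    by (simp only: prod_eq_iff fun_eq_iff fst_add snd_add fst_conv snd_conv plus_fun_apply fun_Compl_def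
      ker_d_op[OF z1] ker_d_op[OF z2]) (simp add: algebra_simps)
qed

end

section \<open>Fourier inversion on the torus\<close>

abbreviation tbox :: "(real ^ 'n) set" where
  "tbox \<equiv> cbox 0 (\<chi> i. 2 * pi)"

section \<open>Integrals of periodic functions over a period box\<close>

definition axis_periodic :: "(real ^ 'n \<Rightarrow> 'a) \<Rightarrow> bool" where
  "axis_periodic f \<longleftrightarrow> (\<forall>\<theta> i. f (\<theta> + axis i (2 * pi)) = f \<theta>)"

lemma axis_periodicD: "axis_periodic f \<Longrightarrow> f (\<theta> + axis i (2 * pi)) = f \<theta>"
  by (simp add: axis_periodic_def)

text \<open>The translated box is cut along the old face; the part that sticks out is moved back by
  one period and completes the remainder to the original box.\<close>

lemma integral_tbox_shift_axis_pos:
  fixes f :: "real ^ 'n \<Rightarrow> 'a::banach"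
  assumes cont: "continuous_on UNIV f" and per: "axis_periodic f" and a: "0 \<le> a" "a \<le> 2 * pi"
  shows "integral tbox (\<lambda>\<theta>. f (\<theta> + axis i a)) = integral tbox f"
proof -
  define c where "c = (axis i a :: real ^ 'n)"
  define e where "e = (axis i (2 * pi) :: real ^ 'n)"
  define q :: "real ^ 'n" where "q = (\<chi> l. if l = i then a else 2 * pi)"
  let ?p = "(\<chi> l. 2 * pi) :: real ^ 'n"
  have cn: "continuous_on S f" for S using cont continuous_on_subset by blast
  have int: "f integrable_on cbox x y" for x y by (rule integrable_continuous[OF cn])
  have k: "axis i 1 \<in> (Basis :: (real ^ 'n) set)" by (simp add: axis_in_Basis_iff)
  have in_axis: "x \<bullet> axis i 1 = x $ i" for x :: "real ^ 'n" by (simp add: inner_axis)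
  have nth: "c $ l = (if l = i then a else 0)" "e $ l = (if l = i then 2 * pi else 0)"
    "q $ l = (if l = i then a else 2 * pi)" for l
    by (simp_all add: c_def e_def q_def axis_def)
  have box: "x \<in> cbox u v \<longleftrightarrow> u $ i \<le> x $ i \<and> x $ i \<le> v $ i \<and> (\<forall>l. l \<noteq> i \<longrightarrow> u $ l \<le> x $ l \<and> x $ l \<le> v $ l)" for x u v :: "real ^ 'n"
    unfolding mem_box_cart by metis
  have S1: "cbox c (?p + c) \<inter> {x. x \<bullet> axis i 1 \<le> 2 * pi} = cbox c ?p"
    and S2: "cbox c (?p + c) \<inter> {x. x \<bullet> axis i 1 \<ge> 2 * pi} = cbox (0 + e) (q + e)"
    and S3: "tbox \<inter> {x. x \<bullet> axis i 1 \<le> a} = cbox 0 q"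
    and S4: "tbox \<inter> {x. x \<bullet> axis i 1 \<ge> a} = cbox c ?p"
    using a by (auto simp: set_eq_iff in_axis box nth)
  have sh: "integral (cbox (x + d) (y + d)) f = integral (cbox x y) (\<lambda>\<theta>. f (\<theta> + d))" for x y d
  proof -
    have "((f \<circ> (+) d) has_integral integral (cbox (x + d) (y + d)) f) (cbox x y)"
      unfolding has_integral_shift_cbox_iff using int by (rule integrable_integral)
    then show ?thesis by (simp add: o_def add.commute integral_unique)
  qed
  have fe: "f (\<theta> + e) = f \<theta>" for \<theta> unfolding e_def by (rule axis_periodicD[OF per])
  have "integral tbox (\<lambda>\<theta>. f (\<theta> + c)) = integral (cbox c (?p + c)) f"
    using sh[of 0 c ?p] by simp
  also have "\<dots> = integral (cbox c ?p) f + integral (cbox (0 + e) (q + e)) f"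
    using integral_split[OF int k, of c "?p + c" "2 * pi"] unfolding S1 S2 .
  also have "integral (cbox (0 + e) (q + e)) f = integral (cbox 0 q) f"
    unfolding sh fe ..
  also have "integral (cbox c ?p) f + integral (cbox 0 q) f = integral tbox f"
    using integral_split[OF int k, of 0 ?p a] unfolding S3 S4 by simp
  finally show ?thesis by (simp add: c_def)
qed

lemma axis_periodic_shift: "axis_periodic f \<Longrightarrow> axis_periodic (\<lambda>\<theta>. f (\<theta> + c))"
  unfolding axis_periodic_def by (metis add.assoc add.commute)

lemma continuous_on_shift: "continuous_on UNIV f \<Longrightarrow> continuous_on UNIV (\<lambda>\<theta>::'a::real_normed_vector. f (\<theta> + c))"
  by (rule continuous_on_compose2[of UNIV f]) (auto intro: continuous_intros)

lemma integral_tbox_shift_axis: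
  fixes f :: "real ^ 'n \<Rightarrow> 'a::banach"
  assumes cont: "continuous_on UNIV f" and per: "axis_periodic f" and a: "\<bar>a\<bar> \<le> 2 * pi"
  shows "integral tbox (\<lambda>\<theta>. f (\<theta> + axis i a)) = integral tbox f"
proof (cases "a \<ge> 0")
  case True
  then show ?thesis using integral_tbox_shift_axis_pos[OF cont per] a by simp
next
  case False
  have "f (\<theta> + axis i a) = f (\<theta> + axis i (a + 2 * pi))" for \<theta>
  proof -
    have "\<theta> + axis i (a + 2 * pi) = (\<theta> + axis i a) + axis i (2 * pi)"
      by (simp add: vec_eq_iff axis_def)
    then show ?thesis by (simp only: axis_periodicD[OF per])
  qed
  then show ?thesis using integral_tbox_shift_axis_pos[OF cont per, of "a + 2 * pi" i] a False by simp
qed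

lemma vec_eq_sum_axis: "v = (\<Sum>i\<in>UNIV. axis i (v $ i))" for v :: "'a::comm_monoid_add ^ 'n"
  by (simp add: vec_eq_iff axis_def)

lemma integral_tbox_shift:
  fixes f :: "real ^ 'n \<Rightarrow> 'a::banach"
  assumes cont: "continuous_on UNIV f" and per: "axis_periodic f" and v: "\<And>i. \<bar>v $ i\<bar> \<le> 2 * pi"
  shows "integral tbox (\<lambda>\<theta>. f (\<theta> + v)) = integral tbox f"
proof -
  have "integral tbox (\<lambda>\<theta>. f (\<theta> + (\<Sum>i\<in>S. axis i (v $ i)))) = integral tbox f" if "finite S" for S
    using that
  proof induction
    case (insert i S)
    let ?s = "\<Sum>i\<in>S. axis i (v $ i)"
    have "integral tbox (\<lambda>\<theta>. f (\<theta> + axis i (v $ i) + ?s)) = integral tbox (\<lambda>\<theta>. f (\<theta> + ?s))"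
      by (rule integral_tbox_shift_axis[OF continuous_on_shift[OF cont] axis_periodic_shift[OF per] v])
    then show ?case using insert by (simp add: add.assoc)
  qed simp
  from this[of UNIV] show ?thesis by (simp add: vec_eq_sum_axis[symmetric])
qed

lemma axis_periodic_int_axis:
  assumes "axis_periodic f"
  shows "f (\<theta> + axis i (2 * pi * of_int n)) = f \<theta>"
proof -
  have nat: "f (\<theta> + axis i (2 * pi * real m)) = f \<theta>" for m \<theta>
  proof (induction m)
    case (Suc m)
    have "\<theta> + axis i (2 * pi * real (Suc m)) = (\<theta> + axis i (2 * pi * real m)) + axis i (2 * pi)"
      by (simp add: vec_eq_iff axis_def algebra_simps)
    then show ?case by (simp only: axis_periodicD[OF assms] Suc)
  qed (simp add: axis_def zero_vec_def[symmetric])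
  show ?thesis
  proof (cases "n \<ge> 0")
    case True
    then show ?thesis using nat[of \<theta> "nat n"] by simp
  next
    case False
    have "(\<theta> + axis i (2 * pi * of_int n)) + axis i (2 * pi * real (nat (- n))) = \<theta>"
      using False by (simp add: vec_eq_iff axis_def algebra_simps)
    then show ?thesis using nat[of "\<theta> + axis i (2 * pi * of_int n)" "nat (- n)"] by (simp only:)
  qed
qed

section \<open>Integer frequency vectors\<close>

definition kv :: "int ^ 'n \<Rightarrow> real ^ 'n" where
  "kv k = (\<chi> i. of_int (k $ i))"

lemma kv_minus: "kv (- k) = - kv k" and kv_diff: "kv (k - l) = kv k - kv l" and kv_add: "kv (k + l) = kv k + kv l"
  and kv_zero: "kv 0 = 0"
  by (simp_all add: kv_def vec_eq_iff)

lemma axis_periodic_int: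
  assumes "axis_periodic f"
  shows "f (\<theta> + (2 * pi) *\<^sub>R kv n) = f \<theta>"
proof -
  have "f (\<theta> + (\<Sum>i\<in>S. axis i (2 * pi * of_int (n $ i)))) = f \<theta>" if "finite S" for S
    using that
  proof induction
    case (insert i S)
    have "\<theta> + (\<Sum>i\<in>insert i S. axis i (2 * pi * of_int (n $ i))) =
        (\<theta> + (\<Sum>i\<in>S. axis i (2 * pi * of_int (n $ i)))) + axis i (2 * pi * of_int (n $ i))"
      using insert by (simp add: add_ac)
    then show ?case by (simp only: axis_periodic_int_axis[OF assms] insert.IH)
  qed simp
  moreover have "(2 * pi) *\<^sub>R kv n = (\<Sum>i\<in>UNIV. axis i (2 * pi * of_int (n $ i)))"
    by (simp add: vec_eq_iff axis_def kv_def)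
  ultimately show ?thesis by simp
qed

lemma cis_kv_axis_periodic: "axis_periodic (\<lambda>\<theta>. cis (kv k \<bullet> \<theta>))"
  unfolding axis_periodic_def
proof (intro allI)
  fix \<theta> i
  have "kv k \<bullet> (\<theta> + axis i (2 * pi)) = kv k \<bullet> \<theta> + 2 * pi * of_int (k $ i)"
    by (simp add: inner_add_right inner_axis kv_def)
  then show "cis (kv k \<bullet> (\<theta> + axis i (2 * pi))) = cis (kv k \<bullet> \<theta>)"
    by (simp add: cis_mult[symmetric] cis_multiple_2pi)
qed

lemma continuous_on_cis_kv: "continuous_on S (\<lambda>\<theta>. cis (k \<bullet> \<theta>))"
  by (intro continuous_intros)

text \<open>A translation by \<open>pi / k $ i\<close> along an axis with
  \<open>k $ i \<noteq> 0\<close> changes the sign of the integrand but not the integral.\<close>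

lemma integral_tbox_cis:
  "integral tbox (\<lambda>\<theta>. cis (kv k \<bullet> \<theta>)) = (if k = 0 then of_real ((2 * pi) ^ CARD('n)) else 0)"
  for k :: "int ^ 'n"
proof (cases "k = 0")
  case True
  have "measure lborel (tbox :: (real ^ 'n) set) = (\<Prod>i\<in>(UNIV :: 'n set). 2 * pi)"
    by (subst content_cbox_cart) (auto simp: interval_ne_empty_cart)
  then show ?thesis using True by (simp add: kv_zero scaleR_conv_of_real)
next
  case False
  then obtain i where i: "k $ i \<noteq> 0" by (auto simp: vec_eq_iff)
  let ?a = "pi / of_int (k $ i)" and ?I = "integral tbox (\<lambda>\<theta>. cis (kv k \<bullet> \<theta>))"
  have "1 \<le> \<bar>real_of_int (k $ i)\<bar>" using i by linarith
  then have a: "\<bar>?a\<bar> \<le> 2 * pi" by (simp add: abs_divide divide_le_eq)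
  have "kv k \<bullet> (\<theta> + axis i ?a) = kv k \<bullet> \<theta> + pi" for \<theta>
    using i by (simp add: inner_add_right inner_axis kv_def)
  then have eq: "cis (kv k \<bullet> (\<theta> + axis i ?a)) = - cis (kv k \<bullet> \<theta>)" for \<theta>
    by (simp add: cis_mult[symmetric])
  have "?I = integral tbox (\<lambda>\<theta>. cis (kv k \<bullet> (\<theta> + axis i ?a)))"
    by (rule integral_tbox_shift_axis[OF continuous_on_cis_kv cis_kv_axis_periodic a, symmetric])
  also have "\<dots> = - ?I" unfolding eq by simp
  finally show ?thesis using False by simp
qed

section \<open>Uniqueness of Fourier coefficients and inversion\<close>

definition torus_coeff :: "(real ^ 'n \<Rightarrow> complex) \<Rightarrow> int ^ 'n \<Rightarrow> complex" where
  "torus_coeff f k = of_real (1 / (2 * pi) ^ CARD('n)) * integral tbox (\<lambda>\<theta>. f \<theta> * cis (- (kv k \<bullet> \<theta>)))"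

text \<open>Orthogonality to all trigonometric polynomials. Such a function will turn out to be
  zero, which is the uniqueness behind Fourier inversion.\<close>

definition annihilating :: "(real ^ 'n \<Rightarrow> complex) \<Rightarrow> bool" where
  "annihilating g \<longleftrightarrow> continuous_on UNIV g \<and> (\<forall>k. integral tbox (\<lambda>\<theta>. g \<theta> * cis (kv k \<bullet> \<theta>)) = 0)"

text \<open>Realizes the torus as a compact subset of complex space, a product of unit circles, on
  which polynomials are trigonometric polynomials and Stone--Weierstrass applies.\<close>

definition etor :: "real ^ 'n \<Rightarrow> complex ^ 'n" where
  "etor \<theta> = (\<chi> i. cis (\<theta> $ i))"

lemma continuous_on_etor: "continuous_on S etor"
  unfolding etor_def by (intro continuous_intros)

text \<open>Multiplication by trigonometric polynomials preserves annihilation; this property is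
  visibly closed under products.\<close>

lemma annihilating_real_polynomial:
  fixes p :: "complex ^ 'n \<Rightarrow> real"
  assumes "real_polynomial_function p"
  shows "annihilating g \<Longrightarrow> annihilating (\<lambda>\<theta>. g \<theta> * of_real (p (etor \<theta>)))"
  using assms
proof (induction p arbitrary: g rule: real_polynomial_function.induct)
  case (linear h)
  have g: "continuous_on S g" for S
    using linear.prems continuous_on_subset unfolding annihilating_def by blast
  have hc: "continuous_on S (\<lambda>\<theta>. h (etor \<theta>))" for S
    using linear.hyps linear_continuous_on continuous_on_compose2[OF _ continuous_on_etor, of UNIV h S] by blast
  have lin: "linear h" using linear.hyps by (simp add: bounded_linear.linear)
  have hE: "of_real (h (etor \<theta>)) = (\<Sum>i\<in>UNIV. (of_real (h (axis i 1)) / 2 - \<i> * of_real (h (axis i \<i>)) / 2) * cis (kv (axis i 1) \<bullet> \<theta>) +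
      (of_real (h (axis i 1)) / 2 + \<i> * of_real (h (axis i \<i>)) / 2) * cis (kv (axis i (-1)) \<bullet> \<theta>))" for \<theta> :: "real ^ 'n"
  proof -
    have "etor \<theta> = (\<Sum>i\<in>UNIV. cos (\<theta> $ i) *\<^sub>R axis i 1 + sin (\<theta> $ i) *\<^sub>R axis i \<i>)"
      unfolding vec_eq_iff
    proof
      fix l
      have "(\<Sum>i\<in>UNIV. cos (\<theta> $ i) *\<^sub>R axis i 1 + sin (\<theta> $ i) *\<^sub>R axis i \<i>) $ l =
        (\<Sum>i\<in>UNIV. if i = l then cos (\<theta> $ i) *\<^sub>R 1 + sin (\<theta> $ i) *\<^sub>R \<i> else 0)"
        unfolding sum_component by (intro sum.cong) (auto simp: axis_def)
      then show "etor \<theta> $ l = (\<Sum>i\<in>UNIV. cos (\<theta> $ i) *\<^sub>R axis i 1 + sin (\<theta> $ i) *\<^sub>R axis i \<i>) $ l"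
        by (simp add: etor_def complex_eq_iff)
    qed
    then have "h (etor \<theta>) = (\<Sum>i\<in>UNIV. cos (\<theta> $ i) * h (axis i 1) + sin (\<theta> $ i) * h (axis i \<i>))"
      using lin by (simp add: linear_sum linear_add linear_scale)
    moreover have "of_real (cos (\<theta> $ i) * a + sin (\<theta> $ i) * b) =
      (of_real a / 2 - \<i> * of_real b / 2) * cis (kv (axis i 1) \<bullet> \<theta>) + (of_real a / 2 + \<i> * of_real b / 2) * cis (kv (axis i (-1)) \<bullet> \<theta>)" for i a b
    proof -
      have "kv (axis i 1) = (axis i 1 :: real ^ 'n)" "kv (axis i (-1)) = (axis i (-1) :: real ^ 'n)"
        by (auto simp: kv_def vec_eq_iff axis_def)
      then have "kv (axis i 1) \<bullet> \<theta> = \<theta> $ i" "kv (axis i (-1)) \<bullet> \<theta> = - (\<theta> $ i)"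
        by (simp_all add: inner_axis')
      then show ?thesis by (simp add: complex_eq_iff field_simps)
    qed
    ultimately show ?thesis by simp
  qed
  have "integral tbox (\<lambda>\<theta>. g \<theta> * of_real (h (etor \<theta>)) * cis (kv k \<bullet> \<theta>)) = 0" for k
  proof -
    have 0: "((\<lambda>\<theta>. g \<theta> * cis (kv m \<bullet> \<theta>)) has_integral 0) tbox" for m
    proof -
      have "(\<lambda>\<theta>. g \<theta> * cis (kv m \<bullet> \<theta>)) integrable_on tbox"
        by (intro integrable_continuous continuous_intros g)
      moreover have "integral tbox (\<lambda>\<theta>. g \<theta> * cis (kv m \<bullet> \<theta>)) = 0"
        using linear.prems by (simp add: annihilating_def)
      ultimately show ?thesis
        using integrable_integral by force
    qed
    have "((\<lambda>\<theta>. \<Sum>i\<in>UNIV. (of_real (h (axis i 1)) / 2 - \<i> * of_real (h (axis i \<i>)) / 2) * (g \<theta> * cis (kv (axis i 1 + k) \<bullet> \<theta>)) +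
      (of_real (h (axis i 1)) / 2 + \<i> * of_real (h (axis i \<i>)) / 2) * (g \<theta> * cis (kv (axis i (-1) + k) \<bullet> \<theta>)))
      has_integral (\<Sum>i\<in>(UNIV :: 'n set). (of_real (h (axis i 1)) / 2 - \<i> * of_real (h (axis i \<i>)) / 2) * 0 +
      (of_real (h (axis i 1)) / 2 + \<i> * of_real (h (axis i \<i>)) / 2) * 0)) tbox"
      by (intro has_integral_sum has_integral_add has_integral_mult_right 0) simp
    moreover have "g \<theta> * of_real (h (etor \<theta>)) * cis (kv k \<bullet> \<theta>) =
      (\<Sum>i\<in>UNIV. (of_real (h (axis i 1)) / 2 - \<i> * of_real (h (axis i \<i>)) / 2) * (g \<theta> * cis (kv (axis i 1 + k) \<bullet> \<theta>)) +
      (of_real (h (axis i 1)) / 2 + \<i> * of_real (h (axis i \<i>)) / 2) * (g \<theta> * cis (kv (axis i (-1) + k) \<bullet> \<theta>)))" for \<theta>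
    proof -
      have c: "cis (kv (l + k) \<bullet> \<theta>) = cis (kv l \<bullet> \<theta>) * cis (kv k \<bullet> \<theta>)" for l
        by (simp add: kv_add inner_add_left cis_mult)
      show ?thesis
        unfolding hE c sum_distrib_left sum_distrib_right by (intro sum.cong refl) (simp only: distrib_left distrib_right mult_ac)
    qed
    ultimately show ?thesis by (simp add: integral_unique)
  qed
  then show ?case
    unfolding annihilating_def using g hc by (auto intro!: continuous_intros)
next
  case (const c)
  have "integral tbox (\<lambda>\<theta>. g \<theta> * of_real c * cis (kv k \<bullet> \<theta>)) = of_real c * integral tbox (\<lambda>\<theta>. g \<theta> * cis (kv k \<bullet> \<theta>))" for k
    by (subst integral_mult_right[symmetric]) (simp add: mult_ac)
  then show ?case
    using const unfolding annihilating_def by (auto intro!: continuous_intros)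
next
  case (add p q)
  have A: "annihilating (\<lambda>\<theta>. g \<theta> * of_real (p (etor \<theta>)))" "annihilating (\<lambda>\<theta>. g \<theta> * of_real (q (etor \<theta>)))"
    using add by blast+
  have int: "(\<lambda>\<theta>. f \<theta> * cis (kv k \<bullet> \<theta>)) integrable_on tbox" if "annihilating f" for f k
    using that continuous_on_subset unfolding annihilating_def by (intro integrable_continuous continuous_intros) blast
  have "integral tbox (\<lambda>\<theta>. g \<theta> * of_real (p (etor \<theta>) + q (etor \<theta>)) * cis (kv k \<bullet> \<theta>)) = 0" for k
    using A integral_add[OF int[OF A(1), of k] int[OF A(2), of k]] unfolding annihilating_def by (simp add: algebra_simps)
  moreover have "continuous_on UNIV (\<lambda>\<theta>. g \<theta> * of_real (p (etor \<theta>) + q (etor \<theta>)))"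
    using A continuous_on_add[of UNIV "\<lambda>\<theta>. g \<theta> * of_real (p (etor \<theta>))" "\<lambda>\<theta>. g \<theta> * of_real (q (etor \<theta>))"]
    unfolding annihilating_def by (simp add: distrib_left)
  ultimately show ?case unfolding annihilating_def by blast
next
  case (mult p q)
  have "annihilating (\<lambda>\<theta>. g \<theta> * of_real (p (etor \<theta>)) * of_real (q (etor \<theta>)))"
    using mult by blast
  then show ?case by (simp add: mult.assoc)
qed

lemma etor_eq_imp:
  assumes "axis_periodic f" "etor \<theta> = etor \<theta>'"
  shows "f \<theta> = f \<theta>'"
proof -
  have "\<exists>n::int. \<theta> $ i = \<theta>' $ i + 2 * pi * n" for i
  proof -
    have "cis (\<theta> $ i) = cis (\<theta>' $ i)"
      using assms(2) by (simp add: etor_def vec_eq_iff)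
    then have "sin (\<theta> $ i) = sin (\<theta>' $ i) \<and> cos (\<theta> $ i) = cos (\<theta>' $ i)"
      by (simp add: complex_eq_iff)
    then show ?thesis using sin_cos_eq_iff by blast
  qed
  then obtain n where n: "\<And>i. \<theta> $ i = \<theta>' $ i + 2 * pi * of_int (n i)" by metis
  have "\<theta> = \<theta>' + (2 * pi) *\<^sub>R kv (\<chi> i. n i)"
    using n by (simp add: vec_eq_iff kv_def)
  then show ?thesis using axis_periodic_int[OF assms(1)] by simp
qed

lemma etor_in_tbox: "\<exists>\<theta>'\<in>tbox. etor \<theta>' = etor \<theta>"
proof
  define n where "n = (\<lambda>i. \<lfloor>\<theta> $ i / (2 * pi)\<rfloor>)"
  define \<theta>' where "\<theta>' = \<theta> - (2 * pi) *\<^sub>R kv (\<chi> i. n i)"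
  have comp: "\<theta>' $ i = \<theta> $ i - 2 * pi * of_int (n i)" for i
    by (simp add: \<theta>'_def kv_def)
  show "\<theta>' \<in> tbox"
    unfolding mem_box_cart
  proof
    fix i
    have "of_int (n i) \<le> \<theta> $ i / (2 * pi)" "\<theta> $ i / (2 * pi) < of_int (n i) + 1"
      unfolding n_def by linarith+
    then have "of_int (n i) * (2 * pi) \<le> \<theta> $ i" "\<theta> $ i < (of_int (n i) + 1) * (2 * pi)"
      by (simp_all only: pos_le_divide_eq[of "2 * pi"] pos_divide_less_eq[of "2 * pi"] pi_gt_zero mult_pos_pos zero_less_numeral)
    then show "0 $ i \<le> \<theta>' $ i \<and> \<theta>' $ i \<le> (\<chi> i. 2 * pi) $ i"
      by (simp add: comp algebra_simps)
  qed
  have "cis (\<theta> $ i - 2 * pi * of_int (n i)) = cis (\<theta> $ i)" for i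
  proof -
    have "cis (\<theta> $ i) = cis (\<theta> $ i - 2 * pi * of_int (n i)) * cis (2 * pi * of_int (n i))"
      unfolding cis_mult by simp
    then show ?thesis by (simp add: cis_multiple_2pi)
  qed
  then show "etor \<theta>' = etor \<theta>"
    by (simp add: etor_def comp)
qed

text \<open>Periodicity makes \<open>h\<close> well defined. Its graph over the torus is a
  continuous image of the compact box, hence closed, and a closed graph with compact range forces
  continuity.\<close>

lemma lift_to_torus:
  fixes g :: "real ^ 'n \<Rightarrow> complex"
  assumes cont: "continuous_on UNIV g" and per: "axis_periodic g"
  obtains h where "continuous_on (etor ` tbox) h" "\<And>\<theta>. h (etor \<theta>) = g \<theta>"
proof -
  define h where "h = (\<lambda>z. g (SOME \<theta>. etor \<theta> = z))"
  have h: "h (etor \<theta>) = g \<theta>" for \<theta>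
    unfolding h_def by (rule etor_eq_imp[OF per]) (rule someI[where P = "\<lambda>\<theta>'. etor \<theta>' = etor \<theta>"], simp)
  have c: "continuous_on tbox g" using cont continuous_on_subset by blast
  have "continuous_on (etor ` tbox) h"
  proof (rule continuous_from_closed_graph)
    show "compact (g ` tbox)" by (rule compact_continuous_image[OF c compact_cbox])
    show "h \<in> etor ` tbox \<rightarrow> g ` tbox" using h by auto
    have "(\<lambda>x. (x, h x)) ` etor ` tbox = (\<lambda>\<theta>. (etor \<theta>, g \<theta>)) ` tbox"
      by (simp add: image_image h)
    moreover have "compact ((\<lambda>\<theta>. (etor \<theta>, g \<theta>)) ` tbox)"
      by (intro compact_continuous_image continuous_on_Pair continuous_on_etor c compact_cbox)
    ultimately show "closed ((\<lambda>x. (x, h x)) ` etor ` tbox)"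
      using compact_imp_closed by simp
  qed
  then show ?thesis using that h by blast
qed

text \<open>The real and imaginary parts of \<open>g\<close> are approximated by polynomials on the
  torus, so \<open>g\<close> is orthogonal to both. Together this says that the integral of its
  squared modulus vanishes.\<close>

lemma annihilating_eq_0:
  fixes g :: "real ^ 'n \<Rightarrow> complex"
  assumes ann: "annihilating g" and per: "axis_periodic g"
  shows "g \<theta> = 0"
proof -
  have cont: "continuous_on S g" for S
    using ann continuous_on_subset unfolding annihilating_def by blast
  obtain h where h: "continuous_on (etor ` tbox) h" "\<And>\<theta>. h (etor \<theta>) = g \<theta>"
    using lift_to_torus[OF cont per] by blast
  have cpt: "compact (etor ` (tbox :: (real ^ 'n) set))"
    by (rule compact_continuous_image[OF continuous_on_etor compact_cbox])
  have int_g: "(\<lambda>\<theta>. norm (g \<theta>)) integrable_on tbox"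
    by (intro integrable_continuous continuous_intros cont)
  define I where "I = integral tbox (\<lambda>\<theta>. norm (g \<theta>))"
  have I: "0 \<le> I" unfolding I_def by (rule integral_nonneg[OF int_g]) simp
  have key: "integral tbox (\<lambda>\<theta>. g \<theta> * of_real (r (h (etor \<theta>)))) = 0"
    if r: "continuous_on UNIV r" for r :: "complex \<Rightarrow> real"
  proof -
    have cr: "continuous_on (etor ` tbox) (\<lambda>z. r (h z))"
      by (rule continuous_on_compose2[OF r h(1)]) simp
    have cg: "continuous_on tbox (\<lambda>\<theta>. r (h (etor \<theta>)))"
      unfolding h(2) by (rule continuous_on_compose2[OF r cont]) simp
    have le: "norm (integral tbox (\<lambda>\<theta>. g \<theta> * of_real (r (h (etor \<theta>))))) \<le> e * I" if "e > 0" for e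
    proof -
      obtain p where p: "real_polynomial_function p" "\<And>x. x \<in> etor ` tbox \<Longrightarrow> \<bar>r (h x) - p x\<bar> < e"
        using Stone_Weierstrass_real_polynomial_function[OF cpt cr \<open>e > 0\<close>] by blast
      have ap: "annihilating (\<lambda>\<theta>. g \<theta> * of_real (p (etor \<theta>)))"
        by (rule annihilating_real_polynomial[OF p(1) ann])
      then have cp: "continuous_on tbox (\<lambda>\<theta>. g \<theta> * of_real (p (etor \<theta>)))"
        using continuous_on_subset unfolding annihilating_def by blast
      have "integral tbox (\<lambda>\<theta>. g \<theta> * of_real (p (etor \<theta>)) * cis (kv 0 \<bullet> \<theta>)) = 0"
        using ap unfolding annihilating_def by blast
      then have z: "integral tbox (\<lambda>\<theta>. g \<theta> * of_real (p (etor \<theta>))) = 0" by (simp add: kv_zero)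
      have i1: "(\<lambda>\<theta>. g \<theta> * of_real (r (h (etor \<theta>)))) integrable_on tbox"
        by (intro integrable_continuous continuous_intros cont cg)
      have i2: "(\<lambda>\<theta>. g \<theta> * of_real (p (etor \<theta>))) integrable_on tbox"
        by (rule integrable_continuous[OF cp])
      have "integral tbox (\<lambda>\<theta>. g \<theta> * of_real (r (h (etor \<theta>)))) =
          integral tbox (\<lambda>\<theta>. g \<theta> * of_real (r (h (etor \<theta>))) - g \<theta> * of_real (p (etor \<theta>)))"
        using integral_diff[OF i1 i2] z by simp
      also have "norm \<dots> \<le> integral tbox (\<lambda>\<theta>. e * norm (g \<theta>))"
      proof (rule integral_norm_bound_integral)
        show "(\<lambda>\<theta>. g \<theta> * of_real (r (h (etor \<theta>))) - g \<theta> * of_real (p (etor \<theta>))) integrable_on tbox"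
          by (rule integrable_diff[OF i1 i2])
        show "(\<lambda>\<theta>. e * norm (g \<theta>)) integrable_on tbox"
          using integrable_cmul[OF int_g, of e] by simp
        fix \<theta> :: "real ^ 'n" assume "\<theta> \<in> tbox"
        then have "\<bar>r (h (etor \<theta>)) - p (etor \<theta>)\<bar> \<le> e"
          using p(2)[of "etor \<theta>"] by force
        then have "norm (g \<theta>) * \<bar>r (h (etor \<theta>)) - p (etor \<theta>)\<bar> \<le> norm (g \<theta>) * e"
          by (intro mult_left_mono) auto
        then show "norm (g \<theta> * of_real (r (h (etor \<theta>))) - g \<theta> * of_real (p (etor \<theta>))) \<le> e * norm (g \<theta>)"
          by (simp only: right_diff_distrib[symmetric] of_real_diff[symmetric] norm_mult norm_of_real mult.commute)
      qed
      also have "\<dots> = e * I" unfolding I_def by simp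
      finally show ?thesis .
    qed
    have "norm (integral tbox (\<lambda>\<theta>. g \<theta> * of_real (r (h (etor \<theta>))))) \<le> 0 + e" if "e > 0" for e
    proof -
      \<comment> \<open>Dividing by \<open>I + 1\<close> avoids a separate case for
        \<open>I = 0\<close>.\<close>
      have "e / (I + 1) * I \<le> e" using I that by (simp add: field_simps)
      moreover have "e / (I + 1) > 0" using I that by simp
      ultimately show ?thesis using le[of "e / (I + 1)"] by linarith
    qed
    then have "norm (integral tbox (\<lambda>\<theta>. g \<theta> * of_real (r (h (etor \<theta>))))) \<le> 0"
      by (rule field_le_epsilon)
    then show ?thesis by simp
  qed
  have i1: "(\<lambda>\<theta>. g \<theta> * of_real (Re (g \<theta>))) integrable_on tbox" and i2: "(\<lambda>\<theta>. \<i> * (g \<theta> * of_real (Im (g \<theta>)))) integrable_on tbox"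
    by (intro integrable_continuous continuous_intros cont)+
  have "integral tbox (\<lambda>\<theta>. g \<theta> * of_real (Re (g \<theta>)) - \<i> * (g \<theta> * of_real (Im (g \<theta>)))) = 0"
    using key[of Re] key[of Im] integral_diff[OF i1 i2] unfolding h(2)
    by (simp add: continuous_on_Re continuous_on_Im)
  moreover have "g \<theta> * of_real (Re (g \<theta>)) - \<i> * (g \<theta> * of_real (Im (g \<theta>))) = of_real ((norm (g \<theta>))\<^sup>2)" for \<theta>
  proof -
    have "(norm (g \<theta>))\<^sup>2 = Re (g \<theta>) * Re (g \<theta>) + Im (g \<theta>) * Im (g \<theta>)"
      by (simp add: cmod_power2 power2_eq_square[of "Re (g \<theta>)"] power2_eq_square[of "Im (g \<theta>)"])
    then show ?thesis by (simp add: complex_eq_iff)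
  qed
  ultimately have 0: "integral tbox (\<lambda>\<theta>. complex_of_real ((norm (g \<theta>))\<^sup>2)) = 0" by simp
  have "((\<lambda>\<theta>. complex_of_real ((norm (g \<theta>))\<^sup>2)) has_integral complex_of_real (integral tbox (\<lambda>\<theta>. (norm (g \<theta>))\<^sup>2))) tbox"
    by (intro has_integral_of_real integrable_integral integrable_continuous continuous_intros cont)
  then have "complex_of_real (integral tbox (\<lambda>\<theta>. (norm (g \<theta>))\<^sup>2)) = 0"
    using integral_unique[OF \<open>(_ has_integral _) tbox\<close>] 0 by simp
  then have int0: "integral tbox (\<lambda>\<theta>. (norm (g \<theta>))\<^sup>2) = 0" by simp
  have ne: "box (0 :: real ^ 'n) (\<chi> i. 2 * pi) \<noteq> {}"
    by (simp add: interval_ne_empty_cart)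
  have c2: "continuous_on tbox (\<lambda>\<theta>. (norm (g \<theta>))\<^sup>2)"
    by (intro continuous_intros cont)
  have "integral tbox (\<lambda>\<theta>. (norm (g \<theta>))\<^sup>2) = 0 \<longleftrightarrow> (\<forall>\<theta>\<in>tbox. (norm (g \<theta>))\<^sup>2 = 0)"
    by (rule integral_cbox_eq_0_iff[OF c2 ne]) simp
  then have zero: "(norm (g \<theta>))\<^sup>2 = 0" if "\<theta> \<in> tbox" for \<theta>
    using that int0 by blast
  obtain \<theta>' where "\<theta>' \<in> tbox" "etor \<theta>' = etor \<theta>" using etor_in_tbox by blast
  then show ?thesis using zero[of \<theta>'] etor_eq_imp[OF per, of \<theta>' \<theta>] by simp
qed

text \<open>The absolutely convergent series is continuous with the same coefficients as
  \<open>f\<close>, so the difference is annihilating and vanishes.\<close>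

lemma torus_fourier_inversion:
  fixes f :: "real ^ 'n \<Rightarrow> complex"
  assumes cont: "continuous_on UNIV f" and per: "axis_periodic f"
    and sum: "(\<lambda>k. norm (torus_coeff f k)) summable_on UNIV"
  shows "f \<theta> = (\<Sum>\<^sub>\<infinity>k. torus_coeff f k * cis (kv k \<bullet> \<theta>))"
proof -
  let ?S = "\<lambda>\<theta>. \<Sum>\<^sub>\<infinity>k. torus_coeff f k * cis (kv k \<bullet> \<theta>)"
  define g where "g = (\<lambda>\<theta>. f \<theta> - ?S \<theta>)"
  have "uniform_limit UNIV (\<lambda>X \<theta>. \<Sum>k\<in>X. torus_coeff f k * cis (kv k \<bullet> \<theta>)) ?S (finite_subsets_at_top UNIV)"
    by (rule Weierstrass_m_test_general[OF _ sum]) (simp add: norm_mult)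
  then have Sc: "continuous_on UNIV ?S"
    by (rule uniform_limit_theorem[rotated]) (auto intro!: always_eventually continuous_intros)
  have gc: "continuous_on UNIV g"
    unfolding g_def by (intro continuous_intros cont Sc)
  have gp: "axis_periodic g"
    unfolding g_def by (simp add: axis_periodic_def axis_periodicD[OF per] axis_periodicD[OF cis_kv_axis_periodic])
  have "integral tbox (\<lambda>\<theta>. g \<theta> * cis (kv l \<bullet> \<theta>)) = 0" for l
  proof -
    have e: "?S \<theta> * cis (kv l \<bullet> \<theta>) = (\<Sum>\<^sub>\<infinity>k. torus_coeff f k * cis (kv (k + l) \<bullet> \<theta>))" for \<theta>
      by (simp add: infsum_cmult_left'[symmetric] kv_add inner_add_left cis_mult[symmetric] mult.assoc)
    have "((\<lambda>k. integral tbox (\<lambda>\<theta>. torus_coeff f k * cis (kv (k + l) \<bullet> \<theta>))) has_sum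
        integral tbox (\<lambda>\<theta>. \<Sum>\<^sub>\<infinity>k. torus_coeff f k * cis (kv (k + l) \<bullet> \<theta>))) UNIV"
      by (rule integral_infsum[OF _ _ sum]) (auto intro!: continuous_intros simp: norm_mult)
    moreover have "integral tbox (\<lambda>\<theta>. torus_coeff f k * cis (kv (k + l) \<bullet> \<theta>)) =
        (if k = - l then torus_coeff f k * of_real ((2 * pi) ^ CARD('n)) else 0)" for k
      by (simp add: integral_tbox_cis eq_neg_iff_add_eq_0)
    ultimately have "integral tbox (\<lambda>\<theta>. ?S \<theta> * cis (kv l \<bullet> \<theta>)) =
        (\<Sum>\<^sub>\<infinity>k. if k = - l then torus_coeff f k * of_real ((2 * pi) ^ CARD('n)) else 0)"
      unfolding e by (simp add: infsumI)
    also have "\<dots> = (\<Sum>\<^sub>\<infinity>k\<in>{- l}. torus_coeff f k * of_real ((2 * pi) ^ CARD('n)))"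
      by (rule infsum_cong_neutral) auto
    also have "\<dots> = integral tbox (\<lambda>\<theta>. f \<theta> * cis (kv l \<bullet> \<theta>))"
      by (simp add: torus_coeff_def kv_minus)
    finally have "integral tbox (\<lambda>\<theta>. ?S \<theta> * cis (kv l \<bullet> \<theta>)) = integral tbox (\<lambda>\<theta>. f \<theta> * cis (kv l \<bullet> \<theta>))" .
    moreover have "(\<lambda>\<theta>. p \<theta> * cis (kv l \<bullet> \<theta>)) integrable_on tbox" if "continuous_on UNIV p" for p
      by (rule integrable_continuous, rule continuous_on_mult[OF continuous_on_subset[OF that subset_UNIV] continuous_on_cis_kv])
    note this[OF cont] this[OF Sc]
    ultimately show ?thesis
      unfolding g_def left_diff_distrib by (simp add: integral_diff)
  qed
  then have "annihilating g" using gc by (simp add: annihilating_def)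
  then have "g \<theta> = 0" by (rule annihilating_eq_0[OF _ gp])
  then show ?thesis by (simp add: g_def)
qed

section \<open>Fourier coefficients of the potential\<close>

text \<open>Morera's theorem after exchanging the contour integral with the parameter integral.\<close>

lemma holomorphic_on_parameter_integral:
  fixes g :: "complex \<Rightarrow> 'a::euclidean_space \<Rightarrow> complex"
  assumes S: "open S"
    and hol: "\<And>\<theta>. \<theta> \<in> cbox a b \<Longrightarrow> (\<lambda>\<zeta>. g \<zeta> \<theta>) holomorphic_on S"
    and cont: "continuous_on (S \<times> cbox a b) (\<lambda>(\<zeta>, \<theta>). g \<zeta> \<theta>)"
  shows "(\<lambda>\<zeta>. integral (cbox a b) (g \<zeta>)) holomorphic_on S"
proof -
  let ?G = "\<lambda>\<zeta>. integral (cbox a b) (g \<zeta>)"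
  have cG: "continuous_on S ?G"
    by (rule integral_continuous_on_param[OF cont])
  have line: "contour_integral (linepath x y) ?G = integral (cbox a b) (\<lambda>\<theta>. contour_integral (linepath x y) (\<lambda>\<zeta>. g \<zeta> \<theta>))"
    "(\<lambda>\<theta>. contour_integral (linepath x y) (\<lambda>\<zeta>. g \<zeta> \<theta>)) integrable_on cbox a b"
    if xy: "closed_segment x y \<subseteq> S" for x y
  proof -
    have lp: "linepath x y t \<in> S" if "t \<in> cbox 0 1" for t
    proof -
      have "linepath x y t \<in> path_image (linepath x y)"
        using that by (auto simp: path_image_def)
      then show ?thesis using xy by auto
    qed
    have c1: "continuous_on (cbox (0, a) (1, b)) (\<lambda>(t, \<theta>). g (linepath x y t) \<theta> * (y - x))"
    proof -
      have "continuous_on (cbox (0, a) (1, b)) (\<lambda>p. case (linepath x y (fst p), snd p) of (\<zeta>, \<theta>) \<Rightarrow> g \<zeta> \<theta>)"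
      proof (rule continuous_on_compose2[OF cont])
        show "continuous_on (cbox (0, a) (1, b)) (\<lambda>p. (linepath x y (fst p), snd p))"
          unfolding linepath_def by (intro continuous_intros)
        show "(\<lambda>p. (linepath x y (fst p), snd p)) ` cbox (0, a) (1, b) \<subseteq> S \<times> cbox a b"
          using lp by (auto simp: cbox_Pair_eq)
      qed
      then have "continuous_on (cbox (0, a) (1, b)) (\<lambda>p. (case (linepath x y (fst p), snd p) of (\<zeta>, \<theta>) \<Rightarrow> g \<zeta> \<theta>) * (y - x))"
        by (intro continuous_intros)
      then show ?thesis by (simp add: case_prod_unfold)
    qed
    have "contour_integral (linepath x y) ?G = integral {0..1} (\<lambda>t. ?G (linepath x y t) * (y - x))"
      by (simp add: contour_integral_integral)
    also have "\<dots> = integral (cbox 0 1) (\<lambda>t. integral (cbox a b) (\<lambda>\<theta>. g (linepath x y t) \<theta> * (y - x)))"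
      by simp
    also have "\<dots> = integral (cbox a b) (\<lambda>\<theta>. integral (cbox 0 1) (\<lambda>t. g (linepath x y t) \<theta> * (y - x)))"
      by (rule integral_swap_continuous[OF c1])
    also have "\<dots> = integral (cbox a b) (\<lambda>\<theta>. contour_integral (linepath x y) (\<lambda>\<zeta>. g \<zeta> \<theta>))"
      by (simp add: contour_integral_integral)
    finally show "contour_integral (linepath x y) ?G = integral (cbox a b) (\<lambda>\<theta>. contour_integral (linepath x y) (\<lambda>\<zeta>. g \<zeta> \<theta>))" .
    have "continuous_on (cbox (a, 0) (b, 1)) (\<lambda>(\<theta>, t). g (linepath x y t) \<theta> * (y - x))"
      using swap_continuous[OF c1] by (simp add: case_prod_unfold)
    then have "continuous_on (cbox a b) (\<lambda>\<theta>. integral (cbox 0 1) (\<lambda>t. g (linepath x y t) \<theta> * (y - x)))"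
      by (intro integral_continuous_on_param) (simp add: cbox_Pair_eq)
    then show "(\<lambda>\<theta>. contour_integral (linepath x y) (\<lambda>\<zeta>. g \<zeta> \<theta>)) integrable_on cbox a b"
      by (intro integrable_continuous) (simp add: contour_integral_integral)
  qed
  have "?G analytic_on S"
  proof (rule Morera_triangle[OF cG S], rule impI)
    fix x y z assume hull: "convex hull {x, y, z} \<subseteq> S"
    have "closed_segment u v \<subseteq> convex hull {x, y, z}" if "u \<in> {x, y, z}" "v \<in> {x, y, z}" for u v
      by (rule closed_segment_subset_convex_hull) (use that in \<open>auto intro: hull_inc\<close>)
    then have seg: "closed_segment x y \<subseteq> S" "closed_segment y z \<subseteq> S" "closed_segment z x \<subseteq> S"
      using hull by blast+
    have 0: "contour_integral (linepath x y) (\<lambda>\<zeta>. g \<zeta> \<theta>) + contour_integral (linepath y z) (\<lambda>\<zeta>. g \<zeta> \<theta>) +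
        contour_integral (linepath z x) (\<lambda>\<zeta>. g \<zeta> \<theta>) = 0" if "\<theta> \<in> cbox a b" for \<theta>
      by (rule has_chain_integral_chain_integral3[OF Cauchy_theorem_triangle[OF holomorphic_on_subset[OF hol[OF that] hull]]])
    have "contour_integral (linepath x y) ?G + contour_integral (linepath y z) ?G + contour_integral (linepath z x) ?G =
      integral (cbox a b) (\<lambda>\<theta>. contour_integral (linepath x y) (\<lambda>\<zeta>. g \<zeta> \<theta>) + contour_integral (linepath y z) (\<lambda>\<zeta>. g \<zeta> \<theta>) +
        contour_integral (linepath z x) (\<lambda>\<zeta>. g \<zeta> \<theta>))"
      using line[OF seg(1)] line[OF seg(2)] line[OF seg(3)] by (simp add: integral_add integrable_add)
    also have "\<dots> = integral (cbox a b) (\<lambda>\<theta>. 0)"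
      by (rule integral_cong) (rule 0)
    finally show "contour_integral (linepath x y) ?G + contour_integral (linepath y z) ?G + contour_integral (linepath z x) ?G = 0"
      by simp
  qed
  then show ?thesis by (rule analytic_imp_holomorphic)
qed

section \<open>Shifting the torus into the complex strip\<close>

lemma analytic_sev_derivative:
  assumes "analytic_sev f S" "z \<in> S"
  obtains f' where "(f has_derivative f') (at z)" "\<And>c v. f' (c *s v) = c * f' v"
  using assms unfolding analytic_sev_def by blast

lemma analytic_sev_continuous_on:
  assumes "analytic_sev f S"
  shows "continuous_on S f"
proof (rule continuous_at_imp_continuous_on, rule ballI)
  fix z assume "z \<in> S"
  then obtain f' where "(f has_derivative f') (at z)"
    using analytic_sev_derivative[OF assms] by blast
  then show "isCont f z" by (rule has_derivative_continuous)
qed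

lemma cvec_add: "cvec (a + b) = cvec a + cvec b"
  by (simp add: cvec_def vec_eq_iff)

lemma cvec_scaleR: "cvec (t *\<^sub>R a) = of_real t *s cvec a"
  by (simp add: cvec_def vec_eq_iff)

lemma continuous_on_cvec: "continuous_on S cvec"
  unfolding cvec_def by (intro continuous_intros)

lemma cvec_ray_in_strip: "\<bar>Im \<zeta>\<bar> * norm e \<le> \<rho> \<Longrightarrow> cvec \<theta> + \<zeta> *s cvec e \<in> strip \<rho>"
proof -
  have "(\<chi> i. Im ((cvec \<theta> + \<zeta> *s cvec e) $ i)) = Im \<zeta> *\<^sub>R e"
    by (simp add: vec_eq_iff cvec_def)
  then show "\<bar>Im \<zeta>\<bar> * norm e \<le> \<rho> \<Longrightarrow> cvec \<theta> + \<zeta> *s cvec e \<in> strip \<rho>"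
    by (simp add: strip_def)
qed

text \<open>A single complex variable suffices: the integral over the torus translated by
  \<open>\<zeta>\<close> along \<open>e\<close> is holomorphic in \<open>\<zeta>\<close>, constant
  for small real translations by periodicity, hence constant by analytic continuation. At
  \<open>- \<i> * s\<close> the exponential supplies the decaying factor.\<close>

lemma torus_coeff_contour_shift:
  fixes f :: "complex ^ 'n \<Rightarrow> complex"
  assumes an: "analytic_sev f (strip \<rho>)" and per: "axis_periodic (\<lambda>\<theta>. f (cvec \<theta>))"
    and s: "0 \<le> s" "s < \<rho>" and e: "norm e = 1"
  shows "integral tbox (\<lambda>\<theta>. f (cvec \<theta>) * cis (- (kv k \<bullet> \<theta>))) =
    integral tbox (\<lambda>\<theta>. f (cvec \<theta> + (- \<i> * of_real s) *s cvec e) * (of_real (exp (- (s * (kv k \<bullet> e)))) * cis (- (kv k \<bullet> \<theta>))))"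
proof -
  define S where "S = {\<zeta> :: complex. \<bar>Im \<zeta>\<bar> < \<rho>}"
  define g where "g = (\<lambda>\<zeta> \<theta>. f (cvec \<theta> + \<zeta> *s cvec e) * exp (- \<i> * (of_real (kv k \<bullet> \<theta>) + \<zeta> * of_real (kv k \<bullet> e))))"
  have S: "open S" unfolding S_def by (intro open_Collect_less continuous_intros)
  have conv: "convex S"
  proof -
    have "S = {\<zeta>. Im \<zeta> < \<rho>} \<inter> {\<zeta>. - \<rho> < Im \<zeta>}" by (auto simp: S_def)
    then show ?thesis by (simp add: convex_Int convex_halfspace_Im_lt convex_halfspace_Im_gt)
  qed
  have in_strip: "cvec \<theta> + \<zeta> *s cvec e \<in> strip \<rho>" if "\<zeta> \<in> S" for \<theta> \<zeta>
    using that e by (intro cvec_ray_in_strip) (simp add: S_def)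
  have hol: "(\<lambda>\<zeta>. g \<zeta> \<theta>) holomorphic_on S" for \<theta>
  proof -
    have "(\<lambda>\<zeta>. f (cvec \<theta> + \<zeta> *s cvec e)) holomorphic_on S"
    proof (rule holomorphic_onI)
      fix \<zeta> assume "\<zeta> \<in> S"
      then obtain f' where f': "(f has_derivative f') (at (cvec \<theta> + \<zeta> *s cvec e))" "\<And>c v. f' (c *s v) = c * f' v"
        using analytic_sev_derivative[OF an in_strip] by blast
      have lin: "bounded_linear (\<lambda>h. h *s cvec e)"
        by (rule bounded_linear_intro[where K = "norm (cvec e)"])
          (auto simp: vec_eq_iff algebra_simps norm_vec_def L2_set_def norm_mult power_mult_distrib sum_distrib_left[symmetric] real_sqrt_mult)
      have "((\<lambda>\<zeta>. cvec \<theta> + \<zeta> *s cvec e) has_derivative (\<lambda>h. h *s cvec e)) (at \<zeta>)"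
        using has_derivative_add[OF has_derivative_const bounded_linear_imp_has_derivative[OF lin]] by simp
      from has_derivative_compose[OF this f'(1)]
      have "((\<lambda>\<zeta>. f (cvec \<theta> + \<zeta> *s cvec e)) has_derivative (\<lambda>h. h * f' (cvec e))) (at \<zeta>)"
        by (simp add: f'(2))
      then have "((\<lambda>\<zeta>. f (cvec \<theta> + \<zeta> *s cvec e)) has_field_derivative f' (cvec e)) (at \<zeta>)"
        unfolding has_field_derivative_def by (rule has_derivative_eq_rhs) (simp add: fun_eq_iff)
      then show "(\<lambda>\<zeta>. f (cvec \<theta> + \<zeta> *s cvec e)) field_differentiable at \<zeta> within S"
        using field_differentiable_at_within field_differentiable_def by blast
    qed
    then show ?thesis unfolding g_def by (intro holomorphic_intros)
  qed
  have cont: "continuous_on (S \<times> tbox) (\<lambda>(\<zeta>, \<theta>). g \<zeta> \<theta>)"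
  proof -
    have "continuous_on (S \<times> tbox) (\<lambda>p. f (cvec (snd p) + fst p *s cvec e))"
    proof (rule continuous_on_compose2[OF analytic_sev_continuous_on[OF an]])
      show "continuous_on (S \<times> tbox) (\<lambda>p. cvec (snd p) + fst p *s cvec e)"
        unfolding cvec_def vector_scalar_mult_def by (intro continuous_intros)
    qed (use in_strip in auto)
    then show ?thesis unfolding g_def case_prod_unfold by (intro continuous_intros)
  qed
  define G where "G = (\<lambda>\<zeta>. integral tbox (g \<zeta>))"
  have holG: "G holomorphic_on S"
    unfolding G_def by (rule holomorphic_on_parameter_integral[OF S hol cont])
  have \<rho>: "\<rho> > 0" using s by simp
  \<comment> \<open>A short real segment is enough, since zero is already a limit point of it; its
    length keeps each component of the translation within one period.\<close>
  have shift: "G (of_real t) = G 0" if t: "\<bar>t\<bar> \<le> 1" for t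
  proof -
    define h where "h = (\<lambda>\<theta>. f (cvec \<theta>) * cis (- (kv k \<bullet> \<theta>)))"
    have "continuous_on UNIV (\<lambda>\<theta>. f (cvec \<theta>))"
    proof (rule continuous_on_compose2[OF analytic_sev_continuous_on[OF an] continuous_on_cvec])
      show "cvec ` UNIV \<subseteq> strip \<rho>" using \<rho> by (auto intro: cvec_in_strip)
    qed
    then have hc: "continuous_on UNIV h" unfolding h_def by (intro continuous_intros)
    have "cis (- (kv k \<bullet> (\<theta> + axis i (2 * pi)))) = cis (- (kv k \<bullet> \<theta>))" for \<theta> i
      using axis_periodicD[OF cis_kv_axis_periodic[of "- k"], of \<theta> i] by (simp add: kv_minus)
    then have hp: "axis_periodic h"
      unfolding h_def axis_periodic_def using axis_periodicD[OF per] by simp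
    have gt: "g (of_real t) \<theta> = h (\<theta> + t *\<^sub>R e)" for t \<theta>
      unfolding g_def h_def cvec_add cvec_scaleR cis_conv_exp by (simp add: inner_add_right algebra_simps)
    have "\<bar>(t *\<^sub>R e) $ i\<bar> \<le> 2 * pi" for i
    proof -
      have "\<bar>e $ i\<bar> \<le> 1" using component_le_norm_cart[of e i] e by simp
      then have "\<bar>t\<bar> * \<bar>e $ i\<bar> \<le> 1 * 1" using t by (intro mult_mono) auto
      then show ?thesis using pi_gt3 by (simp add: abs_mult)
    qed
    from integral_tbox_shift[OF hc hp this]
    have "integral tbox (\<lambda>\<theta>. h (\<theta> + t *\<^sub>R e)) = integral tbox h" .
    moreover have "g (of_real t) = (\<lambda>\<theta>. h (\<theta> + t *\<^sub>R e))" "g 0 = h"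
      using gt[of t] gt[of 0] by (simp_all add: fun_eq_iff)
    ultimately show ?thesis by (simp only: G_def)
  qed
  have "G constant_on S"
  proof (rule analytic_continuation'[OF holG S convex_connected[OF conv]])
    show "of_real ` {-1..1} \<subseteq> S" using \<rho> by (auto simp: S_def)
    show "0 \<in> S" using \<rho> by (simp add: S_def)
    show "(0 :: complex) islimpt of_real ` {-1..1}"
      unfolding islimpt_approachable
    proof (intro allI impI)
      fix \<epsilon> :: real assume "\<epsilon> > 0"
      then show "\<exists>x'\<in>of_real ` {-1..1}. x' \<noteq> (0 :: complex) \<and> dist x' 0 < \<epsilon>"
        by (intro bexI[of _ "of_real (min 1 (\<epsilon> / 2))"]) (auto simp: min_def)
    qed
    show "G constant_on of_real ` {-1..1}"
      unfolding constant_on_def using shift by (intro exI[of _ "G 0"]) auto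
  qed
  moreover have "0 \<in> S" "- \<i> * of_real s \<in> S" using s by (simp_all add: S_def)
  ultimately have "G 0 = G (- \<i> * of_real s)" unfolding constant_on_def by metis
  have "g 0 \<theta> = f (cvec \<theta>) * cis (- (kv k \<bullet> \<theta>))" for \<theta>
    by (simp add: g_def cis_conv_exp)
  then have g0: "g 0 = (\<lambda>\<theta>. f (cvec \<theta>) * cis (- (kv k \<bullet> \<theta>)))" by blast
  have "g (- \<i> * of_real s) \<theta> =
      f (cvec \<theta> + (- \<i> * of_real s) *s cvec e) * (of_real (exp (- (s * (kv k \<bullet> e)))) * cis (- (kv k \<bullet> \<theta>)))" for \<theta>
    unfolding g_def cis_conv_exp exp_of_real[symmetric] exp_add[symmetric] by (simp add: algebra_simps)
  then have "g (- \<i> * of_real s) = (\<lambda>\<theta>. f (cvec \<theta> + (- \<i> * of_real s) *s cvec e) *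
      (of_real (exp (- (s * (kv k \<bullet> e)))) * cis (- (kv k \<bullet> \<theta>))))" by blast
  then show ?thesis using \<open>G 0 = _\<close> g0 by (simp only: G_def)
qed

section \<open>Decay of Fourier coefficients in \<open>x\<close>\<close>

lemma smooth_has_vector_derivative:
  fixes g :: "real \<Rightarrow> complex"
  assumes "smooth g"
  shows "(g has_vector_derivative dx g x) (at x)"
proof -
  have "C_k (Suc 0) g" using assms by (simp only: smooth_def)
  then have "g differentiable (at x)" by simp
  then show ?thesis unfolding dx_def by (simp add: vector_derivative_works)
qed

lemma smooth_dx:
  fixes g :: "real \<Rightarrow> complex"
  assumes "smooth g"
  shows "smooth (dx g)"
  unfolding smooth_def
proof
  fix k
  have "C_k (Suc k) g" using assms by (simp only: smooth_def)
  then have "C_k k (\<lambda>p. frechet_derivative g (at p) 1)" by simp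
  moreover have "frechet_derivative g (at p) 1 = dx g p" for p
    using frechet_derivative_at[OF smooth_has_vector_derivative[OF assms, unfolded has_vector_derivative_def], of p]
    by (metis scaleR_one)
  ultimately show "C_k k (dx g)" by simp
qed

lemma smooth_dx_pow: "smooth g \<Longrightarrow> smooth ((dx ^^ N) g)"
  by (induction N) (simp_all add: smooth_dx)

lemma smooth_continuous_on: "smooth g \<Longrightarrow> continuous_on S g"
  unfolding smooth_def using continuous_on_subset by (metis C_k.simps(1) subset_UNIV)

lemma dx_periodic:
  assumes "smooth g" "\<And>x. g (x + 2 * pi) = g x"
  shows "dx g (x + 2 * pi) = dx g x"
proof -
  have "((\<lambda>x. x + 2 * pi) has_vector_derivative 1) (at x)"
    by (auto intro!: derivative_eq_intros)
  from vector_diff_chain_at[OF this smooth_has_vector_derivative[OF assms(1)]]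
  have "((\<lambda>x. g (x + 2 * pi)) has_vector_derivative 1 *\<^sub>R dx g (x + 2 * pi)) (at x)"
    by (simp add: o_def)
  then show ?thesis
    using smooth_has_vector_derivative[OF assms(1), of x] vector_derivative_unique_at unfolding assms(2) by fastforce
qed

lemma dx_pow_periodic:
  assumes "smooth g" "\<And>x. g (x + 2 * pi) = g x"
  shows "(dx ^^ N) g (x + 2 * pi) = (dx ^^ N) g x"
proof (induction N arbitrary: x)
  case (Suc N)
  then show ?case using dx_periodic[OF smooth_dx_pow[OF assms(1)]] by simp
qed (simp add: assms)

lemma fourier_coeff_dx:
  assumes g: "smooth g" "\<And>x. g (x + 2 * pi) = g x"
  shows "fourier_coeff (dx g) p = \<i> * of_int p * fourier_coeff g p"
proof -
  let ?E = "\<lambda>x. cis (- (real_of_int p * x))"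
  have dE: "(?E has_vector_derivative - \<i> * of_int p * ?E x) (at x)" for x
  proof -
    have "((\<lambda>z. exp (- (\<i> * of_int p * z))) has_field_derivative - \<i> * of_int p * exp (- (\<i> * of_int p * of_real x))) (at (of_real x))"
      by (auto intro!: derivative_eq_intros)
    from has_vector_derivative_real_field[OF this] show ?thesis
      by (simp add: cis_conv_exp mult.assoc)
  qed
  have "((\<lambda>x. g x * ?E x) has_vector_derivative (g x * (- \<i> * of_int p * ?E x) + dx g x * ?E x)) (at x)" for x
    by (rule has_vector_derivative_mult[OF smooth_has_vector_derivative[OF g(1)] dE])
  then have "((\<lambda>x. g x * (- \<i> * of_int p * ?E x) + dx g x * ?E x) has_integral g pi * ?E pi - g (- pi) * ?E (- pi)) {-pi..pi}"
    by (intro fundamental_theorem_of_calculus) (auto intro: has_vector_derivative_at_within)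
  moreover have "g pi = g (- pi)" using g(2)[of "- pi"] by simp
  moreover have "?E pi = ?E (- pi)"
  proof -
    have "?E (- pi) = ?E pi * cis (2 * pi * real_of_int p)"
      unfolding cis_mult by (simp add: algebra_simps)
    then show ?thesis by (simp add: cis_multiple_2pi)
  qed
  ultimately have 0: "((\<lambda>x. g x * (- \<i> * of_int p * ?E x) + dx g x * ?E x) has_integral 0) {-pi..pi}" by simp
  have i1: "(\<lambda>x. g x * ?E x) integrable_on {-pi..pi}" and i2: "(\<lambda>x. dx g x * ?E x) integrable_on {-pi..pi}"
    by (intro integrable_continuous_real continuous_intros smooth_continuous_on g smooth_dx)+
  have "((\<lambda>x. (- \<i> * of_int p) * (g x * ?E x) + dx g x * ?E x) has_integral
      (- \<i> * of_int p) * integral {-pi..pi} (\<lambda>x. g x * ?E x) + integral {-pi..pi} (\<lambda>x. dx g x * ?E x)) {-pi..pi}"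
    by (intro has_integral_add has_integral_mult_right integrable_integral i1 i2)
  then have "(- \<i> * of_int p) * integral {-pi..pi} (\<lambda>x. g x * ?E x) + integral {-pi..pi} (\<lambda>x. dx g x * ?E x) = 0"
    by (intro has_integral_unique[OF _ 0]) (simp add: mult_ac)
  then show ?thesis
    unfolding fourier_coeff_def by (simp add: add_eq_0_iff2 mult_ac)
qed

lemma fourier_coeff_dx_pow:
  assumes g: "smooth g" "\<And>x. g (x + 2 * pi) = g x"
  shows "fourier_coeff ((dx ^^ N) g) p = (\<i> * of_int p) ^ N * fourier_coeff g p"
proof (induction N)
  case (Suc N)
  have "fourier_coeff (dx ((dx ^^ N) g)) p = \<i> * of_int p * fourier_coeff ((dx ^^ N) g) p"
    by (rule fourier_coeff_dx[OF smooth_dx_pow[OF g(1)] dx_pow_periodic[OF g]])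
  then show ?case using Suc by (simp add: mult_ac)
qed simp

lemma norm_fourier_coeff_le:
  assumes "continuous_on {-pi..pi} g" "\<And>x. norm (g x) \<le> C"
  shows "norm (fourier_coeff g p) \<le> C"
proof -
  have "norm (integral {-pi..pi} (\<lambda>x. g x * cis (- (real_of_int p * x)))) \<le> C * (pi - - pi)"
    using assms(2) by (intro integral_bound continuous_intros assms(1)) (auto simp: norm_mult)
  then show ?thesis
    by (simp add: fourier_coeff_def norm_mult norm_divide field_simps)
qed

text \<open>The trivial bound covers \<open>p = 0\<close>, and \<open>N\<close> integrations by
  parts give the decay. The constant is uniform over the parameter set, which will be the whole
  complex strip.\<close>

lemma fourier_coeff_decay:
  assumes B: "\<And>l. \<exists>C>0. \<forall>x. \<forall>\<theta>\<in>S. norm ((dx ^^ l) (F \<theta>) x) \<le> C"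
    and sm: "\<And>\<theta>. \<theta> \<in> S \<Longrightarrow> smooth (F \<theta>)" and per: "\<And>\<theta> x. \<theta> \<in> S \<Longrightarrow> F \<theta> (x + 2 * pi) = F \<theta> x"
  shows "\<exists>C>0. \<forall>\<theta>\<in>S. \<forall>p. norm (fourier_coeff (F \<theta>) p) * (1 + \<bar>real_of_int p\<bar>) ^ N \<le> C"
proof -
  obtain C0 where C0: "C0 > 0" "\<And>x \<theta>. \<theta> \<in> S \<Longrightarrow> norm ((dx ^^ 0) (F \<theta>) x) \<le> C0" using B[of 0] by blast
  obtain C1 where C1: "C1 > 0" "\<And>x \<theta>. \<theta> \<in> S \<Longrightarrow> norm ((dx ^^ N) (F \<theta>) x) \<le> C1" using B[of N] by blast
  have "norm (fourier_coeff (F \<theta>) p) * (1 + \<bar>real_of_int p\<bar>) ^ N \<le> 2 ^ N * (C0 + C1)" if \<theta>: "\<theta> \<in> S" for \<theta> p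
  proof -
    let ?a = "norm (fourier_coeff (F \<theta>) p)"
    have 0: "?a \<le> C0"
      using C0(2)[OF \<theta>] by (intro norm_fourier_coeff_le smooth_continuous_on sm \<theta>) simp
    have "norm (fourier_coeff ((dx ^^ N) (F \<theta>)) p) \<le> C1"
      by (intro norm_fourier_coeff_le smooth_continuous_on smooth_dx_pow sm \<theta> C1(2))
    then have 1: "?a * \<bar>real_of_int p\<bar> ^ N \<le> C1"
      unfolding fourier_coeff_dx_pow[OF sm[OF \<theta>] per[OF \<theta>]] by (simp add: norm_mult norm_power mult.commute)
    have "(1 + \<bar>real_of_int p\<bar>) ^ N \<le> (2 * max 1 \<bar>real_of_int p\<bar>) ^ N"
      by (intro power_mono) auto
    also have "\<dots> = 2 ^ N * max 1 \<bar>real_of_int p\<bar> ^ N" by (rule power_mult_distrib)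
    also have "max 1 \<bar>real_of_int p\<bar> ^ N \<le> 1 + \<bar>real_of_int p\<bar> ^ N"
      by (auto simp: max_def)
    finally have "?a * (1 + \<bar>real_of_int p\<bar>) ^ N \<le> ?a * (2 ^ N * (1 + \<bar>real_of_int p\<bar> ^ N))"
      by (intro mult_left_mono) auto
    also have "\<dots> = 2 ^ N * (?a + ?a * \<bar>real_of_int p\<bar> ^ N)" by (simp add: algebra_simps)
    also have "\<dots> \<le> 2 ^ N * (C0 + C1)"
      using 0 1 by (intro mult_left_mono add_mono) auto
    finally show ?thesis .
  qed
  then show ?thesis
    using C0(1) C1(1) by (intro exI[of _ "2 ^ N * (C0 + C1)"]) auto
qed

section \<open>Summability over integer vectors\<close>

lemma summable_on_abs_int:
  fixes f :: "nat \<Rightarrow> real"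
  assumes "f summable_on UNIV"
  shows "(\<lambda>j::int. f (nat \<bar>j\<bar>)) summable_on UNIV"
proof -
  let ?f = "\<lambda>j::int. f (nat \<bar>j\<bar>)"
  have "?f summable_on range int"
    using assms by (subst summable_on_reindex) (auto simp: o_def inj_on_def)
  moreover have "?f summable_on range (\<lambda>n. - int n)"
    using assms by (subst summable_on_reindex) (auto simp: o_def inj_on_def)
  moreover have "UNIV = range int \<union> range (\<lambda>n. - int n)"
  proof -
    have "j \<in> range int \<union> range (\<lambda>n. - int n)" for j
      by (cases "j \<ge> 0") (auto intro: range_eqI[of _ _ "nat j"] range_eqI[of _ _ "nat (- j)"])
    then show ?thesis by blast
  qed
  ultimately show ?thesis by (metis summable_on_union)
qed

lemma summable_exp_abs_int:
  assumes "c > 0"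
  shows "(\<lambda>j::int. exp (- c * \<bar>real_of_int j\<bar>)) summable_on UNIV"
proof -
  have "summable (\<lambda>n. exp (- c) ^ n)"
    using assms by (intro summable_geometric) simp
  then have "(\<lambda>n::nat. exp (- c * real n)) summable_on UNIV"
    by (simp add: summable_on_UNIV_nonneg_real_iff exp_of_nat_mult[symmetric] mult.commute)
  from summable_on_abs_int[OF this] show ?thesis by simp
qed

definition norm1 :: "int ^ 'n \<Rightarrow> real" where
  "norm1 k = (\<Sum>i\<in>UNIV. \<bar>real_of_int (k $ i)\<bar>)"

text \<open>With the 1-norm the exponential factorizes over the coordinates. A finite set of vectors
  lies in a cube, and the sum over a cube is a product of one-dimensional geometric sums.\<close>

lemma summable_exp_norm1:
  assumes "c > 0"
  shows "(\<lambda>k :: int ^ 'n. exp (- c * norm1 k)) summable_on UNIV"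
proof (rule nonneg_bdd_above_summable_on)
  let ?f = "\<lambda>j::int. exp (- c * \<bar>real_of_int j\<bar>)"
  show "bdd_above (sum (\<lambda>k :: int ^ 'n. exp (- c * norm1 k)) ` {F. F \<subseteq> UNIV \<and> finite F})"
  proof (rule bdd_aboveI2)
    fix F :: "(int ^ 'n) set" assume "F \<in> {F. F \<subseteq> UNIV \<and> finite F}"
    then have fin: "finite F" by simp
    define T where "T = (\<Union>k\<in>F. range (\<lambda>i. k $ i))"
    have T: "finite T" unfolding T_def using fin by auto
    have e: "exp (- c * norm1 k) = (\<Prod>i\<in>UNIV. ?f (k $ i))" for k :: "int ^ 'n"
      unfolding norm1_def sum_distrib_left by (rule exp_sum) simp
    have "(\<Sum>k\<in>F. exp (- c * norm1 k)) = (\<Sum>g\<in>vec_nth ` F. \<Prod>i\<in>UNIV. ?f (g i))"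
      unfolding e by (subst sum.reindex) (auto simp: inj_on_def vec_nth_inject)
    also have "\<dots> \<le> (\<Sum>g\<in>PiE (UNIV :: 'n set) (\<lambda>_. T). \<Prod>i\<in>UNIV. ?f (g i))"
    proof (rule sum_mono2)
      show "finite (PiE (UNIV :: 'n set) (\<lambda>_. T))" by (rule finite_PiE) (use T in auto)
      show "vec_nth ` F \<subseteq> PiE UNIV (\<lambda>_. T)" by (auto simp: T_def PiE_UNIV_domain)
    qed (auto intro: prod_nonneg)
    also have "\<dots> = (\<Prod>i\<in>(UNIV :: 'n set). \<Sum>j\<in>T. ?f j)"
      by (rule prod_sum_PiE[symmetric]) (use T in auto)
    also have "\<dots> \<le> (\<Prod>i\<in>(UNIV :: 'n set). infsum ?f UNIV)"
      using T by (intro prod_mono conjI sum_nonneg finite_sum_le_infsum summable_exp_abs_int assms) auto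
    finally show "(\<Sum>k\<in>F. exp (- c * norm1 k)) \<le> (\<Prod>i\<in>(UNIV :: 'n set). infsum ?f UNIV)" .
  qed
qed simp

lemma norm1_le: "norm1 k \<le> real CARD('n) * norm (kv k)" for k :: "int ^ 'n"
proof -
  have "norm1 k \<le> (\<Sum>i\<in>(UNIV :: 'n set). norm (kv k))"
    unfolding norm1_def
  proof (rule sum_mono)
    fix i show "\<bar>real_of_int (k $ i)\<bar> \<le> norm (kv k)"
      using component_le_norm_cart[of "kv k" i] by (simp add: kv_def)
  qed
  then show ?thesis by simp
qed

lemma summable_exp_kv:
  assumes "c > 0"
  shows "(\<lambda>k :: int ^ 'n. exp (- c * norm (kv k))) summable_on UNIV"
proof (rule summable_on_comparison_test)
  let ?n = "real CARD('n)"
  have n: "?n > 0" by simp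
  show "(\<lambda>k :: int ^ 'n. exp (- (c / ?n) * norm1 k)) summable_on UNIV"
    by (rule summable_exp_norm1) (use assms in simp)
  fix k :: "int ^ 'n"
  have "c / ?n * norm1 k \<le> c / ?n * (?n * norm (kv k))"
    using assms by (intro mult_left_mono norm1_le) auto
  then show "exp (- c * norm (kv k)) \<le> exp (- (c / ?n) * norm1 k)"
    using n by simp
qed simp

lemma norm_kv_ge_1:
  fixes k :: "int ^ 'n"
  assumes "k \<noteq> 0"
  shows "1 \<le> norm (kv k)"
proof -
  obtain i where "k $ i \<noteq> 0" using assms by (auto simp: vec_eq_iff)
  then have "1 \<le> \<bar>real_of_int (k $ i)\<bar>" by linarith
  then show ?thesis using component_le_norm_cart[of "kv k" i] by (simp add: kv_def)
qed

section \<open>Symmetries of Fourier coefficients\<close>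

lemma fourier_coeff_uminus:
  assumes "\<And>x. g (- x) = g x"
  shows "fourier_coeff g (- p) = fourier_coeff g p"
proof -
  have "integral {-pi..pi} (\<lambda>x. g x * cis (real_of_int p * x)) =
      integral {-pi..pi} (\<lambda>x. (\<lambda>x. g x * cis (- (real_of_int p * x))) (- x))"
    using assms by simp
  also have "\<dots> = integral {-pi..pi} (\<lambda>x. g x * cis (- (real_of_int p * x)))"
  proof -
    have "integral {-pi..- (-pi)} (\<lambda>x. h (- x)) = integral {-pi..pi} h" for h :: "real \<Rightarrow> complex"
      by (rule Henstock_Kurzweil_Integration.integral_reflect_real)
    then show ?thesis by (simp only: minus_minus)
  qed
  finally show ?thesis by (simp add: fourier_coeff_def)
qed

lemma cnj_fourier_coeff: "cnj (fourier_coeff g p) = fourier_coeff (\<lambda>x. cnj (g x)) (- p)"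
  unfolding fourier_coeff_def complex_cnj_mult Henstock_Kurzweil_Integration.integral_cnj by (simp add: cis_cnj)

lemma cnj_torus_coeff: "cnj (torus_coeff f k) = torus_coeff (\<lambda>\<theta>. cnj (f \<theta>)) (- k)"
  unfolding torus_coeff_def complex_cnj_mult Henstock_Kurzweil_Integration.integral_cnj by (simp add: cis_cnj kv_minus)

lemma lipschitz_of_dx_bound:
  fixes g :: "real \<Rightarrow> complex"
  assumes "smooth g" "\<And>x. norm (dx g x) \<le> C"
  shows "norm (g x - g y) \<le> C * \<bar>x - y\<bar>"
proof -
  have "norm (g x - g y) \<le> C * norm (x - y)"
  proof (rule differentiable_bound[of UNIV])
    fix z
    show "(g has_derivative (\<lambda>h. h *\<^sub>R dx g z)) (at z within UNIV)"
      using smooth_has_vector_derivative[OF assms(1), of z] by (simp add: has_vector_derivative_def)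
    show "onorm (\<lambda>h. h *\<^sub>R dx g z) \<le> C"
    proof (rule onorm_le)
      fix h show "norm (h *\<^sub>R dx g z) \<le> C * norm h"
        using mult_right_mono[OF assms(2)[of z], of "norm h"] by (simp add: mult.commute)
    qed
  qed auto
  then show ?thesis by simp
qed

text \<open>Separate continuity would not give joint continuity; a Lipschitz bound in
  \<open>x\<close> that is uniform in the parameter does. Joint continuity is what the exchange of
  integrals rests on.\<close>

lemma continuous_on_lipschitz_param:
  fixes F :: "'a::metric_space \<Rightarrow> real \<Rightarrow> complex"
  assumes c: "\<And>x. continuous_on A (\<lambda>\<theta>. F \<theta> x)"
    and L: "\<And>\<theta> x y. \<theta> \<in> A \<Longrightarrow> norm (F \<theta> x - F \<theta> y) \<le> C * \<bar>x - y\<bar>"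
  shows "continuous_on (B \<times> A) (\<lambda>(x, \<theta>). F \<theta> x)"
  unfolding continuous_on_def case_prod_unfold
proof
  fix p assume p: "p \<in> B \<times> A"
  have 1: "((\<lambda>q. F (snd q) (fst p)) \<longlongrightarrow> F (snd p) (fst p)) (at p within B \<times> A)"
  proof -
    have "continuous_on (B \<times> A) (\<lambda>q. F (snd q) (fst p))"
      by (rule continuous_on_compose2[OF c continuous_on_snd[OF continuous_on_id]]) auto
    from bspec[OF this[unfolded continuous_on_def] p] show ?thesis by simp
  qed
  have f: "((\<lambda>q. fst q) \<longlongrightarrow> fst p) (at p within B \<times> A)" by (intro tendsto_intros)
  have "((\<lambda>q. C * \<bar>fst q - fst p\<bar> + norm (F (snd q) (fst p) - F (snd p) (fst p))) \<longlongrightarrow>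
      C * \<bar>fst p - fst p\<bar> + norm (F (snd p) (fst p) - F (snd p) (fst p))) (at p within B \<times> A)"
    by (intro tendsto_intros f 1)
  then have lim: "((\<lambda>q. C * \<bar>fst q - fst p\<bar> + norm (F (snd q) (fst p) - F (snd p) (fst p))) \<longlongrightarrow> 0) (at p within B \<times> A)"
    by simp
  have "((\<lambda>q. F (snd q) (fst q) - F (snd p) (fst p)) \<longlongrightarrow> 0) (at p within B \<times> A)"
  proof (rule Lim_null_comparison[OF _ lim])
    show "\<forall>\<^sub>F q in at p within B \<times> A. norm (F (snd q) (fst q) - F (snd p) (fst p)) \<le>
        C * \<bar>fst q - fst p\<bar> + norm (F (snd q) (fst p) - F (snd p) (fst p))"
      unfolding eventually_at_filter
    proof (intro always_eventually allI impI)
      fix q assume "q \<in> B \<times> A"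
      then have "norm (F (snd q) (fst q) - F (snd q) (fst p)) \<le> C * \<bar>fst q - fst p\<bar>"
        by (intro L) auto
      then show "norm (F (snd q) (fst q) - F (snd p) (fst p)) \<le>
        C * \<bar>fst q - fst p\<bar> + norm (F (snd q) (fst p) - F (snd p) (fst p))"
        using norm_triangle_ineq[of "F (snd q) (fst q) - F (snd q) (fst p)" "F (snd q) (fst p) - F (snd p) (fst p)"] by simp
    qed
  qed
  then show "((\<lambda>q. F (snd q) (fst q)) \<longlongrightarrow> F (snd p) (fst p)) (at p within B \<times> A)"
    by (simp add: LIM_zero_iff)
qed

text \<open>The map \<open>w\<close> will be either the embedding of the real torus or that of an
  imaginary translate of it.\<close>

lemma fourier_coeff_swap:
  fixes F :: "complex ^ 'n \<Rightarrow> real \<Rightarrow> complex" and w :: "real ^ 'n \<Rightarrow> complex ^ 'n"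
  assumes c: "\<And>x. continuous_on S (\<lambda>\<theta>. F \<theta> x)"
    and L: "\<And>\<theta> x y. \<theta> \<in> S \<Longrightarrow> norm (F \<theta> x - F \<theta> y) \<le> C * \<bar>x - y\<bar>"
    and w: "continuous_on UNIV w" "\<And>\<theta>. w \<theta> \<in> S" and E: "continuous_on UNIV E"
  shows "fourier_coeff (\<lambda>x. integral tbox (\<lambda>\<theta>. F (w \<theta>) x * E \<theta>)) p =
      integral tbox (\<lambda>\<theta>. fourier_coeff (F (w \<theta>)) p * E \<theta>)"
    and "continuous_on UNIV (\<lambda>\<theta>. fourier_coeff (F (w \<theta>)) p)"
proof -
  let ?e = "\<lambda>x. cis (- (real_of_int p * x))"
  have cw: "continuous_on (B \<times> UNIV) (\<lambda>(x, \<theta>). F (w \<theta>) x)" for B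
    by (rule continuous_on_lipschitz_param[OF continuous_on_compose2[OF c w(1)]]) (use w(2) L in auto)
  have j: "continuous_on (cbox (-pi, 0) (pi, \<chi> i. 2 * pi)) (\<lambda>(x, \<theta>). F (w \<theta>) x * E \<theta> * ?e x)"
  proof -
    have "continuous_on (cbox (-pi, 0) (pi, \<chi> i. 2 * pi)) (\<lambda>q. F (w (snd q)) (fst q))"
      using continuous_on_subset[OF cw[of UNIV], of "cbox (-pi, 0) (pi, \<chi> i. 2 * pi)"] by (simp add: case_prod_unfold)
    moreover have "continuous_on (cbox (-pi, 0) (pi, \<chi> i. 2 * pi)) (\<lambda>q :: real \<times> (real ^ 'n). E (snd q))"
      by (rule continuous_on_compose2[OF E continuous_on_snd[OF continuous_on_id]]) auto
    ultimately show ?thesis unfolding case_prod_unfold by (intro continuous_intros)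
  qed
  have "integral (cbox (-pi) pi) (\<lambda>x. integral tbox (\<lambda>\<theta>. F (w \<theta>) x * E \<theta> * ?e x)) =
      integral tbox (\<lambda>\<theta>. integral (cbox (-pi) pi) (\<lambda>x. F (w \<theta>) x * E \<theta> * ?e x))"
    by (rule integral_swap_continuous[OF j])
  moreover have "integral tbox (\<lambda>\<theta>. F (w \<theta>) x * E \<theta> * ?e x) = integral tbox (\<lambda>\<theta>. F (w \<theta>) x * E \<theta>) * ?e x" for x
    by (rule integral_mult_left)
  moreover have "integral (cbox (-pi) pi) (\<lambda>x. F (w \<theta>) x * E \<theta> * ?e x) = integral (cbox (-pi) pi) (\<lambda>x. F (w \<theta>) x * ?e x) * E \<theta>" for \<theta>
    by (subst integral_mult_left[symmetric]) (simp add: mult_ac)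
  ultimately show "fourier_coeff (\<lambda>x. integral tbox (\<lambda>\<theta>. F (w \<theta>) x * E \<theta>)) p =
      integral tbox (\<lambda>\<theta>. fourier_coeff (F (w \<theta>)) p * E \<theta>)"
    unfolding fourier_coeff_def interval_cbox by (simp only: mult.assoc integral_mult_right)
  have "continuous_on (UNIV \<times> cbox (-pi) pi) (\<lambda>(\<theta>, x). F (w \<theta>) x * ?e x)"
  proof -
    have "continuous_on (UNIV \<times> cbox (-pi) pi) (\<lambda>q. case (snd q, fst q) of (x, \<theta>) \<Rightarrow> F (w \<theta>) x)"
      by (rule continuous_on_compose2[OF cw[of UNIV]]) (auto intro!: continuous_intros)
    then have "continuous_on (UNIV \<times> cbox (-pi) pi) (\<lambda>q. F (w (fst q)) (snd q))" by simp
    then show ?thesis unfolding case_prod_unfold by (intro continuous_intros)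
  qed
  from integral_continuous_on_param[OF this]
  show "continuous_on UNIV (\<lambda>\<theta>. fourier_coeff (F (w \<theta>)) p)"
    unfolding fourier_coeff_def interval_cbox by (intro continuous_intros)
qed

lemma even_ext_minus: "even_ext V \<theta> (- x) = even_ext V \<theta> x"
  by (simp add: even_ext_def)

lemma arccos_cos_range: "arccos (cos x) \<in> {0..pi}"
  using arccos_bounded[of "cos x"] by simp

text \<open>Both decays hold simultaneously, because the coefficients in \<open>x\<close> may be
  taken on the shifted torus, where the derivatives in \<open>x\<close> have the same bounds.
  Shifting in the direction of \<open>k\<close> itself yields the full exponential rate in the
  Euclidean norm.\<close>

theorem potential_fourier:
  fixes V :: "real ^ 'n \<Rightarrow> real \<Rightarrow> real"
  assumes s: "0 \<le> s" "s < \<rho>" and tp: "torus_periodic V" and v1: "V1 \<rho> V" and v2: "V2 V"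
  shows "\<exists>Vh :: int ^ 'n \<Rightarrow> int \<Rightarrow> complex.
    (\<forall>N. \<exists>C>0. \<forall>k p. norm (Vh k p) * exp (s * norm (kv k)) * (1 + \<bar>real_of_int p\<bar>) ^ N \<le> C) \<and>
    (\<forall>p. Vh 0 p = 0) \<and> (\<forall>k p. Vh k (- p) = Vh k p) \<and> (\<forall>k p. cnj (Vh k p) = Vh (- k) p) \<and>
    (s > 0 \<longrightarrow> (\<forall>\<theta> p. fourier_coeff (\<lambda>x. of_real (even_ext V \<theta> x)) p = (\<Sum>\<^sub>\<infinity>k. Vh k p * cis (kv k \<bullet> \<theta>))))"
proof -
  have \<rho>: "0 < \<rho>" using s by simp
  obtain Vc where an: "analytic_smooth \<rho> Vc" and ext: "\<And>\<theta> x. Vc (cvec \<theta>) x = complex_of_real (even_ext V \<theta> x)"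
    and bd: "\<And>l. \<exists>C>0. \<forall>x. \<forall>\<theta>\<in>strip \<rho>. norm ((dx ^^ l) (Vc \<theta>) x) \<le> C"
    using v1 unfolding V1_def by blast
  have ana: "analytic_sev (\<lambda>\<theta>. Vc \<theta> x) (strip \<rho>)" for x using an by (simp add: analytic_smooth_def)
  have sm: "smooth (Vc \<theta>)" if "\<theta> \<in> strip \<rho>" for \<theta> using an that by (simp add: analytic_smooth_def)
  have px: "Vc \<theta> (x + 2 * pi) = Vc \<theta> x" if "\<theta> \<in> strip \<rho>" for \<theta> x using an that by (simp add: analytic_smooth_def)
  have c: "continuous_on (strip \<rho>) (\<lambda>\<theta>. Vc \<theta> x)" for x by (rule analytic_sev_continuous_on[OF ana])
  obtain C1 where C1: "\<And>x \<theta>. \<theta> \<in> strip \<rho> \<Longrightarrow> norm ((dx ^^ 1) (Vc \<theta>) x) \<le> C1" using bd[of 1] by blast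
  have L: "norm (Vc \<theta> x - Vc \<theta> y) \<le> C1 * \<bar>x - y\<bar>" if "\<theta> \<in> strip \<rho>" for \<theta> x y
    using C1[OF that] by (intro lipschitz_of_dx_bound sm that) simp
  have per: "axis_periodic (\<lambda>\<theta>. even_ext V \<theta> x)" for x
    using tp arccos_cos_range unfolding axis_periodic_def torus_periodic_def even_ext_def by blast
  have per': "axis_periodic (\<lambda>\<theta>. Vc (cvec \<theta>) x)" for x
    using per[of x] by (simp add: axis_periodic_def ext)
  \<comment> \<open>The contour shift works at fixed \<open>x\<close>, so the coefficient in
    \<open>\<theta>\<close> is formed first; \<open>Vh_v\<close> provides the opposite order, which
    inversion in \<open>\<theta>\<close> needs.\<close>
  define Vh where "Vh = (\<lambda>k p. fourier_coeff (\<lambda>x. torus_coeff (\<lambda>\<theta>. Vc (cvec \<theta>) x) k) p)"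
  define v where "v = (\<lambda>p \<theta>. fourier_coeff (Vc (cvec \<theta>)) p)"
  let ?N = "of_real (1 / (2 * pi) ^ CARD('n)) :: complex"
  have fc: "fourier_coeff (\<lambda>x. ?N * g x) p = ?N * fourier_coeff g p" for g p
  proof -
    have "integral {-pi..pi} (\<lambda>x. ?N * g x * cis (- (real_of_int p * x))) =
        ?N * integral {-pi..pi} (\<lambda>x. g x * cis (- (real_of_int p * x)))"
      unfolding mult.assoc by (rule integral_mult_right)
    then show ?thesis by (simp only: fourier_coeff_def mult.left_commute)
  qed
  have cs: "cvec \<theta> \<in> strip \<rho>" for \<theta> :: "real ^ 'n" using \<rho> by (intro cvec_in_strip) simp
  have cE: "continuous_on UNIV (\<lambda>\<theta>. cis (- (kv k \<bullet> \<theta>)))" for k :: "int ^ 'n" by (intro continuous_intros)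
  have Vh_v: "Vh k p = torus_coeff (v p) k" for k p
  proof -
    have "fourier_coeff (\<lambda>x. integral tbox (\<lambda>\<theta>. Vc (cvec \<theta>) x * cis (- (kv k \<bullet> \<theta>)))) p =
        integral tbox (\<lambda>\<theta>. fourier_coeff (Vc (cvec \<theta>)) p * cis (- (kv k \<bullet> \<theta>)))"
      by (rule fourier_coeff_swap(1)[OF c L continuous_on_cvec cs cE])
    then show ?thesis unfolding Vh_def torus_coeff_def fc v_def by (simp only:)
  qed
  have cv: "continuous_on UNIV (v p)" for p
    unfolding v_def by (rule fourier_coeff_swap(2)[OF c L continuous_on_cvec cs cE])
  have Vh0: "Vh 0 p = 0" for p
  proof -
    have "integral tbox (\<lambda>\<theta>. Vc (cvec \<theta>) x) = 0" for x
    proof -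
      have "((\<lambda>\<theta>. V \<theta> (arccos (cos x))) has_integral 0) tbox"
        using v2 arccos_cos_range unfolding V2_def by blast
      then have "((\<lambda>\<theta>. complex_of_real (V \<theta> (arccos (cos x)))) has_integral of_real 0) tbox"
        by (rule has_integral_of_real)
      then show ?thesis by (simp add: ext even_ext_def integral_unique)
    qed
    then show ?thesis by (simp add: Vh_def torus_coeff_def kv_zero fourier_coeff_def)
  qed
  have decay: "\<exists>C>0. \<forall>k p. norm (Vh k p) * exp (s * norm (kv k)) * (1 + \<bar>real_of_int p\<bar>) ^ N \<le> C" for N
  proof -
    obtain C where C: "C > 0" "\<And>\<theta> p. \<theta> \<in> strip \<rho> \<Longrightarrow> norm (fourier_coeff (Vc \<theta>) p) * (1 + \<bar>real_of_int p\<bar>) ^ N \<le> C"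
      using fourier_coeff_decay[OF bd sm px, of N] by blast
    have "norm (Vh k p) * exp (s * norm (kv k)) * (1 + \<bar>real_of_int p\<bar>) ^ N \<le> C" for k p
    proof (cases "k = 0")
      case True
      then show ?thesis using Vh0 C(1) by simp
    next
      case False
      \<comment> \<open>In this direction the exponent \<open>kv k \<bullet> e\<close> attains its
        largest value \<open>norm (kv k)\<close>.\<close>
      define e where "e = kv k /\<^sub>R norm (kv k)"
      have nk: "norm (kv k) > 0" using norm_kv_ge_1[OF False] by linarith
      have e: "norm e = 1" and ke: "kv k \<bullet> e = norm (kv k)"
        using nk by (simp_all add: e_def dot_square_norm power2_eq_square)
      define w where "w = (\<lambda>\<theta>. cvec \<theta> + (- \<i> * of_real s) *s cvec e)"
      define E where "E = (\<lambda>\<theta>. of_real (exp (- (s * norm (kv k)))) * cis (- (kv k \<bullet> \<theta>)))"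
      have w: "continuous_on UNIV w" unfolding w_def by (intro continuous_intros continuous_on_cvec)
      have ws: "w \<theta> \<in> strip \<rho>" for \<theta>
        unfolding w_def using s e by (intro cvec_ray_in_strip) simp
      have E: "continuous_on UNIV E" unfolding E_def by (intro continuous_intros)
      have "torus_coeff (\<lambda>\<theta>. Vc (cvec \<theta>) x) k = ?N * integral tbox (\<lambda>\<theta>. Vc (w \<theta>) x * E \<theta>)" for x
        unfolding torus_coeff_def torus_coeff_contour_shift[OF ana per' s e] ke w_def E_def ..
      then have Vh_eq: "Vh k p = ?N * integral tbox (\<lambda>\<theta>. fourier_coeff (Vc (w \<theta>)) p * E \<theta>)"
        unfolding Vh_def by (simp only: fc fourier_coeff_swap(1)[OF c L w ws E])
      define D where "D = C / (1 + \<bar>real_of_int p\<bar>) ^ N * exp (- (s * norm (kv k)))"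
      have D0: "D \<ge> 0" using C(1) by (simp add: D_def)
      have "norm (integral tbox (\<lambda>\<theta>. fourier_coeff (Vc (w \<theta>)) p * E \<theta>)) \<le> integral tbox (\<lambda>\<theta>::real ^ 'n. D)"
      proof (rule integral_norm_bound_integral)
        show "(\<lambda>\<theta>. fourier_coeff (Vc (w \<theta>)) p * E \<theta>) integrable_on tbox"
        proof (rule integrable_continuous, rule continuous_on_mult)
          have "continuous_on UNIV (\<lambda>\<theta>. fourier_coeff (Vc (w \<theta>)) p)"
            by (rule fourier_coeff_swap(2)[OF c L w ws E])
          then show "continuous_on tbox (\<lambda>\<theta>. fourier_coeff (Vc (w \<theta>)) p)"
            by (rule continuous_on_subset) simp
          show "continuous_on tbox E"
            by (rule continuous_on_subset[OF E]) simp
        qed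
        show "(\<lambda>\<theta>::real ^ 'n. D) integrable_on tbox" by (rule integrable_const)
        fix \<theta>
        have "norm (fourier_coeff (Vc (w \<theta>)) p) \<le> C / (1 + \<bar>real_of_int p\<bar>) ^ N"
          using C(2)[OF ws, of \<theta> p] by (simp add: pos_le_divide_eq)
        then have "norm (fourier_coeff (Vc (w \<theta>)) p) * exp (- (s * norm (kv k))) \<le> D"
          unfolding D_def by (rule mult_right_mono) simp
        then show "norm (fourier_coeff (Vc (w \<theta>)) p * E \<theta>) \<le> D"
          by (simp add: E_def norm_mult)
      qed
      also have "\<dots> = (2 * pi) ^ CARD('n) * D"
      proof -
        have "measure lborel (tbox :: (real ^ 'n) set) = (\<Prod>i\<in>(UNIV :: 'n set). 2 * pi)"
          by (subst content_cbox_cart) (auto simp: interval_ne_empty_cart)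
        then show ?thesis by simp
      qed
      finally have le: "norm (integral tbox (\<lambda>\<theta>. fourier_coeff (Vc (w \<theta>)) p * E \<theta>)) \<le> (2 * pi) ^ CARD('n) * D" .
      have nN: "norm ?N = 1 / (2 * pi) ^ CARD('n)"
        by (simp add: norm_divide norm_power norm_mult)
      have "norm (Vh k p) \<le> 1 / (2 * pi) ^ CARD('n) * ((2 * pi) ^ CARD('n) * D)"
        unfolding Vh_eq norm_mult nN by (rule mult_left_mono[OF le]) simp
      then have "norm (Vh k p) \<le> D"
        by simp
      then have "norm (Vh k p) * exp (s * norm (kv k)) * (1 + \<bar>real_of_int p\<bar>) ^ N \<le>
          D * exp (s * norm (kv k)) * (1 + \<bar>real_of_int p\<bar>) ^ N"
        by (intro mult_right_mono) auto
      also have "\<dots> = C"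
        by (simp add: D_def exp_minus)
      finally show ?thesis .
    qed
    then show ?thesis using C(1) by blast
  qed
  have even: "Vh k (- p) = Vh k p" for k p
    unfolding Vh_def by (rule fourier_coeff_uminus) (simp add: ext even_ext_minus)
  \<comment> \<open>Conjugation reflects both frequencies of a real function; evenness in
    \<open>x\<close> removes the reflection of \<open>p\<close>.\<close>
  have cnj: "cnj (Vh k p) = Vh (- k) p" for k p
  proof -
    have "cnj (Vh k p) = Vh (- k) (- p)"
      unfolding Vh_def cnj_fourier_coeff cnj_torus_coeff by (simp add: ext)
    then show ?thesis by (simp add: even)
  qed
  have inv: "fourier_coeff (\<lambda>x. of_real (even_ext V \<theta> x)) p = (\<Sum>\<^sub>\<infinity>k. Vh k p * cis (kv k \<bullet> \<theta>))" if "s > 0" for \<theta> p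
  proof -
    obtain C where C: "\<And>k p. norm (Vh k p) * exp (s * norm (kv k)) * (1 + \<bar>real_of_int p\<bar>) ^ 0 \<le> C"
      using decay[of 0] by blast
    have "(\<lambda>k. norm (torus_coeff (v p) k)) summable_on UNIV"
    proof (rule summable_on_comparison_test)
      show "(\<lambda>k :: int ^ 'n. C * exp (- s * norm (kv k))) summable_on UNIV"
        by (rule summable_on_cmult_right[OF summable_exp_kv[OF that]])
      show "norm (torus_coeff (v p) k) \<le> C * exp (- s * norm (kv k))" for k
        using C[of k p] unfolding Vh_v[symmetric] by (simp add: exp_minus field_simps)
    qed simp
    moreover have "axis_periodic (v p)"
      using axis_periodicD[OF per] unfolding v_def axis_periodic_def ext[abs_def] by simp
    ultimately have "v p \<theta> = (\<Sum>\<^sub>\<infinity>k. torus_coeff (v p) k * cis (kv k \<bullet> \<theta>))"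
      by (intro torus_fourier_inversion[OF cv])
    then show ?thesis by (simp add: v_def Vh_v ext[abs_def])
  qed
  show ?thesis
    using decay Vh0 even cnj inv by (intro exI[of _ Vh]) blast
qed

section \<open>Nonresonant frequencies\<close>

text \<open>
  Disjoint translates of a slab of thickness \<open>2 \<delta> / |v|\<close> inside the doubled ball
  are counted.
\<close>

lemma measure_slab_le:
  fixes v :: "real ^ 'n"
  assumes v: "v \<noteq> 0" and \<delta>: "\<delta> > 0" and R: "R > 0"
  defines "S \<equiv> {\<omega>. norm \<omega> \<le> R \<and> \<bar>v \<bullet> \<omega>\<bar> \<le> \<delta>}"
  shows "S \<in> lmeasurable"
    and "measure lebesgue S \<le> 6 * \<delta> / (R * norm v) * measure lebesgue (cball 0 (2 * R) :: (real ^ 'n) set)"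
proof -
  let ?B = "cball 0 (2 * R) :: (real ^ 'n) set"
  have nv: "norm v > 0" using v by simp
  have cl: "closed {\<omega>. \<bar>v \<bullet> \<omega>\<bar> \<le> \<delta>}"
    by (intro closed_Collect_le continuous_intros)
  have "S = cball 0 R \<inter> {\<omega>. \<bar>v \<bullet> \<omega>\<bar> \<le> \<delta>}" by (auto simp: S_def)
  then have "compact S" using cl by (simp add: compact_Int_closed)
  then show m: "S \<in> lmeasurable" by (rule lmeasurable_compact)
  define d where "d = \<delta> / norm v"
  have d: "d > 0" using \<delta> nv by (simp add: d_def)
  have count: "real m * measure lebesgue S \<le> measure lebesgue ?B" if m3: "3 * d * real m \<le> R" for m
  proof -
    define e where "e = v /\<^sub>R norm v"
    have e: "norm e = 1" "v \<bullet> e = norm v"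
      using nv by (simp_all add: e_def dot_square_norm power2_eq_square)
    define T where "T = (\<lambda>j::nat. (+) ((3 * d * real j) *\<^sub>R e) ` S)"
    have T: "T j \<in> lmeasurable" "measure lebesgue (T j) = measure lebesgue S" for j
      unfolding T_def using m by (simp_all add: measurable_translation measure_translation)
    have pos: "\<bar>v \<bullet> x - 3 * \<delta> * real j\<bar> \<le> \<delta>" if "x \<in> T j" for x j
      using that nv by (auto simp: T_def S_def inner_add_right e d_def)
    have "disjoint_family_on T {..<m}"
      unfolding disjoint_family_on_def
    proof (intro ballI impI)
      fix i j :: nat assume ij: "i \<noteq> j"
      have "1 \<le> \<bar>real i - real j\<bar>" using ij by linarith
      then have "3 * \<delta> * 1 \<le> 3 * \<delta> * \<bar>real i - real j\<bar>" using \<delta> by (intro mult_left_mono) auto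
      also have "\<dots> = \<bar>3 * \<delta> * real i - 3 * \<delta> * real j\<bar>"
        using \<delta> by (simp add: abs_mult flip: right_diff_distrib)
      finally show "T i \<inter> T j = {}" using pos[of _ i] pos[of _ j] \<delta> by fastforce
    qed
    then have "measure lebesgue (\<Union>j\<in>{..<m}. T j) = (\<Sum>j<m. measure lebesgue (T j))"
      using T(1) by (intro measure_finite_Union) (auto simp: fmeasurable_def less_top[symmetric] simp del: emeasure_completion)
    then have "real m * measure lebesgue S = measure lebesgue (\<Union>j\<in>{..<m}. T j)"
      using T(2) by simp
    also have "\<dots> \<le> measure lebesgue ?B"
    proof (rule measure_mono_fmeasurable)
      show "(\<Union>j\<in>{..<m}. T j) \<subseteq> ?B"
      proof
        fix x assume "x \<in> (\<Union>j\<in>{..<m}. T j)"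
        then obtain j \<omega> where j: "j < m" "norm \<omega> \<le> R" "x = (3 * d * real j) *\<^sub>R e + \<omega>"
          by (auto simp: T_def S_def)
        have "norm x \<le> 3 * d * real j + norm \<omega>"
          unfolding j(3) using d e norm_triangle_ineq[of "(3 * d * real j) *\<^sub>R e" \<omega>] by simp
        also have "3 * d * real j \<le> 3 * d * real m"
          using d j(1) by (intro mult_left_mono) auto
        finally show "x \<in> ?B" using j(2) m3 by simp
      qed
      show "(\<Union>j\<in>{..<m}. T j) \<in> sets lebesgue" using T(1) by (intro sets.finite_UN) (auto intro: fmeasurableD)
    qed simp
    finally show ?thesis .
  qed
  have "measure lebesgue S \<le> 6 * d / R * measure lebesgue ?B"
  proof (cases "3 * d \<le> R")
    case True
    define m where "m = nat \<lfloor>R / (3 * d)\<rfloor>"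
    have q: "R / (3 * d) \<ge> 1" using True d by simp
    have m1: "real m \<le> R / (3 * d)" "R / (3 * d) < real m + 1" "real m \<ge> 1"
    proof -
      have "1 \<le> \<lfloor>R / (3 * d)\<rfloor>" using q by simp
      then show "real m \<le> R / (3 * d)" "R / (3 * d) < real m + 1" "real m \<ge> 1"
        unfolding m_def by linarith+
    qed
    have "3 * d * real m \<le> R" using m1(1) d by (simp add: field_simps)
    note c = count[OF this]
    have "R / (6 * d) = R / (3 * d) / 2" by simp
    then have "R / (6 * d) \<le> real m" using m1 by linarith
    then have "R / (6 * d) * measure lebesgue S \<le> real m * measure lebesgue S" by (rule mult_right_mono) simp
    then have "R / (6 * d) * measure lebesgue S \<le> measure lebesgue ?B" using c by linarith
    then show ?thesis using d R by (simp add: field_simps)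
  next
    case False
    have "measure lebesgue S \<le> measure lebesgue ?B"
      using m R by (intro measure_mono_fmeasurable) (auto simp: S_def fmeasurableD)
    also have "1 \<le> 6 * d / R" using False d R by (simp add: field_simps)
    then have "1 * measure lebesgue ?B \<le> 6 * d / R * measure lebesgue ?B" by (rule mult_right_mono) simp
    finally show ?thesis by simp
  qed
  then show "measure lebesgue S \<le> 6 * \<delta> / (R * norm v) * measure lebesgue ?B"
    by (simp add: d_def divide_simps mult.commute)
qed

text \<open>The measure is exactly \<open>2 ^ n - 1\<close> times that of the ball of radius
  \<open>M\<close>, where \<open>n\<close> is the dimension, and the first factor is at least
  1.\<close>

lemma measure_annulus_ge:
  assumes "M \<ge> 0"
  shows "M ^ CARD('n) * measure lebesgue (ball 0 1 :: (real ^ 'n) set) \<le> measure lebesgue (annulus M :: (real ^ 'n) set)"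
proof -
  let ?n = "CARD('n)" and ?u = "measure lebesgue (ball 0 1 :: (real ^ 'n) set)"
  have "ball 0 M \<subseteq> (cball 0 (2 * M) :: (real ^ 'n) set)" using assms by auto
  then have "measure lebesgue (annulus M :: (real ^ 'n) set) =
      measure lebesgue (cball 0 (2 * M) :: (real ^ 'n) set) - measure lebesgue (ball 0 M :: (real ^ 'n) set)"
    unfolding annulus_def by (intro measurable_measure_Diff) (auto intro: fmeasurableD)
  also have "\<dots> = (2 * M) ^ ?n * ?u - M ^ ?n * ?u"
    using assms content_ball_conv_unit_ball[of "2 * M" "0 :: real ^ 'n"] content_ball_conv_unit_ball[of M "0 :: real ^ 'n"]
    by (simp add: content_cball_conv_ball)
  also have "\<dots> = (2 ^ ?n - 1) * (M ^ ?n * ?u)"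
    by (simp add: power_mult_distrib algebra_simps)
  finally have eq: "measure lebesgue (annulus M :: (real ^ 'n) set) = (2 ^ ?n - 1) * (M ^ ?n * ?u)" .
  have "(2::real) ^ 1 \<le> 2 ^ ?n" by (intro power_increasing) (auto simp: Suc_le_eq)
  then have "1 * (M ^ ?n * ?u) \<le> (2 ^ ?n - 1) * (M ^ ?n * ?u)"
    using assms by (intro mult_right_mono) auto
  then show ?thesis unfolding eq by simp
qed

text \<open>The factor \<open>M\<close> makes the condition invariant under scaling of the annulus.
  The 1-norm in the exponent lets the sum over all \<open>k\<close> factorize.\<close>

definition nonresonant :: "real \<Rightarrow> real \<Rightarrow> real \<Rightarrow> (real ^ 'n) set" where
  "nonresonant \<epsilon> \<gamma> M = {\<omega> \<in> annulus M. \<forall>k. k \<noteq> 0 \<longrightarrow> \<gamma> * M * exp (- (\<epsilon> * norm1 k)) \<le> \<bar>kv k \<bullet> \<omega>\<bar>}"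

lemma nonresonant_measurable: "nonresonant \<epsilon> \<gamma> M \<in> sets lebesgue"
proof -
  have "annulus M \<in> sets (borel :: (real ^ 'n) measure)" unfolding annulus_def by (intro sets.Diff) auto
  moreover have "closed {\<omega> :: real ^ 'n. \<forall>k. k \<noteq> 0 \<longrightarrow> \<gamma> * M * exp (- (\<epsilon> * norm1 k)) \<le> \<bar>kv k \<bullet> \<omega>\<bar>}"
    unfolding Collect_all_eq by (intro closed_INT ballI closed_Collect_imp closed_Collect_le continuous_intros) auto
  ultimately have "nonresonant \<epsilon> \<gamma> M \<in> sets (borel :: (real ^ 'n) measure)"
    unfolding nonresonant_def Collect_conj_eq by (auto intro: sets.Int borel_closed)
  then have "nonresonant \<epsilon> \<gamma> M \<in> sets lborel" by simp
  then show ?thesis by (rule sets_completionI_sets)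
qed

text \<open>Each resonant slab has relative measure at most a constant times
  \<open>\<gamma> * exp (- \<epsilon> * norm1 k)\<close>, and these bounds have a finite sum; hence
  the constant depends on neither \<open>\<gamma>\<close> nor \<open>M\<close>.\<close>

lemma measure_resonant_le:
  assumes "\<epsilon> > 0"
  shows "\<exists>c>0. \<forall>\<gamma> M. 0 < \<gamma> \<longrightarrow> 1 < M \<longrightarrow>
    measure lebesgue (annulus M - nonresonant \<epsilon> \<gamma> M :: (real ^ 'n) set) / measure lebesgue (annulus M :: (real ^ 'n) set) \<le> c * \<gamma>"
proof -
  let ?n = "CARD('n)" and ?u = "measure lebesgue (ball 0 1 :: (real ^ 'n) set)"
  define S where "S = (\<Sum>\<^sub>\<infinity>k :: int ^ 'n. exp (- \<epsilon> * norm1 k))"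
  have sm: "(\<lambda>k :: int ^ 'n. exp (- \<epsilon> * norm1 k)) summable_on UNIV" by (rule summable_exp_norm1[OF assms])
  have S0: "S \<ge> 0" unfolding S_def by (rule infsum_nonneg) simp
  have u: "?u > 0" using content_ball_pos[of 1 "0 :: real ^ 'n"] by simp
  \<comment> \<open>The slab estimate at radius \<open>2 * M\<close> has the factor
    \<open>6 / 2 = 3\<close> and refers to a ball of radius \<open>4 * M\<close>, whence the power
    of 4; adding 1 makes \<open>c\<close> visibly positive.\<close>
  define c where "c = 3 * 4 ^ ?n * S + 1"
  have "measure lebesgue (annulus M - nonresonant \<epsilon> \<gamma> M :: (real ^ 'n) set) / measure lebesgue (annulus M :: (real ^ 'n) set) \<le> c * \<gamma>"
    if \<gamma>: "0 < \<gamma>" and M: "1 < M" for \<gamma> M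
  proof -
    define \<delta> where "\<delta> = (\<lambda>k :: int ^ 'n. \<gamma> * M * exp (- (\<epsilon> * norm1 k)))"
    have \<delta>0: "\<delta> k > 0" for k using \<gamma> M by (simp add: \<delta>_def)
    let ?C = "measure lebesgue (cball 0 (2 * (2 * M)) :: (real ^ 'n) set)"
    have C: "?C = 4 ^ ?n * M ^ ?n * ?u"
      using M content_ball_conv_unit_ball[of "4 * M" "0 :: real ^ 'n"]
      by (simp add: content_cball_conv_ball power_mult_distrib)
    define T where "T = (\<lambda>k :: int ^ 'n. if k = 0 then {} else {\<omega>. norm \<omega> \<le> 2 * M \<and> \<bar>kv k \<bullet> \<omega>\<bar> \<le> \<delta> k})"
    have Tm: "T k \<in> lmeasurable \<and> measure lebesgue (T k) \<le> 3 * \<delta> k / M * ?C" for k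
    proof (cases "k = 0")
      case True
      then show ?thesis using \<delta>0[of k] M by (simp add: T_def)
    next
      case False
      then have k: "kv k \<noteq> 0" "1 \<le> norm (kv k)" using norm_kv_ge_1[OF False] by auto
      have "6 * \<delta> k / (2 * M * norm (kv k)) \<le> 6 * \<delta> k / (2 * M * 1)"
        using k(2) \<delta>0[of k] M by (intro divide_left_mono mult_left_mono mult_pos_pos) auto
      then have "6 * \<delta> k / (2 * M * norm (kv k)) * ?C \<le> 3 * \<delta> k / M * ?C"
        by (intro mult_right_mono) auto
      then show ?thesis
        using measure_slab_le[OF k(1) \<delta>0[of k], of "2 * M"] M False by (simp add: T_def)
    qed
    let ?e = "from_nat :: nat \<Rightarrow> int ^ 'n" and ?B = "3 * \<gamma> * ?C * S"
    \<comment> \<open>The slabs are enumerated by natural numbers. Numbers that are not the code of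
      the vector they decode to receive the empty set, so no slab is counted twice.\<close>
    define T' where "T' = (\<lambda>i. if to_nat (?e i) = i then T (?e i) else {})"
    have T'm: "T' i \<in> lmeasurable" for i using Tm by (simp add: T'_def)
    have "measure lebesgue (\<Union>i\<le>N. T' i) \<le> ?B" for N
    proof -
      let ?F = "{i \<in> {..N}. to_nat (?e i) = i}"
      have "measure lebesgue (\<Union>i\<le>N. T' i) \<le> (\<Sum>i\<le>N. measure lebesgue (T' i))"
        by (rule measure_UNION_le) (use T'm in \<open>auto intro: fmeasurableD\<close>)
      also have "\<dots> = (\<Sum>i\<in>?F. measure lebesgue (T (?e i)))"
        by (intro sum.mono_neutral_cong_right) (auto simp: T'_def)
      also have "\<dots> = (\<Sum>k\<in>?e ` ?F. measure lebesgue (T k))"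
      proof -
        have "inj_on ?e ?F"
          by (rule inj_on_inverseI[of _ to_nat]) simp
        then show ?thesis by (simp add: sum.reindex)
      qed
      also have "\<dots> \<le> (\<Sum>k\<in>?e ` ?F. 3 * \<gamma> * ?C * exp (- \<epsilon> * norm1 k))"
      proof (rule sum_mono)
        fix k :: "int ^ 'n"
        show "measure lebesgue (T k) \<le> 3 * \<gamma> * ?C * exp (- \<epsilon> * norm1 k)"
          using Tm[of k] M by (simp add: \<delta>_def mult.commute mult.left_commute)
      qed
      also have "\<dots> = 3 * \<gamma> * ?C * (\<Sum>k\<in>?e ` ?F. exp (- \<epsilon> * norm1 k))"
        by (simp only: sum_distrib_left)
      also have "\<dots> \<le> 3 * \<gamma> * ?C * S"
        unfolding S_def using \<gamma> by (intro mult_left_mono finite_sum_le_infsum[OF sm]) auto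
      finally show ?thesis .
    qed
    note leN = this
    have B: "(\<Union>i. T' i) \<in> lmeasurable" by (rule fmeasurable_countable_Union) (rule T'm leN)+
    have B2: "measure lebesgue (\<Union>i. T' i) \<le> ?B" by (rule measure_countable_Union_le) (rule T'm leN)+
    have "annulus M - nonresonant \<epsilon> \<gamma> M \<subseteq> (\<Union>i. T' i)"
    proof
      fix \<omega> :: "real ^ 'n" assume "\<omega> \<in> annulus M - nonresonant \<epsilon> \<gamma> M"
      then obtain k where "norm \<omega> \<le> 2 * M" "k \<noteq> 0" "\<bar>kv k \<bullet> \<omega>\<bar> < \<delta> k"
        unfolding nonresonant_def annulus_def \<delta>_def by (auto simp: not_le)
      then have "\<omega> \<in> T k" by (simp add: T_def)
      then have "\<omega> \<in> T' (to_nat k)" by (simp add: T'_def)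
      then show "\<omega> \<in> (\<Union>i. T' i)" by blast
    qed
    moreover have "annulus M - nonresonant \<epsilon> \<gamma> M \<in> sets (lebesgue :: (real ^ 'n) measure)"
      unfolding annulus_def by (intro sets.Diff nonresonant_measurable fmeasurableD) auto
    ultimately have "measure lebesgue (annulus M - nonresonant \<epsilon> \<gamma> M :: (real ^ 'n) set) \<le> measure lebesgue (\<Union>i. T' i)"
      by (rule measure_mono_fmeasurable[OF _ _ B])
    also note B2
    also have "?B \<le> c * \<gamma> * (M ^ ?n * ?u)"
    proof -
      have "0 \<le> \<gamma> * (M ^ ?n * ?u)" using \<gamma> M u by simp
      then show ?thesis unfolding C c_def by (simp add: algebra_simps)
    qed
    also have "\<dots> \<le> c * \<gamma> * measure lebesgue (annulus M :: (real ^ 'n) set)"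
      using measure_annulus_ge[where 'n = 'n, of M] M \<gamma> S0 u by (intro mult_left_mono) (auto simp: c_def)
    finally have "measure lebesgue (annulus M - nonresonant \<epsilon> \<gamma> M :: (real ^ 'n) set) \<le> c * \<gamma> * measure lebesgue (annulus M :: (real ^ 'n) set)" .
    moreover have "measure lebesgue (annulus M :: (real ^ 'n) set) > 0"
    proof -
      have "0 < M ^ ?n * ?u" using M u by simp
      also have "\<dots> \<le> measure lebesgue (annulus M :: (real ^ 'n) set)"
        using M by (intro measure_annulus_ge) simp
      finally show ?thesis .
    qed
    ultimately show ?thesis by (simp add: pos_divide_le_eq)
  qed
  moreover have "c > 0" using S0 by (auto simp: c_def intro!: add_nonneg_pos)
  ultimately show ?thesis by blast
qed

section \<open>Sums over Fourier modes\<close>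

lemma has_sum_fibres:
  fixes f :: "'i \<Rightarrow> 'a::banach" and \<pi> :: "'i \<Rightarrow> int"
  assumes "(\<lambda>i. norm (f i)) summable_on UNIV"
  shows "((\<lambda>p. \<Sum>\<^sub>\<infinity>i\<in>{i. \<pi> i = p}. f i) has_sum (\<Sum>\<^sub>\<infinity>i. f i)) UNIV"
proof -
  let ?S = "SIGMA p:UNIV. {i. \<pi> i = p}"
  have bij: "bij_betw (\<lambda>i. (\<pi> i, i)) UNIV ?S"
    by (rule bij_betwI[of _ _ _ snd]) auto
  have f: "f summable_on UNIV" by (rule abs_summable_summable[OF assms])
  have fib: "f summable_on {i. \<pi> i = p}" for p
    by (rule summable_on_subset_banach[OF f]) simp
  have "(f has_sum infsum f UNIV) UNIV" using f by simp
  then have "((\<lambda>x. f (snd x)) has_sum infsum f UNIV) ?S"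
    unfolding has_sum_reindex_bij_betw[OF bij, of "\<lambda>x. f (snd x)", symmetric] by simp
  then show ?thesis
    by (rule has_sum_SigmaD[where f = "\<lambda>x. f (snd x)"]) (simp add: fib)
qed

lemma pair_product_sum:
  fixes a :: "'a \<Rightarrow> real" and b :: "'b \<Rightarrow> real"
  assumes a: "a summable_on UNIV" "\<And>i. 0 \<le> a i" and b: "b summable_on UNIV" "\<And>i. 0 \<le> b i"
  shows "(\<lambda>(i, j). a i * b j) summable_on UNIV"
    and "(\<Sum>\<^sub>\<infinity>(i, j). a i * b j) = infsum a UNIV * infsum b UNIV"
proof -
  have "(\<lambda>x. a (fst x) * b (snd x)) summable_on (SIGMA i:UNIV. (UNIV :: 'b set))"
  proof (rule summable_on_SigmaI)
    show "((\<lambda>j. a (fst (i, j)) * b (snd (i, j))) has_sum (a i * infsum b UNIV)) UNIV" for i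
      using has_sum_cmult_right[OF has_sum_infsum[OF b(1)], of "a i"] by simp
    show "(\<lambda>i. a i * infsum b UNIV) summable_on UNIV" by (rule summable_on_cmult_left[OF a(1)])
  qed (simp_all add: a b)
  then show s: "(\<lambda>(i, j). a i * b j) summable_on UNIV" by (simp add: case_prod_unfold)
  have "(\<Sum>\<^sub>\<infinity>(i, j). a i * b j) = (\<Sum>\<^sub>\<infinity>i. \<Sum>\<^sub>\<infinity>j. a i * b j)"
    using infsum_Sigma'_banach[of "\<lambda>i j. a i * b j" UNIV "\<lambda>_. UNIV"] s by simp
  also have "\<dots> = infsum a UNIV * infsum b UNIV"
    by (simp add: infsum_cmult_right' infsum_cmult_left')
  finally show "(\<Sum>\<^sub>\<infinity>(i, j). a i * b j) = infsum a UNIV * infsum b UNIV" .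
qed

text \<open>Collects all modes with the same frequency in \<open>x\<close>: at a fixed angle this is
  the sequence of Fourier coefficients in \<open>x\<close>.\<close>

definition push :: "('i \<Rightarrow> int) \<Rightarrow> ('i \<Rightarrow> complex) \<Rightarrow> int \<Rightarrow> complex" where
  "push \<pi> c p = (\<Sum>\<^sub>\<infinity>i\<in>{i. \<pi> i = p}. c i)"

lemma one_plus_abs_add_le: "1 + \<bar>real_of_int (p + q)\<bar> \<le> (1 + \<bar>real_of_int p\<bar>) * (1 + \<bar>real_of_int q\<bar>)"
proof -
  have "(1 + \<bar>real_of_int p\<bar>) * (1 + \<bar>real_of_int q\<bar>) =
      1 + (\<bar>real_of_int p\<bar> + \<bar>real_of_int q\<bar>) + \<bar>real_of_int p\<bar> * \<bar>real_of_int q\<bar>"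
    by (simp add: algebra_simps)
  moreover have "0 \<le> \<bar>real_of_int p\<bar> * \<bar>real_of_int q\<bar>" by simp
  moreover have "\<bar>real_of_int (p + q)\<bar> \<le> \<bar>real_of_int p\<bar> + \<bar>real_of_int q\<bar>" by simp
  ultimately show ?thesis by linarith
qed

lemma one_plus_abs_add_power_le:
  "(1 + \<bar>real_of_int (p + q)\<bar>) ^ N \<le> (1 + \<bar>real_of_int p\<bar>) ^ N * (1 + \<bar>real_of_int q\<bar>) ^ N"
  unfolding power_mult_distrib[symmetric] by (rule power_mono[OF one_plus_abs_add_le]) simp

lemma rapid_push:
  assumes "rapid \<pi> c"
  shows "rapid_seq (push \<pi> c)"
    and "rnorm N (push \<pi> c) \<le> (\<Sum>\<^sub>\<infinity>i. norm (c i) * (1 + \<bar>real_of_int (\<pi> i)\<bar>) ^ N)"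
proof -
  let ?w = "\<lambda>N p. (1 + \<bar>real_of_int p\<bar>) ^ N"
  have sum: "(\<lambda>i. norm (norm (c i) * ?w N (\<pi> i))) summable_on UNIV" for N
    using rapidD[OF assms, of N] by simp
  have c: "(\<lambda>i. norm (c i)) summable_on UNIV" by (rule rapid_summable[OF assms])
  note hs = has_sum_fibres[OF sum, where \<pi> = \<pi>]
  have le: "norm (push \<pi> c p) * ?w N p \<le> (\<Sum>\<^sub>\<infinity>i\<in>{i. \<pi> i = p}. norm (c i) * ?w N (\<pi> i))" for N p
  proof -
    have "norm (push \<pi> c p) \<le> (\<Sum>\<^sub>\<infinity>i\<in>{i. \<pi> i = p}. norm (c i))"
      unfolding push_def by (rule norm_infsum_bound) (rule summable_on_subset_banach[OF c], simp)
    then have "norm (push \<pi> c p) * ?w N p \<le> (\<Sum>\<^sub>\<infinity>i\<in>{i. \<pi> i = p}. norm (c i)) * ?w N p"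
      by (rule mult_right_mono) simp
    also have "\<dots> = (\<Sum>\<^sub>\<infinity>i\<in>{i. \<pi> i = p}. norm (c i) * ?w N (\<pi> i))"
      unfolding infsum_cmult_left'[symmetric] by (rule infsum_cong) simp
    finally show ?thesis .
  qed
  have s: "(\<lambda>p. norm (push \<pi> c p) * ?w N p) summable_on UNIV" for N
    by (rule summable_on_norm_bound[OF has_sum_imp_summable[OF hs[of N]]]) (simp add: le)
  then show "rapid_seq (push \<pi> c)" by (simp add: rapid_def)
  have "rnorm N (push \<pi> c) \<le> (\<Sum>\<^sub>\<infinity>p. \<Sum>\<^sub>\<infinity>i\<in>{i. \<pi> i = p}. norm (c i) * ?w N (\<pi> i))"
    unfolding rnorm_def by (rule infsum_mono[OF s has_sum_imp_summable[OF hs]]) (rule le)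
  also have "\<dots> = (\<Sum>\<^sub>\<infinity>i. norm (c i) * ?w N (\<pi> i))" by (rule infsumI[OF hs])
  finally show "rnorm N (push \<pi> c) \<le> (\<Sum>\<^sub>\<infinity>i. norm (c i) * ?w N (\<pi> i))" .
qed

lemma summable_fibre: "rapid \<pi> c \<Longrightarrow> c summable_on {i. \<pi> i = p}"
  by (rule summable_on_subset_banach[OF abs_summable_summable[OF rapid_summable]]) simp_all

lemma push_minus: "rapid \<pi> c \<Longrightarrow> rapid \<pi> d \<Longrightarrow> push \<pi> (\<lambda>i. c i - d i) p = push \<pi> c p - push \<pi> d p"
  unfolding push_def by (rule infsum_minus_distrib[OF summable_fibre summable_fibre])

lemma push_cmult: "push \<pi> (\<lambda>i. a * c i) p = a * push \<pi> c p"
  unfolding push_def by (rule infsum_cmult_right')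

lemma push_reflect:
  assumes "\<And>i. \<iota> (\<iota> i) = i" "\<And>i. \<pi> (\<iota> i) = - \<pi> i" "\<And>i. c (\<iota> i) = c i"
  shows "push \<pi> c (- p) = push \<pi> c p"
  unfolding push_def using assms by (intro infsum_reindex_bij_witness[of _ \<iota> \<iota>]) auto

lemma cnj_push:
  assumes "\<And>i. \<tau> (\<tau> i) = i" "\<And>i. \<pi> (\<tau> i) = \<pi> i" "\<And>i. c (\<tau> i) = cnj (c i)"
  shows "cnj (push \<pi> c p) = push \<pi> c p"
  unfolding push_def infsum_cnj[symmetric] using assms by (intro infsum_reindex_bij_witness[of _ \<tau> \<tau>]) auto

lemma rapid_pair:
  fixes c :: "'a \<Rightarrow> complex" and d :: "'b \<Rightarrow> complex"
  assumes c: "rapid \<pi> c" and d: "rapid \<pi>' d"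
  shows "rapid (\<lambda>(a, b). \<pi> a + \<pi>' b) (\<lambda>(a, b). c a * d b)"
  unfolding rapid_def
proof
  fix N
  show "(\<lambda>i. norm (case i of (a, b) \<Rightarrow> c a * d b) * (1 + \<bar>real_of_int (case i of (a, b) \<Rightarrow> \<pi> a + \<pi>' b)\<bar>) ^ N) summable_on UNIV"
  proof (rule summable_on_norm_bound)
    show "(\<lambda>(a, b). (norm (c a) * (1 + \<bar>real_of_int (\<pi> a)\<bar>) ^ N) * (norm (d b) * (1 + \<bar>real_of_int (\<pi>' b)\<bar>) ^ N)) summable_on UNIV"
      by (rule pair_product_sum(1)) (simp_all add: rapidD[OF c] rapidD[OF d])
    fix i :: "'a \<times> 'b"
    obtain a b where i: "i = (a, b)" by (cases i)
    have "norm (c a * d b) * (1 + \<bar>real_of_int (\<pi> a + \<pi>' b)\<bar>) ^ N \<le>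
        norm (c a * d b) * ((1 + \<bar>real_of_int (\<pi> a)\<bar>) ^ N * (1 + \<bar>real_of_int (\<pi>' b)\<bar>) ^ N)"
      by (rule mult_left_mono[OF one_plus_abs_add_power_le]) simp
    then show "norm (norm (case i of (a, b) \<Rightarrow> c a * d b) * (1 + \<bar>real_of_int (case i of (a, b) \<Rightarrow> \<pi> a + \<pi>' b)\<bar>) ^ N) \<le>
        (case i of (a, b) \<Rightarrow> (norm (c a) * (1 + \<bar>real_of_int (\<pi> a)\<bar>) ^ N) * (norm (d b) * (1 + \<bar>real_of_int (\<pi>' b)\<bar>) ^ N))"
      by (simp add: i norm_mult mult_ac)
  qed
qed

text \<open>In spaces of negative order the coefficients may grow, though only polynomially; a
  rapidly decreasing family still compensates this, which makes all rearrangements below absolutely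
  convergent.\<close>

lemma sobolev_growth:
  assumes g: "sobolev r g"
  shows "\<exists>C\<ge>0. \<exists>N. \<forall>j. norm (g j) \<le> C * (1 + \<bar>real_of_int j\<bar>) ^ N"
proof -
  have le: "jap j powr (2 * r) * (norm (g j))\<^sup>2 \<le> sob_sq r g" for j
    using finite_sum_le_infsum[OF g[unfolded sobolev_def], of "{j}"] by (simp add: sob_sq_def)
  obtain N where N: "\<bar>- r\<bar> \<le> real N" using real_arch_simple by blast
  have "norm (g j) \<le> sqrt (sob_sq r g) * (1 + \<bar>real_of_int j\<bar>) ^ N" for j
  proof -
    have "sqrt (jap j powr (2 * r) * (norm (g j))\<^sup>2) \<le> sqrt (sob_sq r g)" using le by simp
    then have "jap j powr r * norm (g j) \<le> sqrt (sob_sq r g)"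
      by (simp add: real_sqrt_mult sqrt_jap_powr)
    then have "jap j powr (- r) * (jap j powr r * norm (g j)) \<le> jap j powr (- r) * sqrt (sob_sq r g)"
      by (rule mult_left_mono) simp
    moreover have "jap j powr (- r) * (jap j powr r * norm (g j)) = norm (g j)"
      unfolding mult.assoc[symmetric] powr_add[symmetric] by simp
    moreover have "jap j powr (- r) \<le> (1 + \<bar>real_of_int j\<bar>) ^ N"
      using jap_powr_add_le_power[OF N, of 0 j] by (simp add: jap_def)
    then have "jap j powr (- r) * sqrt (sob_sq r g) \<le> (1 + \<bar>real_of_int j\<bar>) ^ N * sqrt (sob_sq r g)"
      by (rule mult_right_mono) (simp add: sob_sq_nonneg)
    ultimately show ?thesis by (metis mult.commute order_trans)
  qed
  then show ?thesis by (intro exI[of _ "sqrt (sob_sq r g)"]) (auto simp: sob_sq_nonneg)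
qed

lemma rapid_times_shift_summable:
  assumes c: "rapid \<pi> c" and g: "sobolev r g"
  shows "(\<lambda>i. norm (c i * g (k - \<pi> i))) summable_on UNIV"
proof -
  obtain C N where C: "C \<ge> 0" "\<And>j. norm (g j) \<le> C * (1 + \<bar>real_of_int j\<bar>) ^ N"
    using sobolev_growth[OF g] by blast
  show ?thesis
  proof (rule summable_on_norm_bound)
    show "(\<lambda>i. C * (1 + \<bar>real_of_int k\<bar>) ^ N * (norm (c i) * (1 + \<bar>real_of_int (\<pi> i)\<bar>) ^ N)) summable_on UNIV"
      by (rule summable_on_cmult_right[OF rapidD[OF c]])
    fix i
    have "norm (g (k - \<pi> i)) \<le> C * ((1 + \<bar>real_of_int k\<bar>) ^ N * (1 + \<bar>real_of_int (\<pi> i)\<bar>) ^ N)"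
      using C(2)[of "k - \<pi> i"] mult_left_mono[OF one_plus_abs_add_power_le[of k "- \<pi> i" N] C(1)] by simp
    then have "norm (c i) * norm (g (k - \<pi> i)) \<le>
        norm (c i) * (C * ((1 + \<bar>real_of_int k\<bar>) ^ N * (1 + \<bar>real_of_int (\<pi> i)\<bar>) ^ N))"
      by (rule mult_left_mono) simp
    then show "norm (norm (c i * g (k - \<pi> i))) \<le> C * (1 + \<bar>real_of_int k\<bar>) ^ N * (norm (c i) * (1 + \<bar>real_of_int (\<pi> i)\<bar>) ^ N)"
      by (simp add: norm_mult mult_ac)
  qed
qed

lemma kop_push:
  assumes c: "rapid \<pi> c" and g: "sobolev r g"
  shows "kop (\<lambda>k j. push \<pi> c (k - j)) g k = (\<Sum>\<^sub>\<infinity>i. c i * g (k - \<pi> i))"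
proof -
  have "(\<Sum>\<^sub>\<infinity>i. c i * g (k - \<pi> i)) = (\<Sum>\<^sub>\<infinity>p. \<Sum>\<^sub>\<infinity>i\<in>{i. \<pi> i = p}. c i * g (k - \<pi> i))"
    by (rule infsumI[OF has_sum_fibres[OF rapid_times_shift_summable[OF c g]], symmetric])
  also have "\<dots> = (\<Sum>\<^sub>\<infinity>p. push \<pi> c p * g (k - p))"
    unfolding push_def infsum_cmult_left'[symmetric] by (intro infsum_cong) simp
  also have "\<dots> = (\<Sum>\<^sub>\<infinity>j. push \<pi> c (k - j) * g j)"
    by (rule infsum_reindex_bij_witness[of _ "\<lambda>j. k - j" "\<lambda>j. k - j"]) auto
  finally show ?thesis by (simp add: kop_def)
qed

text \<open>The square of a multiplication operator is described by pairs of modes, with frequencies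
  added and coefficients multiplied. The associativity needed is that of an absolutely convergent
  double sum.\<close>

lemma kop_push_pair:
  assumes c: "rapid \<pi> c" and g: "sobolev r g"
  shows "kop (\<lambda>k j. push (\<lambda>(a, b). \<pi> a + \<pi> b) (\<lambda>(a, b). c a * c b) (k - j)) g =
    kop (\<lambda>k j. push \<pi> c (k - j)) (kop (\<lambda>k j. push \<pi> c (k - j)) g)"
proof
  fix k
  let ?h = "kop (\<lambda>k j. push \<pi> c (k - j)) g"
  have "bounded_weight 0 (\<lambda>_ _. 1)" by (rule bounded_weightI[of _ 1 0]) simp
  from wop_sobolev(2)[OF this rapid_push(1)[OF c] g] have h: "sobolev r ?h"
    by (simp add: wop_1)
  have ab: "(\<lambda>(a, b). c a * c b * g (k - (\<pi> a + \<pi> b))) summable_on UNIV"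
    using abs_summable_summable[OF rapid_times_shift_summable[OF rapid_pair[OF c c] g, of k]] by (simp add: case_prod_unfold)
  have "kop (\<lambda>k j. push (\<lambda>(a, b). \<pi> a + \<pi> b) (\<lambda>(a, b). c a * c b) (k - j)) g k =
      (\<Sum>\<^sub>\<infinity>(a, b). c a * c b * g (k - (\<pi> a + \<pi> b)))"
    unfolding kop_push[OF rapid_pair[OF c c] g] by (simp add: case_prod_unfold)
  also have "\<dots> = (\<Sum>\<^sub>\<infinity>a. \<Sum>\<^sub>\<infinity>b. c a * c b * g (k - (\<pi> a + \<pi> b)))"
    using infsum_Sigma'_banach[of "\<lambda>a b. c a * c b * g (k - (\<pi> a + \<pi> b))" UNIV "\<lambda>_. UNIV"]
      ab by simp
  also have "\<dots> = (\<Sum>\<^sub>\<infinity>a. c a * ?h (k - \<pi> a))"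
    unfolding kop_push[OF c g] infsum_cmult_right'[symmetric]
    by (simp add: algebra_simps)
  also have "\<dots> = kop (\<lambda>k j. push \<pi> c (k - j)) ?h k"
    by (rule kop_push[OF c h, symmetric])
  finally show "kop (\<lambda>k j. push (\<lambda>(a, b). \<pi> a + \<pi> b) (\<lambda>(a, b). c a * c b) (k - j)) g k =
    kop (\<lambda>k j. push \<pi> c (k - j)) ?h k" .
qed

lemma weight_family_of_weight:
  assumes f: "\<And>n. weight_upto n m f" and f': "\<And>n. weight_upto n m f'"
    and \<mu>: "\<And>i. \<mu> i = f (\<pi> i) \<or> \<mu> i = f' (\<pi> i)"
  shows "weight_family m \<pi> \<mu>"
  unfolding weight_family_def
proof
  fix b
  obtain C K where C: "C \<ge> 0" "\<And>p j. \<bar>(dl ^^ b) (f p) j\<bar> \<le> C * (1 + \<bar>real_of_int p\<bar>) ^ K * jap j powr (m - real b)"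
    using weight_upto_dl[OF f[of b] order_refl] unfolding bounded_weight_def by blast
  obtain C' K' where C': "C' \<ge> 0" "\<And>p j. \<bar>(dl ^^ b) (f' p) j\<bar> \<le> C' * (1 + \<bar>real_of_int p\<bar>) ^ K' * jap j powr (m - real b)"
    using weight_upto_dl[OF f'[of b] order_refl] unfolding bounded_weight_def by blast
  have "\<bar>(dl ^^ b) (\<mu> i) j\<bar> \<le> (C + C') * (1 + \<bar>real_of_int (\<pi> i)\<bar>) ^ (K + K') * jap j powr (m - real b)" for i j
  proof -
    let ?p = "1 + \<bar>real_of_int (\<pi> i)\<bar>"
    have "C * ?p ^ K \<le> (C + C') * ?p ^ (K + K')" "C' * ?p ^ K' \<le> (C + C') * ?p ^ (K + K')"
      using C(1) C'(1) by (intro mult_mono power_increasing; simp)+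
    then have "C * ?p ^ K * jap j powr (m - real b) \<le> (C + C') * ?p ^ (K + K') * jap j powr (m - real b)"
      "C' * ?p ^ K' * jap j powr (m - real b) \<le> (C + C') * ?p ^ (K + K') * jap j powr (m - real b)"
      by (intro mult_right_mono; simp)+
    note le = order_trans[OF C(2)[of "\<pi> i" j] this(1)] order_trans[OF C'(2)[of "\<pi> i" j] this(2)]
    from \<mu>[of i] show ?thesis
      by (rule disjE) (simp_all only: le)
  qed
  then show "\<exists>C\<ge>0. \<exists>K. \<forall>i j. \<bar>(dl ^^ b) (\<mu> i) j\<bar> \<le> C * (1 + \<bar>real_of_int (\<pi> i)\<bar>) ^ K * jap j powr (m - real b)"
    using C(1) C'(1) by (intro exI[of _ "C + C'"]) auto
qed

section \<open>Families of single modes and pairs of modes\<close>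

lemma infsum_Plus:
  fixes F :: "'a + 'b \<Rightarrow> 'c::{t2_space, topological_comm_monoid_add}"
  assumes "(\<lambda>a. F (Inl a)) summable_on A" "(\<lambda>b. F (Inr b)) summable_on B"
  shows "F summable_on (A <+> B)"
    and "infsum F (A <+> B) = (\<Sum>\<^sub>\<infinity>a\<in>A. F (Inl a)) + (\<Sum>\<^sub>\<infinity>b\<in>B. F (Inr b))"
proof -
  have "F summable_on (Inl ` A)" "F summable_on (Inr ` B)"
    using assms by (simp_all add: summable_on_reindex o_def)
  moreover have "Inl ` A \<inter> Inr ` B = {}" by auto
  ultimately show "F summable_on (A <+> B)"
    and "infsum F (A <+> B) = (\<Sum>\<^sub>\<infinity>a\<in>A. F (Inl a)) + (\<Sum>\<^sub>\<infinity>b\<in>B. F (Inr b))"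
    unfolding Plus_def
    by (simp_all add: summable_on_Un_disjoint infsum_Un_disjoint infsum_reindex o_def)
qed

text \<open>
  The index type \<open>'i + 'i \<times> 'i\<close> carries the Fourier modes of operators that are of degree
  one and two in the generator.
\<close>

definition add_pair :: "('i \<Rightarrow> 'b::plus) \<Rightarrow> 'i \<times> 'i \<Rightarrow> 'b" where
  "add_pair f = (\<lambda>(a, b). f a + f b)"

definition mult_pair :: "('i \<Rightarrow> complex) \<Rightarrow> ('i \<Rightarrow> complex) \<Rightarrow> 'i \<times> 'i \<Rightarrow> complex" where
  "mult_pair A B = (\<lambda>(a, b). A a * B b)"

definition quad_index :: "('i \<Rightarrow> 'b::plus) \<Rightarrow> 'i + 'i \<times> 'i \<Rightarrow> 'b" where
  "quad_index f = case_sum f (add_pair f)"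

text \<open>The factor 2 is that of \<open>2 X B X\<close>; the parameter \<open>e\<close> will be
  \<open>\<i>\<close> for the diagonal and \<open>- \<i>\<close> for the off-diagonal entry.\<close>

definition quad_coeff :: "complex \<Rightarrow> ('i \<Rightarrow> complex) \<Rightarrow> 'i + 'i \<times> 'i \<Rightarrow> complex" where
  "quad_coeff e G = case_sum (\<lambda>a. e * G a) (\<lambda>x. 2 * mult_pair G G x)"

definition quad_weight :: "(int \<Rightarrow> int \<Rightarrow> real) \<Rightarrow> (int \<Rightarrow> int \<Rightarrow> real) \<Rightarrow> ('i \<Rightarrow> int) \<Rightarrow> 'i + 'i \<times> 'i \<Rightarrow> int \<Rightarrow> real" where
  "quad_weight f f' \<pi> = case_sum (\<lambda>a. f (\<pi> a)) (\<lambda>x. f' (add_pair \<pi> x))"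

definition quad_map :: "('i \<Rightarrow> 'i) \<Rightarrow> 'i + 'i \<times> 'i \<Rightarrow> 'i + 'i \<times> 'i" where
  "quad_map \<iota> = map_sum \<iota> (map_prod \<iota> \<iota>)"

lemmas quad_defs = quad_index_def quad_coeff_def quad_weight_def quad_map_def add_pair_def mult_pair_def

lemma weight_family_quad:
  assumes "\<And>n. weight_upto n m f" "\<And>n. weight_upto n m f'"
  shows "weight_family m (quad_index \<pi>) (quad_weight f f' \<pi>)"
  by (rule weight_family_of_weight[OF assms]) (auto simp: quad_defs split: sum.splits)

lemma admissible_cmult: "admissible \<sigma> \<kappa> \<pi> G \<Longrightarrow> admissible \<sigma> \<kappa> \<pi> (\<lambda>i. a * G i)"
  unfolding admissible_def norm_mult mult.assoc by (rule allI, rule summable_on_cmult_right, erule spec)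

lemma gnorm_cmult: "gnorm \<sigma> \<kappa> \<pi> N (\<lambda>i. a * G i) = norm a * gnorm \<sigma> \<kappa> \<pi> N G"
  unfolding gnorm_def norm_mult mult.assoc by (rule infsum_cmult_right')

lemma gnorm_add_le:
  assumes G: "admissible \<sigma> \<kappa> \<pi> G" and H: "admissible \<sigma> \<kappa> \<pi> H"
  shows "admissible \<sigma> \<kappa> \<pi> (\<lambda>i. G i + H i)"
    and "gnorm \<sigma> \<kappa> \<pi> N (\<lambda>i. G i + H i) \<le> gnorm \<sigma> \<kappa> \<pi> N G + gnorm \<sigma> \<kappa> \<pi> N H"
proof -
  let ?W = "\<lambda>N i. exp (\<sigma> * norm (\<kappa> i)) * (1 + \<bar>real_of_int (\<pi> i)\<bar>) ^ N"
  note s = G[unfolded admissible_def mult.assoc, rule_format] H[unfolded admissible_def mult.assoc, rule_format]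
  have le: "norm (G i + H i) * ?W N i \<le> norm (G i) * ?W N i + norm (H i) * ?W N i" for i N
    unfolding distrib_right[symmetric] by (rule mult_right_mono[OF norm_triangle_ineq]) simp
  have "(\<lambda>i. norm (G i + H i) * ?W N i) summable_on UNIV" for N
    by (rule summable_on_norm_bound[OF summable_on_add[OF s[of N]]]) (simp only: real_norm_def abs_mult abs_norm_cancel, use le in simp)
  then show adm: "admissible \<sigma> \<kappa> \<pi> (\<lambda>i. G i + H i)" by (simp add: admissible_def mult.assoc)
  show "gnorm \<sigma> \<kappa> \<pi> N (\<lambda>i. G i + H i) \<le> gnorm \<sigma> \<kappa> \<pi> N G + gnorm \<sigma> \<kappa> \<pi> N H"
    unfolding gnorm_def infsum_add[OF s, symmetric] mult.assoc
    by (rule infsum_mono[OF adm[unfolded admissible_def mult.assoc, rule_format] summable_on_add[OF s]]) (rule le)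
qed

text \<open>The weighted l1 norm is submultiplicative, because frequencies add and both
  \<open>exp (\<sigma> * norm k)\<close> and the powers of \<open>1 + |p|\<close> are
  submultiplicative weights.\<close>

lemma gnorm_mult_pair:
  assumes A: "admissible \<sigma> \<kappa> \<pi> A" and B: "admissible \<sigma> \<kappa> \<pi> B" and \<sigma>: "\<sigma> \<ge> 0"
  shows "admissible \<sigma> (add_pair \<kappa>) (add_pair \<pi>) (mult_pair A B)"
    and "gnorm \<sigma> (add_pair \<kappa>) (add_pair \<pi>) N (mult_pair A B) \<le> gnorm \<sigma> \<kappa> \<pi> N A * gnorm \<sigma> \<kappa> \<pi> N B"
proof -
  let ?W = "\<lambda>N i. exp (\<sigma> * norm (\<kappa> i)) * (1 + \<bar>real_of_int (\<pi> i)\<bar>) ^ N"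
  let ?V = "\<lambda>N x. norm (mult_pair A B x) * exp (\<sigma> * norm (add_pair \<kappa> x)) * (1 + \<bar>real_of_int (add_pair \<pi> x)\<bar>) ^ N"
  let ?P = "\<lambda>N (a, b). (norm (A a) * ?W N a) * (norm (B b) * ?W N b)"
  have sum: "(\<lambda>a. norm (A a) * ?W N a) summable_on UNIV" "(\<lambda>b. norm (B b) * ?W N b) summable_on UNIV" for N
    using A B unfolding admissible_def mult.assoc by simp_all
  have nonneg: "0 \<le> norm (A a) * ?W N a" "0 \<le> norm (B b) * ?W N b" for N a b by simp_all
  have gn: "gnorm \<sigma> \<kappa> \<pi> N A = (\<Sum>\<^sub>\<infinity>a. norm (A a) * ?W N a)" "gnorm \<sigma> \<kappa> \<pi> N B = (\<Sum>\<^sub>\<infinity>b. norm (B b) * ?W N b)" for N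
    by (simp_all add: gnorm_def mult.assoc)
  have P: "?P N summable_on UNIV" "infsum (?P N) UNIV = gnorm \<sigma> \<kappa> \<pi> N A * gnorm \<sigma> \<kappa> \<pi> N B" for N
    unfolding gn by (rule pair_product_sum[OF sum(1) nonneg(1) sum(2) nonneg(2)])+
  have le: "?V N x \<le> ?P N x" for N x
  proof -
    obtain a b where x: "x = (a, b)" by (cases x)
    have "\<sigma> * norm (\<kappa> a + \<kappa> b) \<le> \<sigma> * norm (\<kappa> a) + \<sigma> * norm (\<kappa> b)"
      unfolding distrib_left[symmetric] using \<sigma> by (intro mult_left_mono norm_triangle_ineq)
    then have "exp (\<sigma> * norm (\<kappa> a + \<kappa> b)) \<le> exp (\<sigma> * norm (\<kappa> a)) * exp (\<sigma> * norm (\<kappa> b))"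
      by (simp flip: exp_add)
    then have "exp (\<sigma> * norm (\<kappa> a + \<kappa> b)) * (1 + \<bar>real_of_int (\<pi> a + \<pi> b)\<bar>) ^ N \<le>
        (exp (\<sigma> * norm (\<kappa> a)) * exp (\<sigma> * norm (\<kappa> b))) *
        ((1 + \<bar>real_of_int (\<pi> a)\<bar>) ^ N * (1 + \<bar>real_of_int (\<pi> b)\<bar>) ^ N)"
      by (rule mult_mono[OF _ one_plus_abs_add_power_le]) auto
    then have "norm (A a * B b) * (exp (\<sigma> * norm (\<kappa> a + \<kappa> b)) * (1 + \<bar>real_of_int (\<pi> a + \<pi> b)\<bar>) ^ N) \<le>
        norm (A a * B b) * ((exp (\<sigma> * norm (\<kappa> a)) * exp (\<sigma> * norm (\<kappa> b))) *
        ((1 + \<bar>real_of_int (\<pi> a)\<bar>) ^ N * (1 + \<bar>real_of_int (\<pi> b)\<bar>) ^ N))"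
      by (rule mult_left_mono) simp
    then show ?thesis by (simp add: x add_pair_def mult_pair_def norm_mult mult_ac)
  qed
  have "?V N summable_on UNIV" for N
    by (rule summable_on_norm_bound[OF P(1)[of N]]) (use le in \<open>simp add: abs_mult\<close>)
  then show adm: "admissible \<sigma> (add_pair \<kappa>) (add_pair \<pi>) (mult_pair A B)" by (simp add: admissible_def)
  show "gnorm \<sigma> (add_pair \<kappa>) (add_pair \<pi>) N (mult_pair A B) \<le> gnorm \<sigma> \<kappa> \<pi> N A * gnorm \<sigma> \<kappa> \<pi> N B"
    unfolding P(2)[symmetric] unfolding gnorm_def
    by (rule infsum_mono[OF adm[unfolded admissible_def, rule_format] P(1)]) (rule le)
qed

lemma gnorm_case_sum:
  assumes A: "admissible \<sigma> \<kappa> \<pi> A" and B: "admissible \<sigma> \<kappa>' \<pi>' B"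
  shows "admissible \<sigma> (case_sum \<kappa> \<kappa>') (case_sum \<pi> \<pi>') (case_sum A B)"
    and "gnorm \<sigma> (case_sum \<kappa> \<kappa>') (case_sum \<pi> \<pi>') N (case_sum A B) = gnorm \<sigma> \<kappa> \<pi> N A + gnorm \<sigma> \<kappa>' \<pi>' N B"
proof -
  let ?F = "\<lambda>N i. norm (case_sum A B i) * exp (\<sigma> * norm (case_sum \<kappa> \<kappa>' i)) * (1 + \<bar>real_of_int (case_sum \<pi> \<pi>' i)\<bar>) ^ N"
  have sum: "(\<lambda>a. ?F N (Inl a)) summable_on UNIV" "(\<lambda>b. ?F N (Inr b)) summable_on UNIV" for N
    using A B by (simp_all add: admissible_def)
  note P = infsum_Plus[OF sum, unfolded UNIV_Plus_UNIV]
  show "admissible \<sigma> (case_sum \<kappa> \<kappa>') (case_sum \<pi> \<pi>') (case_sum A B)"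
    unfolding admissible_def using P(1) by blast
  show "gnorm \<sigma> (case_sum \<kappa> \<kappa>') (case_sum \<pi> \<pi>') N (case_sum A B) = gnorm \<sigma> \<kappa> \<pi> N A + gnorm \<sigma> \<kappa>' \<pi>' N B"
    unfolding gnorm_def P(2) by simp
qed

lemma quad_coeff_admissible:
  assumes G: "admissible \<sigma> \<kappa> \<pi> G" and \<sigma>: "\<sigma> \<ge> 0"
  shows "admissible \<sigma> (quad_index \<kappa>) (quad_index \<pi>) (quad_coeff e G)"
    and "gnorm \<sigma> (quad_index \<kappa>) (quad_index \<pi>) N (quad_coeff e G) \<le>
      norm e * gnorm \<sigma> \<kappa> \<pi> N G + 2 * (gnorm \<sigma> \<kappa> \<pi> N G)\<^sup>2"
proof -
  note A = admissible_cmult[OF G, of e] and B = admissible_cmult[OF gnorm_mult_pair(1)[OF G G \<sigma>], of 2]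
  show "admissible \<sigma> (quad_index \<kappa>) (quad_index \<pi>) (quad_coeff e G)"
    unfolding quad_index_def quad_coeff_def by (rule gnorm_case_sum(1)[OF A B])
  show "gnorm \<sigma> (quad_index \<kappa>) (quad_index \<pi>) N (quad_coeff e G) \<le>
      norm e * gnorm \<sigma> \<kappa> \<pi> N G + 2 * (gnorm \<sigma> \<kappa> \<pi> N G)\<^sup>2"
    unfolding quad_index_def quad_coeff_def gnorm_case_sum(2)[OF A B] gnorm_cmult
    using gnorm_mult_pair(2)[OF G G \<sigma>, of N] by (simp add: power2_eq_square)
qed

text \<open>The quadratic part is differenced by inserting a mixed term: with
  \<open>D = G - H\<close>, the product of \<open>G\<close> with itself minus that of
  \<open>H\<close> is \<open>D\<close> times \<open>G\<close> plus \<open>H\<close> times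
  \<open>D\<close>.\<close>

lemma quad_coeff_diff:
  assumes G: "admissible \<sigma> \<kappa> \<pi> G" and H: "admissible \<sigma> \<kappa> \<pi> H" and \<sigma>: "\<sigma> \<ge> 0"
  shows "gnorm \<sigma> (quad_index \<kappa>) (quad_index \<pi>) N (\<lambda>i. quad_coeff e G i - quad_coeff e H i) \<le>
    (norm e + 2 * (gnorm \<sigma> \<kappa> \<pi> N G + gnorm \<sigma> \<kappa> \<pi> N H)) * gnorm \<sigma> \<kappa> \<pi> N (\<lambda>i. G i - H i)"
proof -
  let ?D = "\<lambda>i. G i - H i"
  have D: "admissible \<sigma> \<kappa> \<pi> ?D" by (rule admissible_minus[OF G H])
  note DG = gnorm_mult_pair[OF D G \<sigma>] and HD = gnorm_mult_pair[OF H D \<sigma>]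
  note A = admissible_cmult[OF D, of e]
    and B = admissible_cmult[OF gnorm_add_le(1)[OF DG(1) HD(1)], of 2]
  have eq: "(\<lambda>i. quad_coeff e G i - quad_coeff e H i) =
      case_sum (\<lambda>i. e * ?D i) (\<lambda>x. 2 * (mult_pair ?D G x + mult_pair H ?D x))"
    by (rule ext) (auto simp: quad_defs algebra_simps split: sum.splits)
  show ?thesis
    unfolding eq quad_index_def gnorm_case_sum(2)[OF A B] gnorm_cmult
    using gnorm_add_le(2)[OF DG(1) HD(1), of N] DG(2)[of N] HD(2)[of N] by (simp add: algebra_simps)
qed

definition mode_coeff :: "('i \<Rightarrow> real ^ 'n) \<Rightarrow> ('i \<Rightarrow> complex) \<Rightarrow> real ^ 'n \<Rightarrow> 'i \<Rightarrow> complex" where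
  "mode_coeff \<kappa> G \<theta> i = G i * cis (\<kappa> i \<bullet> \<theta>)"

lemma rapid_mode_coeff:
  assumes "admissible \<sigma> \<kappa> \<pi> G" "0 \<le> \<sigma>"
  shows "rapid \<pi> (mode_coeff \<kappa> G \<theta>)"
proof -
  have "cvec \<theta> \<in> strip 0" by (simp add: strip_def cvec_def vec_eq_iff flip: zero_vec_def)
  from admissible_rapid[OF assms(1) this assms(2)] show ?thesis
    unfolding mode_coeff_def[abs_def] by (simp add: cdot_cvec cis_conv_exp)
qed

lemma kernel_single:
  "kernel \<kappa> \<pi> (\<lambda>i. f (\<pi> i)) G \<theta> k j = of_real (f (k - j) j) * push \<pi> (mode_coeff \<kappa> G \<theta>) (k - j)"
  unfolding kernel_def push_def infsum_cmult_right'[symmetric]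
  by (intro infsum_cong) (simp add: mode_coeff_def)

text \<open>Identifies the matrix of a symbol over the sum type with the two-term form of
  \<open>ker_d\<close> and \<open>ker_o\<close>.\<close>

lemma kernel_quad:
  assumes G: "admissible \<sigma> \<kappa> \<pi> G" and \<sigma>: "0 \<le> \<sigma>"
  shows "kernel (quad_index \<kappa>) (quad_index \<pi>) (quad_weight f f' \<pi>) (quad_coeff e G) \<theta> k j =
    of_real (f (k - j) j) * (e * push \<pi> (mode_coeff \<kappa> G \<theta>) (k - j)) +
    of_real (f' (k - j) j) * (2 * push (add_pair \<pi>) (mult_pair (mode_coeff \<kappa> G \<theta>) (mode_coeff \<kappa> G \<theta>)) (k - j))"
proof -
  let ?c = "mode_coeff \<kappa> G \<theta>"
  note c = rapid_mode_coeff[OF G \<sigma>, of \<theta>]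
  have cc: "rapid (add_pair \<pi>) (mult_pair ?c ?c)"
    unfolding add_pair_def mult_pair_def by (rule rapid_pair[OF c c])
  let ?A = "{a. \<pi> a = k - j}" and ?B = "{x. add_pair \<pi> x = k - j}"
  let ?F = "\<lambda>i. of_real (quad_weight f f' \<pi> i j) * (quad_coeff e G i * cis (quad_index \<kappa> i \<bullet> \<theta>))"
  have set: "{i. quad_index \<pi> i = k - j} = ?A <+> ?B"
  proof (rule set_eqI)
    show "i \<in> {i. quad_index \<pi> i = k - j} \<longleftrightarrow> i \<in> ?A <+> ?B" for i
      by (cases i) (auto simp: quad_index_def)
  qed
  have l: "?F (Inl a) = of_real (f (k - j) j) * e * ?c a" if "a \<in> ?A" for a
    using that by (simp add: quad_defs mode_coeff_def)
  have r: "?F (Inr x) = of_real (f' (k - j) j) * 2 * mult_pair ?c ?c x" if "x \<in> ?B" for x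
    using that by (cases x) (simp add: quad_defs mode_coeff_def inner_add_left cis_mult[symmetric])
  have "(\<lambda>a. ?F (Inl a)) summable_on ?A \<longleftrightarrow> (\<lambda>a. of_real (f (k - j) j) * e * ?c a) summable_on ?A"
    by (rule summable_on_cong) (rule l)
  moreover have "(\<lambda>a. of_real (f (k - j) j) * e * ?c a) summable_on ?A"
    by (rule summable_on_cmult_right[OF summable_fibre[OF c]])
  ultimately have sl: "(\<lambda>a. ?F (Inl a)) summable_on ?A" by simp
  have "(\<lambda>x. ?F (Inr x)) summable_on ?B \<longleftrightarrow> (\<lambda>x. of_real (f' (k - j) j) * 2 * mult_pair ?c ?c x) summable_on ?B"
    by (rule summable_on_cong) (rule r)
  moreover have "(\<lambda>x. of_real (f' (k - j) j) * 2 * mult_pair ?c ?c x) summable_on ?B"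
    by (rule summable_on_cmult_right[OF summable_fibre[OF cc]])
  ultimately have sr: "(\<lambda>x. ?F (Inr x)) summable_on ?B" by simp
  have "kernel (quad_index \<kappa>) (quad_index \<pi>) (quad_weight f f' \<pi>) (quad_coeff e G) \<theta> k j =
      (\<Sum>\<^sub>\<infinity>a\<in>?A. ?F (Inl a)) + (\<Sum>\<^sub>\<infinity>x\<in>?B. ?F (Inr x))"
    unfolding kernel_def set by (rule infsum_Plus(2)[OF sl sr])
  also have "(\<Sum>\<^sub>\<infinity>a\<in>?A. ?F (Inl a)) = of_real (f (k - j) j) * e * push \<pi> ?c (k - j)"
    unfolding push_def infsum_cmult_right'[symmetric] by (rule infsum_cong) (rule l)
  also have "(\<Sum>\<^sub>\<infinity>x\<in>?B. ?F (Inr x)) = of_real (f' (k - j) j) * 2 * push (add_pair \<pi>) (mult_pair ?c ?c) (k - j)"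
    unfolding push_def infsum_cmult_right'[symmetric] by (rule infsum_cong) (rule r)
  finally show ?thesis by (simp add: mult.assoc)
qed

text \<open>The involution \<open>\<iota>\<close> reflects \<open>x\<close> and encodes evenness;
  \<open>\<tau>\<close> reflects the angular frequency and encodes, together with evenness, that the
  coefficients in \<open>x\<close> are real. Time derivatives bring down powers of
  \<open>norm (\<kappa> i)\<close>, paid for by the exponential weight.\<close>

lemma coefficient_flow_modes:
  fixes \<kappa> :: "'i \<Rightarrow> real ^ 'n" and \<omega> :: "real ^ 'n"
  assumes G: "admissible \<sigma> \<kappa> \<pi> G" and \<sigma>: "\<sigma> > 0"
    and \<iota>: "\<And>i. \<iota> (\<iota> i) = i" "\<And>i. \<pi> (\<iota> i) = - \<pi> i" "\<And>i. \<kappa> (\<iota> i) = \<kappa> i" "\<And>i. G (\<iota> i) = G i"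
    and \<tau>: "\<And>i. \<tau> (\<tau> i) = i" "\<And>i. \<pi> (\<tau> i) = \<pi> i" "\<And>i. \<kappa> (\<tau> i) = - \<kappa> i" "\<And>i. G (\<tau> i) = cnj (G i)"
  defines "c \<equiv> \<lambda>t. mode_coeff \<kappa> G (t *\<^sub>R \<omega>)"
  shows "coefficient_flow (\<lambda>t. push \<pi> (c t)) (\<lambda>t. push (add_pair \<pi>) (mult_pair (c t) (c t)))
    (\<lambda>t. push \<pi> (\<lambda>i. \<i> * of_real (\<kappa> i \<bullet> \<omega>) * c t i))"
proof -
  have \<sigma>0: "0 \<le> \<sigma>" using \<sigma> by simp
  have c: "rapid \<pi> (c t)" for t unfolding c_def by (rule rapid_mode_coeff[OF G \<sigma>0])
  have nc: "norm (c t i) = norm (G i)" for t i by (simp add: c_def mode_coeff_def norm_mult)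
  have c_\<iota>: "c t (\<iota> i) = c t i" and c_\<tau>: "c t (\<tau> i) = cnj (c t i)" for t i
    using \<iota> \<tau> by (simp_all add: c_def mode_coeff_def cis_cnj)
  have w: "rapid \<pi> (\<lambda>i. \<i> * of_real (\<kappa> i \<bullet> \<omega>) * c t i)" for t
    unfolding rapid_def
  proof
    fix N
    show "(\<lambda>i. norm (\<i> * of_real (\<kappa> i \<bullet> \<omega>) * c t i) * (1 + \<bar>real_of_int (\<pi> i)\<bar>) ^ N) summable_on UNIV"
    proof (rule summable_on_norm_bound)
      show "(\<lambda>i. norm \<omega> / \<sigma> * (norm (G i) * exp (\<sigma> * norm (\<kappa> i)) * (1 + \<bar>real_of_int (\<pi> i)\<bar>) ^ N)) summable_on UNIV"
        using G unfolding admissible_def by (intro summable_on_cmult_right) blast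
      fix i
      have "\<bar>\<kappa> i \<bullet> \<omega>\<bar> \<le> norm (\<kappa> i) * norm \<omega>" by (rule Cauchy_Schwarz_ineq2)
      also have "\<dots> \<le> (1 / \<sigma> * exp (\<sigma> * norm (\<kappa> i))) * norm \<omega>"
        by (rule mult_right_mono[OF mult_exp_le[OF \<sigma>]]) auto
      finally have "\<bar>\<kappa> i \<bullet> \<omega>\<bar> * (norm (G i) * (1 + \<bar>real_of_int (\<pi> i)\<bar>) ^ N) \<le>
          (1 / \<sigma> * exp (\<sigma> * norm (\<kappa> i))) * norm \<omega> * (norm (G i) * (1 + \<bar>real_of_int (\<pi> i)\<bar>) ^ N)"
        by (rule mult_right_mono) simp
      then show "norm (norm (\<i> * of_real (\<kappa> i \<bullet> \<omega>) * c t i) * (1 + \<bar>real_of_int (\<pi> i)\<bar>) ^ N) \<le>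
          norm \<omega> / \<sigma> * (norm (G i) * exp (\<sigma> * norm (\<kappa> i)) * (1 + \<bar>real_of_int (\<pi> i)\<bar>) ^ N)"
        by (simp add: norm_mult nc abs_mult mult_ac)
    qed
  qed
  have flow: "\<exists>C\<ge>0. \<forall>h::real. \<bar>h\<bar> \<le> 1 \<longrightarrow>
      rnorm N (\<lambda>p. push \<pi> (c (t + h)) p - push \<pi> (c t) p - of_real h * push \<pi> (\<lambda>i. \<i> * of_real (\<kappa> i \<bullet> \<omega>) * c t i) p) \<le> C * h\<^sup>2"
    for t N
  proof -
    \<comment> \<open>The Taylor remainder brings
      \<open>(\<kappa> i \<bullet> \<omega>)\<^sup>2\<close>; after Cauchy--Schwarz,
      \<open>(norm (\<kappa> i))\<^sup>2\<close> is at most \<open>2 / \<sigma>\<^sup>2\<close>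
      times the exponential weight.\<close>
    define C where "C = (norm \<omega>)\<^sup>2 * (2 / \<sigma>\<^sup>2) * gnorm \<sigma> \<kappa> \<pi> N G"
    have "rnorm N (\<lambda>p. push \<pi> (c (t + h)) p - push \<pi> (c t) p - of_real h * push \<pi> (\<lambda>i. \<i> * of_real (\<kappa> i \<bullet> \<omega>) * c t i) p) \<le> C * h\<^sup>2"
      for h :: real
    proof -
      define d where "d = (\<lambda>i. c (t + h) i - c t i - of_real h * (\<i> * of_real (\<kappa> i \<bullet> \<omega>) * c t i))"
      have d: "rapid \<pi> d"
        unfolding d_def by (rule rapid_minus[OF rapid_minus[OF c c] rapid_cmult[OF w]])
      have push_d: "push \<pi> d p = push \<pi> (c (t + h)) p - push \<pi> (c t) p - of_real h * push \<pi> (\<lambda>i. \<i> * of_real (\<kappa> i \<bullet> \<omega>) * c t i) p" for p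
        unfolding d_def push_minus[OF rapid_minus[OF c c] rapid_cmult[OF w]] push_minus[OF c c] push_cmult ..
      have nd: "norm (d i) \<le> (norm \<omega>)\<^sup>2 * (2 / \<sigma>\<^sup>2) * h\<^sup>2 * (norm (G i) * exp (\<sigma> * norm (\<kappa> i)))" for i
      proof -
        define x where "x = \<kappa> i \<bullet> \<omega>"
        have "x\<^sup>2 \<le> (norm (\<kappa> i))\<^sup>2 * (norm \<omega>)\<^sup>2"
          unfolding x_def power_mult_distrib[symmetric] abs_le_square_iff[symmetric]
          using Cauchy_Schwarz_ineq2[of "\<kappa> i" \<omega>] by simp
        also have "\<dots> \<le> ((2 / \<sigma>\<^sup>2) * exp (\<sigma> * norm (\<kappa> i))) * (norm \<omega>)\<^sup>2"
          by (rule mult_right_mono[OF power2_exp_le[OF \<sigma>]]) auto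
        finally have x2: "x\<^sup>2 \<le> ((2 / \<sigma>\<^sup>2) * exp (\<sigma> * norm (\<kappa> i))) * (norm \<omega>)\<^sup>2" .
        have "d i = G i * (exp (\<i> * of_real (t * x) + \<i> * of_real (h * x)) - exp (\<i> * of_real (t * x)) - \<i> * of_real (h * x) * exp (\<i> * of_real (t * x)))"
          by (simp add: d_def c_def mode_coeff_def cis_conv_exp x_def algebra_simps)
        also have "norm \<dots> \<le> norm (G i) * (norm (exp (\<i> * of_real (t * x))) * exp \<bar>Re (\<i> * of_real (h * x))\<bar> * (norm (\<i> * of_real (h * x)))\<^sup>2)"
          unfolding norm_mult[of "G i"] by (rule mult_left_mono[OF norm_exp_remainder]) simp
        also have "\<dots> = norm (G i) * (h\<^sup>2 * x\<^sup>2)" by (simp add: norm_mult power_mult_distrib)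
        also have "\<dots> \<le> norm (G i) * (h\<^sup>2 * (((2 / \<sigma>\<^sup>2) * exp (\<sigma> * norm (\<kappa> i))) * (norm \<omega>)\<^sup>2))"
          by (intro mult_left_mono x2) auto
        finally show ?thesis by (simp add: mult_ac)
      qed
      have "rnorm N (push \<pi> d) \<le> (\<Sum>\<^sub>\<infinity>i. norm (d i) * (1 + \<bar>real_of_int (\<pi> i)\<bar>) ^ N)"
        by (rule rapid_push(2)[OF d])
      also have "\<dots> \<le> (\<Sum>\<^sub>\<infinity>i. (norm \<omega>)\<^sup>2 * (2 / \<sigma>\<^sup>2) * h\<^sup>2 * (norm (G i) * exp (\<sigma> * norm (\<kappa> i)) * (1 + \<bar>real_of_int (\<pi> i)\<bar>) ^ N))"
      proof (rule infsum_mono[OF rapidD[OF d]])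
        show "(\<lambda>i. (norm \<omega>)\<^sup>2 * (2 / \<sigma>\<^sup>2) * h\<^sup>2 * (norm (G i) * exp (\<sigma> * norm (\<kappa> i)) * (1 + \<bar>real_of_int (\<pi> i)\<bar>) ^ N)) summable_on UNIV"
          using G unfolding admissible_def by (intro summable_on_cmult_right) blast
        show "norm (d i) * (1 + \<bar>real_of_int (\<pi> i)\<bar>) ^ N \<le>
            (norm \<omega>)\<^sup>2 * (2 / \<sigma>\<^sup>2) * h\<^sup>2 * (norm (G i) * exp (\<sigma> * norm (\<kappa> i)) * (1 + \<bar>real_of_int (\<pi> i)\<bar>) ^ N)" for i
          unfolding mult.assoc[symmetric] by (rule mult_right_mono[OF nd[unfolded mult.assoc[symmetric]]]) simp
      qed
      also have "\<dots> = C * h\<^sup>2"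
        unfolding infsum_cmult_right' C_def gnorm_def by (simp add: mult_ac)
      finally show ?thesis unfolding push_d[abs_def] .
    qed
    moreover have "C \<ge> 0" by (simp add: C_def gnorm_nonneg)
    ultimately show ?thesis by blast
  qed
  have cc: "rapid (add_pair \<pi>) (mult_pair (c t) (c t))" for t
    unfolding add_pair_def mult_pair_def by (rule rapid_pair[OF c c])
  show ?thesis
  proof
    fix t p
    show "rapid_seq (push \<pi> (c t))" by (rule rapid_push(1)[OF c])
    show "rapid_seq (push (add_pair \<pi>) (mult_pair (c t) (c t)))" by (rule rapid_push(1)[OF cc])
    show "rapid_seq (push \<pi> (\<lambda>i. \<i> * of_real (\<kappa> i \<bullet> \<omega>) * c t i))" by (rule rapid_push(1)[OF w])
    show "push \<pi> (c t) (- p) = push \<pi> (c t) p"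
      by (rule push_reflect[of \<iota>]) (simp_all add: \<iota> c_\<iota>)
    show "push (add_pair \<pi>) (mult_pair (c t) (c t)) (- p) = push (add_pair \<pi>) (mult_pair (c t) (c t)) p"
      by (rule push_reflect[of "map_prod \<iota> \<iota>"]) (auto simp: \<iota> c_\<iota> add_pair_def mult_pair_def)
    show "push \<pi> (\<lambda>i. \<i> * of_real (\<kappa> i \<bullet> \<omega>) * c t i) (- p) = push \<pi> (\<lambda>i. \<i> * of_real (\<kappa> i \<bullet> \<omega>) * c t i) p"
      by (rule push_reflect[of \<iota>]) (simp_all add: \<iota> c_\<iota>)
    show "cnj (push \<pi> (c t) p) = push \<pi> (c t) p"
      by (rule cnj_push[of \<tau>]) (simp_all add: \<tau> c_\<tau>)
    show "cnj (push (add_pair \<pi>) (mult_pair (c t) (c t)) p) = push (add_pair \<pi>) (mult_pair (c t) (c t)) p"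
      by (rule cnj_push[of "map_prod \<tau> \<tau>"]) (auto simp: \<tau> c_\<tau> add_pair_def mult_pair_def)
  next
    fix N t
    show "\<exists>C\<ge>0. \<forall>h::real. \<bar>h\<bar> \<le> 1 \<longrightarrow>
      rnorm N (\<lambda>p. push \<pi> (c (t + h)) p - push \<pi> (c t) p - of_real h * push \<pi> (\<lambda>i. \<i> * of_real (\<kappa> i \<bullet> \<omega>) * c t i) p) \<le> C * h\<^sup>2"
      by (rule flow)
  next
    fix r g t assume "sobolev r g"
    then show "kop (\<lambda>k j. push (add_pair \<pi>) (mult_pair (c t) (c t)) (k - j)) g =
        kop (\<lambda>k j. push \<pi> (c t) (k - j)) (kop (\<lambda>k j. push \<pi> (c t) (k - j)) g)"
      unfolding add_pair_def mult_pair_def by (rule kop_push_pair[OF c])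
  qed
qed

section \<open>The generator and the transformed equation\<close>

lemma summable_inverse_square_int: "(\<lambda>p::int. 1 / (1 + \<bar>real_of_int p\<bar>)\<^sup>2) summable_on UNIV"
proof -
  have "summable (\<lambda>n. inverse (real (Suc n) ^ 2))"
    unfolding summable_Suc_iff[of "\<lambda>n. inverse (real n ^ 2)"] by (rule inverse_power_summable) simp
  then have "summable (\<lambda>n. 1 / (1 + real n)\<^sup>2)" by (simp add: inverse_eq_divide)
  then have "(\<lambda>n. 1 / (1 + real n)\<^sup>2) summable_on UNIV"
    by (subst summable_on_UNIV_nonneg_real_iff) auto
  from summable_on_abs_int[OF this] show ?thesis by simp
qed

lemma kernel_dominated:
  assumes m: "bounded_weight 0 m" and a: "rapid_seq a"
  shows "\<exists>\<alpha>. \<alpha> summable_on UNIV \<and> (\<forall>k j. norm (of_real (m (k - j) j) * (c * a (k - j))) \<le> \<alpha> (k - j))"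
proof -
  obtain C K where C: "C \<ge> 0" "\<And>p j. \<bar>m p j\<bar> \<le> C * (1 + \<bar>real_of_int p\<bar>) ^ K * jap j powr 0"
    using m unfolding bounded_weight_def by blast
  let ?\<alpha> = "\<lambda>p. C * norm c * (norm (a p) * (1 + \<bar>real_of_int p\<bar>) ^ K)"
  have "?\<alpha> summable_on UNIV" by (rule summable_on_cmult_right[OF rapidD[OF a]])
  moreover have "norm (of_real (m (k - j) j) * (c * a (k - j))) \<le> ?\<alpha> (k - j)" for k j
  proof -
    have "\<bar>m (k - j) j\<bar> * (norm c * norm (a (k - j))) \<le> (C * (1 + \<bar>real_of_int (k - j)\<bar>) ^ K) * (norm c * norm (a (k - j)))"
      using C(2)[of "k - j" j] by (intro mult_right_mono) simp_all
    then show ?thesis by (simp add: norm_mult mult_ac)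
  qed
  ultimately show ?thesis by blast
qed

text \<open>Under exchange of \<open>k\<close> and \<open>j\<close> the weight of the commutator
  changes sign, which conjugation of the factor \<open>\<i>\<close> compensates: the diagonal matrix
  is Hermitian. The weight of the anticommutator is symmetric, so the off-diagonal matrix equals its
  transpose and its adjoint is its conjugate.\<close>

lemma is_adjoint_ker:
  assumes a: "rapid_seq a" "rapid_seq a2" and even: "\<And>p. a (- p) = a p" "\<And>p. a2 (- p) = a2 p"
    and real: "\<And>p. cnj (a p) = a p" "\<And>p. cnj (a2 p) = a2 p"
  shows "is_adjoint (kop (ker_d mass a a2)) (kop (ker_d mass a a2))"
    and "is_adjoint (kop (ker_o mass a a2)) (cnj_op (kop (ker_o mass a a2)))"
proof -
  obtain \<alpha> where \<alpha>: "\<alpha> summable_on UNIV" "\<And>k j. norm (of_real (sw_diff mass (k - j) j) * (\<i> * a (k - j))) \<le> \<alpha> (k - j)"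
    using kernel_dominated[OF sw_bounded(2) a(1)] by blast
  obtain \<beta> where \<beta>: "\<beta> summable_on UNIV" "\<And>k j. norm (of_real (sw_sum mass (k - j) j) * (- \<i> * a (k - j))) \<le> \<beta> (k - j)"
    using kernel_dominated[OF sw_bounded(3) a(1)] by blast
  obtain \<gamma> where \<gamma>: "\<gamma> summable_on UNIV" "\<And>k j. norm (of_real (sw mass (k - j) j) * (2 * a2 (k - j))) \<le> \<gamma> (k - j)"
    using kernel_dominated[OF sw_bounded(1) a(2)] by blast
  have sym: "a (j - k) = a (k - j)" "a2 (j - k) = a2 (k - j)" for j k
    using even(1)[of "k - j"] even(2)[of "k - j"] by simp_all
  have sw: "sw mass (j - k) k = sw mass (k - j) j" "sw_diff mass (j - k) k = - sw_diff mass (k - j) j"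
    "sw_sum mass (j - k) k = sw_sum mass (k - j) j" for j k
    by (simp_all add: sw_def sw_diff_def sw_sum_def algebra_simps)
  show "is_adjoint (kop (ker_d mass a a2)) (kop (ker_d mass a a2))"
  proof (rule kop_hermitian)
    show "norm (ker_d mass a a2 k j) \<le> \<alpha> (k - j) + \<gamma> (k - j)" for k j
      unfolding ker_d_def by (rule norm_triangle_mono[OF \<alpha>(2) \<gamma>(2)])
    show "(\<lambda>p. \<alpha> p + \<gamma> p) summable_on UNIV" by (rule summable_on_add[OF \<alpha>(1) \<gamma>(1)])
    show "ker_d mass a a2 (- k) (- j) = ker_d mass a a2 k j" for k j by (rule ker_minus) (rule even)+
    show "ker_d mass a a2 k j = cnj (ker_d mass a a2 j k)" for k j
      by (simp add: ker_d_def real sym[of j k] sw[of j k])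
  qed
  have "is_adjoint (kop (ker_o mass a a2)) (kop (\<lambda>k j. cnj (ker_o mass a a2 k j)))"
  proof (rule kop_hermitian)
    show "norm (ker_o mass a a2 k j) \<le> \<beta> (k - j) + \<gamma> (k - j)" for k j
      unfolding ker_o_def by (rule norm_triangle_mono[OF \<beta>(2) \<gamma>(2)])
    show "(\<lambda>p. \<beta> p + \<gamma> p) summable_on UNIV" by (rule summable_on_add[OF \<beta>(1) \<gamma>(1)])
    show "ker_o mass a a2 (- k) (- j) = ker_o mass a a2 k j" for k j by (rule ker_minus) (rule even)+
    show "cnj (ker_o mass a a2 k j) = cnj (ker_o mass a a2 j k)" for k j
      by (simp add: ker_o_def real sym[of j k] sw[of j k])
  qed
  moreover have "cnj_op (kop (ker_o mass a a2)) = kop (\<lambda>k j. cnj (ker_o mass a a2 k j))"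
    by (rule ext) (rule cnj_op_kop, rule ker_minus, (rule even)+)
  ultimately show "is_adjoint (kop (ker_o mass a a2)) (cnj_op (kop (ker_o mass a a2)))" by simp
qed

lemma mult_V_eq_kop:
  "mult_V V \<theta> f = kop (\<lambda>k j. fourier_coeff (\<lambda>x. of_real (even_ext V \<theta> x)) (k - j)) f"
proof
  fix k
  have "fourier_coeff (\<lambda>x. g x * a * cis (real_of_int j * x)) k = fourier_coeff g (k - j) * a" for g a j
  proof -
    have "(\<lambda>x. g x * a * cis (real_of_int j * x) * cis (- (real_of_int k * x))) =
        (\<lambda>x. a * (g x * cis (- (real_of_int (k - j) * x))))"
      by (rule ext) (simp add: mult.assoc cis_mult mult.left_commute algebra_simps)
    then show ?thesis by (simp add: fourier_coeff_def)
  qed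
  then show "mult_V V \<theta> f k = kop (\<lambda>k j. fourier_coeff (\<lambda>x. of_real (even_ext V \<theta> x)) (k - j)) f k"
    by (simp add: mult_V_def psido_def kop_def)
qed

text \<open>An index \<open>(k, p)\<close> has angular frequency \<open>k\<close>, embedded in real
  vectors, while \<open>snd\<close> is its frequency in \<open>x\<close>.\<close>

definition mode :: "(int ^ 'n) \<times> int \<Rightarrow> real ^ 'n" where
  "mode i = kv (fst i)"

text \<open>For \<open>k = 0\<close> the quotient is \<open>0\<close>, in accordance with the vanishing mean of the potential.\<close>

definition generator :: "(int ^ 'n \<Rightarrow> int \<Rightarrow> complex) \<Rightarrow> real ^ 'n \<Rightarrow> (int ^ 'n) \<times> int \<Rightarrow> complex" where
  "generator Vh \<omega> i = Vh (fst i) (snd i) / (2 * \<i> * of_real (mode i \<bullet> \<omega>))"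

text \<open>The constant \<open>A\<close> precedes \<open>B\<close> and \<open>G\<close>, so it
  serves the generator and its differences for all frequencies and all \<open>M\<close> at
  once.\<close>

lemma small_divisor_sum:
  fixes Vh :: "int ^ 'n \<Rightarrow> int \<Rightarrow> complex"
  assumes \<rho>: "\<rho> > 0"
    and decay: "\<And>N. \<exists>C>0. \<forall>k p. norm (Vh k p) * exp (7 / 8 * \<rho> * norm (kv k)) * (1 + \<bar>real_of_int p\<bar>) ^ N \<le> C"
  shows "\<exists>A\<ge>0. \<forall>B\<ge>0. \<forall>G. (\<forall>i. norm (G i) \<le> B * (norm (Vh (fst i) (snd i)) * exp (3 / 16 * \<rho> * norm (mode i)))) \<longrightarrow>
    (\<lambda>i. norm (G i) * exp (5 / 8 * \<rho> * norm (mode i)) * (1 + \<bar>real_of_int (snd i)\<bar>) ^ N) summable_on UNIV \<and>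
    gnorm (5 / 8 * \<rho>) mode snd N G \<le> A * B"
proof -
  obtain C where C: "C > 0" "\<And>k p. norm (Vh k p) * exp (7 / 8 * \<rho> * norm (kv k)) * (1 + \<bar>real_of_int p\<bar>) ^ (N + 2) \<le> C"
    using decay[of "N + 2"] by blast
  \<comment> \<open>The rate left over is \<open>7/8 - 3/16 - 5/8 = 1/16\<close>, and two powers of
    \<open>1 + |p|\<close> are spent on summability in \<open>p\<close>.\<close>
  define q :: "(int ^ 'n) \<times> int \<Rightarrow> real" where
    "q = (\<lambda>(k, p). exp (- (\<rho> / 16) * norm (kv k)) * (1 / (1 + \<bar>real_of_int p\<bar>)\<^sup>2))"
  have q: "q summable_on UNIV"
    unfolding q_def using \<rho> by (intro pair_product_sum(1) summable_exp_kv summable_inverse_square_int) auto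
  have q0: "0 \<le> q i" for i by (cases i) (simp add: q_def)
  define A where "A = C * infsum q UNIV"
  have "(\<lambda>i. norm (G i) * exp (5 / 8 * \<rho> * norm (mode i)) * (1 + \<bar>real_of_int (snd i)\<bar>) ^ N) summable_on UNIV \<and>
      gnorm (5 / 8 * \<rho>) mode snd N G \<le> A * B"
    if B: "B \<ge> 0" and G: "\<forall>i. norm (G i) \<le> B * (norm (Vh (fst i) (snd i)) * exp (3 / 16 * \<rho> * norm (mode i)))" for B G
  proof -
    let ?F = "\<lambda>i. norm (G i) * exp (5 / 8 * \<rho> * norm (mode i)) * (1 + \<bar>real_of_int (snd i)\<bar>) ^ N"
    have le: "?F i \<le> B * C * q i" for i
    proof -
      obtain k p where i: "i = (k, p)" by (cases i)
      let ?K = "norm (kv k)" and ?P = "1 + \<bar>real_of_int p\<bar>"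
      have e: "exp (3 / 16 * \<rho> * ?K) * exp (5 / 8 * \<rho> * ?K) = exp (7 / 8 * \<rho> * ?K) * exp (- (\<rho> / 16) * ?K)"
        by (simp flip: exp_add)
      have "?F i \<le> B * (norm (Vh k p) * exp (3 / 16 * \<rho> * ?K)) * exp (5 / 8 * \<rho> * ?K) * ?P ^ N"
        using G[rule_format, of i] unfolding i mode_def fst_conv snd_conv by (intro mult_right_mono) auto
      also have "\<dots> = B * norm (Vh k p) * (exp (3 / 16 * \<rho> * ?K) * exp (5 / 8 * \<rho> * ?K)) * ?P ^ N"
        by (simp only: mult_ac)
      also have "\<dots> = B * (norm (Vh k p) * exp (7 / 8 * \<rho> * ?K) * ?P ^ (N + 2)) * q i"
      proof -
        have "x ^ N = x ^ (N + 2) * (1 / x\<^sup>2)" if "x > 0" for x :: real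
          using that by (simp add: power2_eq_square)
        from this[of ?P] have "?P ^ N = ?P ^ (N + 2) * (1 / ?P\<^sup>2)" by (simp add: add_pos_nonneg)
        then show ?thesis unfolding e i q_def case_prod_conv by (simp only: mult_ac)
      qed
      also have "\<dots> \<le> B * C * q i"
        by (intro mult_right_mono mult_left_mono C(2) B q0)
      finally show ?thesis .
    qed
    have Bq: "(\<lambda>i. B * C * q i) summable_on UNIV" by (rule summable_on_cmult_right[OF q])
    have F: "?F summable_on UNIV"
      by (rule summable_on_norm_bound[OF Bq]) (use le in \<open>simp add: abs_mult\<close>)
    have "gnorm (5 / 8 * \<rho>) mode snd N G \<le> (\<Sum>\<^sub>\<infinity>i. B * C * q i)"
      unfolding gnorm_def by (rule infsum_mono[OF F Bq]) (rule le)
    also have "\<dots> = A * B" unfolding infsum_cmult_right' A_def by simp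
    finally show ?thesis using F by blast
  qed
  moreover have "A \<ge> 0" using C(1) q0 by (simp add: A_def infsum_nonneg)
  ultimately show ?thesis by blast
qed

text \<open>
  The strip of width \<open>\<rho>\<close> is consumed as follows: the Fourier coefficients decay with rate
  \<open>7/8 \<rho>\<close>, each small divisor costs \<open>\<rho>/16\<close>, the factor \<open>|k|\<close> coming from the Lipschitz
  dependence on \<open>\<omega>\<close> another \<open>\<rho>/16\<close>, summability \<open>\<rho>/16\<close>, and \<open>5/8 \<rho>\<close> remains.
\<close>

locale potential_modes =
  fixes \<rho> \<gamma> :: real and Vh :: "int ^ 'n \<Rightarrow> int \<Rightarrow> complex"
  assumes \<rho>: "\<rho> > 0" and \<gamma>: "\<gamma> > 0"
    and decay: "\<And>N. \<exists>C>0. \<forall>k p. norm (Vh k p) * exp (7 / 8 * \<rho> * norm (kv k)) * (1 + \<bar>real_of_int p\<bar>) ^ N \<le> C"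
    and Vh_0: "Vh 0 p = 0" and Vh_even: "Vh k (- p) = Vh k p" and Vh_cnj: "cnj (Vh k p) = Vh (- k) p"
begin

text \<open>The 1-norm is at most the dimension times the Euclidean norm; dividing by the dimension
  limits the loss of a divisor to \<open>exp (\<rho> / 16 * norm (kv k))\<close>.\<close>

definition nonres :: "real \<Rightarrow> (real ^ 'n) set" where
  "nonres M = nonresonant (\<rho> / (16 * real CARD('n))) \<gamma> M"

abbreviation gen :: "real ^ 'n \<Rightarrow> (int ^ 'n) \<times> int \<Rightarrow> complex" where
  "gen \<equiv> generator Vh"

lemma divisor_ge:
  assumes "\<omega> \<in> nonres M" "k \<noteq> 0" "M > 0"
  shows "\<gamma> * M \<le> \<bar>kv k \<bullet> \<omega>\<bar> * exp (\<rho> / 16 * norm (kv k))"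
proof -
  let ?e = "\<rho> / (16 * real CARD('n))"
  have "?e * norm1 k \<le> ?e * (real CARD('n) * norm (kv k))"
    using \<rho> by (intro mult_left_mono norm1_le) simp
  then have "?e * norm1 k \<le> \<rho> / 16 * norm (kv k)" by simp
  then have "\<gamma> * M * exp (- (\<rho> / 16 * norm (kv k))) \<le> \<gamma> * M * exp (- (?e * norm1 k))"
    using \<gamma> assms(3) by (intro mult_left_mono) auto
  also have "\<dots> \<le> \<bar>kv k \<bullet> \<omega>\<bar>"
    using assms(1,2) by (simp add: nonres_def nonresonant_def)
  finally have "\<gamma> * M * exp (- (\<rho> / 16 * norm (kv k))) * exp (\<rho> / 16 * norm (kv k)) \<le> \<bar>kv k \<bullet> \<omega>\<bar> * exp (\<rho> / 16 * norm (kv k))"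
    by (rule mult_right_mono) simp
  then show ?thesis by (simp add: exp_minus field_simps)
qed

lemma divisor_nonzero:
  assumes "\<omega> \<in> nonres M" "k \<noteq> 0" "M > 0"
  shows "kv k \<bullet> \<omega> \<noteq> 0"
proof
  assume "kv k \<bullet> \<omega> = 0"
  then have "\<gamma> * M \<le> 0" using divisor_ge[OF assms] by simp
  then show False using mult_pos_pos[OF \<gamma> assms(3)] by linarith
qed

text \<open>One divisor costs a rate of \<open>\<rho> / 16\<close> only. The weaker rate
  \<open>3 / 16 * \<rho>\<close> is stated so that this bound and the one for differences feed the
  same summation.\<close>

lemma norm_gen_le:
  assumes \<omega>: "\<omega> \<in> nonres M" and M: "M > 0"
  shows "norm (gen \<omega> i) \<le> 1 / (2 * \<gamma> * M) * (norm (Vh (fst i) (snd i)) * exp (3 / 16 * \<rho> * norm (mode i)))"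
proof -
  obtain k p where i: "i = (k, p)" by (cases i)
  show ?thesis
  proof (cases "k = 0")
    case True
    then show ?thesis by (simp add: i generator_def Vh_0)
  next
    case False
    let ?x = "\<bar>kv k \<bullet> \<omega>\<bar>" and ?E = "exp (\<rho> / 16 * norm (kv k))"
    have x: "?x > 0" using divisor_nonzero[OF \<omega> False M] by simp
    have "1 / (2 * ?x) \<le> 1 / (2 * \<gamma> * M) * ?E"
      using divisor_ge[OF \<omega> False M] x \<gamma> M by (simp add: field_simps)
    also have "\<dots> \<le> 1 / (2 * \<gamma> * M) * exp (3 / 16 * \<rho> * norm (kv k))"
      using \<gamma> M \<rho> by (intro mult_left_mono) (auto intro: mult_right_mono)
    finally have "norm (Vh k p) * (1 / (2 * ?x)) \<le> norm (Vh k p) * (1 / (2 * \<gamma> * M) * exp (3 / 16 * \<rho> * norm (kv k)))"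
      by (rule mult_left_mono) simp
    then show ?thesis by (simp add: i generator_def mode_def norm_divide norm_mult mult_ac)
  qed
qed

text \<open>The difference of the reciprocals of \<open>x\<close> and \<open>y\<close> is
  \<open>(y - x) / (x * y)\<close>: each of the two divisors costs a rate of
  \<open>\<rho> / 16\<close>, and so does the factor \<open>norm (kv k)\<close> in the numerator, at
  the price of the constant \<open>16 / \<rho>\<close>, halved by the 2 in the generator.\<close>

lemma norm_gen_diff_le:
  assumes \<omega>: "\<omega> \<in> nonres M" and \<omega>': "\<omega>' \<in> nonres M" and M: "M > 0"
  shows "norm (gen \<omega> i - gen \<omega>' i) \<le>
    8 / \<rho> * norm (\<omega> - \<omega>') / (\<gamma> * M)\<^sup>2 * (norm (Vh (fst i) (snd i)) * exp (3 / 16 * \<rho> * norm (mode i)))"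
proof -
  obtain k p where i: "i = (k, p)" by (cases i)
  show ?thesis
  proof (cases "k = 0")
    case True
    then show ?thesis by (simp add: i generator_def Vh_0)
  next
    case False
    let ?x = "kv k \<bullet> \<omega>" and ?y = "kv k \<bullet> \<omega>'" and ?K = "norm (kv k)"
    let ?E = "exp (\<rho> / 16 * ?K)" and ?d = "norm (\<omega> - \<omega>')"
    have x: "?x \<noteq> 0" "?y \<noteq> 0" using divisor_nonzero[OF _ False M] \<omega> \<omega>' by auto
    have \<gamma>M: "\<gamma> * M > 0" using \<gamma> M by simp
    have E3: "exp (3 / 16 * \<rho> * ?K) = ?E * ?E * ?E"
      by (simp flip: exp_add)
    have "gen \<omega> i - gen \<omega>' i = Vh k p * (of_real (?y - ?x) / (2 * \<i> * of_real (?x * ?y)))"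
      using x by (simp add: i generator_def mode_def field_simps)
    then have "norm (gen \<omega> i - gen \<omega>' i) = norm (Vh k p) * (\<bar>?y - ?x\<bar> / (2 * (\<bar>?x\<bar> * \<bar>?y\<bar>)))"
      by (simp only: norm_mult norm_divide norm_of_real norm_ii abs_mult) simp
    also have "\<bar>?y - ?x\<bar> / (2 * (\<bar>?x\<bar> * \<bar>?y\<bar>)) \<le> 8 / \<rho> * ?d / (\<gamma> * M)\<^sup>2 * exp (3 / 16 * \<rho> * ?K)"
    proof -
      have "\<bar>?y - ?x\<bar> = \<bar>kv k \<bullet> (\<omega> - \<omega>')\<bar>" by (simp add: inner_diff_right abs_minus_commute)
      also have "\<dots> \<le> ?K * ?d" by (rule Cauchy_Schwarz_ineq2)
      also have "\<dots> \<le> (1 / (\<rho> / 16) * ?E) * ?d"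
        using \<rho> by (intro mult_right_mono mult_exp_le) auto
      finally have n: "\<bar>?y - ?x\<bar> \<le> 16 / \<rho> * ?E * ?d" by simp
      have "(\<gamma> * M) * (\<gamma> * M) \<le> (\<bar>?x\<bar> * ?E) * (\<bar>?y\<bar> * ?E)"
        using \<gamma>M by (intro mult_mono[OF divisor_ge[OF \<omega> False M] divisor_ge[OF \<omega>' False M]]) auto
      then have d: "(\<gamma> * M)\<^sup>2 / (?E * ?E) \<le> \<bar>?x\<bar> * \<bar>?y\<bar>"
        by (simp add: pos_divide_le_eq power2_eq_square mult_ac)
      have "\<bar>?y - ?x\<bar> / (2 * (\<bar>?x\<bar> * \<bar>?y\<bar>)) \<le> (16 / \<rho> * ?E * ?d) / (2 * ((\<gamma> * M)\<^sup>2 / (?E * ?E)))"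
      proof (rule frac_le)
        have "0 < (\<gamma> * M)\<^sup>2 / (?E * ?E)" using \<gamma>M by (intro divide_pos_pos) auto
        then show "0 < 2 * ((\<gamma> * M)\<^sup>2 / (?E * ?E))" by linarith
      qed (use n d \<rho> in simp_all)
      then show ?thesis unfolding E3 by (simp add: mult_ac)
    qed
    then have "norm (Vh k p) * (\<bar>?y - ?x\<bar> / (2 * (\<bar>?x\<bar> * \<bar>?y\<bar>))) \<le>
        norm (Vh k p) * (8 / \<rho> * ?d / (\<gamma> * M)\<^sup>2 * exp (3 / 16 * \<rho> * ?K))"
      by (rule mult_left_mono) simp
    finally show ?thesis by (simp add: i mode_def mult_ac)
  qed
qed

text \<open>One \<open>A\<close> serves every \<open>M\<close>, which is the origin of the
  uniformity in \<open>M\<close> of the final estimate. The Lipschitz bound is in fact quadratic in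
  \<open>1 / M\<close>; as \<open>M > 1\<close>, one of the two factors is dropped.\<close>

lemma gen_bounds:
  shows "\<exists>A\<ge>0. \<forall>M>1. \<forall>\<omega>\<in>nonres M. gnorm (5 / 8 * \<rho>) mode snd N (gen \<omega>) \<le> A / M \<and>
      (\<forall>\<omega>'\<in>nonres M. gnorm (5 / 8 * \<rho>) mode snd N (\<lambda>i. gen \<omega> i - gen \<omega>' i) \<le> A / M * norm (\<omega> - \<omega>'))"
    and "\<omega> \<in> nonres M \<Longrightarrow> M > 1 \<Longrightarrow> admissible (5 / 8 * \<rho>) mode snd (gen \<omega>)"
proof -
  obtain A where A: "A \<ge> 0" "\<And>B G. B \<ge> 0 \<Longrightarrow>
      \<forall>i. norm (G i) \<le> B * (norm (Vh (fst i) (snd i)) * exp (3 / 16 * \<rho> * norm (mode i))) \<Longrightarrow>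
      gnorm (5 / 8 * \<rho>) mode snd N G \<le> A * B"
    using small_divisor_sum[OF \<rho> decay, of N] by blast
  define A' where "A' = A * (1 / (2 * \<gamma>)) + A * (8 / \<rho> / \<gamma>\<^sup>2)"
  have "gnorm (5 / 8 * \<rho>) mode snd N (gen \<omega>) \<le> A' / M \<and>
      (\<forall>\<omega>'\<in>nonres M. gnorm (5 / 8 * \<rho>) mode snd N (\<lambda>i. gen \<omega> i - gen \<omega>' i) \<le> A' / M * norm (\<omega> - \<omega>'))"
    if M: "M > 1" and \<omega>: "\<omega> \<in> nonres M" for M \<omega>
  proof (intro conjI ballI)
    have M0: "M > 0" using M by simp
    have "gnorm (5 / 8 * \<rho>) mode snd N (gen \<omega>) \<le> A * (1 / (2 * \<gamma> * M))"
      using \<gamma> M by (intro A(2) allI norm_gen_le[OF \<omega> M0]) simp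
    also have "\<dots> = A * (1 / (2 * \<gamma>)) / M" by simp
    also have "\<dots> \<le> A' / M" using A(1) M \<rho> \<gamma> unfolding A'_def by (intro divide_right_mono) auto
    finally show "gnorm (5 / 8 * \<rho>) mode snd N (gen \<omega>) \<le> A' / M" .
    fix \<omega>' assume \<omega>': "\<omega>' \<in> nonres M"
    have "gnorm (5 / 8 * \<rho>) mode snd N (\<lambda>i. gen \<omega> i - gen \<omega>' i) \<le> A * (8 / \<rho> * norm (\<omega> - \<omega>') / (\<gamma> * M)\<^sup>2)"
      using \<rho> by (intro A(2) allI norm_gen_diff_le[OF \<omega> \<omega>' M0]) simp
    also have "\<dots> = A * (8 / \<rho> / \<gamma>\<^sup>2) / M / M * norm (\<omega> - \<omega>')"
    proof -
      have sq: "(\<gamma> * M)\<^sup>2 = \<gamma>\<^sup>2 * (M * M)" by (simp only: power2_eq_square mult_ac)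
      show ?thesis unfolding sq by simp
    qed
    also have "\<dots> \<le> A' / M * norm (\<omega> - \<omega>')"
    proof (rule mult_right_mono)
      have "A * (8 / \<rho> / \<gamma>\<^sup>2) / M / M \<le> A * (8 / \<rho> / \<gamma>\<^sup>2) / M / 1"
        using A(1) M \<rho> by (intro divide_left_mono) auto
      also have "\<dots> \<le> A' / M" using A(1) M \<rho> \<gamma> unfolding A'_def div_by_1 by (intro divide_right_mono) auto
      finally show "A * (8 / \<rho> / \<gamma>\<^sup>2) / M / M \<le> A' / M" .
    qed simp
    finally show "gnorm (5 / 8 * \<rho>) mode snd N (\<lambda>i. gen \<omega> i - gen \<omega>' i) \<le> A' / M * norm (\<omega> - \<omega>')" .
  qed
  moreover have "A' \<ge> 0" using A(1) \<rho> \<gamma> by (simp add: A'_def)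
  ultimately show "\<exists>A\<ge>0. \<forall>M>1. \<forall>\<omega>\<in>nonres M. gnorm (5 / 8 * \<rho>) mode snd N (gen \<omega>) \<le> A / M \<and>
      (\<forall>\<omega>'\<in>nonres M. gnorm (5 / 8 * \<rho>) mode snd N (\<lambda>i. gen \<omega> i - gen \<omega>' i) \<le> A / M * norm (\<omega> - \<omega>'))"
    by blast
next
  assume \<omega>: "\<omega> \<in> nonres M" and M: "M > 1"
  have "(\<lambda>i. norm (gen \<omega> i) * exp (5 / 8 * \<rho> * norm (mode i)) * (1 + \<bar>real_of_int (snd i)\<bar>) ^ N) summable_on UNIV" for N
  proof -
    have B: "0 \<le> 1 / (2 * \<gamma> * M)" using \<gamma> M by simp
    have le: "norm (gen \<omega> i) \<le> 1 / (2 * \<gamma> * M) * (norm (Vh (fst i) (snd i)) * exp (3 / 16 * \<rho> * norm (mode i)))" for i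
      using norm_gen_le[OF \<omega>] M by simp
    from small_divisor_sum[OF \<rho> decay, of N] obtain A where
      "\<forall>B\<ge>0. \<forall>G. (\<forall>i. norm (G i) \<le> B * (norm (Vh (fst i) (snd i)) * exp (3 / 16 * \<rho> * norm (mode i)))) \<longrightarrow>
        (\<lambda>i. norm (G i) * exp (5 / 8 * \<rho> * norm (mode i)) * (1 + \<bar>real_of_int (snd i)\<bar>) ^ N) summable_on UNIV \<and>
        gnorm (5 / 8 * \<rho>) mode snd N G \<le> A * B"
      by (elim exE conjE)
    from this[rule_format, OF B, of "gen \<omega>", OF le] show ?thesis by (rule conjunct1)
  qed
  then show "admissible (5 / 8 * \<rho>) mode snd (gen \<omega>)" by (simp add: admissible_def)
qed

section \<open>The symbols of the generator and of the new perturbation\<close>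

abbreviation qmode :: "((int ^ 'n) \<times> int) + ((int ^ 'n) \<times> int) \<times> ((int ^ 'n) \<times> int) \<Rightarrow> real ^ 'n" where
  "qmode \<equiv> quad_index mode"

abbreviation qfreq :: "((int ^ 'n) \<times> int) + ((int ^ 'n) \<times> int) \<times> ((int ^ 'n) \<times> int) \<Rightarrow> int" where
  "qfreq \<equiv> quad_index snd"

definition X_sym :: "real \<Rightarrow> real ^ 'n \<Rightarrow> 'n symbol" where
  "X_sym mass \<omega> = exp_symbol mode snd (\<lambda>i. sw mass (snd i)) (gen \<omega>)"

definition Vd_sym :: "real \<Rightarrow> real ^ 'n \<Rightarrow> 'n symbol" where
  "Vd_sym mass \<omega> = exp_symbol qmode qfreq (quad_weight (sw_diff mass) (sw mass) snd) (quad_coeff \<i> (gen \<omega>))"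

definition Vo_sym :: "real \<Rightarrow> real ^ 'n \<Rightarrow> 'n symbol" where
  "Vo_sym mass \<omega> = exp_symbol qmode qfreq (quad_weight (sw_sum mass) (sw mass) snd) (quad_coeff (- \<i>) (gen \<omega>))"

lemma sw_weight_0: "weight_upto n 0 (sw mass)"
  by (rule weight_upto_mono[OF sw_weight(1)]) simp

lemma weight_families:
  "weight_family (- 1) (snd :: (int ^ 'n) \<times> int \<Rightarrow> int) (\<lambda>i. sw mass (snd i))"
  "weight_family (- 1) qfreq (quad_weight (sw_diff mass) (sw mass) snd)"
  "weight_family 0 qfreq (quad_weight (sw_sum mass) (sw mass) snd)"
  by (rule weight_family_of_weight[of _ "sw mass" "sw mass"] weight_family_quad sw_weight sw_weight_0 | simp)+

lemma gen_reflect: "gen \<omega> (fst i, - snd i) = gen \<omega> i"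
  by (simp add: generator_def mode_def Vh_even)

lemma gen_cnj: "gen \<omega> (- fst i, snd i) = cnj (gen \<omega> i)"
  by (simp add: generator_def mode_def kv_minus Vh_cnj)

lemma mode_Ints: "mode i $ l \<in> \<int>"
  by (simp add: mode_def kv_def)

text \<open>The reflection of the frequency in \<open>x\<close> leaves coefficients and weights
  invariant, since \<open>V\<close> is even in \<open>x\<close> and the symbol of \<open>B\<close>
  is even in \<open>j\<close>; on pairs it acts componentwise.\<close>

lemma symbols_PA:
  assumes \<omega>: "\<omega> \<in> nonres M" and M: "M > 1"
  shows "X_sym mass \<omega> \<in> PA (- 1) (\<rho> / 2)" "Vd_sym mass \<omega> \<in> PA (- 1) (\<rho> / 2)" "Vo_sym mass \<omega> \<in> PA 0 (\<rho> / 2)"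
proof -
  have \<sigma>: "\<rho> / 2 < 5 / 8 * \<rho>" "0 \<le> 5 / 8 * \<rho>" using \<rho> by simp_all
  note G = gen_bounds(2)[OF \<omega> M]
  let ?\<iota> = "\<lambda>i :: (int ^ 'n) \<times> int. (fst i, - snd i)"
  show "X_sym mass \<omega> \<in> PA (- 1) (\<rho> / 2)"
    unfolding X_sym_def
    by (rule exp_symbol_PA[OF weight_families(1) G \<sigma>, where \<iota> = ?\<iota>])
      (simp_all add: mode_Ints gen_reflect sw_minus mode_def kv_def)
  have q: "quad_map ?\<iota> (quad_map ?\<iota> i) = i" "qfreq (quad_map ?\<iota> i) = - qfreq i" "qmode (quad_map ?\<iota> i) = qmode i"
    "quad_coeff e (gen \<omega>) (quad_map ?\<iota> i) = quad_coeff e (gen \<omega>) i" "qmode i $ l \<in> \<int>" for i e l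
    by (cases i; auto simp: quad_defs gen_reflect mode_def kv_def map_prod_def split: prod.splits)+
  have qw: "quad_weight f f' snd (quad_map ?\<iota> i) (- j) = quad_weight f f' snd i j"
    if "\<And>p j. f (- p) (- j) = f p j" "\<And>p j. f' (- p) (- j) = f' p j" for f f' and i :: "((int ^ 'n) \<times> int) + ((int ^ 'n) \<times> int) \<times> ((int ^ 'n) \<times> int)" and j
  proof -
    have "- a - b = - (b + a)" "- a + - b = - (a + b)" for a b :: int by simp_all
    then have "f' (- a - b) (- j) = f' (b + a) j" "f' (- a + - b) (- j) = f' (a + b) j" for a b
      by (simp_all only: that(2))
    then show ?thesis using that(1) by (cases i; auto simp: quad_defs split: prod.splits)
  qed
  show "Vd_sym mass \<omega> \<in> PA (- 1) (\<rho> / 2)"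
    unfolding Vd_sym_def
    by (rule exp_symbol_PA[OF weight_families(2) quad_coeff_admissible(1)[OF G \<sigma>(2)] \<sigma>, where \<iota> = "quad_map ?\<iota>"])
      (rule q qw sw_minus)+
  show "Vo_sym mass \<omega> \<in> PA 0 (\<rho> / 2)"
    unfolding Vo_sym_def
    by (rule exp_symbol_PA[OF weight_families(3) quad_coeff_admissible(1)[OF G \<sigma>(2)] \<sigma>, where \<iota> = "quad_map ?\<iota>"])
      (rule q qw sw_minus)+
qed

section \<open>Seminorm estimates uniform in \<open>M\<close>\<close>

lemma lip_wp_generator:
  assumes wt: "weight_family m (snd :: (int ^ 'n) \<times> int \<Rightarrow> int) \<mu>"
  shows "\<exists>K\<ge>0. \<forall>M>1. \<forall>w\<ge>0. lip_wp w (nonres M) m (\<rho> / 2) l (\<lambda>\<omega>. exp_symbol mode snd \<mu> (gen \<omega>)) \<le> ennreal (K * (1 + w) / M)"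
proof -
  let ?\<sigma> = "5 / 8 * \<rho>"
  have \<sigma>: "\<rho> / 2 \<le> ?\<sigma>" using \<rho> by simp
  obtain N C where C: "C \<ge> 0" "\<And>G. admissible ?\<sigma> mode snd G \<Longrightarrow>
      wp m (\<rho> / 2) l (exp_symbol mode snd \<mu> G) \<le> ennreal (C * gnorm ?\<sigma> mode snd N G)"
    using wp_exp_symbol_le[OF wt, of ?\<sigma> mode "\<rho> / 2" l] \<sigma> by blast
  obtain A where A: "A \<ge> 0" "\<And>M \<omega>. M > 1 \<Longrightarrow> \<omega> \<in> nonres M \<Longrightarrow> gnorm ?\<sigma> mode snd N (gen \<omega>) \<le> A / M"
    "\<And>M \<omega> \<omega>'. M > 1 \<Longrightarrow> \<omega> \<in> nonres M \<Longrightarrow> \<omega>' \<in> nonres M \<Longrightarrow>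
      gnorm ?\<sigma> mode snd N (\<lambda>i. gen \<omega> i - gen \<omega>' i) \<le> A / M * norm (\<omega> - \<omega>')"
    using gen_bounds(1)[of N] by blast
  have "lip_wp w (nonres M) m (\<rho> / 2) l (\<lambda>\<omega>. exp_symbol mode snd \<mu> (gen \<omega>)) \<le> ennreal (C * A * (1 + w) / M)"
    if M: "M > 1" and w: "w \<ge> 0" for M w
  proof -
    have "lip_wp w (nonres M) m (\<rho> / 2) l (\<lambda>\<omega>. exp_symbol mode snd \<mu> (gen \<omega>)) \<le> ennreal (C * (A / M + w * (A / M)))"
      by (rule lip_wp_exp_symbol_le[OF wt C(2) C(1) _ _ w \<sigma> gen_bounds(2)[OF _ M] A(2)[OF M] A(3)[OF M]])
        (use A(1) M in simp_all)
    also have "C * (A / M + w * (A / M)) = C * A * (1 + w) / M" by (simp add: algebra_simps add_divide_distrib)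
    finally show ?thesis .
  qed
  then show ?thesis using C(1) A(1) by (intro exI[of _ "C * A"]) simp
qed

text \<open>One factor of each quadratic term is bounded by \<open>A\<close>, independently of
  \<open>M\<close>, and the other by \<open>A / M\<close>; the quadratic part thus obeys the same
  bound as the linear one.\<close>

lemma lip_wp_quad:
  assumes wt: "weight_family m qfreq \<mu>" and e: "norm e = 1"
  shows "\<exists>K\<ge>0. \<forall>M>1. \<forall>w\<ge>0. lip_wp w (nonres M) m (\<rho> / 2) l (\<lambda>\<omega>. exp_symbol qmode qfreq \<mu> (quad_coeff e (gen \<omega>))) \<le> ennreal (K * (1 + w) / M)"
proof -
  let ?\<sigma> = "5 / 8 * \<rho>"
  have \<sigma>: "\<rho> / 2 \<le> ?\<sigma>" "0 \<le> ?\<sigma>" using \<rho> by simp_all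
  obtain N C where C: "C \<ge> 0" "\<And>G. admissible ?\<sigma> qmode qfreq G \<Longrightarrow>
      wp m (\<rho> / 2) l (exp_symbol qmode qfreq \<mu> G) \<le> ennreal (C * gnorm ?\<sigma> qmode qfreq N G)"
    using wp_exp_symbol_le[OF wt, of ?\<sigma> qmode "\<rho> / 2" l] \<sigma> by blast
  obtain A where A: "A \<ge> 0" "\<And>M \<omega>. M > 1 \<Longrightarrow> \<omega> \<in> nonres M \<Longrightarrow> gnorm ?\<sigma> mode snd N (gen \<omega>) \<le> A / M"
    "\<And>M \<omega> \<omega>'. M > 1 \<Longrightarrow> \<omega> \<in> nonres M \<Longrightarrow> \<omega>' \<in> nonres M \<Longrightarrow>
      gnorm ?\<sigma> mode snd N (\<lambda>i. gen \<omega> i - gen \<omega>' i) \<le> A / M * norm (\<omega> - \<omega>')"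
    using gen_bounds(1)[of N] by blast
  \<comment> \<open>The 1 stems from the linear part and \<open>4 * A\<close> from twice the two
    norms in the difference of squares; this also dominates the factor \<open>1 + 2 * A\<close> of
    the size estimate.\<close>
  define L where "L = (1 + 4 * A) * A"
  have L0: "L \<ge> 0" using A(1) by (simp add: L_def)
  have "lip_wp w (nonres M) m (\<rho> / 2) l (\<lambda>\<omega>. exp_symbol qmode qfreq \<mu> (quad_coeff e (gen \<omega>))) \<le> ennreal (C * L * (1 + w) / M)"
    if M: "M > 1" and w: "w \<ge> 0" for M w
  proof -
    have "A * 1 \<le> A * M" using A(1) M by (intro mult_left_mono) auto
    then have AM: "0 \<le> A / M" "A / M \<le> A" using A(1) M by (simp_all add: pos_divide_le_eq)
    have adm: "admissible ?\<sigma> qmode qfreq (quad_coeff e (gen \<omega>))" if "\<omega> \<in> nonres M" for \<omega>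
      by (rule quad_coeff_admissible(1)[OF gen_bounds(2)[OF that M] \<sigma>(2)])
    have bd: "gnorm ?\<sigma> qmode qfreq N (quad_coeff e (gen \<omega>)) \<le> L / M" if \<omega>: "\<omega> \<in> nonres M" for \<omega>
    proof -
      let ?g = "gnorm ?\<sigma> mode snd N (gen \<omega>)"
      have g: "0 \<le> ?g" "?g \<le> A / M" by (rule gnorm_nonneg) (rule A(2)[OF M \<omega>])
      have "gnorm ?\<sigma> qmode qfreq N (quad_coeff e (gen \<omega>)) \<le> ?g + 2 * ?g\<^sup>2"
        using quad_coeff_admissible(2)[OF gen_bounds(2)[OF \<omega> M] \<sigma>(2), of N e] by (simp add: e)
      also have "\<dots> = (1 + 2 * ?g) * ?g" by (simp add: power2_eq_square algebra_simps)
      also have "\<dots> \<le> (1 + 4 * A) * (A / M)"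
        using g AM A(1) by (intro mult_mono) auto
      finally show ?thesis by (simp add: L_def)
    qed
    have lip: "gnorm ?\<sigma> qmode qfreq N (\<lambda>i. quad_coeff e (gen \<omega>) i - quad_coeff e (gen \<omega>') i) \<le> L / M * norm (\<omega> - \<omega>')"
      if \<omega>: "\<omega> \<in> nonres M" and \<omega>': "\<omega>' \<in> nonres M" for \<omega> \<omega>'
    proof -
      let ?g = "\<lambda>\<omega>. gnorm ?\<sigma> mode snd N (gen \<omega>)"
      have g: "?g \<omega> \<le> A" "?g \<omega>' \<le> A"
        using A(2)[OF M \<omega>] A(2)[OF M \<omega>'] AM by simp_all
      have "gnorm ?\<sigma> qmode qfreq N (\<lambda>i. quad_coeff e (gen \<omega>) i - quad_coeff e (gen \<omega>') i) \<le>
          (1 + 2 * (?g \<omega> + ?g \<omega>')) * gnorm ?\<sigma> mode snd N (\<lambda>i. gen \<omega> i - gen \<omega>' i)"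
        using quad_coeff_diff[OF gen_bounds(2)[OF \<omega> M] gen_bounds(2)[OF \<omega>' M] \<sigma>(2), of N e] by (simp add: e)
      also have "\<dots> \<le> (1 + 4 * A) * (A / M * norm (\<omega> - \<omega>'))"
        using g A(1) A(3)[OF M \<omega> \<omega>'] by (intro mult_mono) (auto simp: gnorm_nonneg)
      finally show ?thesis by (simp add: L_def)
    qed
    have "lip_wp w (nonres M) m (\<rho> / 2) l (\<lambda>\<omega>. exp_symbol qmode qfreq \<mu> (quad_coeff e (gen \<omega>))) \<le> ennreal (C * (L / M + w * (L / M)))"
      by (rule lip_wp_exp_symbol_le[OF wt C(2) C(1) _ _ w \<sigma>(1) adm bd lip])
        (use L0 M in simp_all)
    also have "C * (L / M + w * (L / M)) = C * L * (1 + w) / M" by (simp add: algebra_simps add_divide_distrib)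
    finally show ?thesis .
  qed
  then show ?thesis using C(1) L0 by (intro exI[of _ "C * L"]) simp
qed

section \<open>Operators, adjointness and conjugation\<close>

lemma Op_symbols:
  assumes \<omega>: "\<omega> \<in> nonres M" and M: "M > 1"
  defines "c \<equiv> \<lambda>\<theta>. mode_coeff mode (gen \<omega>) \<theta>"
  shows "Op (X_sym mass \<omega>) \<theta> = wop (sw mass) (push snd (c \<theta>))"
    and "Op (Vd_sym mass \<omega>) \<theta> = kop (ker_d mass (push snd (c \<theta>)) (push (add_pair snd) (mult_pair (c \<theta>) (c \<theta>))))"
    and "Op (Vo_sym mass \<omega>) \<theta> = kop (ker_o mass (push snd (c \<theta>)) (push (add_pair snd) (mult_pair (c \<theta>) (c \<theta>))))"
proof -
  have \<sigma>: "0 \<le> 5 / 8 * \<rho>" using \<rho> by simp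
  note G = gen_bounds(2)[OF \<omega> M]
  note Q = quad_coeff_admissible(1)[OF G \<sigma>]
  show "Op (X_sym mass \<omega>) \<theta> = wop (sw mass) (push snd (c \<theta>))"
    by (intro ext) (simp add: X_sym_def Op_exp_symbol[OF weight_families(1) G \<sigma>] kernel_single c_def wop_def kop_def)
  show "Op (Vd_sym mass \<omega>) \<theta> = kop (ker_d mass (push snd (c \<theta>)) (push (add_pair snd) (mult_pair (c \<theta>) (c \<theta>))))"
    by (intro ext) (simp add: Vd_sym_def Op_exp_symbol[OF weight_families(2) Q \<sigma>] kernel_quad[OF G \<sigma>] c_def ker_d_def kop_def)
  show "Op (Vo_sym mass \<omega>) \<theta> = kop (ker_o mass (push snd (c \<theta>)) (push (add_pair snd) (mult_pair (c \<theta>) (c \<theta>))))"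
    by (intro ext) (simp add: Vo_sym_def Op_exp_symbol[OF weight_families(3) Q \<sigma>] kernel_quad[OF G \<sigma>] c_def ker_o_def kop_def)
qed

text \<open>The direction \<open>\<eta>\<close> is independent of \<open>\<omega>\<close>:
  \<open>\<eta> = \<omega>\<close> is the quasi-periodic motion of the equation, while an arbitrary
  \<open>\<eta>\<close> at time 1 gives access to every point of the torus.\<close>

lemma gen_flow:
  assumes \<omega>: "\<omega> \<in> nonres M" and M: "M > 1"
  defines "c \<equiv> \<lambda>\<theta>. mode_coeff mode (gen \<omega>) \<theta>"
  shows "coefficient_flow (\<lambda>t. push snd (c (t *\<^sub>R \<eta>))) (\<lambda>t. push (add_pair snd) (mult_pair (c (t *\<^sub>R \<eta>)) (c (t *\<^sub>R \<eta>))))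
    (\<lambda>t. push snd (\<lambda>i. \<i> * of_real (mode i \<bullet> \<eta>) * c (t *\<^sub>R \<eta>) i))"
  unfolding c_def
  by (rule coefficient_flow_modes[OF gen_bounds(2)[OF \<omega> M],
        where \<iota> = "\<lambda>i. (fst i, - snd i)" and \<tau> = "\<lambda>i. (- fst i, snd i)"])
    (use \<rho> in \<open>simp_all add: gen_reflect gen_cnj mode_def kv_minus\<close>)

lemma symbols_adjoint:
  assumes \<omega>: "\<omega> \<in> nonres M" and M: "M > 1"
  shows "is_adjoint (Op (Vd_sym mass \<omega>) \<theta>) (Op (Vd_sym mass \<omega>) \<theta>)"
    and "is_adjoint (Op (Vo_sym mass \<omega>) \<theta>) (cnj_op (Op (Vo_sym mass \<omega>) \<theta>))"
proof -
  interpret F: coefficient_flow mass "\<lambda>t. push snd (mode_coeff mode (gen \<omega>) (t *\<^sub>R \<theta>))"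
    "\<lambda>t. push (add_pair snd) (mult_pair (mode_coeff mode (gen \<omega>) (t *\<^sub>R \<theta>)) (mode_coeff mode (gen \<omega>) (t *\<^sub>R \<theta>)))"
    "\<lambda>t. push snd (\<lambda>i. \<i> * of_real (mode i \<bullet> \<theta>) * mode_coeff mode (gen \<omega>) (t *\<^sub>R \<theta>) i)"
    by (rule gen_flow[OF \<omega> M])
  note F1 = F.rapid_u[of 1] F.rapid_u2[of 1] F.even_u[of 1] F.even_u2[of 1] F.real_u[of 1] F.real_u2[of 1]
  note adj = is_adjoint_ker[OF F1[unfolded scaleR_one], of mass]
  show "is_adjoint (Op (Vd_sym mass \<omega>) \<theta>) (Op (Vd_sym mass \<omega>) \<theta>)"
    unfolding Op_symbols[OF \<omega> M] by (rule adj)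
  show "is_adjoint (Op (Vo_sym mass \<omega>) \<theta>) (cnj_op (Op (Vo_sym mass \<omega>) \<theta>))"
    unfolding Op_symbols[OF \<omega> M] by (rule adj)
qed

text \<open>The derivative in the direction \<open>\<omega>\<close> multiplies by the very divisor
  in the generator and recovers half the potential. At \<open>k = 0\<close> both sides vanish, by
  the zero mean.\<close>

lemma push_derivative:
  assumes \<omega>: "\<omega> \<in> nonres M" and M: "M > 1"
  shows "2 * push snd (\<lambda>i. \<i> * of_real (mode i \<bullet> \<omega>) * mode_coeff mode (gen \<omega>) \<theta> i) p =
    (\<Sum>\<^sub>\<infinity>k. Vh k p * cis (kv k \<bullet> \<theta>))"
proof -
  have "2 * push snd (\<lambda>i. \<i> * of_real (mode i \<bullet> \<omega>) * mode_coeff mode (gen \<omega>) \<theta> i) p =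
      push snd (\<lambda>i. Vh (fst i) (snd i) * cis (mode i \<bullet> \<theta>)) p"
    unfolding push_cmult[symmetric]
  proof (rule arg_cong[of _ _ "\<lambda>c. push snd c p"], rule ext)
    fix i :: "(int ^ 'n) \<times> int"
    show "2 * (\<i> * of_real (mode i \<bullet> \<omega>) * mode_coeff mode (gen \<omega>) \<theta> i) = Vh (fst i) (snd i) * cis (mode i \<bullet> \<theta>)"
      using divisor_nonzero[OF \<omega>, of "fst i"] M
      by (cases "fst i = 0") (simp_all add: mode_coeff_def generator_def mode_def Vh_0)
  qed
  also have "\<dots> = (\<Sum>\<^sub>\<infinity>k. Vh k p * cis (kv k \<bullet> \<theta>))"
    unfolding push_def by (rule infsum_reindex_bij_witness[of _ "\<lambda>k. (k, p)" fst]) (auto simp: mode_def)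
  finally show ?thesis .
qed

lemma conjugates_symbols:
  assumes \<omega>: "\<omega> \<in> nonres M" and M: "M > 1"
    and V: "\<And>\<theta> p. fourier_coeff (\<lambda>x. of_real (even_ext V \<theta> x)) p = (\<Sum>\<^sub>\<infinity>k. Vh k p * cis (kv k \<bullet> \<theta>))"
  shows "conjugates
    (\<lambda>t. op_exp (\<lambda>z. cscale (- \<i>) (op_times_mat (Op (X_sym mass \<omega>) (t *\<^sub>R \<omega>)) \<sigma>4 z)))
    (\<lambda>t z. H0_op mass z + W_op mass V (t *\<^sub>R \<omega>) z)
    (\<lambda>t z. H0_op mass z + V_op (Vd_sym mass \<omega>) (Vo_sym mass \<omega>) (t *\<^sub>R \<omega>) z)"
  unfolding W_op_def V_op_def Op_symbols[OF \<omega> M]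
proof (rule coefficient_flow.conjugates_coefficient_flow[OF gen_flow[OF \<omega> M]])
  show "mult_V V (t *\<^sub>R \<omega>) f k = kop (\<lambda>k j. 2 * push snd (\<lambda>i. \<i> * of_real (mode i \<bullet> \<omega>) * mode_coeff mode (gen \<omega>) (t *\<^sub>R \<omega>) i) (k - j)) f k"
    for t f k
    unfolding mult_V_eq_kop V push_derivative[OF \<omega> M] ..
qed

end

text \<open>The order of the quantifiers expresses the uniformities: the constants
  \<open>C w l\<close> are chosen before \<open>M\<close>, after \<open>\<gamma>0\<close>, and the
  frequency set is chosen before the weight \<open>w\<close>.\<close>

theorem theorem3p1:
  fixes \<rho> mass :: real and V :: "real ^ 'n \<Rightarrow> real \<Rightarrow> real"
  assumes "\<rho> > 0" and "mass \<ge> 0"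
    and "torus_periodic V" and "V1 \<rho> V" and "V2 V"
  shows "\<exists>c0>0. \<forall>\<gamma>0. 0 < \<gamma>0 \<and> \<gamma>0 < 1 \<longrightarrow>
    (\<exists>C :: real \<Rightarrow> nat \<Rightarrow> real. (\<forall>w>0. \<forall>l. C w l > 0) \<and>
      (\<forall>M>1. \<exists>\<Omega>0 :: (real ^ 'n) set.
        \<Omega>0 \<subseteq> annulus M \<and> \<Omega>0 \<in> sets lebesgue \<and>
        measure lebesgue (annulus M - \<Omega>0) / measure lebesgue (annulus M :: (real ^ 'n) set) \<le> c0 * \<gamma>0 \<and>
        (\<forall>w>0. \<exists>X Vd Vo :: real ^ 'n \<Rightarrow> 'n symbol.
          X \<in> Lip_PA w \<Omega>0 (- 1) (\<rho> / 2) \<and>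
          Vd \<in> Lip_PA w \<Omega>0 (- 1) (\<rho> / 2) \<and>
          Vo \<in> Lip_PA w \<Omega>0 0 (\<rho> / 2) \<and>
          (\<forall>\<omega>\<in>\<Omega>0. \<forall>\<theta>.
            is_adjoint (Op (Vd \<omega>) \<theta>) (Op (Vd \<omega>) \<theta>) \<and>
            is_adjoint (Op (Vo \<omega>) \<theta>) (cnj_op (Op (Vo \<omega>) \<theta>))) \<and>
          (\<forall>\<omega>\<in>\<Omega>0. conjugates
            (\<lambda>t. op_exp (\<lambda>z. cscale (- \<i>) (op_times_mat (Op (X \<omega>) (t *\<^sub>R \<omega>)) \<sigma>4 z)))
            (\<lambda>t z. H0_op mass z + W_op mass V (t *\<^sub>R \<omega>) z)
            (\<lambda>t z. H0_op mass z + V_op (Vd \<omega>) (Vo \<omega>) (t *\<^sub>R \<omega>) z)) \<and>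
          (\<forall>l. lip_wp w \<Omega>0 (- 1) (\<rho> / 2) l Vd + lip_wp w \<Omega>0 0 (\<rho> / 2) l Vo
                 \<le> ennreal (C w l / M)))))"
proof -
  \<comment> \<open>Names the body of the conclusion. The witnesses for the three symbols will not
    depend on \<open>w\<close>, which enters the estimates alone.\<close>
  let "\<exists>c0>0. \<forall>\<gamma>0. _ \<longrightarrow> (\<exists>C. (\<forall>w>0. \<forall>l. C w l > 0) \<and> (\<forall>M>1. \<exists>\<Omega>0.
      \<Omega>0 \<subseteq> annulus M \<and> _ \<and> _ \<and> (\<forall>w>0. \<exists>X Vd Vo. ?Q C M \<Omega>0 w X Vd Vo)))" = ?thesis
  let ?e = "\<rho> / (16 * real CARD('n))"
  obtain c0 where c0: "c0 > 0" "\<And>\<gamma> M. 0 < \<gamma> \<Longrightarrow> 1 < M \<Longrightarrow>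
      measure lebesgue (annulus M - nonresonant ?e \<gamma> M :: (real ^ 'n) set) / measure lebesgue (annulus M :: (real ^ 'n) set) \<le> c0 * \<gamma>"
    using measure_resonant_le[of ?e, where 'n = 'n] assms(1) by auto
  have s: "0 \<le> 7 / 8 * \<rho>" "7 / 8 * \<rho> < \<rho>" "7 / 8 * \<rho> > 0" using assms(1) by simp_all
  obtain Vh :: "int ^ 'n \<Rightarrow> int \<Rightarrow> complex" where
    decay: "\<forall>N. \<exists>C>0. \<forall>k p. norm (Vh k p) * exp (7 / 8 * \<rho> * norm (kv k)) * (1 + \<bar>real_of_int p\<bar>) ^ N \<le> C"
    and Vh: "\<forall>p. Vh 0 p = 0" "\<forall>k p. Vh k (- p) = Vh k p" "\<forall>k p. cnj (Vh k p) = Vh (- k) p"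
    and inv: "\<forall>\<theta> p. fourier_coeff (\<lambda>x. of_real (even_ext V \<theta> x)) p = (\<Sum>\<^sub>\<infinity>k. Vh k p * cis (kv k \<bullet> \<theta>))"
    using potential_fourier[OF s(1,2) assms(3-5)] s(3) by blast
  show ?thesis
  proof (intro exI[of _ c0] conjI allI impI c0(1), elim conjE)
    fix \<gamma> :: real assume \<gamma>: "0 < \<gamma>" "\<gamma> < 1"
    interpret potential_modes \<rho> \<gamma> Vh
      using assms(1) \<gamma>(1) decay Vh by unfold_locales auto
    have "\<exists>K\<ge>0. \<forall>M>1. \<forall>w\<ge>0. lip_wp w (nonres M) (- 1) (\<rho> / 2) l (Vd_sym mass) \<le> ennreal (K * (1 + w) / M)" for l
      unfolding Vd_sym_def[abs_def] by (rule lip_wp_quad[OF weight_families(2)]) simp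
    then obtain Kd where Kd: "\<And>l. Kd l \<ge> 0" "\<And>l M w. M > 1 \<Longrightarrow> w \<ge> 0 \<Longrightarrow>
        lip_wp w (nonres M) (- 1) (\<rho> / 2) l (Vd_sym mass) \<le> ennreal (Kd l * (1 + w) / M)"
      by metis
    have "\<exists>K\<ge>0. \<forall>M>1. \<forall>w\<ge>0. lip_wp w (nonres M) 0 (\<rho> / 2) l (Vo_sym mass) \<le> ennreal (K * (1 + w) / M)" for l
      unfolding Vo_sym_def[abs_def] by (rule lip_wp_quad[OF weight_families(3)]) simp
    then obtain Ko where Ko: "\<And>l. Ko l \<ge> 0" "\<And>l M w. M > 1 \<Longrightarrow> w \<ge> 0 \<Longrightarrow>
        lip_wp w (nonres M) 0 (\<rho> / 2) l (Vo_sym mass) \<le> ennreal (Ko l * (1 + w) / M)"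
      by metis
    \<comment> \<open>The factor \<open>1 + w\<close> comes from the Lipschitz part of the seminorm,
      weighted by \<open>w\<close>; the summand 1 makes the constant strictly positive.\<close>
    define C where "C w l = (Kd l + Ko l + 1) * (1 + w)" for w l
    have fin: "lip_wp w (nonres M) (- 1) (\<rho> / 2) l (X_sym mass) < \<infinity>" "lip_wp w (nonres M) (- 1) (\<rho> / 2) l (Vd_sym mass) < \<infinity>"
      "lip_wp w (nonres M) 0 (\<rho> / 2) l (Vo_sym mass) < \<infinity>" if "M > 1" "w > 0" for w M l
    proof -
      have "\<exists>K\<ge>0. \<forall>M>1. \<forall>w\<ge>0. lip_wp w (nonres M) (- 1) (\<rho> / 2) l (X_sym mass) \<le> ennreal (K * (1 + w) / M)"
        unfolding X_sym_def[abs_def] by (rule lip_wp_generator[OF weight_families(1)])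
      then obtain K where K: "\<forall>M>1. \<forall>w\<ge>0. lip_wp w (nonres M) (- 1) (\<rho> / 2) l (X_sym mass) \<le> ennreal (K * (1 + w) / M)"
        by (elim exE conjE)
      show "lip_wp w (nonres M) (- 1) (\<rho> / 2) l (X_sym mass) < \<infinity>"
        by (rule le_less_trans[OF K[rule_format, of M w]]) (use that in simp_all)
      show "lip_wp w (nonres M) (- 1) (\<rho> / 2) l (Vd_sym mass) < \<infinity>"
        by (rule le_less_trans[OF Kd(2)]) (use that in simp_all)
      show "lip_wp w (nonres M) 0 (\<rho> / 2) l (Vo_sym mass) < \<infinity>"
        by (rule le_less_trans[OF Ko(2)]) (use that in simp_all)
    qed
    have est: "lip_wp w (nonres M) (- 1) (\<rho> / 2) l (Vd_sym mass) + lip_wp w (nonres M) 0 (\<rho> / 2) l (Vo_sym mass) \<le> ennreal (C w l / M)"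
      if "M > 1" "w > 0" for w M l
    proof -
      have "lip_wp w (nonres M) (- 1) (\<rho> / 2) l (Vd_sym mass) + lip_wp w (nonres M) 0 (\<rho> / 2) l (Vo_sym mass) \<le>
          ennreal (Kd l * (1 + w) / M) + ennreal (Ko l * (1 + w) / M)"
        using that by (intro add_mono Kd(2) Ko(2)) simp_all
      also have "\<dots> = ennreal (Kd l * (1 + w) / M + Ko l * (1 + w) / M)"
        using that Kd(1) Ko(1) by (intro ennreal_plus[symmetric]) simp_all
      also have "\<dots> \<le> ennreal (C w l / M)"
        using that unfolding C_def by (intro ennreal_leI) (simp add: field_simps)
      finally show ?thesis .
    qed
    have Q: "?Q C M (nonres M) w (X_sym mass) (Vd_sym mass) (Vo_sym mass)" if M: "M > 1" and w: "w > 0" for M w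
      using symbols_PA[OF _ M] symbols_adjoint[OF _ M] conjugates_symbols[OF _ M inv[rule_format]] fin[OF M w] est[OF M w]
      by (simp add: Lip_PA_def)
    have C: "C w l > 0" if "w > 0" for w l
      using that Kd(1)[of l] Ko(1)[of l] by (simp add: C_def)
    have meas: "measure lebesgue (annulus M - nonres M) / measure lebesgue (annulus M :: (real ^ 'n) set) \<le> c0 * \<gamma>" if "M > 1" for M
      unfolding nonres_def by (rule c0(2)[OF \<gamma>(1) that])
    have sub: "nonres M \<subseteq> annulus M" for M by (auto simp: nonres_def nonresonant_def)
    have sets: "nonres M \<in> sets lebesgue" for M unfolding nonres_def by (rule nonresonant_measurable)
    show "\<exists>C. (\<forall>w>0. \<forall>l. C w l > 0) \<and> (\<forall>M>1. \<exists>\<Omega>0.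
        \<Omega>0 \<subseteq> annulus M \<and> \<Omega>0 \<in> sets lebesgue \<and>
        measure lebesgue (annulus M - \<Omega>0) / measure lebesgue (annulus M :: (real ^ 'n) set) \<le> c0 * \<gamma> \<and>
        (\<forall>w>0. \<exists>X Vd Vo. ?Q C M \<Omega>0 w X Vd Vo))"
    proof (intro exI[of _ C] conjI allI impI C)
      fix M :: real assume M: "M > 1"
      show "\<exists>\<Omega>0. \<Omega>0 \<subseteq> annulus M \<and> \<Omega>0 \<in> sets lebesgue \<and>
          measure lebesgue (annulus M - \<Omega>0) / measure lebesgue (annulus M :: (real ^ 'n) set) \<le> c0 * \<gamma> \<and>
          (\<forall>w>0. \<exists>X Vd Vo. ?Q C M \<Omega>0 w X Vd Vo)"
        by (rule exI[of _ "nonres M"], intro conjI sub sets meas[OF M] allI impI, rule exI[of _ "X_sym mass"],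
            rule exI[of _ "Vd_sym mass"], rule exI[of _ "Vo_sym mass"], rule Q[OF M])
    qed
  qed
qed

end
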